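(* Let $R=\mathbb{Q}[q^{\pm1}]$ and write $\{d\}=R/(\varphi_d)$, where $\varphi_d$ is the $d$-th cyclotomic polynomial in $q$, and $\{d\}^k$ for the direct sum of $k$ copies. For the Coxeter systems $(W,S)$ of the affine types $\tilde I_1,\tilde G_2,\tilde F_4,\tilde E_6,\tilde E_7,\tilde E_8$, the local homology groups $H_i=H_i(X_W;R)$, $0\le i\le |S|-1$, are, as $R$-modules, the following. Type $\tilde I_1$: $H_0\cong\{2\}$, $H_1\cong R$. Type $\tilde G_2$: $H_0\cong\{2\}$, $H_1\cong\{2\}\oplus\{3\}$, $H_2\cong R$. Type $\tilde F_4$: $H_0\cong\{2\}$, $H_1\cong\{2\}$, $H_2\cong\{2\}\oplus\{3\}$, $H_3\cong\{2\}^2\oplus\{3\}\oplus\{4\}\oplus\{8\}$, $H_4\cong R$. Type $\tilde E_6$: $H_0\cong\{2\}$, $H_1=H_2=0$, $H_3\cong\{3\}$, $H_4\cong\{5\}\oplus\{8\}$, $H_5\cong\{2\}\oplus\{3\}^3\oplus\{6\}^2\oplus\{9\}^2\oplus\{12\}^2$, $H_6\cong R$. Type $\tilde E_7$: $H_0\cong\{2\}$, $H_1=H_2=0$, $H_3\cong\{3\}$, $H_4=H_5=0$, $H_6\cong\{2\}^3\oplus\{3\}\oplus\{4\}\oplus\{6\}\oplus\{8\}\oplus\{10\}\oplus\{14\}\oplus\{18\}$, $H_7\cong R$. Type $\tilde E_8$: $H_0\cong\{2\}$, $H_1=H_2=H_3=0$, $H_4\cong\{4\}$, $H_5=0$, $H_6\cong\{5\}\oplus\{8\}$,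 $H_7\cong\{2\}^2\oplus\{3\}\oplus\{4\}\oplus\{5\}\oplus\{8\}\oplus\{9\}\oplus\{14\}$, $H_8\cong R$.
   Context: $\tilde I_1$ denotes the infinite dihedral Coxeter system (two generators $s,t$ with $m(s,t)=\infty$, also called $\tilde A_1$); the other types are the standard irreducible affine Coxeter systems. In type $\tilde X_n$ one has $|S|=n+1$. For a Coxeter system $(W,S)$ with $S$ finite, $X_W$ is the quotient of the Salvetti complex of $W$ by the action of $W$; its fundamental group is the Artin group $G_W$, and its cells are indexed by $K_W=\{\sigma\subseteq S\mid \text{the parabolic subgroup } W_\sigma \text{ generated by }\sigma\text{ is finite}\}$ (including $\varnothing$; for $W$ irreducible affine, $K_W$ consists of all proper subsets of $S$). The coefficients are in the local system on $X_W$ given by the action of $G_W$ on $R$ in which every standard generator acts as multiplication by $-q$. Concretely, $H_*(X_W;R)$ is the homology of the complex of free $R$-modules $C_k=\bigoplus_{\sigma\in K_W,\ |\sigma|=k}R\,e_\sigma$ with boundary $$\partial(e_\sigma)=\sum_{\tau\subset\sigma,\ |\tau|=|\sigma|-1}[\sigma:\tau]\,\frac{W_\sigma(q)}{W_\tau(q)}\,e_\tau,$$ where $W_\sigma(q)=\sum_{w\in W_\sigma}q^{\ell(w)}$ is the Poincaré polynomial of $W_\sigma$ and $[\sigma:\tau]=\pm1$ is the usual simplicial incidence number with respect to a fixed total order on $S$. *)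

theory Defs
  imports
    Complex_Main
    "HOL-Library.Poly_Mapping"
    "HOL-Library.Extended_Nat"
    "HOL-Computational_Algebra.Polynomial"
    "HOL-Algebra.Generated_Groups"
    "HOL-Algebra.Module"
    "HOL-Algebra.Ideal"
begin

section \<open>Coxeter groups given by a Coxeter matrix\<close>

text \<open>
  Words over \<open>S\<close> modulo the congruence generated by the relations \<open>(s t)^m(s,t) = 1\<close>
  (no relation if \<open>m(s,t) = \<infinity>\<close>). A Coxeter matrix has \<open>m(s,s) = 1\<close>, so every generator is its
  own inverse; hence no formal inverses are needed and the quotient monoid is the group
  presented by these generators and relations.
\<close>

inductive cox_eq :: "'s set \<Rightarrow> ('s \<Rightarrow> 's \<Rightarrow> enat) \<Rightarrow> 's list \<Rightarrow> 's list \<Rightarrow> bool"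
  for S m where
  refl: "u \<in> lists S \<Longrightarrow> cox_eq S m u u"
| sym: "cox_eq S m u v \<Longrightarrow> cox_eq S m v u"
| trans: "cox_eq S m u v \<Longrightarrow> cox_eq S m v w \<Longrightarrow> cox_eq S m u w"
| rel: "u \<in> lists S \<Longrightarrow> v \<in> lists S \<Longrightarrow> s \<in> S \<Longrightarrow> t \<in> S \<Longrightarrow> m s t = enat k \<Longrightarrow>
    cox_eq S m (u @ concat (replicate k [s, t]) @ v) (u @ v)"

definition cox_class :: "'s set \<Rightarrow> ('s \<Rightarrow> 's \<Rightarrow> enat) \<Rightarrow> 's list \<Rightarrow> 's list set" where
  "cox_class S m u = {v. cox_eq S m u v}"

definition coxeter_group :: "'s set \<Rightarrow> ('s \<Rightarrow> 's \<Rightarrow> enat) \<Rightarrow> 's list set monoid" where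
  "coxeter_group S m =
    \<lparr>carrier = cox_class S m ` lists S,
     mult = (\<lambda>X Y. \<Union>u\<in>X. \<Union>v\<in>Y. cox_class S m (u @ v)),
     one = cox_class S m []\<rparr>"

text \<open>An element is the set of all words representing it.\<close>

definition cox_length :: "'s list set \<Rightarrow> nat" where
  "cox_length w = (LEAST l. \<exists>u\<in>w. length u = l)"

definition parabolic :: "'s set \<Rightarrow> ('s \<Rightarrow> 's \<Rightarrow> enat) \<Rightarrow> 's set \<Rightarrow> 's list set set" where
  "parabolic S m \<sigma> = generate (coxeter_group S m) ((\<lambda>s. cox_class S m [s]) ` \<sigma>)"

definition poincare_poly :: "'s set \<Rightarrow> ('s \<Rightarrow> 's \<Rightarrow> enat) \<Rightarrow> 's set \<Rightarrow> rat poly" where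
  "poincare_poly S m \<sigma> = (\<Sum>w\<in>parabolic S m \<sigma>. monom 1 (cox_length w))"

definition finite_type_subsets :: "'s set \<Rightarrow> ('s \<Rightarrow> 's \<Rightarrow> enat) \<Rightarrow> 's set set" where
  "finite_type_subsets S m = {\<sigma>. \<sigma> \<subseteq> S \<and> finite (parabolic S m \<sigma>)}"


section \<open>Laurent polynomials over the rationals\<close>

text \<open>
  Finitely supported functions \<open>int \<Rightarrow>\<^sub>0 rat\<close> with the convolution product form the group ring
  of the integers over the rationals; \<open>q\<close> is \<open>Poly_Mapping.single 1 1\<close>.
\<close>

type_synonym qlaurent = "int \<Rightarrow>\<^sub>0 rat"

definition qlaurent_ring :: "qlaurent ring" where
  "qlaurent_ring = \<lparr>carrier = UNIV, mult = (*), one = 1, zero = 0, add = (+)\<rparr>"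

definition laurent_of_poly :: "rat poly \<Rightarrow> qlaurent" where
  "laurent_of_poly p = (\<Sum>i\<le>degree p. Poly_Mapping.single (int i) (coeff p i))"

definition cyclotomic :: "nat \<Rightarrow> rat poly" where
  "cyclotomic d = (THE p. map_poly (of_rat :: rat \<Rightarrow> complex) p =
     (\<Prod>\<zeta> | \<zeta> ^ d = 1 \<and> (\<forall>k. 0 < k \<and> k < d \<longrightarrow> \<zeta> ^ k \<noteq> 1). [:- \<zeta>, 1:]))"


section \<open>Modules\<close>

text \<open>The record type of modules extends that of rings; the fields \<open>mult\<close> and \<open>one\<close> carry no
  meaning for a module.\<close>

definition quotient_module :: "('r, 'm) module \<Rightarrow> 'm set \<Rightarrow> ('r, 'm set) module" where
  "quotient_module M N =
    \<lparr>carrier = a_rcosets\<^bsub>M\<^esub> N, mult = undefined, one = undefined,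
     zero = N, add = set_add M,
     smult = (\<lambda>r X. \<Union>x\<in>X. N +>\<^bsub>M\<^esub> (r \<odot>\<^bsub>M\<^esub> x))\<rparr>"

definition regular_module :: "'r ring \<Rightarrow> ('r, 'r) module" where
  "regular_module R = ring.extend R \<lparr>smult = mult R\<rparr>"

definition direct_sum_module :: "('r, 'm) module list \<Rightarrow> ('r, nat \<Rightarrow> 'm) module" where
  "direct_sum_module Ms =
    \<lparr>carrier = \<Pi>\<^sub>E i\<in>{..<length Ms}. carrier (Ms ! i), mult = undefined, one = undefined,
     zero = (\<lambda>i\<in>{..<length Ms}. \<zero>\<^bsub>Ms ! i\<^esub>),
     add = (\<lambda>f g. \<lambda>i\<in>{..<length Ms}. f i \<oplus>\<^bsub>Ms ! i\<^esub> g i),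
     smult = (\<lambda>r f. \<lambda>i\<in>{..<length Ms}. r \<odot>\<^bsub>Ms ! i\<^esub> f i)\<rparr>"

definition module_iso :: "'r ring \<Rightarrow> ('r, 'm) module \<Rightarrow> ('r, 'n) module \<Rightarrow> bool" where
  "module_iso R M N \<longleftrightarrow> (\<exists>f. bij_betw f (carrier M) (carrier N) \<and>
     (\<forall>x\<in>carrier M. \<forall>y\<in>carrier M. f (x \<oplus>\<^bsub>M\<^esub> y) = f x \<oplus>\<^bsub>N\<^esub> f y) \<and>
     (\<forall>r\<in>carrier R. \<forall>x\<in>carrier M. f (r \<odot>\<^bsub>M\<^esub> x) = r \<odot>\<^bsub>N\<^esub> f x))"

abbreviation qlaurent_iso (infix \<open>\<cong>\<^sub>R\<close> 50) where
  "M \<cong>\<^sub>R N \<equiv> module_iso qlaurent_ring M N"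

abbreviation free_rank_one :: "(qlaurent, qlaurent) module" where
  "free_rank_one \<equiv> regular_module qlaurent_ring"

text \<open>The module \<open>{d} = R/(\<phi>\<^sub>d)\<close>, and \<open>{d\<^sub>1} \<oplus> \<dots> \<oplus> {d\<^sub>r}\<close> for a list of indices
  (the zero module for the empty list).\<close>

definition cyclo_module :: "nat \<Rightarrow> (qlaurent, qlaurent set) module" where
  "cyclo_module d =
    quotient_module free_rank_one (PIdl\<^bsub>qlaurent_ring\<^esub> (laurent_of_poly (cyclotomic d)))"

definition cyclo_sum :: "nat list \<Rightarrow> (qlaurent, nat \<Rightarrow> qlaurent set) module" where
  "cyclo_sum ds = direct_sum_module (map cyclo_module ds)"


section \<open>The local homology of the quotient of the Salvetti complex\<close>

text \<open>A chain \<open>c\<close> stands for the sum of all \<open>c \<sigma> e\<^sub>\<sigma>\<close>, for finite \<open>S\<close>.\<close>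

definition salvetti_chains ::
    "'s set \<Rightarrow> ('s \<Rightarrow> 's \<Rightarrow> enat) \<Rightarrow> nat \<Rightarrow> (qlaurent, 's set \<Rightarrow> qlaurent) module" where
  "salvetti_chains S m k =
    \<lparr>carrier = {c. \<forall>\<sigma>. c \<sigma> \<noteq> 0 \<longrightarrow> \<sigma> \<in> finite_type_subsets S m \<and> card \<sigma> = k},
     mult = undefined, one = undefined,
     zero = (\<lambda>\<sigma>. 0), add = (\<lambda>c c' \<sigma>. c \<sigma> + c' \<sigma>), smult = (\<lambda>r c \<sigma>. r * c \<sigma>)\<rparr>"

text \<open>The sign with which \<open>\<tau> = \<sigma> - {s}\<close> occurs in the simplicial boundary of \<open>\<sigma>\<close>: the exponent is
  the position of \<open>s\<close> in \<open>\<sigma>\<close>, counted from 0.\<close>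

definition incidence :: "'s::linorder set \<Rightarrow> 's set \<Rightarrow> qlaurent" where
  "incidence \<sigma> \<tau> = (- 1) ^ card {t \<in> \<sigma>. t < the_elem (\<sigma> - \<tau>)}"

text \<open>The polynomial division is exact, since \<open>W\<^sub>\<tau>(q)\<close> divides \<open>W\<^sub>\<sigma>(q)\<close>. The boundary of a
  0-chain is 0.\<close>

definition salvetti_boundary ::
    "'s::linorder set \<Rightarrow> ('s \<Rightarrow> 's \<Rightarrow> enat) \<Rightarrow> ('s set \<Rightarrow> qlaurent) \<Rightarrow> ('s set \<Rightarrow> qlaurent)" where
  "salvetti_boundary S m c = (\<lambda>\<tau>.
     \<Sum>\<sigma> | \<sigma> \<in> finite_type_subsets S m \<and> \<tau> \<subset> \<sigma> \<and> card \<sigma> = Suc (card \<tau>).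
       c \<sigma> * (incidence \<sigma> \<tau> * laurent_of_poly (poincare_poly S m \<sigma> div poincare_poly S m \<tau>)))"

definition salvetti_cycles ::
    "'s::linorder set \<Rightarrow> ('s \<Rightarrow> 's \<Rightarrow> enat) \<Rightarrow> nat \<Rightarrow> (qlaurent, 's set \<Rightarrow> qlaurent) module" where
  "salvetti_cycles S m k = (salvetti_chains S m k)
     \<lparr>carrier := {c \<in> carrier (salvetti_chains S m k). salvetti_boundary S m c = (\<lambda>\<tau>. 0)}\<rparr>"

definition salvetti_homology ::
    "'s::linorder set \<Rightarrow> ('s \<Rightarrow> 's \<Rightarrow> enat) \<Rightarrow> nat \<Rightarrow> (qlaurent, ('s set \<Rightarrow> qlaurent) set) module" where
  "salvetti_homology S m k = quotient_module (salvetti_cycles S m k)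
     (salvetti_boundary S m ` carrier (salvetti_chains S m (Suc k)))"


section \<open>The exceptional affine types\<close>

text \<open>Coxeter matrix of a labelled diagram; an edge \<open>((s, t), k)\<close> is listed with \<open>s < t\<close>.\<close>

definition diagram_matrix :: "((nat \<times> nat) \<times> enat) list \<Rightarrow> nat \<Rightarrow> nat \<Rightarrow> enat" where
  "diagram_matrix es s t =
    (if s = t then 1
     else case map_of es (min s t, max s t) of None \<Rightarrow> 2 | Some k \<Rightarrow> k)"

datatype affine_type = I1_tilde | G2_tilde | F4_tilde | E6_tilde | E7_tilde | E8_tilde

fun affine_rank :: "affine_type \<Rightarrow> nat" where
  "affine_rank I1_tilde = 1"
| "affine_rank G2_tilde = 2"
| "affine_rank F4_tilde = 4"
| "affine_rank E6_tilde = 6"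
| "affine_rank E7_tilde = 7"
| "affine_rank E8_tilde = 8"

text \<open>Bourbaki numbering for the types \<open>E\<close>, with 0 as the additional node.\<close>

fun affine_diagram :: "affine_type \<Rightarrow> ((nat \<times> nat) \<times> enat) list" where
  "affine_diagram I1_tilde = [((0,1),\<infinity>)]"
| "affine_diagram G2_tilde = [((0,1),3), ((1,2),6)]"
| "affine_diagram F4_tilde = [((0,1),3), ((1,2),3), ((2,3),4), ((3,4),3)]"
| "affine_diagram E6_tilde = [((1,3),3), ((3,4),3), ((4,5),3), ((5,6),3), ((2,4),3), ((0,2),3)]"
| "affine_diagram E7_tilde = [((0,1),3), ((1,3),3), ((3,4),3), ((4,5),3), ((5,6),3), ((6,7),3),
     ((2,4),3)]"
| "affine_diagram E8_tilde = [((1,3),3), ((3,4),3), ((4,5),3), ((5,6),3), ((6,7),3), ((7,8),3),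
     ((0,8),3), ((2,4),3)]"

definition affine_homology ::
    "affine_type \<Rightarrow> nat \<Rightarrow> (qlaurent, (nat set \<Rightarrow> qlaurent) set) module" where
  "affine_homology X =
     salvetti_homology {0..affine_rank X} (diagram_matrix (affine_diagram X))"

end

theory Submission
  imports Defs "HOL-Library.Function_Algebras" "HOL-Computational_Algebra.Field_as_Ring"
    "HOL-Computational_Algebra.Polynomial_Factorial" "HOL-Computational_Algebra.Fundamental_Theorem_Algebra"
begin

text \<open>
  For an affine type every proper subset of \<open>S\<close> is spherical, and \<open>W\<^sub>\<sigma>\<close> is a product of cyclotomic
  polynomials. Rescaling \<open>e\<^sub>\<sigma>\<close> by \<open>W\<^sub>\<sigma>\<close> therefore identifies the Salvetti complex with the subcomplex of
  the augmented chain complex of the boundary of a simplex in which the coefficient at \<open>\<sigma>\<close> is divisible by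
  \<open>W\<^sub>\<sigma>\<close>. By the Chinese remainder theorem its homology below the top degree splits into one part for each
  cyclotomic polynomial \<open>\<phi>\<close>, where the coefficient at \<open>\<sigma>\<close> is only required to be divisible by the power of
  \<open>\<phi>\<close> in \<open>W\<^sub>\<sigma>\<close>. The exponents filter the simplex, and a discrete Morse matching within the levels of this
  filtration leaves so few critical cells, with levels growing by one from degree to degree, that each part
  can be read off from their numbers. The Poincare polynomials come from counting orbits of
  fundamental weights; these counts and the matchings are checked by evaluation.
\<close>

section \<open>Words in a Coxeter group\<close>

text \<open>The full simplex is acyclic, so below the top degree homology arises only from the
  divisibility conditions. Eliminating the matched sets leaves cycles determined by their values at
  critical sets. If these have level j in degree k and level j + 1 in degree k + 1, such a cycle is
  \<phi>^j times a vector of free coordinates, and it bounds exactly when \<phi> divides all of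
  them: each summand is R/(\<phi>), never R/(\<phi>^2), and no differential between critical cells
  has to be computed. Only the ranks r_k remain, and they follow from |crit_k| = r_k + r_(k-1). In
  the top degree the Salvetti complex lacks the cell S; its cycles are the multiples of the boundary
  of the simplex by the lcm of the W_\<sigma> of the facets, a free module of rank one. The
  polynomials W_\<sigma> are built one node at a time as (series of minimal coset representatives)
  times W_(\<sigma> - s). That the orbit of the weight of s really enumerates these cosets is the
  delicate point: it is reduced to rank two by a confluence argument, and rank two is a finite
  computation.\<close>

lemma rev_in_lists_iff [simp]: "rev u \<in> lists S \<longleftrightarrow> u \<in> lists S"
  by (simp add: in_lists_conv_set)

primrec alt :: "'s \<Rightarrow> 's \<Rightarrow> nat \<Rightarrow> 's list" where
  "alt s t 0 = []"
| "alt s t (Suc n) = s # alt t s n"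

lemma alt_add: "alt s t (2 * k + n) = alt s t (2 * k) @ alt s t n"
  by (induction k) auto

lemma alt_snoc: "alt s t (2 * i + 1) @ [t] = alt s t (2 * i + 2)"
  by (induction i) auto

lemma alt_concat: "concat (replicate k [s, t]) = alt s t (2 * k)"
  by (induction k) auto

lemma length_alt [simp]: "length (alt s t n) = n"
  by (induction n arbitrary: s t) auto

lemma alt_add_gen: "alt s t (n + k) = alt s t n @ (if even n then alt s t k else alt t s k)"
  by (induction n arbitrary: s t) auto

lemma alt_in_lists: "s \<in> T \<Longrightarrow> t \<in> T \<Longrightarrow> alt s t n \<in> lists T"
  by (induction n arbitrary: s t) auto

lemma rev_alt: "rev (alt s t n) = (if even n then alt t s n else alt s t n)"
proof (induction n arbitrary: s t)
  case (Suc n)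
  then show ?case using alt_add_gen[of t s n 1] alt_add_gen[of s t n 1] by auto
qed simp

text \<open>Splits the relator (s t)^k into the two sides of the braid relation, the second one
  reversed.\<close>

lemma alt_double: "alt s t (2 * k) = alt s t k @ rev (alt t s k)"
  using alt_add_gen[of s t k k] by (simp add: rev_alt mult_2)

locale coxeter_system =
  fixes S :: "'s set" and m :: "'s \<Rightarrow> 's \<Rightarrow> enat"
  assumes diag: "s \<in> S \<Longrightarrow> m s s = 1"
begin

abbreviation eqv :: "'s list \<Rightarrow> 's list \<Rightarrow> bool" (infix \<open>\<approx>\<close> 50) where
  "u \<approx> v \<equiv> cox_eq S m u v"

lemma concat_replicate_lists: "s \<in> S \<Longrightarrow> t \<in> S \<Longrightarrow> concat (replicate k [s, t]) \<in> lists S"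
  by (induction k) auto

lemma eqv_lists: "u \<approx> v \<Longrightarrow> u \<in> lists S \<and> v \<in> lists S"
proof (induction rule: cox_eq.induct)
  case (rel u v s t k)
  then show ?case using concat_replicate_lists[of s t k] by auto
qed auto

lemma eqv_refl [simp]: "u \<approx> u \<longleftrightarrow> u \<in> lists S"
  using eqv_lists cox_eq.refl by blast

lemma eqv_context: "u \<approx> v \<Longrightarrow> x \<in> lists S \<Longrightarrow> y \<in> lists S \<Longrightarrow> x @ u @ y \<approx> x @ v @ y"
proof (induction rule: cox_eq.induct)
  case (rel u v s t k)
  show ?case
    using cox_eq.rel[of "x @ u" S "v @ y" s t m k] rel by auto
next
  case (refl u) then show ?case by auto
next
  case (sym u v) then show ?case by (meson cox_eq.sym)
next
  case (trans u v w) then show ?case by (meson cox_eq.trans)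
qed

lemma eqv_append: "u \<approx> u' \<Longrightarrow> v \<approx> v' \<Longrightarrow> u @ v \<approx> u' @ v'"
  using eqv_context[of u u' "[]" v] eqv_context[of v v' u' "[]"] eqv_lists
  by (metis append.right_neutral append_Nil cox_eq.trans lists.Nil)

lemma eqv_Cons: "s \<in> S \<Longrightarrow> u \<approx> v \<Longrightarrow> s # u \<approx> s # v"
  using eqv_append[of "[s]" "[s]" u v] by simp

lemma eqv_square: "s \<in> S \<Longrightarrow> u \<in> lists S \<Longrightarrow> s # s # u \<approx> u"
  using cox_eq.rel[of "[]" S u s s m 1] diag by (simp add: one_enat_def)

lemma eqv_rev_right: "u \<in> lists S \<Longrightarrow> u @ rev u \<approx> []"
proof (induction u rule: rev_induct)
  case (snoc s u)
  have "u @ [s, s] @ rev u \<approx> u @ [] @ rev u"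
    using eqv_context[of "[s, s]" "[]" u "rev u"] eqv_square[of s "[]"] snoc by simp
  moreover have "u @ rev u \<approx> []" using snoc by auto
  ultimately have "u @ [s, s] @ rev u \<approx> []" by (metis append_Nil cox_eq.trans)
  then show ?case by simp
qed simp

lemma eqv_rev_left: "u \<in> lists S \<Longrightarrow> rev u @ u \<approx> []"
  using eqv_rev_right[of "rev u"] by simp

lemma eqv_cancel_right: "u @ w \<approx> v @ w \<Longrightarrow> u \<approx> v"
proof -
  assume a: "u @ w \<approx> v @ w"
  then have l: "u \<in> lists S" "w \<in> lists S" "v \<in> lists S" using eqv_lists by fastforce+
  have "u @ w @ rev w \<approx> v @ w @ rev w" using eqv_append[OF a, of "rev w" "rev w"] l by simp
  moreover have "u @ w @ rev w \<approx> u" "v @ w @ rev w \<approx> v"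
    using eqv_append[of _ _ "w @ rev w" "[]"] eqv_rev_right[of w] l
    by (metis append.right_neutral eqv_refl)+
  ultimately show ?thesis by (meson cox_eq.sym cox_eq.trans)
qed

lemma eqv_cancel_left: "w @ u \<approx> w @ v \<Longrightarrow> u \<approx> v"
proof -
  assume a: "w @ u \<approx> w @ v"
  then have l: "u \<in> lists S" "w \<in> lists S" "v \<in> lists S" using eqv_lists by fastforce+
  have "rev w @ w @ u \<approx> rev w @ w @ v" using eqv_append[OF _ a, of "rev w" "rev w"] l by simp
  moreover have "rev w @ w @ u \<approx> u" "rev w @ w @ v \<approx> v"
    using eqv_append[of "rev w @ w" "[]"] eqv_rev_left[of w] l
    by (metis append_Nil append_assoc eqv_refl)+
  ultimately show ?thesis by (meson cox_eq.sym cox_eq.trans)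
qed

lemma eqv_move_left: "a \<in> lists S \<Longrightarrow> x \<in> lists S \<Longrightarrow> y \<in> lists S \<Longrightarrow> rev a @ x \<approx> y \<longleftrightarrow> x \<approx> a @ y"
proof
  assume a: "a \<in> lists S" "x \<in> lists S" "y \<in> lists S"
  have e: "a @ rev a @ x \<approx> x" using eqv_append[of "a @ rev a" "[]" x x] eqv_rev_right a by auto
  { assume "rev a @ x \<approx> y"
    then have "a @ rev a @ x \<approx> a @ y" using eqv_append a by auto
    then show "x \<approx> a @ y" using e by (meson cox_eq.sym cox_eq.trans) }
  { assume "x \<approx> a @ y"
    then have "a @ rev a @ x \<approx> a @ y" using e by (meson cox_eq.trans)
    then show "rev a @ x \<approx> y" using eqv_cancel_left by auto }
qed

lemma eqv_move_right: "a \<in> lists S \<Longrightarrow> x \<in> lists S \<Longrightarrow> y \<in> lists S \<Longrightarrow> x @ rev a \<approx> y \<longleftrightarrow> x \<approx> y @ a"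
proof
  assume a: "a \<in> lists S" "x \<in> lists S" "y \<in> lists S"
  have e: "x @ rev a @ a \<approx> x" using eqv_append[of x x "rev a @ a" "[]"] eqv_rev_left a by auto
  { assume "x @ rev a \<approx> y"
    then have "x @ rev a @ a \<approx> y @ a" using eqv_append[of "x @ rev a" y a a] a by auto
    then show "x \<approx> y @ a" using e by (meson cox_eq.sym cox_eq.trans) }
  { assume "x \<approx> y @ a"
    then have "x @ rev a @ a \<approx> y @ a" using e by (meson cox_eq.trans)
    then show "x @ rev a \<approx> y" using eqv_cancel_right[of "x @ rev a" a y] by auto }
qed

lemma eqv_rev: "u \<approx> v \<Longrightarrow> rev u \<approx> rev v"
proof -
  assume a: "u \<approx> v"
  then have l: "u \<in> lists S" "v \<in> lists S" using eqv_lists by auto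
  have "rev u @ u \<approx> rev u @ v" using eqv_append[of "rev u" "rev u" u v] a l by simp
  then have "rev u @ v \<approx> []" using eqv_rev_left[OF l(1)] by (meson cox_eq.sym cox_eq.trans)
  moreover have "rev v @ v \<approx> []" using eqv_rev_left[OF l(2)] .
  ultimately have "rev u @ v \<approx> rev v @ v" by (meson cox_eq.sym cox_eq.trans)
  then show ?thesis using eqv_cancel_right by blast
qed

text \<open>Relators have even length. In the exchange argument this sharpens "not longer" to
  "shorter".\<close>

lemma eqv_parity: "u \<approx> v \<Longrightarrow> even (length u) = even (length v)"
proof (induction rule: cox_eq.induct)
  case (rel u v s t k)
  have "length (concat (replicate k [s, t])) = 2 * k" by (induction k) auto
  then show ?case by simp
qed auto


subsection \<open>The exchange condition\<close>

text \<open>The reflections crossed by a word, as words. The parity with which a given group element occurs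
  in this list depends only on the group element that the word represents (Bourbaki, Lie IV.1.4).\<close>

primrec refls :: "'s list \<Rightarrow> 's list list" where
  "refls [] = []"
| "refls (s # u) = [s] # map (\<lambda>w. s # w @ [s]) (refls u)"

definition refl_count :: "'s list \<Rightarrow> 's list \<Rightarrow> nat" where
  "refl_count u t = length (filter (\<lambda>w. w \<approx> t) (refls u))"

lemma refls_append: "refls (u @ v) = refls u @ map (\<lambda>w. u @ w @ rev u) (refls v)"
  by (induction u) auto

lemma refls_lists: "u \<in> lists S \<Longrightarrow> w \<in> set (refls u) \<Longrightarrow> w \<in> lists S"
  by (induction u arbitrary: w) (auto simp: in_lists_conv_set)

lemma refls_elem: "w \<in> set (refls u) \<Longrightarrow> \<exists>y b z. u = y @ b # z \<and> w = y @ [b] @ rev y"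
proof (induction u arbitrary: w)
  case (Cons s u)
  then consider "w = [s]" | w' where "w' \<in> set (refls u)" "w = s # w' @ [s]" by auto
  then show ?case
  proof cases
    case 1 then show ?thesis by (intro exI[of _ "[]"]) auto
  next
    case 2
    then obtain y b z where "u = y @ b # z" "w' = y @ [b] @ rev y" using Cons.IH by blast
    then show ?thesis using 2 by (intro exI[of _ "s # y"] exI[of _ b] exI[of _ z]) auto
  qed
qed simp

lemma eqv_conj: "a \<in> lists S \<Longrightarrow> x \<in> lists S \<Longrightarrow> t \<in> lists S \<Longrightarrow>
    a @ x @ rev a \<approx> t \<longleftrightarrow> x \<approx> rev a @ t @ a"
  using eqv_move_right[of a "a @ x" t] eqv_move_left[of "rev a" x "t @ a"] by simp

text \<open>The cocycle rule: the reflections of \<open>v\<close> reappear conjugated by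
  \<open>u\<close>, and moving the conjugation to the other side turns this into a count at a
  conjugate element.\<close>

lemma refl_count_append:
  assumes "u \<in> lists S" "v \<in> lists S" "t \<in> lists S"
  shows "refl_count (u @ v) t = refl_count u t + refl_count v (rev u @ t @ u)"
proof -
  have "filter (\<lambda>w. u @ w @ rev u \<approx> t) (refls v) = filter (\<lambda>w. w \<approx> rev u @ t @ u) (refls v)"
    using assms refls_lists[OF assms(2)] by (intro filter_cong) (auto simp: eqv_conj)
  then show ?thesis unfolding refl_count_def refls_append by (simp add: filter_map o_def)
qed

lemma refl_count_cong: "t \<approx> t' \<Longrightarrow> refl_count u t = refl_count u t'"
  unfolding refl_count_def by (metis cox_eq.sym cox_eq.trans)

lemma alt_lists: "s \<in> S \<Longrightarrow> t \<in> S \<Longrightarrow> alt s t n \<in> lists S"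
  by (induction n arbitrary: s t) auto

lemma refls_alt: "refls (alt s t n) = map (\<lambda>i. alt s t (2 * i + 1)) [0..<n]"
proof (induction n arbitrary: s t)
  case (Suc n)
  have "[0..<Suc n] = 0 # map Suc [0..<n]" by (simp add: map_Suc_upt upt_conv_Cons del: upt_Suc)
  moreover have "s # alt t s (2 * i + 1) @ [s] = alt s t (2 * Suc i + 1)" for i
    using alt_snoc[of t s i] by (metis add_2_eq_Suc' add_Suc_shift alt.simps(2) mult_Suc_right
        Suc_eq_plus1 add.commute)
  ultimately show ?case using Suc[of t s] by (simp del: upt_Suc)
qed simp

text \<open>The reflections of the relator are the words \<open>alt s t (2 * i + 1)\<close> for i <
  2k. Shifting i by k prepends the relator itself, so the second half of the list repeats the first
  half as group elements and every count is even.\<close>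

lemma refl_count_relator:
  assumes "s \<in> S" "t \<in> S" "m s t = enat k" "x \<in> lists S"
  shows "even (refl_count (alt s t (2 * k)) x)"
proof -
  have rel: "alt s t (2 * k) \<approx> []"
    using cox_eq.rel[of "[]" S "[]" s t m k] assms by (simp add: alt_concat)
  have *: "alt s t (2 * (i + k) + 1) \<approx> x \<longleftrightarrow> alt s t (2 * i + 1) \<approx> x" for i
  proof -
    have "alt s t (2 * (i + k) + 1) = alt s t (2 * k) @ alt s t (2 * i + 1)"
      using alt_add[of s t k "2 * i + 1"] by (simp add: algebra_simps)
    then have "alt s t (2 * (i + k) + 1) \<approx> alt s t (2 * i + 1)"
      using eqv_append[OF rel, of "alt s t (2 * i + 1)" "alt s t (2 * i + 1)"]
        alt_lists[OF assms(1,2), of "2 * i + 1"] by simp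
    then show ?thesis by (meson cox_eq.sym cox_eq.trans)
  qed
  have "[0..<2 * k] = [0..<k] @ map (\<lambda>i. i + k) [0..<k]"
    using upt_add_eq_append[of 0 k k] by (simp add: map_add_upt mult_2)
  then have "refl_count (alt s t (2 * k)) x = length (filter (\<lambda>i. alt s t (2 * i + 1) \<approx> x) [0..<k])
      + length (filter (\<lambda>i. alt s t (2 * (i + k) + 1) \<approx> x) [0..<k])"
    unfolding refl_count_def refls_alt by (simp only: filter_map o_def length_map filter_append length_append)
  also have "\<dots> = 2 * length (filter (\<lambda>i. alt s t (2 * i + 1) \<approx> x) [0..<k])"
    unfolding * by simp
  finally have "refl_count (alt s t (2 * k)) x = 2 * length (filter (\<lambda>i. alt s t (2 * i + 1) \<approx> x) [0..<k])" .
  then show ?thesis by simp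
qed

text \<open>An inserted relator contributes an even count by itself, and being trivial in the group
  it does not change the conjugate of \<open>x\<close> at which the remaining word \<open>v\<close>
  is counted.\<close>

lemma refl_count_parity: "u \<approx> v \<Longrightarrow> x \<in> lists S \<Longrightarrow> even (refl_count u x) = even (refl_count v x)"
proof (induction rule: cox_eq.induct)
  case (rel u v s t k)
  let ?r = "alt s t (2 * k)"
  have r: "?r \<in> lists S" using alt_lists rel by auto
  have e: "?r \<approx> []" using cox_eq.rel[of "[]" S "[]" s t m k] rel by (simp add: alt_concat)
  have l: "rev u @ x @ u \<in> lists S" using rel by auto
  have "rev ?r @ (rev u @ x @ u) @ ?r \<approx> [] @ (rev u @ x @ u) @ []"
    by (intro eqv_append) (use eqv_rev[OF e] e l in auto)
  then have "refl_count v (rev ?r @ (rev u @ x @ u) @ ?r) = refl_count v (rev u @ x @ u)"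
    using refl_count_cong by fastforce
  moreover have "refl_count (u @ ?r @ v) x =
      refl_count u x + (refl_count ?r (rev u @ x @ u) + refl_count v (rev ?r @ (rev u @ x @ u) @ ?r))"
    using refl_count_append[of u "?r @ v" x] refl_count_append[of ?r v "rev u @ x @ u"] rel r l by auto
  moreover have "even (refl_count ?r (rev u @ x @ u))"
    using refl_count_relator rel l by auto
  ultimately show ?case using refl_count_append[of u v x] rel unfolding alt_concat by auto
qed auto

section \<open>Reduced words and deletion of letters\<close>

definition reduced :: "'s list \<Rightarrow> bool" where
  "reduced u \<longleftrightarrow> u \<in> lists S \<and> (\<forall>v. u \<approx> v \<longrightarrow> length u \<le> length v)"

lemma reduced_exists: "u \<in> lists S \<Longrightarrow> \<exists>v. u \<approx> v \<and> reduced v"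
proof -
  assume "u \<in> lists S"
  then have "\<exists>v. u \<approx> v" using eqv_refl by blast
  then obtain v where v: "u \<approx> v" "\<forall>w. u \<approx> w \<longrightarrow> length v \<le> length w"
    using ex_has_least_nat[of "\<lambda>v. u \<approx> v" _ length] by blast
  then have "reduced v" unfolding reduced_def using eqv_lists by (meson cox_eq.trans)
  then show ?thesis using v by blast
qed

lemma reduced_Nil [simp]: "reduced []" by (simp add: reduced_def)

text \<open>If \<open>s\<close> shortens \<open>u\<close>, then \<open>u\<close> is equivalent to
  \<open>s # v\<close> with \<open>v\<close> shorter than \<open>u\<close>. The reflection
  \<open>[s]\<close> is crossed exactly once by \<open>s # v\<close>, hence an odd number of times
  by \<open>u\<close>, and a crossing of \<open>u\<close> that equals \<open>[s]\<close> is the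
  letter to be exchanged.\<close>

lemma exchange:
  assumes u: "reduced u" and s: "s \<in> S" and n: "\<not> reduced (s # u)"
  shows "\<exists>y b z. u = y @ b # z \<and> s # y \<approx> y @ [b]"
proof -
  have ul: "u \<in> lists S" using u by (simp add: reduced_def)
  obtain v where v: "s # u \<approx> v" "reduced v" using reduced_exists s ul by (metis lists.Cons)
  have "length v < Suc (length u)"
    using n v s ul unfolding reduced_def
    by (metis (no_types, lifting) cox_eq.trans length_Cons linorder_not_less lists.Cons order_trans cox_eq.sym)
  moreover have "even (length v) \<noteq> even (length u)" using eqv_parity[OF v(1)] by auto
  ultimately have lv: "length v < length u" using less_Suc_eq by auto
  have vl: "v \<in> lists S" using v eqv_lists by auto
  have usv: "u \<approx> s # v"
    using eqv_Cons[OF s v(1)] eqv_square[OF s ul] by (meson cox_eq.sym cox_eq.trans)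
  \<comment> \<open>If \<open>v\<close> crossed \<open>[s]\<close>, deleting the crossing letter
    would turn \<open>s # v\<close> into a word for \<open>u\<close> that is shorter than
    \<open>v\<close>, hence shorter than the reduced word \<open>u\<close>.\<close>
  have no: "\<not> w \<approx> [s]" if w: "w \<in> set (refls v)" for w
  proof
    assume ws: "w \<approx> [s]"
    obtain y b z where y: "v = y @ b # z" "w = y @ [b] @ rev y" using refls_elem[OF w] by blast
    have l: "y \<in> lists S" "b \<in> S" "z \<in> lists S" using vl y by auto
    have "(y @ [b]) @ rev y \<approx> [s]" using ws y by simp
    then have "y @ [b] \<approx> [s] @ y" using eqv_move_right[of y "y @ [b]" "[s]"] l s by auto
    then have "(y @ [b]) @ b # z \<approx> ([s] @ y) @ b # z" using eqv_append l by (metis eqv_refl lists.Cons)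
    moreover have "y @ (b # b # z) \<approx> y @ z" using eqv_append[of y y] eqv_square[of b z] l by simp
    ultimately have "s # v \<approx> y @ z" using y by (simp, meson cox_eq.sym cox_eq.trans)
    then have "u \<approx> y @ z" using usv by (meson cox_eq.trans)
    then have "length u \<le> length (y @ z)" using u unfolding reduced_def by blast
    then show False using y lv by simp
  qed
  \<comment> \<open>Conjugating \<open>[s]\<close> by \<open>s\<close> gives \<open>[s]\<close>
    again, so the cocycle rule counts it 1 + 0 times in \<open>s # v\<close>.\<close>
  have "[s] @ [s] @ [s] \<approx> [s]" using eqv_square[of s "[s]"] s by auto
  then have "refl_count v ([s] @ [s] @ [s]) = refl_count v [s]" by (rule refl_count_cong)
  moreover have "refl_count v [s] = 0" unfolding refl_count_def using no by (simp add: filter_empty_conv)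
  moreover have "refl_count [s] [s] = 1" unfolding refl_count_def using s by simp
  ultimately have "refl_count (s # v) [s] = 1"
    using refl_count_append[of "[s]" v "[s]"] s vl by simp
  then have "odd (refl_count u [s])" using refl_count_parity[OF usv, of "[s]"] s by auto
  then have "refl_count u [s] \<noteq> 0" by (metis even_zero)
  then obtain w where w: "w \<in> set (refls u)" "w \<approx> [s]"
    unfolding refl_count_def by (auto simp: filter_empty_conv)
  obtain y b z where y: "u = y @ b # z" "w = y @ [b] @ rev y" using refls_elem[OF w(1)] by blast
  have l: "y \<in> lists S" "b \<in> S" "z \<in> lists S" using ul y by auto
  have "(y @ [b]) @ rev y \<approx> [s]" using w y by simp
  then have "y @ [b] \<approx> [s] @ y" using eqv_move_right[of y "y @ [b]" "[s]"] l s by auto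
  then show ?thesis using y by (metis append_Cons append_Nil cox_eq.sym)
qed

lemma exchange_delete:
  assumes "s \<in> S" "y @ b # z \<in> lists S" "s # y \<approx> y @ [b]"
  shows "s # y @ b # z \<approx> y @ z"
proof -
  have "b # z \<approx> b # z" using assms by simp
  from eqv_append[OF assms(3) this] have "(s # y) @ b # z \<approx> (y @ [b]) @ b # z" .
  moreover have "y @ b # b # z \<approx> y @ z" using assms eqv_append[of y y] eqv_square[of b z] by simp
  ultimately show ?thesis using cox_eq.trans by fastforce
qed

lemma reduced_Cons_lower: "reduced u \<Longrightarrow> s \<in> S \<Longrightarrow> s # u \<approx> v \<Longrightarrow> length u \<le> Suc (length v)"
proof -
  assume a: "reduced u" "s \<in> S" "s # u \<approx> v"
  have "s # s # u \<approx> s # v" using eqv_Cons a by auto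
  then have "u \<approx> s # v" using eqv_square[of s u] a by (meson cox_eq.sym cox_eq.trans reduced_def)
  then show ?thesis using a(1) unfolding reduced_def by fastforce
qed

text \<open>Reducing by the exchange condition only deletes letters, so the result stays over
  \<open>T\<close>. Hence the length of an element of a parabolic subgroup is attained by a word in
  its own generators.\<close>

lemma parabolic_reduced:
  assumes "T \<subseteq> S" "u \<in> lists T" shows "\<exists>v\<in>lists T. u \<approx> v \<and> reduced v"
  using assms(2)
proof (induction u)
  case Nil then show ?case by (intro bexI[of _ "[]"]) auto
next
  case (Cons s u)
  then obtain v where v: "v \<in> lists T" "u \<approx> v" "reduced v" by auto
  have s: "s \<in> S" "s \<in> T" using Cons assms by auto
  have e: "s # u \<approx> s # v" using eqv_Cons s v by auto
  show ?case
  proof (cases "reduced (s # v)")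
    case True then show ?thesis using e v s by (intro bexI[of _ "s # v"]) auto
  next
    case False
    then obtain y b z where y: "v = y @ b # z" "s # y \<approx> y @ [b]" using exchange v s by blast
    have d: "s # v \<approx> y @ z" using exchange_delete[of s y b z] y s v reduced_def by auto
    have "reduced (y @ z)"
      unfolding reduced_def
    proof safe
      show "\<And>x. x \<in> set (y @ z) \<Longrightarrow> x \<in> S" using v y unfolding reduced_def by auto
      fix w assume "y @ z \<approx> w"
      then have "s # v \<approx> w" using d by (meson cox_eq.trans)
      then have "length v \<le> Suc (length w)" using reduced_Cons_lower v s by auto
      then show "length (y @ z) \<le> length w" using y by simp
    qed
    then show ?thesis using e d v y by (intro bexI[of _ "y @ z"]) (auto intro: cox_eq.trans)
  qed
qed

text \<open>The letters of \<open>u\<close> are put in front of \<open>v\<close> one by one. If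
  reducedness failed, exchange would delete a letter of \<open>u\<close>, giving a shorter word for
  \<open>u\<close>, or a letter of \<open>v\<close>, giving a shorter element in the same coset of
  the parabolic subgroup of \<open>T\<close>; both contradict \<open>min\<close>.\<close>

lemma min_coset_additive:
  assumes T: "T \<subseteq> S" and u: "u \<in> lists S"
    and min: "\<And>v w. v \<in> lists T \<Longrightarrow> u @ v \<approx> w \<Longrightarrow> length u \<le> length w"
    and v: "v \<in> lists T" "reduced v"
  shows "reduced (u @ v)"
proof -
  have vl: "v \<in> lists S" using v reduced_def by auto
  have "u1 @ u2 = u \<Longrightarrow> reduced (u2 @ v)" for u1 u2
  proof (induction u2 arbitrary: u1)
    case (Cons s u2)
    have IH: "reduced (u2 @ v)" using Cons.IH[of "u1 @ [s]"] Cons.prems by simp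
    have l: "u1 \<in> lists S" "s \<in> S" "u2 \<in> lists S" using Cons.prems u by auto
    show ?case
    proof (rule ccontr)
      assume "\<not> reduced ((s # u2) @ v)"
      then obtain y b z where y: "u2 @ v = y @ b # z" "s # y \<approx> y @ [b]"
        using exchange[OF IH l(2)] by auto
      then consider z' where "u2 = y @ b # z'" "z = z' @ v" | y' where "y = u2 @ y'" "v = y' @ b # z"
        by (auto simp: append_eq_append_conv2 append_eq_Cons_conv Cons_eq_append_conv)
      then show False
      proof cases
        case 1
        then have "s # u2 \<approx> y @ z'" using exchange_delete[of s y b z'] l y by auto
        then have "u1 @ s # u2 \<approx> u1 @ y @ z'" using eqv_append[of u1 u1] l by simp
        then have "length u \<le> length (u1 @ y @ z')" using min[of "[]" "u1 @ y @ z'"] Cons.prems by simp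
        then show False using 1 Cons.prems by auto
      next
        case 2
        have "s # u2 @ y' @ b # z \<approx> u2 @ y' @ z" using exchange_delete[of s "u2 @ y'" b z] l y 2 vl by auto
        then have "s # u2 @ v @ rev (y' @ z) \<approx> u2"
          using eqv_move_right[of "y' @ z" "s # u2 @ v" u2] 2 vl l by simp
        then have "u1 @ s # u2 @ v @ rev (y' @ z) \<approx> u1 @ u2" using eqv_append[of u1 u1] l by simp
        moreover have "v @ rev (y' @ z) \<in> lists T" using v 2 by auto
        ultimately have "length u \<le> length (u1 @ u2)" using min[of "v @ rev (y' @ z)" "u1 @ u2"] Cons.prems by auto
        then show False using Cons.prems by auto
      qed
    qed
  qed (use v in simp)
  then show ?thesis by (metis append_Nil)
qed

end

context coxeter_system
begin

subsection \<open>Parabolic subgroups\<close>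

abbreviation cl :: "'s list \<Rightarrow> 's list set" where
  "cl u \<equiv> cox_class S m u"

lemma foldr_eqv:
  assumes act_act: "\<And>i l. i \<in> S \<Longrightarrow> act i (act i l) = l"
    and braid: "\<And>i j k l. i \<in> S \<Longrightarrow> j \<in> S \<Longrightarrow> i \<noteq> j \<Longrightarrow> m i j = enat k \<Longrightarrow> foldr act (alt i j (2 * k)) l = l"
  shows "u \<approx> v \<Longrightarrow> foldr act u l = foldr act v l"
proof (induction arbitrary: l rule: cox_eq.induct)
  case (rel u v i j k)
  have "foldr act (alt i j (2 * k)) l' = l'" for l'
  proof (cases "i = j")
    case True
    then have "k = 1" using rel diag by (metis one_enat_def enat.inject)
    then show ?thesis using True rel act_act by (simp add: numeral_2_eq_2)
  next
    case False then show ?thesis using braid rel by auto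
  qed
  then show ?case by (simp add: alt_concat)
qed auto

lemma cl_eq_iff: "u \<in> lists S \<Longrightarrow> cl u = cl v \<longleftrightarrow> u \<approx> v"
  unfolding cox_class_def by (metis (no_types, lifting) Collect_cong cox_eq.sym cox_eq.trans eqv_refl mem_Collect_eq)

lemma mult_cl:
  assumes "u \<in> lists S" "v \<in> lists S"
  shows "cl u \<otimes>\<^bsub>coxeter_group S m\<^esub> cl v = cl (u @ v)"
proof -
  have *: "cl (x @ y) = cl (u @ v)" if "x \<in> cl u" "y \<in> cl v" for x y
    using eqv_append[of u x v y] cl_eq_iff[of "u @ v" "x @ y"] assms that by (simp add: cox_class_def)
  have "cl u \<otimes>\<^bsub>coxeter_group S m\<^esub> cl v = (\<Union>x\<in>cl u. \<Union>y\<in>cl v. cl (x @ y))"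
    by (simp add: coxeter_group_def)
  also have "\<dots> = (\<Union>x\<in>cl u. \<Union>y\<in>cl v. cl (u @ v))" by (simp add: * cong: SUP_cong_simp)
  also have "\<dots> = cl (u @ v)"
  proof -
    have "u \<in> cl u" "v \<in> cl v" using assms by (simp_all add: cox_class_def)
    then show ?thesis by blast
  qed
  finally show ?thesis .
qed

lemma one_cl: "\<one>\<^bsub>coxeter_group S m\<^esub> = cl []" by (simp add: coxeter_group_def)

lemma carrier_cl: "carrier (coxeter_group S m) = cl ` lists S" by (simp add: coxeter_group_def)

lemma group_coxeter: "group (coxeter_group S m)"
proof (rule groupI)
  fix x assume "x \<in> carrier (coxeter_group S m)"
  then obtain u where u: "u \<in> lists S" "x = cl u" by (auto simp: carrier_cl)
  then have "cl (rev u) \<otimes>\<^bsub>coxeter_group S m\<^esub> x = \<one>\<^bsub>coxeter_group S m\<^esub>"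
    using mult_cl[of "rev u" u] eqv_rev_left[of u] cl_eq_iff[of "rev u @ u" "[]"] by (simp add: one_cl)
  then show "\<exists>y\<in>carrier (coxeter_group S m). y \<otimes>\<^bsub>coxeter_group S m\<^esub> x = \<one>\<^bsub>coxeter_group S m\<^esub>"
    using u by (intro bexI[of _ "cl (rev u)"]) (auto simp: carrier_cl)
next
  fix x y assume "x \<in> carrier (coxeter_group S m)" "y \<in> carrier (coxeter_group S m)"
  then obtain u v where "u \<in> lists S" "x = cl u" "v \<in> lists S" "y = cl v" unfolding carrier_cl by blast
  then show "x \<otimes>\<^bsub>coxeter_group S m\<^esub> y \<in> carrier (coxeter_group S m)"
    by (simp add: carrier_cl mult_cl)
  fix z assume "z \<in> carrier (coxeter_group S m)"
  then obtain w where "w \<in> lists S" "z = cl w" unfolding carrier_cl by blast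
  then show "x \<otimes>\<^bsub>coxeter_group S m\<^esub> y \<otimes>\<^bsub>coxeter_group S m\<^esub> z =
      x \<otimes>\<^bsub>coxeter_group S m\<^esub> (y \<otimes>\<^bsub>coxeter_group S m\<^esub> z)"
    using \<open>u \<in> lists S\<close> \<open>x = cl u\<close> \<open>v \<in> lists S\<close> \<open>y = cl v\<close> by (simp add: mult_cl)
next
  show "\<one>\<^bsub>coxeter_group S m\<^esub> \<in> carrier (coxeter_group S m)" by (simp add: carrier_cl one_cl)
next
  fix x assume "x \<in> carrier (coxeter_group S m)"
  then obtain u where "u \<in> lists S" "x = cl u" unfolding carrier_cl by blast
  then show "\<one>\<^bsub>coxeter_group S m\<^esub> \<otimes>\<^bsub>coxeter_group S m\<^esub> x = x" by (simp add: mult_cl one_cl)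
qed

lemma inv_cl: "u \<in> lists S \<Longrightarrow> inv\<^bsub>coxeter_group S m\<^esub> (cl u) = cl (rev u)"
proof -
  interpret group "coxeter_group S m" by (rule group_coxeter)
  assume u: "u \<in> lists S"
  show ?thesis
    by (rule inv_equality)
      (use u mult_cl[of "rev u" u] eqv_rev_left[of u] cl_eq_iff[of "rev u @ u" "[]"] in \<open>simp_all add: one_cl carrier_cl\<close>)
qed

lemma parabolic_eq:
  assumes "T \<subseteq> S" shows "parabolic S m T = cl ` lists T"
proof
  have TS: "u \<in> lists T \<Longrightarrow> u \<in> lists S" for u using assms by auto
  show "parabolic S m T \<subseteq> cl ` lists T"
  proof
    fix x assume "x \<in> parabolic S m T"
    then show "x \<in> cl ` lists T"
      unfolding parabolic_def
    proof (induction rule: generate.induct)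
      case one then show ?case by (auto simp: one_cl)
    next
      case (incl h) then show ?case by auto
    next
      case (inv h)
      then obtain s where s: "s \<in> T" "h = cl [s]" by auto
      then have "inv\<^bsub>coxeter_group S m\<^esub> h = cl [s]" using inv_cl[of "[s]"] assms by auto
      then show ?case using s by auto
    next
      case (eng h1 h2)
      then obtain u v where "u \<in> lists T" "v \<in> lists T" "h1 = cl u" "h2 = cl v" by auto
      then show ?case using mult_cl TS by (metis append_in_lists_conv imageI)
    qed
  qed
  show "cl ` lists T \<subseteq> parabolic S m T"
  proof
    fix x assume "x \<in> cl ` lists T"
    then obtain u where u: "u \<in> lists T" "x = cl u" by auto
    have "cl u \<in> parabolic S m T"
      using u(1)
    proof (induction u)
      case Nil then show ?case unfolding parabolic_def by (metis generate.one one_cl)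
    next
      case (Cons s u)
      then have "cl [s] \<otimes>\<^bsub>coxeter_group S m\<^esub> cl u \<in> parabolic S m T"
        unfolding parabolic_def by (auto intro: generate.eng generate.incl)
      then show ?case using mult_cl[of "[s]" u] Cons TS[of "s # u"] by auto
    qed
    then show "x \<in> parabolic S m T" using u by simp
  qed
qed

lemma cox_length_reduced: "reduced u \<Longrightarrow> cox_length (cl u) = length u"
  unfolding cox_length_def cox_class_def 
  by (rule Least_equality) (auto simp: reduced_def intro!: exI[of _ u])

lemma parabolic_reduced_rep: "T \<subseteq> S \<Longrightarrow> x \<in> parabolic S m T \<Longrightarrow> \<exists>u\<in>lists T. x = cl u \<and> reduced u"
proof -
  assume a: "T \<subseteq> S" "x \<in> parabolic S m T"
  then obtain u where u: "u \<in> lists T" "x = cl u" using parabolic_eq by auto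
  obtain v where "v \<in> lists T" "u \<approx> v" "reduced v" using parabolic_reduced[OF a(1) u(1)] by auto
  moreover have "u \<in> lists S" using a u by auto
  ultimately show ?thesis using u cl_eq_iff by metis
qed

lemma parabolic_empty: "parabolic S m {} = {cl []}"
  using parabolic_eq[of "{}"] by simp

lemma poincare_empty: "poincare_poly S m {} = 1"
  unfolding poincare_poly_def parabolic_empty using cox_length_reduced[of "[]"] by (simp add: one_poly_eq_simps)

end

subsection \<open>Coset tables\<close>

text \<open>An action of the group on a set, a finite orbit \<open>\<Lambda>\<close> of the parabolic subgroup of \<open>T\<close>, and the
  distance \<open>h\<close> from the base point. The dihedral condition makes the stabiliser of the base point
  the parabolic subgroup of \<open>T - {s}\<close>, so \<open>\<Lambda>\<close> enumerates the minimal coset representatives.\<close>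

locale coset_table = coxeter_system S m for S :: "'s set" and m +
  fixes T :: "'s set" and s :: 's and act :: "'s \<Rightarrow> 'l \<Rightarrow> 'l" and \<Lambda> :: "'l set"
    and l0 :: 'l and h :: "'l \<Rightarrow> nat"
  assumes TS: "T \<subseteq> S" and sT: "s \<in> T" and finL: "finite \<Lambda>" and l0: "l0 \<in> \<Lambda>"
    and act_act: "i \<in> S \<Longrightarrow> act i (act i l) = l"
    and braid: "i \<in> S \<Longrightarrow> j \<in> S \<Longrightarrow> i \<noteq> j \<Longrightarrow> m i j = enat k \<Longrightarrow> foldr act (alt i j (2 * k)) l = l"
    and act_in: "i \<in> T \<Longrightarrow> l \<in> \<Lambda> \<Longrightarrow> act i l \<in> \<Lambda>"
    and l0_fix: "i \<in> T \<Longrightarrow> act i l0 = l0 \<longleftrightarrow> i \<noteq> s"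
    and h0: "l \<in> \<Lambda> \<Longrightarrow> h l = 0 \<longleftrightarrow> l = l0"
    and hstep: "i \<in> T \<Longrightarrow> l \<in> \<Lambda> \<Longrightarrow> act i l = l \<or> h (act i l) = Suc (h l) \<or> h l = Suc (h (act i l))"
    and descent: "l \<in> \<Lambda> \<Longrightarrow> l \<noteq> l0 \<Longrightarrow> \<exists>i\<in>T. h l = Suc (h (act i l))"
    and dihedral: "i \<in> T \<Longrightarrow> j \<in> T \<Longrightarrow> i \<noteq> j \<Longrightarrow> l \<in> \<Lambda> \<Longrightarrow> h (act i l) < h l \<Longrightarrow> h (act j l) \<le> h l \<Longrightarrow>
      \<exists>k\<ge>2. m i j = enat k \<and> (\<forall>p. 0 < p \<and> p \<le> k \<longrightarrow> h (foldr act (rev (alt i j p)) l) < h l)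
        \<and> (act j l \<noteq> l \<longrightarrow> (\<forall>p. 0 < p \<and> p \<le> k \<longrightarrow> h (foldr act (rev (alt j i p)) l) < h l))"
begin

abbreviation wact :: "'s list \<Rightarrow> 'l \<Rightarrow> 'l" where "wact \<equiv> foldr act"

lemma wact_eqv: "u \<approx> v \<Longrightarrow> wact u l = wact v l"
  using foldr_eqv[of act u v l] act_act braid by blast

lemma wact_in: "u \<in> lists T \<Longrightarrow> l \<in> \<Lambda> \<Longrightarrow> wact u l \<in> \<Lambda>"
  by (induction u) (auto simp: act_in)

lemma h_wact: "u \<in> lists T \<Longrightarrow> h (wact u l0) \<le> length u"
proof (induction u)
  case Nil then show ?case using h0[OF l0] by simp
next
  case (Cons i u)
  then have "wact u l0 \<in> \<Lambda>" "i \<in> T" using wact_in l0 by auto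
  then show ?case using hstep[of i "wact u l0"] Cons by auto
qed

definition down :: "'l \<Rightarrow> 's" where
  "down l = (SOME i. i \<in> T \<and> h l = Suc (h (act i l)))"

lemma down: "l \<in> \<Lambda> \<Longrightarrow> l \<noteq> l0 \<Longrightarrow> down l \<in> T \<and> h l = Suc (h (act (down l) l))"
  unfolding down_def using someI_ex[of "\<lambda>i. i \<in> T \<and> h l = Suc (h (act i l))"] descent[of l] by blast

primrec repk :: "nat \<Rightarrow> 'l \<Rightarrow> 's list" where
  "repk 0 l = []"
| "repk (Suc k) l = down l # repk k (act (down l) l)"

definition rep :: "'l \<Rightarrow> 's list" where "rep l = repk (h l) l"

lemma rep_l0: "rep l0 = []" unfolding rep_def using h0[OF l0] by simp

lemma rep_step: "l \<in> \<Lambda> \<Longrightarrow> l \<noteq> l0 \<Longrightarrow> rep l = down l # rep (act (down l) l)"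
  unfolding rep_def using down[of l] by simp

lemma rep_props: "l \<in> \<Lambda> \<Longrightarrow> rep l \<in> lists T \<and> length (rep l) = h l \<and> wact (rep l) l0 = l"
proof (induction "h l" arbitrary: l)
  case 0 then show ?case using h0[of l] rep_l0 by auto
next
  case (Suc n)
  then have n: "l \<noteq> l0" using h0[of l] by auto
  note d = down[OF Suc.prems n]
  have "act (down l) l \<in> \<Lambda>" using act_in d Suc.prems by auto
  moreover have "n = h (act (down l) l)" using d Suc.hyps(2) by simp
  ultimately have "rep (act (down l) l) \<in> lists T \<and> length (rep (act (down l) l)) = h (act (down l) l)
      \<and> wact (rep (act (down l) l)) l0 = act (down l) l" using Suc.hyps(1) by blast
  then show ?case using rep_step[OF Suc.prems n] d act_act[of "down l" l] TS Suc.hyps(2) by auto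
qed

lemma rep_lists: "l \<in> \<Lambda> \<Longrightarrow> rep l \<in> lists S" using rep_props[of l] TS by auto

text \<open>Equality of left cosets of the parabolic subgroup generated by \<open>T - {s}\<close>,
  expressed on words.\<close>

definition ceq :: "'s list \<Rightarrow> 's list \<Rightarrow> bool" (infix \<open>\<sim>\<close> 50) where
  "u \<sim> v \<longleftrightarrow> (\<exists>q\<in>lists (T - {s}). u \<approx> v @ q)"

lemma QS: "q \<in> lists (T - {s}) \<Longrightarrow> q \<in> lists S" using TS by auto

lemma eqv_ceq: "u \<approx> v \<Longrightarrow> u \<sim> v"
  unfolding ceq_def by (rule bexI[of _ "[]"]) auto

lemma ceq_sym: "u \<sim> v \<Longrightarrow> v \<sim> u"
proof -
  assume "u \<sim> v"
  then obtain q where q: "q \<in> lists (T - {s})" "u \<approx> v @ q" by (auto simp: ceq_def)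
  then have "u \<in> lists S" "v \<in> lists S" using eqv_lists by fastforce+
  then have "u @ rev q \<approx> v" using eqv_move_right[of q u v] q QS by simp
  then show ?thesis unfolding ceq_def by (intro bexI[of _ "rev q"]) (use q in \<open>auto intro: cox_eq.sym\<close>)
qed

lemma ceq_trans [trans]: "u \<sim> v \<Longrightarrow> v \<sim> w \<Longrightarrow> u \<sim> w"
proof -
  assume "u \<sim> v" "v \<sim> w"
  then obtain q q' where q: "q \<in> lists (T - {s})" "u \<approx> v @ q" "q' \<in> lists (T - {s})" "v \<approx> w @ q'"
    by (auto simp: ceq_def)
  have "v @ q \<approx> (w @ q') @ q" using eqv_append[OF q(4), of q q] QS q by simp
  then have "u \<approx> w @ (q' @ q)" using q(2) by (metis append_assoc cox_eq.trans)
  then show ?thesis unfolding ceq_def using q by (intro bexI[of _ "q' @ q"]) auto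
qed

lemma ceq_append: "x \<in> lists S \<Longrightarrow> u \<sim> v \<Longrightarrow> x @ u \<sim> x @ v"
  unfolding ceq_def using eqv_append[of x x u] by auto

text \<open>Transport of representatives along a rank two path that stays below height
  \<open>N\<close>. Each single step joins two points below \<open>N\<close>; a step that does not
  go up is an instance of \<open>IH\<close> at its start, an upward step is an instance read
  backwards from its end.\<close>

lemma rep_path:
  assumes IH: "\<And>l j. l \<in> \<Lambda> \<Longrightarrow> h l < N \<Longrightarrow> j \<in> T \<Longrightarrow> h (act j l) \<le> h l \<Longrightarrow> j # rep l \<sim> rep (act j l)"
    and ij: "i \<in> T" "j \<in> T" and l: "l \<in> \<Lambda>" "h l < N"
    and low: "\<forall>q\<le>p. h (wact (rev (alt i j q)) l) < N"
  shows "rep l \<sim> alt i j p @ rep (wact (rev (alt i j p)) l)"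
  using ij l low
proof (induction p arbitrary: i j l)
  case 0
  then show ?case using eqv_ceq rep_lists by auto
next
  case (Suc p)
  let ?l = "act i l"
  have l': "?l \<in> \<Lambda>" using Suc.prems act_in by auto
  have "h (wact (rev (alt i j 1)) l) < N" using Suc.prems(5) by (metis Suc_eq_plus1 le_add2)
  then have hl: "h ?l < N" by simp
  have "h (wact (rev (alt j i q)) ?l) < N" if "q \<le> p" for q
    using Suc.prems(5)[rule_format, of "Suc q"] that by simp
  then have 1: "rep ?l \<sim> alt j i p @ rep (wact (rev (alt j i p)) ?l)"
    using Suc.IH[of j i ?l] Suc.prems l' hl by auto
  have 2: "rep l \<sim> i # rep ?l"
  proof (cases "h ?l \<le> h l")
    case True
    then have "i # rep l \<sim> rep ?l" using IH Suc.prems by auto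
    then have "[i] @ (i # rep l) \<sim> [i] @ rep ?l" using ceq_append[of "[i]"] Suc.prems TS by auto
    moreover have "rep l \<sim> i # i # rep l"
      using eqv_ceq[OF cox_eq.sym[OF eqv_square[of i "rep l"]]] rep_lists Suc.prems TS by auto
    ultimately show ?thesis using ceq_trans by simp
  next
    case False
    then have "i # rep ?l \<sim> rep (act i ?l)" using IH[OF l' hl, of i] Suc.prems act_act[of i l] TS by auto
    then show ?thesis using act_act[of i l] Suc.prems TS ceq_sym by auto
  qed
  have "i # rep ?l \<sim> i # alt j i p @ rep (wact (rev (alt j i p)) ?l)"
    using ceq_append[OF _ 1, of "[i]"] Suc.prems TS by auto
  then show ?case using 2 ceq_trans by simp
qed

text \<open>A confluence argument by induction on the height. With \<open>d\<close> the chosen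
  descent of \<open>l\<close>, the alternating paths of length m(d, j) that leave \<open>l\<close>
  through \<open>d\<close> and through \<open>j\<close> end in the same point \<open>y\<close> by
  the braid relation. By the dihedral condition the path through \<open>d\<close>, and also the one
  through \<open>j\<close> if it moves \<open>l\<close>, runs strictly below \<open>l\<close> after
  its first step, where the induction hypothesis applies.\<close>

lemma rep_equivariant_down:
  "l \<in> \<Lambda> \<Longrightarrow> j \<in> T \<Longrightarrow> h (act j l) \<le> h l \<Longrightarrow> j # rep l \<sim> rep (act j l)"
proof (induction "h l" arbitrary: l j rule: less_induct)
  case less
  have jS: "j \<in> S" using less TS by auto
  note l = less.prems(1)
  have IH: "\<And>l' j. l' \<in> \<Lambda> \<Longrightarrow> h l' < h l \<Longrightarrow> j \<in> T \<Longrightarrow> h (act j l') \<le> h l' \<Longrightarrow> j # rep l' \<sim> rep (act j l')"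
    using less.hyps by blast
  show ?case
  proof (cases "l = l0")
    case True
    then have "act j l = l" using hstep[of j l] less.prems h0[of l] by auto
    then have "j \<noteq> s" using l0_fix[of j] less.prems True by auto
    then show ?thesis using True less.prems jS l0_fix[of j] rep_l0
      by (auto simp: ceq_def intro!: bexI[of _ "[j]"])
  next
    case False
    define d where "d = down l"
    have d: "d \<in> T" "h l = Suc (h (act d l))" "rep l = d # rep (act d l)"
      using down[OF l False] rep_step[OF l False] by (auto simp: d_def)
    have dS: "d \<in> S" using d TS by auto
    have dl: "act d l \<in> \<Lambda>" using act_in d l by auto
    show ?thesis
    proof (cases "j = d")
      case True
      then have "j # rep l \<approx> rep (act j l)" using d eqv_square[of d "rep (act d l)"] dS dl rep_lists by auto
      then show ?thesis by (rule eqv_ceq)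
    next
      case False
      obtain k where k: "k \<ge> 2" "m d j = enat k"
        and P: "\<forall>p. 0 < p \<and> p \<le> k \<longrightarrow> h (wact (rev (alt d j p)) l) < h l"
        and Q: "act j l \<noteq> l \<longrightarrow> (\<forall>p. 0 < p \<and> p \<le> k \<longrightarrow> h (wact (rev (alt j d p)) l) < h l)"
        using dihedral[of d j l] d less.prems False by auto
      have eqw: "alt d j k \<approx> alt j d k"
      proof -
        have "alt d j (2 * k) \<approx> []"
          using cox_eq.rel[of "[]" S "[]" d j m k] k dS jS by (simp add: alt_concat)
        then have "alt d j k @ rev (alt j d k) \<approx> []" by (simp add: alt_double)
        then show ?thesis using eqv_move_right[of "alt j d k" "alt d j k" "[]"] alt_lists dS jS by simp
      qed
      define y where "y = wact (rev (alt d j k)) l"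
      have y: "wact (rev (alt j d k)) l = y" unfolding y_def using wact_eqv[OF eqv_rev[OF eqw]] by simp
      have y_in: "y \<in> \<Lambda>" unfolding y_def using wact_in[of "rev (alt d j k)" l] l alt_in_lists[of d T j k]
        d(1) less.prems(2) by simp
      have path: "rep l \<sim> alt d j (Suc p) @ rep (wact (rev (alt d j (Suc p))) l)" if "Suc p \<le> k" for p
      proof -
        have "h (wact (rev (alt j d q)) (act d l)) < h l" if "q \<le> p" for q
          using P[rule_format, of "Suc q"] that \<open>Suc p \<le> k\<close> by simp
        then have "rep (act d l) \<sim> alt j d p @ rep (wact (rev (alt j d p)) (act d l))"
          using rep_path[where N = "h l" and i = j and j = d and l = "act d l" and p = p, OF IH] d dl less.prems by auto
        then show ?thesis using ceq_append[of "[d]"] dS d by simp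
      qed
      have full: "rep l \<sim> alt d j k @ rep y" using path[of "k - 1"] k unfolding y_def by simp
      have swap: "alt j d k @ rep y \<sim> rep l"
      proof -
        have "alt j d k @ rep y \<approx> alt d j k @ rep y"
          using eqv_append[OF cox_eq.sym[OF eqw]] rep_lists[OF y_in] by simp
        then show ?thesis using ceq_trans[OF eqv_ceq ceq_sym[OF full]] by simp
      qed
      define k' where "k' = k - 2"
      then have k': "k = Suc (Suc k')" using k by simp
      show ?thesis
      proof (cases "act j l = l")
        \<comment> \<open>Since \<open>j\<close> fixes \<open>l\<close>, the path that begins with
          \<open>j\<close> wastes its first step, so the path that begins with \<open>d\<close>
          reaches \<open>y\<close> one step early. Prefixing \<open>j\<close> then completes the
          other side of the braid relation.\<close>
        case True
        have "wact (rev (alt d j (Suc k'))) l = y" using y True k' by simp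
        then have "rep l \<sim> alt d j (Suc k') @ rep y" using path[of k'] k' by simp
        then have "j # rep l \<sim> alt j d k @ rep y" using ceq_append[of "[j]"] jS k' by simp
        then show ?thesis using ceq_trans[OF _ swap] True by simp
      next
        \<comment> \<open>Both paths descend. The one through \<open>act j l\<close> shows that
          \<open>j # rep (act j l)\<close> lies in the coset of \<open>rep l\<close>; multiplying by
          \<open>j\<close> once more reverses this.\<close>
        case False
        have jl: "act j l \<in> \<Lambda>" using act_in l less.prems by auto
        have hQ: "h (wact (rev (alt d j q)) (act j l)) < h l" if "q \<le> Suc k'" for q
          using Q[rule_format, OF False, of "Suc q"] that k' by simp
        have "rep (act j l) \<sim> alt d j (Suc k') @ rep (wact (rev (alt d j (Suc k'))) (act j l))"
          using rep_path[where N = "h l" and i = d and j = j and l = "act j l" and p = "Suc k'", OF IH] hQ hQ[of 0] d less.prems jl by auto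
        then have "rep (act j l) \<sim> alt d j (Suc k') @ rep y" using y k' by simp
        then have "j # rep (act j l) \<sim> alt j d k @ rep y" using ceq_append[of "[j]"] jS k' by simp
        then have e: "j # rep (act j l) \<sim> rep l" using ceq_trans[OF _ swap] by simp
        have "j # rep l \<sim> j # j # rep (act j l)" using ceq_append[OF _ ceq_sym[OF e], of "[j]"] jS by simp
        moreover have "j # j # rep (act j l) \<sim> rep (act j l)"
          by (intro eqv_ceq eqv_square jS rep_lists jl)
        ultimately show ?thesis by (rule ceq_trans)
      qed
    qed
  qed
qed

lemma rep_equivariant:
  assumes l: "l \<in> \<Lambda>" and j: "j \<in> T" shows "j # rep l \<sim> rep (act j l)"
proof (cases "h (act j l) \<le> h l")
  case True then show ?thesis using rep_equivariant_down assms by auto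
next
  case False
  have jS: "j \<in> S" using j TS by auto
  have e: "j # rep (act j l) \<sim> rep l"
    using rep_equivariant_down[of "act j l" j] False act_in[OF j l] act_act[OF jS, of l] j by auto
  have "j # rep l \<sim> j # j # rep (act j l)" using ceq_append[OF _ ceq_sym[OF e], of "[j]"] jS by simp
  moreover have "j # j # rep (act j l) \<sim> rep (act j l)"
    by (intro eqv_ceq eqv_square jS rep_lists act_in[OF j l])
  ultimately show ?thesis by (rule ceq_trans)
qed

text \<open>The decisive consequence: a word that fixes \<open>l0\<close> lies in the parabolic
  subgroup of \<open>T - {s}\<close>, so the stabiliser of the base point is no larger than
  expected.\<close>

lemma word_ceq_rep: "u \<in> lists T \<Longrightarrow> u \<sim> rep (wact u l0)"
proof (induction u)
  case Nil show ?case using eqv_ceq[of "[]" "[]"] rep_l0 by simp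
next
  case (Cons j u)
  have "[j] \<in> lists S" using Cons TS by auto
  from ceq_append[OF this] Cons have "[j] @ u \<sim> [j] @ rep (wact u l0)" by simp
  moreover have "j # rep (wact u l0) \<sim> rep (act j (wact u l0))"
    using Cons.prems by (intro rep_equivariant wact_in l0) auto
  ultimately show ?case using ceq_trans[of "j # u" "j # rep (wact u l0)"] by simp
qed

lemma wact_Q: "q \<in> lists (T - {s}) \<Longrightarrow> wact q l0 = l0"
  by (induction q) (auto simp: l0_fix)

text \<open>One letter changes \<open>h\<close> by at most 1, so no word over \<open>T\<close> that
  carries \<open>l0\<close> to \<open>l\<close> is shorter than \<open>h l\<close>. Thus
  \<open>rep l\<close> is shortest in its coset and lengths add.\<close>

lemma rep_additive:
  assumes l: "l \<in> \<Lambda>" and q: "q \<in> lists (T - {s})" "reduced q"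
  shows "reduced (rep l @ q)"
proof (rule min_coset_additive[of "T - {s}"])
  fix v w assume v: "v \<in> lists (T - {s})" and e: "rep l @ v \<approx> w"
  have "rep l @ v \<in> lists T" using rep_props[OF l] v by auto
  then obtain w' where w': "w' \<in> lists T" "rep l @ v \<approx> w'" "reduced w'" using parabolic_reduced[OF TS] by blast
  have "wact w' l0 = l" using wact_eqv[OF w'(2)] wact_Q[OF v] rep_props[OF l] by (metis foldr_append)
  then have "h l \<le> length w'" using h_wact[OF w'(1)] by simp
  also have "length w' \<le> length w" using w' e unfolding reduced_def by (meson cox_eq.sym cox_eq.trans)
  finally show "length (rep l) \<le> length w" using rep_props[OF l] by simp
qed (use TS rep_lists l q in auto)

text \<open>Injectivity: acting on \<open>l0\<close> recovers \<open>l\<close> from the product,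
  since the second factor fixes \<open>l0\<close>. Surjectivity is
  \<open>word_ceq_rep\<close>.\<close>

lemma bij_coset: "bij_betw (\<lambda>(l, x). cl (rep l) \<otimes>\<^bsub>coxeter_group S m\<^esub> x)
    (\<Lambda> \<times> parabolic S m (T - {s})) (parabolic S m T)"
  unfolding bij_betw_def
proof
  have Qsub: "T - {s} \<subseteq> S" using TS by auto
  have form: "cl (rep l) \<otimes>\<^bsub>coxeter_group S m\<^esub> cl q = cl (rep l @ q)" if "l \<in> \<Lambda>" "q \<in> lists (T - {s})" for l q
    using mult_cl rep_lists that QS by auto
  show "inj_on (\<lambda>(l, x). cl (rep l) \<otimes>\<^bsub>coxeter_group S m\<^esub> x) (\<Lambda> \<times> parabolic S m (T - {s}))"
  proof (rule inj_onI, clarify)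
    fix l x l' x' assume a: "l \<in> \<Lambda>" "l' \<in> \<Lambda>" "x \<in> parabolic S m (T - {s})" "x' \<in> parabolic S m (T - {s})"
      "cl (rep l) \<otimes>\<^bsub>coxeter_group S m\<^esub> x = cl (rep l') \<otimes>\<^bsub>coxeter_group S m\<^esub> x'"
    obtain q q' where q: "q \<in> lists (T - {s})" "x = cl q" "q' \<in> lists (T - {s})" "x' = cl q'"
      using a parabolic_eq[OF Qsub] by auto
    have e: "rep l @ q \<approx> rep l' @ q'"
      using a q form cl_eq_iff[of "rep l @ q"] rep_lists QS by auto
    have "wact (rep l @ q) l0 = l" "wact (rep l' @ q') l0 = l'" using wact_Q q rep_props a by auto
    then have "l = l'" using wact_eqv[OF e] by metis
    moreover have "q \<approx> q'" using e \<open>l = l'\<close> eqv_cancel_left by auto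
    ultimately show "l = l' \<and> x = x'" using q cl_eq_iff QS by auto
  qed
  show "(\<lambda>(l, x). cl (rep l) \<otimes>\<^bsub>coxeter_group S m\<^esub> x) ` (\<Lambda> \<times> parabolic S m (T - {s})) = parabolic S m T"
  proof
    show "(\<lambda>(l, x). cl (rep l) \<otimes>\<^bsub>coxeter_group S m\<^esub> x) ` (\<Lambda> \<times> parabolic S m (T - {s})) \<subseteq> parabolic S m T"
    proof clarify
      fix l x assume a: "l \<in> \<Lambda>" "x \<in> parabolic S m (T - {s})"
      then obtain q where q: "q \<in> lists (T - {s})" "x = cl q" using parabolic_eq[OF Qsub] by auto
      then have "rep l @ q \<in> lists T" using rep_props a by auto
      then show "cl (rep l) \<otimes>\<^bsub>coxeter_group S m\<^esub> x \<in> parabolic S m T"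
        using form[OF a(1) q(1)] q parabolic_eq[OF TS] by auto
    qed
    show "parabolic S m T \<subseteq> (\<lambda>(l, x). cl (rep l) \<otimes>\<^bsub>coxeter_group S m\<^esub> x) ` (\<Lambda> \<times> parabolic S m (T - {s}))"
    proof
      fix x assume "x \<in> parabolic S m T"
      then obtain u where u: "u \<in> lists T" "x = cl u" using parabolic_eq[OF TS] by auto
      obtain q where q: "q \<in> lists (T - {s})" "u \<approx> rep (wact u l0) @ q"
        using word_ceq_rep[OF u(1)] by (auto simp: ceq_def)
      have li: "wact u l0 \<in> \<Lambda>" using wact_in u l0 by auto
      have "x = cl (rep (wact u l0)) \<otimes>\<^bsub>coxeter_group S m\<^esub> cl q"
        using form[OF li q(1)] q u cl_eq_iff[of u] eqv_lists by auto
      then show "x \<in> (\<lambda>(l, x). cl (rep l) \<otimes>\<^bsub>coxeter_group S m\<^esub> x) ` (\<Lambda> \<times> parabolic S m (T - {s}))"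
        using li q parabolic_eq[OF Qsub] by (auto intro!: image_eqI[of _ _ "(wact u l0, cl q)"])
    qed
  qed
qed

lemma finite_parabolic: "finite (parabolic S m (T - {s})) \<Longrightarrow> finite (parabolic S m T)"
  using bij_betw_finite[OF bij_coset] finL by auto

lemma poincare_coset:
  "poincare_poly S m T = (\<Sum>l\<in>\<Lambda>. monom 1 (h l)) * poincare_poly S m (T - {s})"
proof -
  have Qsub: "T - {s} \<subseteq> S" using TS by auto
  have len: "cox_length (cl (rep l) \<otimes>\<^bsub>coxeter_group S m\<^esub> x) = h l + cox_length x"
    if l: "l \<in> \<Lambda>" and x: "x \<in> parabolic S m (T - {s})" for l x
  proof -
    obtain q where q: "q \<in> lists (T - {s})" "x = cl q" "reduced q" using parabolic_reduced_rep[OF Qsub x] by auto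
    have "cl (rep l) \<otimes>\<^bsub>coxeter_group S m\<^esub> x = cl (rep l @ q)" using mult_cl rep_lists[OF l] QS q by auto
    then show ?thesis using cox_length_reduced rep_additive[OF l q(1,3)] q rep_props[OF l] by auto
  qed
  have "poincare_poly S m T = (\<Sum>(l, x)\<in>\<Lambda> \<times> parabolic S m (T - {s}). monom 1 (h l + cox_length x))"
    unfolding poincare_poly_def
    by (subst sum.reindex_bij_betw[OF bij_coset, symmetric]) (auto intro!: sum.cong simp: len)
  also have "\<dots> = (\<Sum>l\<in>\<Lambda>. monom 1 (h l)) * poincare_poly S m (T - {s})"
    unfolding poincare_poly_def
    by (simp only: sum_product sum.cartesian_product mult_monom mult_1_left)
  finally show ?thesis .
qed

end

section \<open>Reflections in weight coordinates\<close>

text \<open>The simple reflection on a weight that is given by its pairings with the simple coroots;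
  row \<open>i\<close> of \<open>A\<close> lists the pairings of the \<open>i\<close>-th simple
  root.\<close>

definition wrefl :: "('i \<Rightarrow> 'i \<Rightarrow> int) \<Rightarrow> 'i \<Rightarrow> ('i \<Rightarrow> int) \<Rightarrow> 'i \<Rightarrow> int" where
  "wrefl A i f = (\<lambda>x. f x - f i * A i x)"

text \<open>The pairs of nonpositive Cartan entries with a * b = 4 cos^2(\<pi> / k), that is 0, 1,
  2, 3 and, for the infinite bond, 4 in the symmetric form only.\<close>

definition bond_ok :: "enat \<Rightarrow> int \<Rightarrow> int \<Rightarrow> bool" where
  "bond_ok k a b \<longleftrightarrow> k = 2 \<and> a = 0 \<and> b = 0 \<or> k = 3 \<and> a = -1 \<and> b = -1 \<or>
     k = 4 \<and> (a = -1 \<and> b = -2 \<or> a = -2 \<and> b = -1) \<or>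
     k = 6 \<and> (a = -1 \<and> b = -3 \<or> a = -3 \<and> b = -1) \<or> k = \<infinity> \<and> a = -2 \<and> b = -2"

definition cartan_for :: "('i \<Rightarrow> 'i \<Rightarrow> int) \<Rightarrow> 'i set \<Rightarrow> ('i \<Rightarrow> 'i \<Rightarrow> enat) \<Rightarrow> bool" where
  "cartan_for A S m \<longleftrightarrow> (\<forall>i\<in>S. A i i = 2) \<and> (\<forall>i\<in>S. \<forall>j\<in>S. i \<noteq> j \<longrightarrow> bond_ok (m i j) (A i j) (A j i))"

lemma wrefl_wrefl: "A i i = 2 \<Longrightarrow> wrefl A i (wrefl A i f) = f"
  by (rule ext) (simp add: wrefl_def)

lemma wrefl_zero: "f i = 0 \<Longrightarrow> wrefl A i f = f"
  by (rule ext) (simp add: wrefl_def)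

lemma wrefl_neg: "A i i = 2 \<Longrightarrow> wrefl A i f i = - f i"
  by (simp add: wrefl_def)

text \<open>The reflections in \<open>i\<close> and \<open>j\<close> move \<open>f\<close> only by
  multiples of the rows \<open>i\<close> and \<open>j\<close> of \<open>A\<close>. In the two
  coefficients \<open>p\<close> and \<open>q\<close> of \<open>st\<close> the relation is a finite
  computation for each of the four finite bonds.\<close>

lemma wrefl_braid:
  assumes "A i i = 2" "A j j = 2" "bond_ok (enat k) (A i j) (A j i)"
  shows "foldr (wrefl A) (alt i j (2 * k)) f = f"
proof -
  define st where "st = (\<lambda>p q x. f x - p * A i x - q * A j x)"
  have steps: "wrefl A i (st p q) = st (f i - p - q * A j i) q" "wrefl A j (st p q) = st p (f j - q - p * A i j)" for p q
    using assms by (auto simp: st_def wrefl_def algebra_simps fun_eq_iff)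
  have k: "k = 2 \<or> k = 3 \<or> k = 4 \<or> k = 6" using assms(3) by (auto simp: bond_ok_def numeral_eq_enat)
  have "foldr (wrefl A) (alt i j (2 * k)) (st 0 0) = st 0 0"
    using k assms(3)
    by (elim disjE; auto simp: bond_ok_def numeral_eq_enat eval_nat_numeral steps algebra_simps)
  then show ?thesis by (simp add: st_def)
qed

text \<open>\<open>u\<close> and \<open>v\<close> are the coordinates at \<open>i\<close> and \<open>j\<close>; the predicate says that along the first \<open>p\<close> steps
  of the alternating path that starts with \<open>i\<close> no reflection moves upwards.\<close>

fun descending :: "int \<Rightarrow> int \<Rightarrow> int \<Rightarrow> int \<Rightarrow> nat \<Rightarrow> bool" where
  "descending a b u v 0 = True"
| "descending a b u v (Suc p) = (u \<le> 0 \<and> descending b a (v - u * a) (- u) p)"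

lemma descending_mono: "descending a b u v n \<Longrightarrow> p \<le> n \<Longrightarrow> descending a b u v p"
proof (induction n arbitrary: a b u v p)
  case (Suc n)
  then show ?case by (cases p) auto
qed simp

text \<open>The rank two case behind the dihedral condition: from an antidominant weight the
  alternating path through all letters of the longest element never goes up. For each finite bond
  the coordinates met on the way are explicit and visibly nonpositive.\<close>

lemma bond_descending:
  assumes "bond_ok (enat k) a b" "u \<le> 0" "v \<le> 0" "p \<le> k"
  shows "descending a b u v p" and "2 \<le> k"
proof -
  have "k = 2 \<or> k = 3 \<or> k = 4 \<or> k = 6" using assms(1) by (auto simp: bond_ok_def numeral_eq_enat)
  then have "descending a b u v k \<and> 2 \<le> k" using assms(1-3)
    by (elim disjE; auto simp: bond_ok_def numeral_eq_enat eval_nat_numeral algebra_simps)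
  then show "descending a b u v p" "2 \<le> k" using descending_mono assms(4) by auto
qed

text \<open>\<open>L k\<close> is level k of the orbit of the fundamental weight of
  \<open>s\<close>, counted by downward reflections. \<open>K\<close> contains the nodes that move
  the orbit: those in \<open>T - K\<close> are orthogonal to \<open>K\<close>, their coordinates
  stay 0, and so a single enumeration for \<open>K\<close> serves every such
  \<open>T\<close>.\<close>

locale weight_levels = coxeter_system S m for S :: "'s set" and m +
  fixes A :: "'s \<Rightarrow> 's \<Rightarrow> int" and T K :: "'s set" and s :: 's
    and L :: "nat \<Rightarrow> ('s \<Rightarrow> int) set" and M :: nat
  assumes cartan: "cartan_for A S m" and TS: "T \<subseteq> S" and KT: "K \<subseteq> T" and sK: "s \<in> K"
    and fin_bond: "i \<in> T \<Longrightarrow> j \<in> T \<Longrightarrow> m i j \<noteq> \<infinity>"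
    and sep: "i \<in> K \<Longrightarrow> j \<in> T - K \<Longrightarrow> A i j = 0"
    and L0: "L 0 = {\<lambda>x. if x = s then 1 else 0}" and finLev: "finite (L k)" and LM: "k \<ge> M \<Longrightarrow> L k = {}"
    and up: "f \<in> L k \<Longrightarrow> i \<in> K \<Longrightarrow> f i > 0 \<Longrightarrow> wrefl A i f \<in> L (Suc k)"
    and down: "f \<in> L (Suc k) \<Longrightarrow> i \<in> K \<Longrightarrow> f i < 0 \<Longrightarrow> wrefl A i f \<in> L k"
    and desc: "f \<in> L (Suc k) \<Longrightarrow> \<exists>i\<in>K. f i < 0"
begin

definition lev :: "('s \<Rightarrow> int) \<Rightarrow> nat" where "lev f = (THE k. f \<in> L k)"

lemma A_diag: "i \<in> S \<Longrightarrow> A i i = 2" using cartan by (simp add: cartan_for_def)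

text \<open>A weight of positive level has a negative coordinate, which the fundamental weight has
  not; reflecting there lowers both supposed levels at once.\<close>

lemma level_unique: "f \<in> L k \<Longrightarrow> f \<in> L k' \<Longrightarrow> k = k'"
proof (induction k arbitrary: f k')
  case 0
  then have "f i \<ge> 0" for i using L0 by auto
  then show ?case using desc[of f "k' - 1"] 0 by (cases k') (auto simp: not_less[symmetric])
next
  case (Suc k)
  obtain i where i: "i \<in> K" "f i < 0" using desc Suc.prems by auto
  show ?case
  proof (cases k')
    case 0
    then have "f i \<ge> 0" using L0 Suc.prems by auto
    then show ?thesis using i by simp
  next
    case (Suc k'')
    then show ?thesis using Suc.IH[of "wrefl A i f" k''] down i Suc.prems \<open>f \<in> L (Suc k)\<close> by auto
  qed
qed

lemma levels_bounded: "(\<Union>k. L k) = (\<Union>k<M. L k)"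
proof -
  have "k < M" if "x \<in> L k" for x k using LM[of k] that by (cases "k < M") auto
  then show ?thesis by blast
qed

lemma lev_eq: "f \<in> L k \<Longrightarrow> lev f = k"
  unfolding lev_def by (rule the_equality) (auto simp: level_unique)

lemma outside_zero: "f \<in> L k \<Longrightarrow> i \<in> T - K \<Longrightarrow> f i = 0"
proof (induction k arbitrary: f)
  case 0 then show ?case using L0 sK by auto
next
  case (Suc k)
  obtain j where j: "j \<in> K" "f j < 0" using desc Suc.prems by auto
  have "wrefl A j f i = 0" using Suc.IH[OF down[OF Suc.prems(1) j]] Suc.prems by auto
  then show ?case using sep[OF j(1)] Suc.prems by (auto simp: wrefl_def)
qed

lemma level_step:
  assumes f: "f \<in> L k" and i: "i \<in> T"
  shows "f i = 0 \<and> wrefl A i f = f \<or> f i > 0 \<and> wrefl A i f \<in> L (Suc k) \<or>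
    f i < 0 \<and> (\<exists>k'. k = Suc k' \<and> wrefl A i f \<in> L k')"
proof -
  consider "f i = 0" | "i \<in> K" "f i > 0" | "i \<in> K" "f i < 0"
    using outside_zero[OF f] i by (metis DiffI linorder_neqE)
  then show ?thesis
  proof cases
    case 3
    then have "k \<noteq> 0" using f L0 by (metis (mono_tags, lifting) not_one_less_zero order_less_irrefl singletonD)
    then show ?thesis using 3 down f by (cases k) auto
  qed (use f up wrefl_zero in auto)
qed

lemma level_path:
  "descending (A i j) (A j i) (f i) (f j) p \<Longrightarrow> f \<in> L k \<Longrightarrow> i \<in> T \<Longrightarrow> j \<in> T \<Longrightarrow>
    \<exists>k'\<le>k. foldr (wrefl A) (rev (alt i j p)) f \<in> L k'"
proof (induction p arbitrary: i j f k)
  case (Suc p)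
  have "f i \<le> 0" using Suc.prems(1) by simp
  then consider "wrefl A i f = f" | k' where "k = Suc k'" "wrefl A i f \<in> L k'"
    using level_step[OF Suc.prems(2,3)] by force
  then obtain k' where k': "k' \<le> k" "wrefl A i f \<in> L k'"
  proof cases
    case 1
    then show ?thesis using that[of k] Suc.prems(2) by simp
  next
    case (2 k')
    then show ?thesis using that[of k'] by simp
  qed
  have "wrefl A i f j = f j - f i * A i j" "wrefl A i f i = - f i"
    using A_diag Suc.prems TS by (auto simp: wrefl_def)
  then have "\<exists>k''\<le>k'. foldr (wrefl A) (rev (alt j i p)) (wrefl A i f) \<in> L k''"
    using Suc.IH[of j i "wrefl A i f" k'] Suc.prems k' by simp
  then obtain k'' where "k'' \<le> k'" "foldr (wrefl A) (rev (alt j i p)) (wrefl A i f) \<in> L k''" by auto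
  then show ?case using k' by (intro exI[of _ k'']) simp
qed auto

lemma wrefl_action:
  shows "i \<in> S \<Longrightarrow> wrefl A i (wrefl A i f) = f"
    and "i \<in> S \<Longrightarrow> j \<in> S \<Longrightarrow> i \<noteq> j \<Longrightarrow> m i j = enat k \<Longrightarrow> foldr (wrefl A) (alt i j (2 * k)) f = f"
  using wrefl_wrefl wrefl_braid cartan unfolding cartan_for_def by metis+

text \<open>A descent at \<open>i\<close> means a negative coordinate and a non-ascent at
  \<open>j\<close> a nonpositive one. So the dihedral condition becomes the antidominant situation
  of \<open>bond_descending\<close>.\<close>

lemma is_coset_table: "coset_table S m T s (wrefl A) (\<Union>k. L k) (\<lambda>x. if x = s then 1 else 0) lev"
proof unfold_locales
  let ?f0 = "(\<lambda>x. if x = s then 1 else 0) :: 's \<Rightarrow> int"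
  show "T \<subseteq> S" by (rule TS)
  show "s \<in> T" using sK KT by auto
  show "finite (\<Union>k. L k)" unfolding levels_bounded using finLev by auto
  show "?f0 \<in> (\<Union>k. L k)" using L0 by auto
  show "wrefl A i (wrefl A i l) = l" if "i \<in> S" for i l using wrefl_action that by auto
  show "foldr (wrefl A) (alt i j (2 * k)) l = l" if "i \<in> S" "j \<in> S" "i \<noteq> j" "m i j = enat k" for i j k l
    using wrefl_action that by auto
  fix i assume i: "i \<in> T"
  then have Aii: "A i i = 2" using A_diag TS by auto
  show "wrefl A i ?f0 = ?f0 \<longleftrightarrow> i \<noteq> s"
    using wrefl_neg[of A i ?f0, OF Aii] wrefl_zero[of ?f0 i A] by (metis (mono_tags, lifting) one_neq_neg_one)
  fix l assume l: "l \<in> (\<Union>k. L k)"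
  then obtain k where k: "l \<in> L k" by auto
  show "wrefl A i l \<in> (\<Union>k. L k)" using level_step[OF k i] k by auto
  show "wrefl A i l = l \<or> lev (wrefl A i l) = Suc (lev l) \<or> lev l = Suc (lev (wrefl A i l))"
    using level_step[OF k i] k lev_eq by auto
next
  fix l assume l: "l \<in> (\<Union>k. L k)"
  then obtain k where k: "l \<in> L k" by auto
  show "lev l = 0 \<longleftrightarrow> l = (\<lambda>x. if x = s then 1 else 0)"
  proof -
    have "lev l = 0 \<longleftrightarrow> l \<in> L 0" using lev_eq[OF k] k lev_eq[of l 0] by metis
    then show ?thesis by (simp add: L0)
  qed
  show "\<exists>i\<in>T. lev l = Suc (lev (wrefl A i l))" if "l \<noteq> (\<lambda>x. if x = s then 1 else 0)"
  proof -
    have "k \<noteq> 0"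
    proof
      assume "k = 0"
      with k have "l \<in> L 0" by simp
      with that show False by (simp add: L0)
    qed
    then obtain k' where k': "k = Suc k'" using not0_implies_Suc by auto
    have lk: "l \<in> L (Suc k')" using k k' by simp
    then obtain i where i: "i \<in> K" "l i < 0" using desc by blast
    show ?thesis
    proof (rule bexI[of _ i])
      show "lev l = Suc (lev (wrefl A i l))" using lev_eq[OF lk] lev_eq[OF down[OF lk i]] by simp
      show "i \<in> T" using i KT by auto
    qed
  qed
  fix i j assume ij: "i \<in> T" "j \<in> T" "i \<noteq> j"
    and low: "lev (wrefl A i l) < lev l" "lev (wrefl A j l) \<le> lev l"
  have neg: "l i < 0" using level_step[OF k ij(1)] low(1) lev_eq k by fastforce
  have nonpos: "l j \<le> 0" using level_step[OF k ij(2)] low(2) lev_eq[OF k] lev_eq[of "wrefl A j l" "Suc k"] by fastforce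
  obtain n where n: "m i j = enat n" using fin_bond ij by auto
  have b: "bond_ok (enat n) (A i j) (A j i)" using cartan ij TS n unfolding cartan_for_def by (metis subsetD)
  then have b': "bond_ok (enat n) (A j i) (A i j)" by (auto simp: bond_ok_def)
  \<comment> \<open>The first reflection lowers the level because its coordinate is negative; the
    remaining ones never raise it, because the path is descending.\<close>
  have strict: "lev (foldr (wrefl A) (rev (alt i' j' p)) l) < lev l"
    if h: "i' \<in> T" "j' \<in> T" "l i' < 0" "l j' \<le> 0" "0 < p" "p \<le> n" "bond_ok (enat n) (A i' j') (A j' i')" for i' j' p
  proof -
    obtain p' where p': "p = Suc p'" using \<open>0 < p\<close> by (cases p) auto
    have "descending (A i' j') (A j' i') (l i') (l j') p"
      using bond_descending(1)[OF h(7), of "l i'" "l j'" p] h by auto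
    moreover have "wrefl A i' l j' = l j' - l i' * A i' j'" "wrefl A i' l i' = - l i'"
      using A_diag h TS by (auto simp: wrefl_def)
    moreover obtain k' where k': "k = Suc k'" "wrefl A i' l \<in> L k'"
      using level_step[OF k h(1)] h(3) by auto
    ultimately obtain k'' where "k'' \<le> k'" "foldr (wrefl A) (rev (alt j' i' p')) (wrefl A i' l) \<in> L k''"
      using level_path[of j' i' "wrefl A i' l" p' k'] h p' by auto
    then show ?thesis using lev_eq k' k p' by (metis comp_apply foldr.simps(1,2) foldr_append id_apply
        le_imp_less_Suc alt.simps(2) rev.simps(2))
  qed
  show "\<exists>k\<ge>2. m i j = enat k \<and>
       (\<forall>p. 0 < p \<and> p \<le> k \<longrightarrow> lev (foldr (wrefl A) (rev (alt i j p)) l) < lev l) \<and>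
       (wrefl A j l \<noteq> l \<longrightarrow> (\<forall>p. 0 < p \<and> p \<le> k \<longrightarrow> lev (foldr (wrefl A) (rev (alt j i p)) l) < lev l))"
  proof (intro exI[of _ n] conjI allI impI n)
    show "2 \<le> n" using bond_descending(2)[OF b neg[THEN less_imp_le] nonpos, of 0] by simp
    show "lev (foldr (wrefl A) (rev (alt i j p)) l) < lev l" if "0 < p \<and> p \<le> n" for p
      using strict[OF ij(1,2) neg nonpos _ _ b] that by auto
    show "lev (foldr (wrefl A) (rev (alt j i p)) l) < lev l" if "wrefl A j l \<noteq> l" "0 < p \<and> p \<le> n" for p
    proof -
      have "l j \<noteq> 0" using that(1) wrefl_zero by metis
      then show ?thesis using strict[OF ij(2,1) _ _ _ _ b'] neg nonpos that(2) by auto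
    qed
  qed
qed

lemma poincare_levels:
  "poincare_poly S m T = (\<Sum>k<M. monom (of_nat (card (L k))) k) * poincare_poly S m (T - {s})"
  and finite_levels: "finite (parabolic S m (T - {s})) \<Longrightarrow> finite (parabolic S m T)"
proof -
  interpret coset_table S m T s "wrefl A" "\<Union>k. L k" "\<lambda>x. if x = s then 1 else 0" lev by (rule is_coset_table)
  have "(\<Sum>l\<in>(\<Union>k. L k). monom 1 (lev l)) = (\<Sum>k<M. \<Sum>l\<in>L k. monom (1::rat) (lev l))"
    unfolding levels_bounded using level_unique finLev by (intro sum.UNION_disjoint) auto
  also have "\<dots> = (\<Sum>k<M. monom (of_nat (card (L k))) k)"
  proof (rule sum.cong)
    fix k
    have "(\<Sum>l\<in>L k. monom (1::rat) (lev l)) = (\<Sum>l\<in>L k. monom 1 k)" using lev_eq by (intro sum.cong) auto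
    also have "\<dots> = monom (of_nat (card (L k))) k" by (simp add: of_nat_poly smult_monom flip: of_nat_monom)
    finally show "(\<Sum>l\<in>L k. monom (1::rat) (lev l)) = monom (of_nat (card (L k))) k" .
  qed simp
  finally show "poincare_poly S m T = (\<Sum>k<M. monom (of_nat (card (L k))) k) * poincare_poly S m (T - {s})"
    using poincare_coset by simp
  show "finite (parabolic S m (T - {s})) \<Longrightarrow> finite (parabolic S m T)" by (rule finite_parabolic)
qed

end


subsection \<open>Infinite groups\<close>

text \<open>The additional coordinate \<open>z\<close> records the height in the root lattice; on a finite orbit it would
  have a minimum, where all weight coordinates are nonpositive, against the invariance of the level.\<close>

lemma infinite_parabolic:
  assumes cox: "coxeter_system S m" and A: "cartan_for A S m" and z: "z \<notin> S" and o: "o' \<in> S" and fin: "finite S"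
    and c_pos: "\<And>i. i \<in> S \<Longrightarrow> c i > 0" and c_null: "\<And>i. i \<in> S \<Longrightarrow> (\<Sum>j\<in>S. c j * A i j) = 0"
  shows "infinite (parabolic S m S)"
proof
  interpret coxeter_system S m by (rule cox)
  \<comment> \<open>Every simple root gets the value 1 at \<open>z\<close>, so the reflection in
    \<open>i\<close> lowers the \<open>z\<close>-coordinate by the coordinate at
    \<open>i\<close>.\<close>
  define B where "B = (\<lambda>i j. if j = z then 1 else A i j)"
  have Bii: "B i i = 2" if "i \<in> S" for i using A that z by (auto simp: B_def cartan_for_def)
  have BB: "bond_ok (m i j) (B i j) (B j i)" if "i \<in> S" "j \<in> S" "i \<noteq> j" for i j
    using A that z unfolding B_def cartan_for_def by metis
  have inv: "u \<approx> v \<Longrightarrow> foldr (wrefl B) u l = foldr (wrefl B) v l" for u v l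
  proof (rule foldr_eqv)
    show "wrefl B i (wrefl B i l) = l" if "i \<in> S" for i l using wrefl_wrefl Bii that by metis
    show "foldr (wrefl B) (alt i j (2 * k)) l = l" if "i \<in> S" "j \<in> S" "i \<noteq> j" "m i j = enat k" for i j k l
      using wrefl_braid[of B i j k l] Bii BB[of i j] that by auto
  qed
  define f0 :: "'a \<Rightarrow> int" where "f0 = (\<lambda>x. if x = o' then 1 else 0)"
  define orb where "orb = (\<lambda>u. foldr (wrefl B) u f0) ` lists S"
  assume f: "finite (parabolic S m S)"
  \<comment> \<open>The orbit map factors through the group, so a finite group would have a finite
    orbit.\<close>
  have "orb \<subseteq> (\<lambda>x. foldr (wrefl B) (SOME u. u \<in> x) f0) ` parabolic S m S"
  proof
    fix l assume "l \<in> orb"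
    then obtain u where u: "u \<in> lists S" "l = foldr (wrefl B) u f0" by (auto simp: orb_def)
    have "(SOME v. v \<in> cl u) \<in> cl u" by (rule someI[of _ u]) (use u in \<open>simp add: cox_class_def\<close>)
    then have "u \<approx> (SOME v. v \<in> cl u)" by (simp add: cox_class_def)
    then have "l = foldr (wrefl B) (SOME v. v \<in> cl u) f0" using u inv by auto
    then show "l \<in> (\<lambda>x. foldr (wrefl B) (SOME u. u \<in> x) f0) ` parabolic S m S"
      using u parabolic_eq[of S] by blast
  qed
  then have fo: "finite orb" using f finite_surj by blast
  \<comment> \<open>The level of a weight is its pairing with the null vector \<open>c\<close>. A
    reflection changes the weight by a multiple of a row of \<open>A\<close>, and these rows are
    orthogonal to \<open>c\<close>.\<close>
  have lev: "(\<Sum>j\<in>S. c j * foldr (wrefl B) u f0 j) = c o'" if "u \<in> lists S" for u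
    using that
  proof (induction u)
    case Nil
    have "(\<Sum>j\<in>S. c j * f0 j) = (\<Sum>j\<in>S. if j = o' then c j else 0)" by (intro sum.cong) (auto simp: f0_def)
    then show ?case using o fin by simp
  next
    case (Cons i u)
    let ?l = "foldr (wrefl B) u f0"
    have "(\<Sum>j\<in>S. c j * wrefl B i ?l j) = (\<Sum>j\<in>S. c j * ?l j) - (\<Sum>j\<in>S. ?l i * (c j * A i j))"
      unfolding sum_subtractf[symmetric] using z
      by (intro sum.cong) (auto simp: wrefl_def B_def algebra_simps)
    also have "(\<Sum>j\<in>S. ?l i * (c j * A i j)) = 0"
      using c_null[of i] Cons by (simp add: sum_distrib_left[symmetric])
    finally show ?case using Cons by simp
  qed
  have ne: "orb \<noteq> {}" unfolding orb_def using lists.Nil by blast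
  have "Min ((\<lambda>l. l z) ` orb) \<in> (\<lambda>l. l z) ` orb" using fo ne by (intro Min_in) auto
  then obtain l where "l \<in> orb" and min: "l z = Min ((\<lambda>l. l z) ` orb)" by auto
  then have l: "l \<in> orb" "\<And>l'. l' \<in> orb \<Longrightarrow> l z \<le> l' z" using fo by auto
  obtain u where u: "u \<in> lists S" "l = foldr (wrefl B) u f0" using l by (auto simp: orb_def)
  \<comment> \<open>At the minimum of the \<open>z\<close>-coordinate the reflected weight has value
    \<open>l z - l i\<close>, which cannot be smaller than \<open>l z\<close>.\<close>
  have neg: "l i \<le> 0" if "i \<in> S" for i
  proof -
    have "wrefl B i l \<in> orb" unfolding orb_def u(2) using u(1) that by (intro image_eqI[of _ _ "i # u"]) simp_all
    from l(2)[OF this] show ?thesis by (simp add: wrefl_def B_def)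
  qed
  have "(\<Sum>j\<in>S. c j * l j) \<le> 0"
  proof (rule sum_nonpos)
    fix j assume "j \<in> S"
    then show "c j * l j \<le> 0" using c_pos[of j] neg[of j] by (simp add: mult_nonneg_nonpos)
  qed
  then show False using lev[OF u(1)] c_pos[OF o] unfolding u(2)[symmetric] by simp
qed

section \<open>Cartan matrices of labelled diagrams\<close>

text \<open>Absolute values of the two Cartan entries of a bond, the larger one for the smaller
  node. The orientation is a choice that the Coxeter group does not see, but the null vectors of the
  affine diagrams refer to it. The last case serves the infinite bond.\<close>

definition bond :: "enat \<Rightarrow> int \<times> int" where
  "bond k = (if k = 3 then (1, 1) else if k = 4 then (2, 1) else if k = 6 then (3, 1) else (2, 2))"

definition cartan :: "((nat \<times> nat) \<times> enat) list \<Rightarrow> nat \<Rightarrow> nat \<Rightarrow> int" where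
  "cartan es i j = (if i = j then 2 else case map_of es (min i j, max i j) of None \<Rightarrow> 0
     | Some k \<Rightarrow> - (if i < j then fst (bond k) else snd (bond k)))"

definition valid_diagram :: "((nat \<times> nat) \<times> enat) list \<Rightarrow> nat \<Rightarrow> bool" where
  "valid_diagram es n \<longleftrightarrow> (\<forall>((s, t), k) \<in> set es. s < t \<and> t \<le> n \<and> (k = 3 \<or> k = 4 \<or> k = 6 \<or> k = \<infinity>))"

lemma valid_diagram_map_of:
  "valid_diagram es n \<Longrightarrow> map_of es (s, t) = Some k \<Longrightarrow> s < t \<and> t \<le> n \<and> (k = 3 \<or> k = 4 \<or> k = 6 \<or> k = \<infinity>)"
  unfolding valid_diagram_def using map_of_SomeD[of es "(s, t)" k] by fastforce

lemma coxeter_diagram: "coxeter_system S (diagram_matrix es)"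
  by unfold_locales (simp add: diagram_matrix_def)

lemma cartan_for_diagram: "valid_diagram es n \<Longrightarrow> cartan_for (cartan es) S (diagram_matrix es)"
  unfolding cartan_for_def
proof (intro conjI ballI impI)
  fix i j :: nat assume v: "valid_diagram es n" and "i \<noteq> j"
  show "bond_ok (diagram_matrix es i j) (cartan es i j) (cartan es j i)"
  proof (cases "map_of es (min i j, max i j)")
    case None
    then show ?thesis using \<open>i \<noteq> j\<close>
      by (simp add: bond_ok_def diagram_matrix_def cartan_def min.commute max.commute)
  next
    case (Some k)
    have "k = 3 \<or> k = 4 \<or> k = 6 \<or> k = \<infinity>" using valid_diagram_map_of[OF v Some] by auto
    then show ?thesis using \<open>i \<noteq> j\<close> Some
      by (auto simp: bond_ok_def diagram_matrix_def cartan_def min.commute max.commute bond_def)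
  qed
qed (simp add: cartan_def)

lemma cartan_outside:
  assumes "valid_diagram es n" "i \<le> n" "n < j" shows "cartan es i j = 0"
proof -
  have "map_of es (i, j) = None"
    using valid_diagram_map_of[OF assms(1), of i j] assms by (cases "map_of es (i, j)") auto
  then show ?thesis using assms by (simp add: cartan_def min_def max_def)
qed

definition cartan_rows :: "((nat \<times> nat) \<times> enat) list \<Rightarrow> nat \<Rightarrow> int list list" where
  "cartan_rows es N = map (\<lambda>i. map (cartan es i) [0..<N]) [0..<N]"

lemma cartan_rows_nth: "i < N \<Longrightarrow> j < N \<Longrightarrow> cartan_rows es N ! i ! j = cartan es i j"
  by (simp add: cartan_rows_def)


subsection \<open>Enumerating the orbit of a fundamental weight\<close>

definition refl_list :: "int list list \<Rightarrow> nat \<Rightarrow> int list \<Rightarrow> int list" where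
  "refl_list rows i l = (let c = l ! i in map2 (\<lambda>x a. x - c * a) l (rows ! i))"

definition next_level :: "int list list \<Rightarrow> nat list \<Rightarrow> int list list \<Rightarrow> int list list" where
  "next_level rows K a =
     remdups (concat (map (\<lambda>l. map (\<lambda>i. refl_list rows i l) (filter (\<lambda>i. l ! i > 0) K)) a))"

text \<open>New levels are produced by going up. This test guarantees that going down from the new
  level leads back to the previous one and that each new weight has a descent, so the numbering of
  the levels is a length function.\<close>

definition down_ok :: "int list list \<Rightarrow> nat list \<Rightarrow> int list list \<Rightarrow> int list list \<Rightarrow> bool" where
  "down_ok rows K a b = list_all (\<lambda>l.
     list_all (\<lambda>i. l ! i < 0 \<longrightarrow> List.member a (refl_list rows i l)) K \<and> list_ex (\<lambda>i. l ! i < 0) K) b"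

text \<open>The list of level sizes is the coefficient list of the length series of minimal coset
  representatives. \<open>None\<close> reports a failed test or exhausted fuel.\<close>

fun level_sizes :: "int list list \<Rightarrow> nat list \<Rightarrow> nat \<Rightarrow> int list list \<Rightarrow> nat list option" where
  "level_sizes rows K 0 a = None"
| "level_sizes rows K (Suc n) a = (let b = next_level rows K a in
     if b = [] then Some [length a]
     else if down_ok rows K a b then map_option (\<lambda>x. length a # x) (level_sizes rows K n b) else None)"

text \<open>Padding by 0 is stable under reflections in the nodes of the diagram, since Cartan
  entries beyond its last node vanish.\<close>

definition emb :: "int list \<Rightarrow> nat \<Rightarrow> int" where
  "emb l = (\<lambda>j. if j < length l then l ! j else 0)"

lemma emb_inj: "length l = length l' \<Longrightarrow> emb l = emb l' \<Longrightarrow> l = l'"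
proof (rule nth_equalityI)
  fix i assume e: "emb l = emb l'" and i: "i < length l" and len: "length l = length l'"
  show "l ! i = l' ! i" using fun_cong[OF e, of i] i len unfolding emb_def by simp
qed

lemma refl_list_length: "length l = N \<Longrightarrow> i < N \<Longrightarrow> length (refl_list (cartan_rows es N) i l) = N"
  by (simp add: refl_list_def cartan_rows_def Let_def)

lemma emb_refl_list:
  assumes "valid_diagram es n" "length l = Suc n" "i \<le> n"
  shows "emb (refl_list (cartan_rows es (Suc n)) i l) = wrefl (cartan es) i (emb l)"
proof
  fix j
  have len: "length (refl_list (cartan_rows es (Suc n)) i l) = Suc n" using refl_list_length assms by simp
  show "emb (refl_list (cartan_rows es (Suc n)) i l) j = wrefl (cartan es) i (emb l) j"
  proof (cases "j \<le> n")
    case True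
    then show ?thesis using assms len
      by (simp add: emb_def wrefl_def refl_list_def Let_def cartan_rows_def del: upt_Suc)
  next
    case False
    then show ?thesis using assms len cartan_outside[of es n i j] by (simp add: emb_def wrefl_def)
  qed
qed

definition level_chain :: "int list list \<Rightarrow> nat list \<Rightarrow> int list list list \<Rightarrow> bool" where
  "level_chain rows K Ls \<longleftrightarrow>
    (\<forall>k<length Ls. distinct (Ls ! k) \<and> (\<forall>l\<in>set (Ls ! k). length l = length rows \<and>
       (\<forall>i\<in>set K. l ! i > 0 \<longrightarrow> Suc k < length Ls \<and> refl_list rows i l \<in> set (Ls ! Suc k)))) \<and>
    (\<forall>k. Suc k < length Ls \<longrightarrow> down_ok rows K (Ls ! k) (Ls ! Suc k))"

lemma level_sizes_chain:
  assumes "level_sizes rows K n a = Some ns" "\<forall>l\<in>set a. length l = length rows" "distinct a"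
    and rows: "\<forall>i\<in>set K. length (rows ! i) = length rows"
  shows "\<exists>Ls. ns = map length Ls \<and> Ls \<noteq> [] \<and> hd Ls = a \<and> level_chain rows K Ls"
  using assms(1-3)
proof (induction n arbitrary: a ns)
  case (Suc n)
  let ?b = "next_level rows K a"
  have up: "\<forall>l\<in>set a. \<forall>i\<in>set K. l ! i > 0 \<longrightarrow> refl_list rows i l \<in> set ?b"
    by (auto simp: next_level_def)
  show ?case
  proof (cases "?b = []")
    case True
    then have "ns = [length a]" using Suc.prems by simp
    moreover have "level_chain rows K [a]" using Suc.prems up True by (auto simp: level_chain_def)
    ultimately show ?thesis by (intro exI[of _ "[a]"]) auto
  next
    case False
    then obtain ns' where ns': "down_ok rows K a ?b" "level_sizes rows K n ?b = Some ns'" "ns = length a # ns'"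
      using Suc.prems by (auto simp: Let_def split: if_splits)
    have "\<forall>l\<in>set ?b. length l = length rows"
      using Suc.prems rows by (auto simp: next_level_def refl_list_def Let_def)
    moreover have "distinct ?b" by (simp add: next_level_def)
    ultimately obtain Ls where Ls: "ns' = map length Ls" "Ls \<noteq> []" "hd Ls = ?b" "level_chain rows K Ls"
      using Suc.IH ns' by blast
    have Ls0: "Ls ! 0 = ?b" using Ls(2,3) by (simp add: hd_conv_nth)
    have "level_chain rows K (a # Ls)"
      unfolding level_chain_def
    proof (intro conjI allI impI ballI)
      fix k assume k: "k < length (a # Ls)"
      show "distinct ((a # Ls) ! k)" using k Ls(4) Suc.prems by (cases k) (auto simp: level_chain_def)
      fix l assume l: "l \<in> set ((a # Ls) ! k)"
      show "length l = length rows" using k l Ls(4) Suc.prems by (cases k) (auto simp: level_chain_def)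
      fix i assume i: "i \<in> set K" "l ! i > 0"
      show "Suc k < length (a # Ls)" "refl_list rows i l \<in> set ((a # Ls) ! Suc k)"
        using k l i Ls(2,4) Ls0 up by (cases k; auto simp: level_chain_def)+
    next
      fix k assume "Suc k < length (a # Ls)"
      then show "down_ok rows K ((a # Ls) ! k) ((a # Ls) ! Suc k)"
        using Ls(4) Ls0 ns'(1) by (cases k) (auto simp: level_chain_def)
    qed
    then show ?thesis using Ls ns' by (intro exI[of _ "a # Ls"]) auto
  qed
qed simp

definition poly_of :: "nat list \<Rightarrow> rat poly" where "poly_of ns = Poly (map of_nat ns)"

lemma poly_of_simps [simp]: "poly_of [] = 0" "poly_of (x # xs) = pCons (of_nat x) (poly_of xs)"
  by (simp_all add: poly_of_def)

lemma poly_of_sum: "poly_of ns = (\<Sum>k<length ns. monom (of_nat (ns ! k)) k)"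
  by (rule poly_eqI) (simp add: poly_of_def coeff_sum nth_default_def if_distrib cong: if_cong)

definition unit_vec :: "nat \<Rightarrow> nat \<Rightarrow> int list" where
  "unit_vec N s = map (\<lambda>j. if j = s then 1 else 0) [0..<N]"

lemma poincare_level_sizes:
  assumes v: "valid_diagram es n" and T: "T \<subseteq> {0..n}" and K: "set K \<subseteq> T" "s \<in> set K"
    and fin_bond: "\<And>i j. i \<in> T \<Longrightarrow> j \<in> T \<Longrightarrow> diagram_matrix es i j \<noteq> \<infinity>"
    and sep: "\<And>i j. i \<in> set K \<Longrightarrow> j \<in> T - set K \<Longrightarrow> cartan es i j = 0"
    and sizes: "level_sizes (cartan_rows es (Suc n)) K fuel [unit_vec (Suc n) s] = Some ns"
    and fin: "finite (parabolic {0..n} (diagram_matrix es) (T - {s}))"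
  shows "finite (parabolic {0..n} (diagram_matrix es) T)"
    and "poincare_poly {0..n} (diagram_matrix es) T =
      poly_of ns * poincare_poly {0..n} (diagram_matrix es) (T - {s})"
proof -
  let ?rows = "cartan_rows es (Suc n)"
  have lr: "length ?rows = Suc n" by (simp add: cartan_rows_def)
  have Kn: "\<And>i. i \<in> set K \<Longrightarrow> i \<le> n" using K T by auto
  obtain Ls where Ls: "ns = map length Ls" "Ls \<noteq> []" "hd Ls = [unit_vec (Suc n) s]" "level_chain ?rows K Ls"
    using level_sizes_chain[OF sizes] Kn lr by (auto simp: unit_vec_def cartan_rows_def less_Suc_eq_le simp del: upt_Suc)
  define L where "L = (\<lambda>k. if k < length Ls then emb ` set (Ls ! k) else {})"
  have len: "length l = Suc n" if "k < length Ls" "l \<in> set (Ls ! k)" for k l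
    using Ls(4) that lr by (auto simp: level_chain_def)
  have emb_at: "emb l i = l ! i" if "k < length Ls" "l \<in> set (Ls ! k)" "i \<in> set K" for k l i
    using len[OF that(1,2)] Kn[OF that(3)] by (simp add: emb_def)
  have emb_refl: "wrefl (cartan es) i (emb l) = emb (refl_list ?rows i l)"
    if "k < length Ls" "l \<in> set (Ls ! k)" "i \<in> set K" for k l i
    using emb_refl_list[OF v len[OF that(1,2)] Kn[OF that(3)]] by simp
  have fb: "diagram_matrix es i j \<noteq> \<infinity>" if "i \<in> T" "j \<in> T" for i j using fin_bond that by auto
  interpret weight_levels "{0..n}" "diagram_matrix es" "cartan es" T "set K" s L "length Ls"
  proof (intro weight_levels.intro weight_levels_axioms.intro coxeter_diagram)
    show "cartan_for (cartan es) {0..n} (diagram_matrix es)" by (rule cartan_for_diagram[OF v])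
    have "Ls ! 0 = [unit_vec (Suc n) s]" using Ls(2,3) by (simp add: hd_conv_nth)
    moreover have "emb (unit_vec (Suc n) s) = (\<lambda>x. if x = s then 1 else 0)"
      using Kn[OF K(2)] by (auto simp: emb_def unit_vec_def simp del: upt_Suc)
    ultimately show "L 0 = {\<lambda>x. if x = s then 1 else 0}" using Ls(2) by (simp add: L_def)
    fix k show "finite (L k)" by (simp add: L_def)
    show "length Ls \<le> k \<Longrightarrow> L k = {}" by (simp add: L_def)
    fix f i assume i: "i \<in> set K"
    { assume f: "f \<in> L k" "f i > 0"
      then obtain l where l: "k < length Ls" "l \<in> set (Ls ! k)" "f = emb l" by (auto simp: L_def split: if_splits)
      then have "l ! i > 0" using emb_at i f by auto
      then have "Suc k < length Ls \<and> refl_list ?rows i l \<in> set (Ls ! Suc k)"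
        using Ls(4) l i by (auto simp: level_chain_def)
      then show "wrefl (cartan es) i f \<in> L (Suc k)" using emb_refl[OF l(1,2) i] l by (auto simp: L_def) }
    { assume f: "f \<in> L (Suc k)" "f i < 0"
      then obtain l where l: "Suc k < length Ls" "l \<in> set (Ls ! Suc k)" "f = emb l" by (auto simp: L_def split: if_splits)
      then have "l ! i < 0" using emb_at i f by auto
      then have "refl_list ?rows i l \<in> set (Ls ! k)"
        using Ls(4) l i by (auto simp: level_chain_def down_ok_def list_all_iff)
      then show "wrefl (cartan es) i f \<in> L k" using emb_refl[OF l(1,2) i] l by (auto simp: L_def) }
  next
    fix f k assume f: "f \<in> L (Suc k)"
    then obtain l where l: "Suc k < length Ls" "l \<in> set (Ls ! Suc k)" "f = emb l" by (auto simp: L_def split: if_splits)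
    then have "\<exists>i\<in>set K. l ! i < 0"
      using Ls(4) by (auto simp: level_chain_def down_ok_def list_all_iff list_ex_iff)
    then show "\<exists>i\<in>set K. f i < 0" using emb_at l by auto
  qed (use T K sep fb in auto)
  have card: "card (L k) = ns ! k" if "k < length Ls" for k
  proof -
    have "inj_on emb (set (Ls ! k))" using emb_inj len[OF that] by (intro inj_onI) metis
    moreover have "distinct (Ls ! k)" using Ls(4) that by (auto simp: level_chain_def)
    ultimately show ?thesis using that Ls(1) by (simp add: L_def card_image distinct_card)
  qed
  show "finite (parabolic {0..n} (diagram_matrix es) T)" by (rule finite_levels[OF fin])
  have "(\<Sum>k<length Ls. monom (of_nat (card (L k)) :: rat) k) = poly_of ns"
    unfolding poly_of_sum using card Ls(1) by (intro sum.cong) auto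
  then show "poincare_poly {0..n} (diagram_matrix es) T =
      poly_of ns * poincare_poly {0..n} (diagram_matrix es) (T - {s})"
    using poincare_levels by simp
qed


subsection \<open>Tables of degrees\<close>

definition qint :: "nat \<Rightarrow> rat poly" where "qint d = (\<Sum>i<d. monom 1 i)"

text \<open>With \<open>ds\<close> the degrees of a finite Coxeter group this is the product formula
  for its Poincare polynomial, where \<open>qint d\<close> is the q-integer [d].\<close>

definition qprod :: "nat list \<Rightarrow> rat poly" where "qprod ds = prod_list (map qint ds)"

lemma coeff_qint: "coeff (qint d) k = (if k < d then 1 else 0)"
  by (simp add: qint_def coeff_sum)

lemma qint_Suc: "qint (Suc d) = 1 + pCons 0 (qint d)"
  by (rule poly_eqI) (simp add: coeff_qint coeff_pCons split: nat.split)

lemma qint_nonzero: "d > 0 \<Longrightarrow> qint d \<noteq> 0"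
proof -
  assume "d > 0"
  then have "coeff (qint d) 0 = 1" by (cases d) (auto simp: qint_Suc)
  then show ?thesis by auto
qed

fun list_add :: "nat list \<Rightarrow> nat list \<Rightarrow> nat list" where
  "list_add [] ys = ys"
| "list_add (x # xs) [] = x # xs"
| "list_add (x # xs) (y # ys) = (x + y) # list_add xs ys"

primrec mulq :: "nat \<Rightarrow> nat list \<Rightarrow> nat list" where
  "mulq 0 p = []"
| "mulq (Suc d) p = list_add p (0 # mulq d p)"

lemma poly_of_list_add: "poly_of (list_add xs ys) = poly_of xs + poly_of ys"
  by (induction xs ys rule: list_add.induct) auto

lemma poly_of_mulq: "poly_of (mulq d p) = qint d * poly_of p"
proof (induction d)
  case 0 show ?case by (simp add: qint_def)
next
  case (Suc d) then show ?case by (simp add: qint_Suc poly_of_list_add algebra_simps)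
qed

lemma poly_of_foldr_mulq: "poly_of (foldr mulq ds p) = qprod ds * poly_of p"
  by (induction ds) (auto simp: qprod_def poly_of_mulq mult.assoc)

type_synonym degree_table = "(nat list \<times> nat \<times> nat list) list"

definition table_degrees :: "degree_table \<Rightarrow> nat list \<Rightarrow> nat list option" where
  "table_degrees tab K = (if K = [] then Some [] else map_option snd (map_of tab K))"

definition list_minus :: "nat list \<Rightarrow> nat list \<Rightarrow> nat list" where
  "list_minus xs ys = foldr remove1 ys xs"

text \<open>Verifies that the orbit series times the Poincare polynomial of \<open>K - {s}\<close>
  has the claimed factorisation, by comparing integer coefficient lists after common degrees are
  cancelled. The fuel 300 exceeds the number of levels, which is at most 121 even in type
  E8.\<close>

definition entry_ok :: "int list list \<Rightarrow> degree_table \<Rightarrow> nat list \<times> nat \<times> nat list \<Rightarrow> bool" where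
  "entry_ok rows tab = (\<lambda>(K, s, ds).
     distinct K \<and> List.member K s \<and> list_all (\<lambda>i. i < length rows) K \<and> list_all (\<lambda>d. 0 < d) ds \<and>
     (case table_degrees tab (remove1 s K) of None \<Rightarrow> False
      | Some ds' \<Rightarrow> (case level_sizes rows K 300 [unit_vec (length rows) s] of None \<Rightarrow> False
        | Some ns \<Rightarrow> foldr mulq (list_minus ds' ds) ns = foldr mulq (list_minus ds ds') [1])))"

lemma mset_list_minus: "mset (list_minus xs ys) = mset xs - mset ys"
  unfolding list_minus_def by (induction ys arbitrary: xs) (auto simp: diff_diff_add_mset[symmetric] diff_right_commute)

lemma qprod_mset: "qprod ds = (\<Prod>d\<in>#mset ds. qint d)"
  unfolding qprod_def by (induction ds) auto

lemma qprod_cong: "mset ds = mset ds' \<Longrightarrow> qprod ds = qprod ds'"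
  by (simp add: qprod_mset)

lemma qprod_append: "qprod (ds @ ds') = qprod ds * qprod ds'"
  by (simp add: qprod_def)

lemma qprod_nonzero: "0 \<notin> set ds \<Longrightarrow> qprod ds \<noteq> 0"
  unfolding qprod_def by (induction ds) (auto simp: qint_nonzero)

text \<open>The test compares only the factors left after cancelling common degrees. Multiplying
  both sides by what was cancelled gives the full identity times \<open>qprod ?a\<close>, a nonzero
  factor that is divided out.\<close>

lemma qprod_quotient:
  assumes "foldr mulq (list_minus ds' ds) ns = foldr mulq (list_minus ds ds') [1]" "0 \<notin> set ds'"
  shows "poly_of ns * qprod ds' = qprod ds"
proof -
  let ?a = "list_minus ds' ds" and ?b = "list_minus ds ds'"
  have 1: "qprod ?a * poly_of ns = qprod ?b"
    using arg_cong[OF assms(1), of poly_of] by (simp add: poly_of_foldr_mulq one_pCons[symmetric])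
  have "a + (b - a) = b + (a - b)" for a b :: nat by arith
  then have "mset (ds @ ?a) = mset (ds' @ ?b)"
    by (intro multiset_eqI) (simp add: mset_list_minus)
  then have 2: "qprod ds * qprod ?a = qprod ds' * qprod ?b" using qprod_cong qprod_append by metis
  have "set_mset (mset ?a) \<subseteq> set_mset (mset ds')" unfolding mset_list_minus by (rule set_mset_mono) simp
  then have nz: "qprod ?a \<noteq> 0" using assms(2) by (intro qprod_nonzero) auto
  have "qprod ?a * (poly_of ns * qprod ds') = qprod ?a * qprod ds"
    using 1 2 by (metis mult.assoc mult.commute)
  then show ?thesis using nz by simp
qed

definition table_ok :: "((nat \<times> nat) \<times> enat) list \<Rightarrow> nat \<Rightarrow> degree_table \<Rightarrow> bool" where
  "table_ok es n tab = list_all (entry_ok (cartan_rows es (Suc n)) tab) tab"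

text \<open>Nodes of \<open>K\<close> are peeled off one at a time while the orthogonal set
  \<open>R\<close> is carried along. In this way the product formula for orthogonal sets comes out
  of the coset tables themselves.\<close>

lemma poincare_table_entry:
  assumes v: "valid_diagram es n" and tab: "table_ok es n tab"
  shows "table_degrees tab K = Some ds \<Longrightarrow> R \<subseteq> {0..n} \<Longrightarrow> set K \<inter> R = {} \<Longrightarrow>
    (\<And>i j. i \<in> set K \<union> R \<Longrightarrow> j \<in> set K \<union> R \<Longrightarrow> diagram_matrix es i j \<noteq> \<infinity>) \<Longrightarrow>
    (\<And>i j. i \<in> set K \<Longrightarrow> j \<in> R \<Longrightarrow> cartan es i j = 0) \<Longrightarrow>
    finite (parabolic {0..n} (diagram_matrix es) R) \<Longrightarrow>
    0 \<notin> set ds \<and> set K \<subseteq> {0..n} \<and> finite (parabolic {0..n} (diagram_matrix es) (set K \<union> R)) \<and>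
    poincare_poly {0..n} (diagram_matrix es) (set K \<union> R) = qprod ds * poincare_poly {0..n} (diagram_matrix es) R"
proof (induction "length K" arbitrary: K ds rule: less_induct)
  case less
  show ?case
  proof (cases "K = []")
    case True
    then show ?thesis using less.prems by (auto simp: table_degrees_def qprod_def)
  next
    case False
    then obtain s where "map_of tab K = Some (s, ds)" using less.prems(1) by (auto simp: table_degrees_def)
    then have "entry_ok (cartan_rows es (Suc n)) tab (K, s, ds)"
      using tab map_of_SomeD by (fastforce simp: table_ok_def list_all_iff)
    then obtain ds' ns where e: "distinct K" "s \<in> set K" "\<forall>i\<in>set K. i \<le> n" "0 \<notin> set ds"
        "table_degrees tab (remove1 s K) = Some ds'"
        "level_sizes (cartan_rows es (Suc n)) K 300 [unit_vec (Suc n) s] = Some ns"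
        "foldr mulq (list_minus ds' ds) ns = foldr mulq (list_minus ds ds') [1]"
      by (auto simp: entry_ok_def list_all_iff cartan_rows_def less_Suc_eq_le split: option.splits simp del: upt_Suc)
    have K': "set (remove1 s K) = set K - {s}" using e by simp
    have lt: "length (remove1 s K) < length K" using e(2) by (simp add: length_remove1) (metis False length_greater_0_conv Suc_pred lessI)
    have IH: "0 \<notin> set ds' \<and> set (remove1 s K) \<subseteq> {0..n} \<and>
        finite (parabolic {0..n} (diagram_matrix es) (set (remove1 s K) \<union> R)) \<and>
        poincare_poly {0..n} (diagram_matrix es) (set (remove1 s K) \<union> R) =
          qprod ds' * poincare_poly {0..n} (diagram_matrix es) R"
      by (rule less.hyps[OF lt e(5) less.prems(2)]) (use less.prems K' in auto)
    have T: "set K \<union> R - {s} = set (remove1 s K) \<union> R" using K' e(2) less.prems(3) by auto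
    have Kn: "set K \<subseteq> {0..n}" using e(3) by auto
    have TT: "set K \<union> R \<subseteq> {0..n}" using Kn less.prems(2) by simp
    have fin: "finite (parabolic {0..n} (diagram_matrix es) (set K \<union> R - {s}))" using IH T by simp
    have sep: "cartan es i j = 0" if "i \<in> set K" "j \<in> set K \<union> R - set K" for i j
      using less.prems(5) that by blast
    have "finite (parabolic {0..n} (diagram_matrix es) (set K \<union> R)) \<and>
        poincare_poly {0..n} (diagram_matrix es) (set K \<union> R) =
        poly_of ns * poincare_poly {0..n} (diagram_matrix es) (set K \<union> R - {s})"
    proof (intro conjI)
      have KR: "set K \<subseteq> set K \<union> R" by simp
      show "finite (parabolic {0..n} (diagram_matrix es) (set K \<union> R))"
        by (rule poincare_level_sizes(1)[OF v TT KR e(2) _ _ e(6) fin]) (fact less.prems(4), fact sep)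
      show "poincare_poly {0..n} (diagram_matrix es) (set K \<union> R) =
          poly_of ns * poincare_poly {0..n} (diagram_matrix es) (set K \<union> R - {s})"
        by (rule poincare_level_sizes(2)[OF v TT KR e(2) _ _ e(6) fin]) (fact less.prems(4), fact sep)
    qed
    then show ?thesis using IH T qprod_quotient[OF e(7)] e(3,4) by (auto simp: mult.assoc[symmetric])
  qed
qed

section \<open>Connected components of sets of nodes\<close>

function reach :: "int list list \<Rightarrow> nat list \<Rightarrow> nat list \<Rightarrow> nat list \<Rightarrow> nat list \<times> nat list" where
  "reach rows [] rest acc = (acc, rest)"
| "reach rows (x # fr) rest acc = (let r = rows ! x in
     reach rows (filter (\<lambda>j. r ! j \<noteq> 0) rest @ fr) (filter (\<lambda>j. r ! j = 0) rest) (x # acc))"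
  by pat_completeness auto
termination
proof (relation "measure (\<lambda>(rows, fr, rest, acc). length fr + length rest)")
  fix rows :: "int list list" and x fr rest acc r
  show "((rows, filter (\<lambda>j. r ! j \<noteq> 0) rest @ fr, filter (\<lambda>j. r ! j = 0) rest, x # acc), rows, x # fr, rest, acc)
      \<in> measure (\<lambda>(rows, fr, rest, acc :: nat list). length fr + length rest)" if "r = rows ! x"
    using sum_length_filter_compl[of "\<lambda>j. r ! j = 0" rest] by simp
qed simp

lemma reach_props:
  "reach rows fr rest acc = (K, rest') \<Longrightarrow> (\<forall>x\<in>set acc. \<forall>j\<in>set rest. rows ! x ! j = 0) \<Longrightarrow>
    distinct (fr @ rest @ acc) \<Longrightarrow>
    (\<forall>x\<in>set K. \<forall>j\<in>set rest'. rows ! x ! j = 0) \<and> set K \<union> set rest' = set fr \<union> set rest \<union> set acc \<and>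
    set K \<inter> set rest' = {} \<and> distinct K \<and> distinct rest' \<and> length rest' \<le> length rest"
proof (induction rows fr rest acc arbitrary: K rest' rule: reach.induct)
  case (2 rows x fr rest acc)
  let ?a = "filter (\<lambda>j. rows ! x ! j \<noteq> 0) rest" and ?b = "filter (\<lambda>j. rows ! x ! j = 0) rest"
  have "reach rows (?a @ fr) ?b (x # acc) = (K, rest')" using 2(2) by (simp add: Let_def)
  moreover have "\<forall>y\<in>set (x # acc). \<forall>j\<in>set ?b. rows ! y ! j = 0" using 2(3) by auto
  moreover have "distinct ((?a @ fr) @ ?b @ (x # acc))" using 2(4) by auto
  ultimately have IH: "(\<forall>x\<in>set K. \<forall>j\<in>set rest'. rows ! x ! j = 0) \<and>
      set K \<union> set rest' = set (?a @ fr) \<union> set ?b \<union> set (x # acc) \<and>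
      set K \<inter> set rest' = {} \<and> distinct K \<and> distinct rest' \<and> length rest' \<le> length ?b"
    using 2(1) by blast
  moreover have "set (?a @ fr) \<union> set ?b \<union> set (x # acc) = set (x # fr) \<union> set rest \<union> set acc" by auto
  moreover have "length ?b \<le> length rest" by simp
  ultimately show ?case by (metis le_trans)
qed auto

text \<open>Each component is sorted because the keys of the degree tables are increasing lists. The
  number is fuel: every component removes at least one node.\<close>

fun components :: "int list list \<Rightarrow> nat \<Rightarrow> nat list \<Rightarrow> nat list list" where
  "components rows 0 T = []"
| "components rows (Suc n) [] = []"
| "components rows (Suc n) (x # xs) = (let (K, rest) = reach rows [x] xs [] in sort K # components rows n rest)"

lemma poincare_components:
  assumes v: "valid_diagram es n" and tab: "table_ok es n tab"
  shows "length T \<le> f \<Longrightarrow> distinct T \<Longrightarrow> set T \<subseteq> {0..n} \<Longrightarrow>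
    (\<And>i j. i \<in> set T \<Longrightarrow> j \<in> set T \<Longrightarrow> diagram_matrix es i j \<noteq> \<infinity>) \<Longrightarrow>
    those (map (table_degrees tab) (components (cartan_rows es (Suc n)) f T)) = Some dss \<Longrightarrow>
    finite (parabolic {0..n} (diagram_matrix es) (set T)) \<and>
    poincare_poly {0..n} (diagram_matrix es) (set T) = qprod (concat dss) \<and> 0 \<notin> set (concat dss)"
proof (induction "cartan_rows es (Suc n)" f T arbitrary: dss rule: components.induct)
  case (3 f x xs)
  let ?rows = "cartan_rows es (Suc n)"
  interpret coxeter_system "{0..n}" "diagram_matrix es" by (rule coxeter_diagram)
  obtain K rest where r: "reach ?rows [x] xs [] = (K, rest)" by fastforce
  have p: "\<forall>x\<in>set K. \<forall>j\<in>set rest. ?rows ! x ! j = 0" "set K \<union> set rest = set (x # xs)"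
      "set K \<inter> set rest = {}" "distinct rest" "length rest \<le> length xs"
    using reach_props[OF r] 3(3) by auto
  obtain ds dss' where d: "table_degrees tab (sort K) = Some ds"
      "those (map (table_degrees tab) (components ?rows f rest)) = Some dss'" "dss = ds # dss'"
    using 3(6) r by (auto split: option.splits)
  have IH: "finite (parabolic {0..n} (diagram_matrix es) (set rest)) \<and>
      poincare_poly {0..n} (diagram_matrix es) (set rest) = qprod (concat dss') \<and> 0 \<notin> set (concat dss')"
  proof (rule 3(1)[OF HOL.refl r[symmetric]])
    show "length rest \<le> f" using p(5) 3(2) by simp
    show "set rest \<subseteq> {0..n}" using p(2) 3(4) by auto
    show "diagram_matrix es i j \<noteq> \<infinity>" if "i \<in> set rest" "j \<in> set rest" for i j
      using 3(5)[of i j] that p(2) by blast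
  qed (use p d in simp_all)
  have "0 \<notin> set ds \<and> finite (parabolic {0..n} (diagram_matrix es) (set (sort K) \<union> set rest)) \<and>
      poincare_poly {0..n} (diagram_matrix es) (set (sort K) \<union> set rest) =
        qprod ds * poincare_poly {0..n} (diagram_matrix es) (set rest)"
  proof -
    have "cartan es i j = 0" if "i \<in> set K" "j \<in> set rest" for i j
    proof -
      have "i \<le> n" "j \<le> n" using that p(2) 3(4) by auto
      then show ?thesis using p(1) that cartan_rows_nth[of i "Suc n" j es] by auto
    qed
    moreover have "set rest \<subseteq> {0..n}" using p(2) 3(4) by auto
    moreover have "diagram_matrix es i j \<noteq> \<infinity>" if "i \<in> set K \<union> set rest" "j \<in> set K \<union> set rest" for i j
      using 3(5)[of i j] that p(2) by blast
    ultimately show ?thesis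
      using poincare_table_entry[OF v tab d(1), of "set rest"] p(3) IH by simp
  qed
  then show ?case using IH p(2) d(3) by (auto simp: qprod_append)
next
  case (1 T)
  interpret coxeter_system "{0..n}" "diagram_matrix es" by (rule coxeter_diagram)
  show ?case using 1 by (auto simp: parabolic_empty poincare_empty qprod_def)
next
  case (2 f)
  interpret coxeter_system "{0..n}" "diagram_matrix es" by (rule coxeter_diagram)
  show ?case using 2 by (auto simp: parabolic_empty poincare_empty qprod_def)
qed

section \<open>The chain complex of a simplex\<close>

definition sgn_at :: "'s::linorder \<Rightarrow> 's set \<Rightarrow> 'r::comm_ring_1" where
  "sgn_at s \<tau> = (- 1) ^ card {t \<in> \<tau>. t < s}"

text \<open>The boundary of the augmented chain complex of the full simplex on \<open>S\<close>,
  evaluated at \<open>\<tau>\<close> as a signed sum over its cofaces. The empty set is a cell, and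
  the degree of a cell is its cardinality.\<close>

definition bd :: "'s::linorder set \<Rightarrow> ('s set \<Rightarrow> 'r::comm_ring_1) \<Rightarrow> 's set \<Rightarrow> 'r" where
  "bd S c \<tau> = (\<Sum>s\<in>S - \<tau>. sgn_at s \<tau> * c (insert s \<tau>))"

definition chains :: "'s set \<Rightarrow> nat \<Rightarrow> ('s set \<Rightarrow> 'r::comm_ring_1) set" where
  "chains S k = {c. \<forall>\<sigma>. c \<sigma> \<noteq> 0 \<longrightarrow> \<sigma> \<subseteq> S \<and> card \<sigma> = k}"

definition cycles :: "'s::linorder set \<Rightarrow> nat \<Rightarrow> ('s set \<Rightarrow> 'r::comm_ring_1) set" where
  "cycles S k = {c \<in> chains S k. bd S c = (\<lambda>\<tau>. 0)}"

lemma sgn_at_square [simp]: "sgn_at s \<tau> * sgn_at s \<tau> = (1 :: 'r::comm_ring_1)"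
  by (simp add: sgn_at_def flip: power_add mult_2)

lemma bd_add: "bd S (\<lambda>\<sigma>. a \<sigma> + b \<sigma>) = (\<lambda>\<tau>. bd S a \<tau> + bd S b \<tau>)"
  by (rule ext) (simp add: bd_def sum.distrib distrib_left)

lemma bd_diff: "bd S (\<lambda>\<sigma>. a \<sigma> - b \<sigma>) = (\<lambda>\<tau>. bd S a \<tau> - bd S b \<tau>)"
  by (rule ext) (simp add: bd_def sum_subtractf right_diff_distrib)

lemma bd_scale: "bd S (\<lambda>\<sigma>. r * a \<sigma>) = (\<lambda>\<tau>. r * bd S a \<tau>)"
  by (rule ext) (simp add: bd_def sum_distrib_left mult.left_commute)

lemma bd_zero: "bd S (\<lambda>\<sigma>. 0) = (\<lambda>\<tau>. 0)"
  by (rule ext) (simp add: bd_def)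

lemma chains_zero: "(\<lambda>\<sigma>. 0) \<in> chains S k" by (simp add: chains_def)

lemma chains_add: "a \<in> chains S k \<Longrightarrow> b \<in> chains S k \<Longrightarrow> (\<lambda>\<sigma>. a \<sigma> + b \<sigma>) \<in> chains S k"
  unfolding chains_def mem_Collect_eq by (metis add.right_neutral)

lemma chains_diff: "a \<in> chains S k \<Longrightarrow> b \<in> chains S k \<Longrightarrow> (\<lambda>\<sigma>. a \<sigma> - b \<sigma>) \<in> chains S k"
  unfolding chains_def mem_Collect_eq by (metis diff_zero)

lemma chains_scale: "a \<in> chains S k \<Longrightarrow> (\<lambda>\<sigma>. r * a \<sigma>) \<in> chains S k"
  unfolding chains_def mem_Collect_eq by (metis mult_zero_right)

lemma chains_eq_0: "a \<in> chains S k \<Longrightarrow> \<not> (\<sigma> \<subseteq> S \<and> card \<sigma> = k) \<Longrightarrow> a \<sigma> = 0"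
  unfolding chains_def by auto

lemma cycles_add: "a \<in> cycles S k \<Longrightarrow> b \<in> cycles S k \<Longrightarrow> (\<lambda>\<sigma>. a \<sigma> + b \<sigma>) \<in> cycles S k"
  using chains_add[of a S k b] bd_add[of S a b] by (simp add: cycles_def)

lemma cycles_diff: "a \<in> cycles S k \<Longrightarrow> b \<in> cycles S k \<Longrightarrow> (\<lambda>\<sigma>. a \<sigma> - b \<sigma>) \<in> cycles S k"
  using chains_diff[of a S k b] bd_diff[of S a b] by (simp add: cycles_def)

lemma cycles_scale: "a \<in> cycles S k \<Longrightarrow> (\<lambda>\<sigma>. r * a \<sigma>) \<in> cycles S k"
  using chains_scale[of a S k r] bd_scale[of S r a] by (simp add: cycles_def)

lemma cycles_zero: "(\<lambda>\<sigma>. 0) \<in> cycles S k"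
  using chains_zero[of S k] bd_zero[of S] by (simp add: cycles_def)

lemma cycles_chains: "a \<in> cycles S k \<Longrightarrow> a \<in> chains S k" by (simp add: cycles_def)

lemma cycles_bd: "a \<in> cycles S k \<Longrightarrow> bd S a \<tau> = 0" by (simp add: cycles_def)

lemma cycles_sum:
  assumes "finite A" "\<And>a. a \<in> A \<Longrightarrow> v a \<in> cycles S k"
  shows "(\<lambda>\<sigma>. \<Sum>a\<in>A. r a * v a \<sigma>) \<in> cycles S k"
  using assms
proof (induction A rule: finite_induct)
  case empty then show ?case by (simp add: cycles_zero)
next
  case (insert a A)
  then show ?case using cycles_add[OF cycles_scale[of "v a" S k "r a"]] by simp
qed

lemma bd_chains:
  assumes "finite S" "c \<in> chains S (Suc k)" shows "bd S c \<in> chains S k"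
  unfolding chains_def
proof (intro CollectI allI impI)
  fix \<tau> assume "bd S c \<tau> \<noteq> 0"
  then have "\<not> (\<forall>s\<in>S - \<tau>. c (insert s \<tau>) = 0)" unfolding bd_def by (intro notI) (simp add: sum.neutral)
  then obtain s where s: "s \<in> S - \<tau>" "c (insert s \<tau>) \<noteq> 0" by blast
  then have c: "insert s \<tau> \<subseteq> S" "card (insert s \<tau>) = Suc k" using assms(2) by (auto simp: chains_def)
  have "finite \<tau>" using finite_subset[of \<tau> S] c assms(1) by auto
  then show "\<tau> \<subseteq> S \<and> card \<tau> = k" using c s by auto
qed

lemma sgn_at_insert:
  assumes "finite \<tau>" "s \<notin> \<tau>"
  shows "sgn_at t (insert s \<tau>) = (if s < t then - sgn_at t \<tau> else (sgn_at t \<tau> :: 'r::comm_ring_1))"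
proof -
  have "{x \<in> insert s \<tau>. x < t} = (if s < t then insert s {x \<in> \<tau>. x < t} else {x \<in> \<tau>. x < t})" by auto
  then show ?thesis using assms by (auto simp: sgn_at_def)
qed

text \<open>Adding \<open>s\<close> and \<open>t\<close> to \<open>\<tau>\<close> in the two orders
  gives opposite signs, so the double sum equals its own negative; characteristic 0 then makes it
  vanish.\<close>

lemma bd_bd:
  fixes c :: "'s::linorder set \<Rightarrow> 'r::{idom, ring_char_0}"
  assumes "finite S" "\<tau> \<subseteq> S" shows "bd S (bd S c) \<tau> = 0"
proof -
  have ft: "finite \<tau>" using assms finite_subset by auto
  define f where "f = (\<lambda>s t. if s = t then 0
    else sgn_at s \<tau> * (sgn_at t (insert s \<tau>) * c (insert t (insert s \<tau>))))"
  have anti: "f s t = - f t s" if "s \<in> S - \<tau>" "t \<in> S - \<tau>" for s t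
    using that ft by (auto simp: f_def sgn_at_insert insert_commute)
  have "bd S (bd S c) \<tau> = (\<Sum>s\<in>S - \<tau>. \<Sum>t\<in>S - \<tau>. f s t)"
    unfolding bd_def
  proof (rule sum.cong)
    fix s assume s: "s \<in> S - \<tau>"
    have "(\<Sum>t\<in>S - \<tau>. f s t) = (\<Sum>t\<in>S - insert s \<tau>. f s t)"
      using assms s by (intro sum.mono_neutral_right) (auto simp: f_def)
    then show "sgn_at s \<tau> * (\<Sum>t\<in>S - insert s \<tau>. sgn_at t (insert s \<tau>) * c (insert t (insert s \<tau>))) =
        (\<Sum>t\<in>S - \<tau>. f s t)"
      unfolding sum_distrib_left by (simp only:) (rule sum.cong, auto simp: f_def)
  qed simp
  moreover have "(\<Sum>s\<in>S - \<tau>. \<Sum>t\<in>S - \<tau>. f s t) = - (\<Sum>s\<in>S - \<tau>. \<Sum>t\<in>S - \<tau>. f s t)"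
  proof -
    have "(\<Sum>s\<in>S - \<tau>. \<Sum>t\<in>S - \<tau>. f s t) = (\<Sum>t\<in>S - \<tau>. \<Sum>s\<in>S - \<tau>. f s t)" by (rule sum.swap)
    also have "\<dots> = (\<Sum>t\<in>S - \<tau>. \<Sum>s\<in>S - \<tau>. - f t s)" by (intro sum.cong HOL.refl anti)
    finally show ?thesis by (simp add: sum_negf)
  qed
  ultimately have "2 * bd S (bd S c) \<tau> = 0" by (metis add.right_inverse mult_2)
  then show ?thesis by simp
qed

lemma bd_in_cycles:
  fixes c :: "'s::linorder set \<Rightarrow> 'r::{idom, ring_char_0}"
  assumes "finite S" "c \<in> chains S (Suc k)" shows "bd S c \<in> cycles S k"
proof -
  have "bd S (bd S c) \<tau> = 0" for \<tau>
  proof (cases "\<tau> \<subseteq> S")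
    case False
    have "bd S c (insert s \<tau>) = 0" for s
      by (rule chains_eq_0[OF bd_chains[OF assms]]) (use False in auto)
    then show ?thesis by (simp add: bd_def)
  qed (rule bd_bd[OF assms(1)])
  then show ?thesis using bd_chains[OF assms] by (auto simp: cycles_def)
qed

section \<open>Cones and the acyclicity of the simplex\<close>

definition cone :: "'s \<Rightarrow> ('s set \<Rightarrow> 'r::comm_ring_1) \<Rightarrow> 's set \<Rightarrow> 'r" where
  "cone v c \<sigma> = (if v \<in> \<sigma> then c (\<sigma> - {v}) else 0)"

lemma cone_chains:
  assumes "finite S" "v \<in> S" "c \<in> chains S k" shows "cone v c \<in> chains S (Suc k)"
  unfolding chains_def
proof (intro CollectI allI impI)
  fix \<sigma> assume "cone v c \<sigma> \<noteq> 0"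
  then have s: "v \<in> \<sigma>" "c (\<sigma> - {v}) \<noteq> 0" by (auto simp: cone_def split: if_splits)
  then have "\<sigma> - {v} \<subseteq> S" "card (\<sigma> - {v}) = k" using assms(3) by (auto simp: chains_def)
  then show "\<sigma> \<subseteq> S \<and> card \<sigma> = Suc k"
    using s assms(1,2) finite_subset[of "\<sigma> - {v}" S] card_Suc_Diff1[of \<sigma> v] by auto
qed

lemma bd_cone_apex_free:
  fixes c :: "'s::linorder set \<Rightarrow> 'b::comm_ring_1"
  assumes "finite S" "v \<in> S" "\<And>s. s \<in> S \<Longrightarrow> v \<le> s" "\<tau> \<subseteq> S" "v \<notin> \<tau>"
  shows "bd S (cone v c) \<tau> = c \<tau>"
proof -
  have "bd S (cone v c) \<tau> = (\<Sum>s\<in>{v}. sgn_at s \<tau> * cone v c (insert s \<tau>))"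
    unfolding bd_def using assms by (intro sum.mono_neutral_right) (auto simp: cone_def)
  also have "(\<Sum>s\<in>{v}. sgn_at s \<tau> * cone v c (insert s \<tau>)) = c \<tau>"
  proof -
    have e: "{t \<in> \<tau>. t < v} = {}" using assms(3,4) by force
    have "sgn_at v \<tau> = (1 :: 'b)" unfolding sgn_at_def e by simp
    then show ?thesis using assms(5) by (simp add: cone_def)
  qed
  finally show ?thesis .
qed

text \<open>For a set containing \<open>v\<close>, the boundary at the set without \<open>v\<close>
  has only one term left, since every other coface avoids \<open>v\<close>. A cycle is therefore
  determined by its values on sets avoiding \<open>v\<close>.\<close>

lemma cycle_eq_0:
  assumes "finite S" "v \<in> S" "y \<in> cycles S k" "\<And>\<tau>. \<tau> \<subseteq> S \<Longrightarrow> v \<notin> \<tau> \<Longrightarrow> y \<tau> = 0"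
  shows "y = (\<lambda>\<tau>. 0)"
proof
  fix \<sigma> show "y \<sigma> = 0"
  proof (cases "\<sigma> \<subseteq> S \<and> v \<in> \<sigma>")
    case True
    define \<rho> where "\<rho> = \<sigma> - {v}"
    have r: "\<sigma> = insert v \<rho>" "v \<notin> \<rho>" "\<rho> \<subseteq> S" using True by (auto simp: \<rho>_def)
    have "y (insert s \<rho>) = 0" if "s \<in> S - \<rho> - {v}" for s
      by (rule assms(4)) (use that r in auto)
    then have "bd S y \<rho> = (\<Sum>s\<in>{v}. sgn_at s \<rho> * y (insert s \<rho>))"
      unfolding bd_def using assms r by (intro sum.mono_neutral_right) auto
    then have "sgn_at v \<rho> * y \<sigma> = 0" using cycles_bd[OF assms(3)] r by simp
    then have "(sgn_at v \<rho> * sgn_at v \<rho>) * y \<sigma> = 0" by (metis mult.assoc mult_zero_right)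
    then show ?thesis by simp
  next
    case False
    then show ?thesis using assms(3,4) chains_eq_0 cycles_chains by metis
  qed
qed

text \<open>The cone from the least vertex is a contraction: with this apex the signs are 1, so
  \<open>c\<close> and the boundary of its cone agree on sets avoiding the apex, and two cycles that
  agree there are equal.\<close>

lemma cycle_is_bd:
  fixes c :: "'s::linorder set \<Rightarrow> 'r::{idom, ring_char_0}"
  assumes "finite S" "S \<noteq> {}" "c \<in> cycles S k"
  shows "\<exists>w\<in>chains S (Suc k). bd S w = c"
proof -
  define v where "v = Min S"
  have v: "v \<in> S" "\<And>s. s \<in> S \<Longrightarrow> v \<le> s" using assms by (auto simp: v_def)
  have h: "cone v c \<in> chains S (Suc k)" using cone_chains assms v cycles_chains by metis
  have "(\<lambda>\<tau>. c \<tau> - bd S (cone v c) \<tau>) = (\<lambda>\<tau>. 0)"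
  proof (rule cycle_eq_0[OF assms(1) v(1)])
    show "(\<lambda>\<tau>. c \<tau> - bd S (cone v c) \<tau>) \<in> cycles S k"
      by (intro cycles_diff assms(3) bd_in_cycles[OF assms(1) h])
    show "c \<tau> - bd S (cone v c) \<tau> = 0" if "\<tau> \<subseteq> S" "v \<notin> \<tau>" for \<tau>
      using bd_cone_apex_free[OF assms(1) v that, of c] by simp
  qed
  then have "bd S (cone v c) = c" by (metis eq_iff_diff_eq_0 ext)
  then show ?thesis using h by auto
qed


subsection \<open>Coordinates on spaces of rational functions\<close>

text \<open>For a linear space \<open>Z\<close> this says that restriction to the positions in
  \<open>A\<close> is an isomorphism onto the rational functions on \<open>A\<close>.\<close>

definition dual_coords :: "('x \<Rightarrow> rat) set \<Rightarrow> 'x set \<Rightarrow> bool" where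
  "dual_coords Z A \<longleftrightarrow> finite A \<and> (\<forall>z\<in>Z. (\<forall>a\<in>A. z a = 0) \<longrightarrow> z = (\<lambda>x. 0)) \<and>
     (\<forall>a\<in>A. \<exists>z\<in>Z. z a = 1 \<and> (\<forall>b\<in>A - {a}. z b = 0))"

definition lin_closed :: "('x \<Rightarrow> rat) set \<Rightarrow> bool" where
  "lin_closed Z \<longleftrightarrow> (\<lambda>x. 0) \<in> Z \<and> (\<forall>f\<in>Z. \<forall>g\<in>Z. (\<lambda>x. f x + g x) \<in> Z) \<and> (\<forall>r. \<forall>f\<in>Z. (\<lambda>x. r * f x) \<in> Z)"

lemma lin_closed_add: "lin_closed Z \<Longrightarrow> f \<in> Z \<Longrightarrow> g \<in> Z \<Longrightarrow> (\<lambda>x. f x + g x) \<in> Z"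
proof -
  assume "lin_closed Z" "f \<in> Z" "g \<in> Z"
  then have "\<forall>g\<in>Z. (\<lambda>x. f x + g x) \<in> Z" unfolding lin_closed_def by (elim conjE) (erule bspec)
  then show ?thesis using \<open>g \<in> Z\<close> by (rule bspec)
qed

lemma lin_closed_scale: "lin_closed Z \<Longrightarrow> f \<in> Z \<Longrightarrow> (\<lambda>x. r * f x) \<in> Z"
proof -
  assume "lin_closed Z" "f \<in> Z"
  then have "\<forall>f\<in>Z. (\<lambda>x. r * f x) \<in> Z" unfolding lin_closed_def by (elim conjE) (erule spec)
  then show ?thesis using \<open>f \<in> Z\<close> by (rule bspec)
qed

lemma lin_closed_diff: "lin_closed Z \<Longrightarrow> f \<in> Z \<Longrightarrow> g \<in> Z \<Longrightarrow> (\<lambda>x. f x - g x) \<in> Z"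
  using lin_closed_add[of Z f "\<lambda>x. (-1) * g x"] lin_closed_scale[of Z g "-1"] by simp

lemma lin_closed_sum:
  "finite A \<Longrightarrow> lin_closed Z \<Longrightarrow> (\<And>a. a \<in> A \<Longrightarrow> v a \<in> Z) \<Longrightarrow> (\<lambda>x. \<Sum>a\<in>A. r a * v a x) \<in> Z"
proof (induction A rule: finite_induct)
  case empty then show ?case by (simp add: lin_closed_def)
next
  case (insert a A)
  have "(\<lambda>x. \<Sum>a\<in>A. r a * v a x) \<in> Z" using insert by simp
  then show ?case using lin_closed_add[OF insert.prems(1) lin_closed_scale[OF insert.prems(1)], of "v a"] insert by simp
qed

lemma dual_coords_expand:
  assumes Z: "lin_closed Z" and A: "finite A" and det: "\<And>z. z \<in> Z \<Longrightarrow> (\<forall>a\<in>A. z a = 0) \<Longrightarrow> z = (\<lambda>x. 0)"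
    and v: "\<And>a. a \<in> A \<Longrightarrow> v a \<in> Z \<and> v a a = 1 \<and> (\<forall>b\<in>A - {a}. v a b = 0)" and z: "z \<in> Z"
  shows "z = (\<lambda>x. \<Sum>a\<in>A. z a * v a x)"
proof -
  have at: "(\<Sum>a\<in>A. z a * v a b) = z b" if "b \<in> A" for b
  proof -
    have "(\<Sum>a\<in>A. z a * v a b) = (\<Sum>a\<in>{b}. z a * v a b)"
      using A that v by (intro sum.mono_neutral_right) auto
    then show ?thesis using v[OF that] by simp
  qed
  have "(\<lambda>x. z x - (\<Sum>a\<in>A. z a * v a x)) = (\<lambda>x. 0)"
    by (rule det) (use at lin_closed_diff[OF Z z lin_closed_sum[OF A Z]] v in auto)
  then show ?thesis by (metis eq_iff_diff_eq_0 ext)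
qed

text \<open>The vectors dual to the positions form a basis, so both cardinalities are the dimension
  of \<open>Z\<close>.\<close>

lemma dual_coords_card:
  assumes Z: "lin_closed Z" and A: "dual_coords Z A" and B: "dual_coords Z B"
  shows "card A = card B"
proof -
  interpret vs: vector_space "\<lambda>(a::rat) (f :: 'a \<Rightarrow> rat) x. a * f x"
    by unfold_locales (auto simp: plus_fun_def algebra_simps)
  have dim: "vs.dim Z = card A" if dA: "dual_coords Z A" for A
  proof -
    have fA: "finite A" using dA by (simp add: dual_coords_def)
    obtain v where v: "\<And>a. a \<in> A \<Longrightarrow> v a \<in> Z \<and> v a a = 1 \<and> (\<forall>b\<in>A - {a}. v a b = 0)"
      using dA unfolding dual_coords_def by metis
    have inj: "inj_on v A" using v by (intro inj_onI) (metis DiffI singletonD zero_neq_one)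
    have sumfun: "(\<Sum>a\<in>C. (\<lambda>x. r a * v a x)) = (\<lambda>x. \<Sum>a\<in>C. r a * v a x)" for C r
      by (induction C rule: infinite_finite_induct) (auto simp: fun_eq_iff)
    have expand: "z = (\<lambda>x. \<Sum>a\<in>A. z a * v a x)" if "z \<in> Z" for z
      by (rule dual_coords_expand[OF Z fA _ v that]) (use dA in \<open>auto simp: dual_coords_def\<close>)
    have span: "vs.span (v ` A) = vs.span Z"
    proof
      show "vs.span (v ` A) \<subseteq> vs.span Z" using v by (intro vs.span_mono) auto
      have "Z \<subseteq> vs.span (v ` A)"
      proof
        fix z assume "z \<in> Z"
        then have "z = (\<Sum>a\<in>A. (\<lambda>x. z a * v a x))" using expand sumfun by metis
        also have "\<dots> \<in> vs.span (v ` A)"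
          by (intro vs.span_sum vs.span_scale vs.span_base) auto
        finally show "z \<in> vs.span (v ` A)" .
      qed
      then show "vs.span Z \<subseteq> vs.span (v ` A)" by (simp add: vs.span_minimal vs.subspace_span)
    qed
    have indep: "vs.independent (v ` A)"
    proof (rule vs.independent_if_scalars_zero)
      show "finite (v ` A)" using fA by simp
      fix f x assume s: "(\<Sum>x\<in>v ` A. (\<lambda>y. f x * x y)) = 0" and x: "x \<in> v ` A"
      obtain b where b: "b \<in> A" "x = v b" using x by auto
      have "(\<Sum>x\<in>v ` A. (\<lambda>y. f x * x y)) = (\<Sum>a\<in>A. (\<lambda>y. f (v a) * v a y))"
        using inj by (simp add: sum.reindex)
      then have "(\<lambda>y. \<Sum>a\<in>A. f (v a) * v a y) = (\<lambda>y. 0)" using s sumfun[of "\<lambda>a. f (v a)" A] by (simp add: zero_fun_def)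
      then have "(\<Sum>a\<in>A. f (v a) * v a b) = 0" by (rule fun_cong)
      moreover have "(\<Sum>a\<in>A. f (v a) * v a b) = (\<Sum>a\<in>{b}. f (v a) * v a b)"
        using fA b v by (intro sum.mono_neutral_right) auto
      ultimately show "f x = 0" using v[OF b(1)] b by simp
    qed
    show ?thesis using vs.dim_eq_card[OF span indep] inj by (simp add: card_image)
  qed
  show ?thesis using dim[OF A] dim[OF B] by simp
qed

text \<open>Choice of pivots as in Gaussian elimination: positions for the subspace \<open>Y\<close>
  with vanishing coordinate \<open>c\<close> are found first, and \<open>c\<close> is added exactly
  when \<open>Y\<close> is a proper subspace.\<close>

lemma dual_coords_exists:
  "finite C \<Longrightarrow> lin_closed Z \<Longrightarrow> (\<And>z. z \<in> Z \<Longrightarrow> (\<forall>a\<in>C. z a = 0) \<Longrightarrow> z = (\<lambda>x. 0)) \<Longrightarrow>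
    \<exists>P\<subseteq>C. dual_coords Z P"
proof (induction C arbitrary: Z rule: finite_induct)
  case empty
  then show ?case by (intro exI[of _ "{}"]) (auto simp: dual_coords_def)
next
  case (insert c C)
  define Y where "Y = {z \<in> Z. z c = 0}"
  have Y: "lin_closed Y" using insert.prems(1) unfolding Y_def lin_closed_def by auto
  obtain P where P: "P \<subseteq> C" "dual_coords Y P"
    using insert.IH[OF Y] insert.prems(2) by (auto simp: Y_def)
  then have fP: "finite P" "c \<notin> P" using insert.hyps by (auto simp: dual_coords_def)
  have det: "z = (\<lambda>x. 0)" if "z \<in> Y" "\<forall>a\<in>P. z a = 0" for z using P(2) that by (auto simp: dual_coords_def)
  obtain v where v: "\<And>a. a \<in> P \<Longrightarrow> v a \<in> Y \<and> v a a = 1 \<and> (\<forall>b\<in>P - {a}. v a b = 0)"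
    using P(2) unfolding dual_coords_def by metis
  show ?case
  proof (cases "Y = Z")
    case True
    then show ?thesis using P by auto
  next
    case False
    then obtain w where w: "w \<in> Z" "w c \<noteq> 0" by (auto simp: Y_def)
    define w1 where "w1 = (\<lambda>x. (1 / w c) * w x)"
    have w1: "w1 \<in> Z" "w1 c = 1"
      using w lin_closed_scale[OF insert.prems(1) w(1), of "1 / w c"] by (simp_all add: w1_def)
    define w2 where "w2 = (\<lambda>x. w1 x - (\<Sum>a\<in>P. w1 a * v a x))"
    have vZ: "\<And>a. a \<in> P \<Longrightarrow> v a \<in> Z" "\<And>a. a \<in> P \<Longrightarrow> v a c = 0" using v by (auto simp: Y_def)
    have "w2 \<in> Z" unfolding w2_def
      by (rule lin_closed_diff[OF insert.prems(1) w1(1) lin_closed_sum[OF fP(1) insert.prems(1)]]) (rule vZ)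
    moreover have "w2 c = 1" using w1 vZ(2) by (simp add: w2_def)
    moreover have "w2 b = 0" if "b \<in> P" for b
    proof -
      have "(\<Sum>a\<in>P. w1 a * v a b) = (\<Sum>a\<in>{b}. w1 a * v a b)"
        using fP that v by (intro sum.mono_neutral_right) auto
      then show ?thesis using v[OF that] by (simp add: w2_def)
    qed
    ultimately have w2: "w2 \<in> Z" "w2 c = 1" "\<And>b. b \<in> P \<Longrightarrow> w2 b = 0" by auto
    have "dual_coords Z (insert c P)"
      unfolding dual_coords_def
    proof (intro conjI ballI impI)
      show "finite (insert c P)" using fP by simp
      show "z = (\<lambda>x. 0)" if "z \<in> Z" "\<forall>a\<in>insert c P. z a = 0" for z
        by (rule det) (use that in \<open>auto simp: Y_def\<close>)
      fix a assume "a \<in> insert c P"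
      then consider "a = c" | "a \<in> P" by auto
      then show "\<exists>z\<in>Z. z a = 1 \<and> (\<forall>b\<in>insert c P - {a}. z b = 0)"
      proof cases
        case 1
        then show ?thesis using w2 by (intro bexI[of _ w2]) auto
      next
        case 2
        then show ?thesis using v[OF 2] vZ[OF 2] by (intro bexI[of _ "v a"]) auto
      qed
    qed
    then show ?thesis using P(1) by (intro exI[of _ "insert c P"]) auto
  qed
qed

lemma dual_coords_basis:
  assumes "dual_coords Z A"
  obtains v where "\<And>a. a \<in> A \<Longrightarrow> v a \<in> Z \<and> v a a = 1 \<and> (\<forall>b\<in>A - {a}. v a b = 0)"
proof -
  have "\<forall>a\<in>A. \<exists>z. z \<in> Z \<and> z a = 1 \<and> (\<forall>b\<in>A - {a}. z b = 0)" using assms unfolding dual_coords_def by blast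
  from bchoice[OF this] show thesis using that by blast
qed

section \<open>Filtered matchings\<close>

definition facet_of :: "'s set \<Rightarrow> 's set \<Rightarrow> bool" where
  "facet_of \<tau> \<sigma> \<longleftrightarrow> (\<exists>s. s \<notin> \<tau> \<and> \<sigma> = insert s \<tau>)"

text \<open>The pairs are removed in the given order; the order condition makes the corresponding part of the
  boundary matrix triangular.\<close>

locale matched_filtration =
  fixes S :: "'s::linorder set" and n :: nat and e :: "'s set \<Rightarrow> nat" and ps :: "('s set \<times> 's set) list"
  assumes finS: "finite S" and cardS: "card S = Suc n"
    and mono: "\<tau> \<subseteq> \<sigma> \<Longrightarrow> \<sigma> \<subset> S \<Longrightarrow> e \<tau> \<le> e \<sigma>"
    and pairs: "(\<tau>, \<sigma>) \<in> set ps \<Longrightarrow> facet_of \<tau> \<sigma> \<and> \<sigma> \<subset> S \<and> e \<sigma> = e \<tau>"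
    and dist: "distinct (map fst ps @ map snd ps)"
    and order: "sorted_wrt (\<lambda>p q. \<not> facet_of (fst p) (snd q) \<and> e (fst q) \<le> e (fst p)) ps"
begin

definition D :: "'s set set" where "D = fst ` set ps"
definition U :: "'s set set" where "U = snd ` set ps"
definition crit :: "nat \<Rightarrow> 's set set" where
  "crit k = {\<kappa>. \<kappa> \<subset> S \<and> card \<kappa> = k \<and> \<kappa> \<notin> D \<and> \<kappa> \<notin> U}"
definition lattice :: "'r \<Rightarrow> ('s set \<Rightarrow> 'r::comm_ring_1) set" where
  "lattice \<phi> = {x. \<forall>\<sigma>. \<sigma> \<subset> S \<longrightarrow> \<phi> ^ e \<sigma> dvd x \<sigma>}"

lemma DU_disjoint: "\<tau> \<in> D \<Longrightarrow> \<tau> \<notin> U" using dist by (auto simp: D_def U_def)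

lemma finite_sub: "\<sigma> \<subseteq> S \<Longrightarrow> finite \<sigma>" using finS finite_subset by auto

lemma finite_D: "finite D" by (simp add: D_def)

lemma pair_card: "(\<tau>, \<sigma>) \<in> set ps \<Longrightarrow> card \<sigma> = Suc (card \<tau>) \<and> \<tau> \<subset> S"
  using pairs[of \<tau> \<sigma>] finite_sub[of \<sigma>] by (auto simp: facet_of_def)

lemma pair_level: "q \<in> set ps \<Longrightarrow> e (fst q) = e (snd q)"
  using pairs[of "fst q" "snd q"] by (metis prod.collapse)

lemma bd_lattice:
  assumes c: "c \<in> chains S (Suc k)" "c \<in> lattice \<phi>" "c S = 0" shows "bd S c \<in> lattice \<phi>"
  unfolding lattice_def
proof (intro CollectI allI impI)
  fix \<tau> assume t: "\<tau> \<subset> S"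
  show "\<phi> ^ e \<tau> dvd bd S c \<tau>"
    unfolding bd_def
  proof (intro dvd_sum dvd_mult)
    fix s assume s: "s \<in> S - \<tau>"
    show "\<phi> ^ e \<tau> dvd c (insert s \<tau>)"
    proof (cases "insert s \<tau> = S")
      case False
      then have "insert s \<tau> \<subset> S" using s t by auto
      then have "\<phi> ^ e (insert s \<tau>) dvd c (insert s \<tau>)" "e \<tau> \<le> e (insert s \<tau>)"
        using c(2) mono[of \<tau> "insert s \<tau>"] by (auto simp: lattice_def)
      then show ?thesis using le_imp_power_dvd dvd_trans by blast
    qed (use c(3) in simp)
  qed
qed

lemma chain_top_zero: "c \<in> chains S k \<Longrightarrow> k \<le> n \<Longrightarrow> c S = 0"
  using chains_eq_0[of c S k S] cardS by auto

lemma lattice_add: "a \<in> lattice \<phi> \<Longrightarrow> b \<in> lattice \<phi> \<Longrightarrow> (\<lambda>\<sigma>. a \<sigma> + b \<sigma>) \<in> lattice \<phi>"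
  by (simp add: lattice_def)

lemma lattice_diff: "a \<in> lattice \<phi> \<Longrightarrow> b \<in> lattice \<phi> \<Longrightarrow> (\<lambda>\<sigma>. a \<sigma> - b \<sigma>) \<in> lattice \<phi>"
  by (simp add: lattice_def)

lemma lattice_scale: "a \<in> lattice \<phi> \<Longrightarrow> (\<lambda>\<sigma>. r * a \<sigma>) \<in> lattice \<phi>"
  by (simp add: lattice_def)

text \<open>Forward substitution. The equation at the lower set of the newest pair fixes the value
  of \<open>u\<close> at its upper set; the order of the pairs leaves the earlier equations
  untouched, and the equal levels within a pair keep \<open>u\<close> in the lattice.\<close>

lemma eliminate_list:
  fixes x :: "'s set \<Rightarrow> 'r::{idom, ring_char_0}"
  assumes x: "x \<in> chains S k" "x \<in> lattice \<phi>"
  shows "set qs \<subseteq> set ps \<Longrightarrow> sorted_wrt (\<lambda>p q. \<not> facet_of (fst p) (snd q) \<and> e (fst q) \<le> e (fst p)) qs \<Longrightarrow>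
    \<exists>u\<in>chains S (Suc k). u \<in> lattice \<phi> \<and> (\<forall>\<sigma>. u \<sigma> \<noteq> 0 \<longrightarrow> \<sigma> \<in> snd ` set qs) \<and>
      (\<forall>\<tau>\<in>fst ` set qs. x \<tau> = bd S u \<tau>)"
proof (induction qs rule: rev_induct)
  case Nil
  show ?case by (intro bexI[of _ "\<lambda>\<sigma>. 0"]) (auto simp: lattice_def chains_zero)
next
  case (snoc p qs)
  obtain \<tau> \<sigma> where p: "p = (\<tau>, \<sigma>)" by fastforce
  have pm: "(\<tau>, \<sigma>) \<in> set ps" using snoc.prems p by auto
  obtain s where s: "s \<notin> \<tau>" "\<sigma> = insert s \<tau>" "\<sigma> \<subset> S" "e \<sigma> = e \<tau>" using pairs[OF pm] by (auto simp: facet_of_def)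
  have tS: "\<tau> \<subset> S" and cs: "card \<sigma> = Suc (card \<tau>)" using pair_card[OF pm] by auto
  obtain u where u: "u \<in> chains S (Suc k)" "u \<in> lattice \<phi>" "\<forall>\<sigma>. u \<sigma> \<noteq> 0 \<longrightarrow> \<sigma> \<in> snd ` set qs"
      "\<forall>\<tau>\<in>fst ` set qs. x \<tau> = bd S u \<tau>"
    using snoc by (auto simp: sorted_wrt_append)
  have uS: "u S = 0"
  proof (rule ccontr)
    assume "u S \<noteq> 0"
    then obtain q where q: "q \<in> set qs" "snd q = S" using u(3) by auto
    then have "(fst q, snd q) \<in> set ps" using snoc.prems by auto
    then have "snd q \<subset> S" using pairs by blast
    then show False using q by simp
  qed
  show ?case
  proof (cases "card \<tau> = k")
    case False
    have "x \<tau> = 0" "bd S u \<tau> = 0"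
      using chains_eq_0[OF x(1), of \<tau>] chains_eq_0[OF bd_chains[OF finS u(1)], of \<tau>] False by auto
    then show ?thesis using u p by (intro bexI[of _ u]) auto
  next
    case True
    define d where "d = sgn_at s \<tau> * (x \<tau> - bd S u \<tau>)"
    define \<delta> where "\<delta> = (\<lambda>\<rho>. if \<rho> = \<sigma> then d else 0)"
    have dch: "\<delta> \<in> chains S (Suc k)" using s cs True by (auto simp: \<delta>_def chains_def)
    have "\<phi> ^ e \<tau> dvd x \<tau>" "\<phi> ^ e \<tau> dvd bd S u \<tau>"
      using x(2) bd_lattice[OF u(1,2) uS] tS by (auto simp: lattice_def)
    then have "\<phi> ^ e \<sigma> dvd d" using s(4) by (simp add: d_def)
    then have dl: "\<delta> \<in> lattice \<phi>" by (auto simp: \<delta>_def lattice_def)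
    have bdt: "bd S \<delta> \<tau> = x \<tau> - bd S u \<tau>"
    proof -
      have "bd S \<delta> \<tau> = (\<Sum>r\<in>{s}. sgn_at r \<tau> * \<delta> (insert r \<tau>))"
        unfolding bd_def using finS s by (intro sum.mono_neutral_right) (auto simp: \<delta>_def)
      also have "\<dots> = (sgn_at s \<tau> * sgn_at s \<tau>) * (x \<tau> - bd S u \<tau>)"
        using s by (simp add: \<delta>_def d_def mult.assoc)
      finally show ?thesis by simp
    qed
    have bdo: "bd S \<delta> \<rho> = 0" if "\<not> facet_of \<rho> \<sigma>" for \<rho>
      unfolding bd_def using that by (intro sum.neutral) (auto simp: \<delta>_def facet_of_def)
    show ?thesis
    proof (intro bexI[of _ "\<lambda>\<rho>. u \<rho> + \<delta> \<rho>"] conjI allI impI ballI)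
      show "(\<lambda>\<rho>. u \<rho> + \<delta> \<rho>) \<in> chains S (Suc k)" using chains_add u(1) dch by blast
      show "(\<lambda>\<rho>. u \<rho> + \<delta> \<rho>) \<in> lattice \<phi>" using lattice_add u(2) dl by blast
      fix \<rho>
      show "\<rho> \<in> snd ` set (qs @ [p])" if "u \<rho> + \<delta> \<rho> \<noteq> 0"
      proof (cases "\<rho> = \<sigma>")
        case True then show ?thesis using p by simp
      next
        case False
        then have "u \<rho> \<noteq> 0" using that by (simp add: \<delta>_def)
        then show ?thesis using u(3) by auto
      qed
      assume r: "\<rho> \<in> fst ` set (qs @ [p])"
      show "x \<rho> = bd S (\<lambda>\<rho>. u \<rho> + \<delta> \<rho>) \<rho>"
      proof (cases "\<rho> = \<tau>")
        case True
        then show ?thesis using bdt bd_add[of S u \<delta>] by simp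
      next
        case False
        then obtain q where q: "q \<in> set qs" "\<rho> = fst q" using r p by auto
        then have "\<not> facet_of \<rho> \<sigma>" using snoc.prems(2) p by (auto simp: sorted_wrt_append)
        then show ?thesis using bdo u(4) q bd_add[of S u \<delta>] by simp
      qed
    qed
  qed
qed

lemma eliminate:
  fixes x :: "'s set \<Rightarrow> 'r::{idom, ring_char_0}"
  assumes "x \<in> chains S k" "x \<in> lattice \<phi>"
  shows "\<exists>u\<in>chains S (Suc k). u \<in> lattice \<phi> \<and> (\<forall>\<sigma>. u \<sigma> \<noteq> 0 \<longrightarrow> \<sigma> \<in> U) \<and> (\<forall>\<tau>\<in>D. x \<tau> = bd S u \<tau>)"
  using eliminate_list[OF assms, of ps] order by (simp add: D_def U_def)

lemma U_proper: "\<sigma> \<in> U \<Longrightarrow> \<sigma> \<subset> S"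
proof -
  assume "\<sigma> \<in> U"
  then obtain \<tau> where "(\<tau>, \<sigma>) \<in> set ps" by (auto simp: U_def)
  then show ?thesis using pairs by blast
qed

lemma D_proper: "\<tau> \<in> D \<Longrightarrow> \<tau> \<subset> S"
proof -
  assume "\<tau> \<in> D"
  then obtain \<sigma> where "(\<tau>, \<sigma>) \<in> set ps" by (auto simp: D_def)
  then show ?thesis using pair_card by blast
qed

text \<open>The same triangular system, read for uniqueness and restricted to levels from
  \<open>j\<close> on. The restriction is consistent because cofaces inside the proper sets never
  have a smaller level.\<close>

lemma triangular_vanish:
  fixes x :: "'s set \<Rightarrow> 'r::{idom, ring_char_0}"
  assumes x: "x S = 0" and b: "\<And>\<tau>. \<tau> \<in> D \<Longrightarrow> e \<tau> \<ge> j \<Longrightarrow> bd S x \<tau> = 0"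
    and o: "\<And>\<sigma>. \<sigma> \<subset> S \<Longrightarrow> e \<sigma> \<ge> j \<Longrightarrow> \<sigma> \<notin> U \<Longrightarrow> x \<sigma> = 0"
    and s: "\<sigma> \<subset> S" "e \<sigma> \<ge> j"
  shows "x \<sigma> = 0"
proof -
  have main: "i < length ps \<Longrightarrow> e (fst (ps ! i)) \<ge> j \<Longrightarrow> x (snd (ps ! i)) = 0" for i
  proof (induction i rule: less_induct)
    case (less i)
    obtain \<tau> \<sigma> where p: "ps ! i = (\<tau>, \<sigma>)" by fastforce
    have pm: "(\<tau>, \<sigma>) \<in> set ps" using less.prems p nth_mem by metis
    obtain t where t: "t \<notin> \<tau>" "\<sigma> = insert t \<tau>" "\<sigma> \<subset> S" using pairs[OF pm] by (auto simp: facet_of_def)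
    have tS: "\<tau> \<subset> S" using pair_card[OF pm] by auto
    have tD: "\<tau> \<in> D" using pm by (force simp: D_def)
    have zero: "x (insert r \<tau>) = 0" if r: "r \<in> S - \<tau> - {t}" for r
    proof (cases "insert r \<tau> = S")
      case True then show ?thesis using x by simp
    next
      case False
      then have pr: "insert r \<tau> \<subset> S" using r tS by auto
      have lv: "e (insert r \<tau>) \<ge> j" using mono[OF subset_insertI pr] less.prems(2) p by simp
      show ?thesis
      proof (cases "insert r \<tau> \<in> U")
        case False then show ?thesis using o[OF pr lv] by simp
      next
        case True
        then obtain q where q: "q \<in> set ps" "snd q = insert r \<tau>" by (auto simp: U_def)
        then obtain i' where i': "i' < length ps" "ps ! i' = q" by (metis in_set_conv_nth)
        have fac: "facet_of \<tau> (insert r \<tau>)" using r by (auto simp: facet_of_def)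
        have "i' \<noteq> i" using i' q p t r by auto
        moreover have "\<not> i < i'"
        proof
          assume "i < i'"
          then have "\<not> facet_of (fst (ps ! i)) (snd (ps ! i'))"
            using sorted_wrt_nth_less[OF order] i' by blast
          then show False using fac q i' p by simp
        qed
        ultimately have "i' < i" by simp
        moreover have "e (fst q) = e (snd q)" using pair_level q(1) by blast
        ultimately show ?thesis using less.IH[of i'] i' q lv by auto
      qed
    qed
    have "bd S x \<tau> = (\<Sum>r\<in>{t}. sgn_at r \<tau> * x (insert r \<tau>))"
      unfolding bd_def using finS t zero by (intro sum.mono_neutral_right) auto
    then have "sgn_at t \<tau> * x \<sigma> = 0" using b[OF tD] less.prems(2) p t by simp
    then have "(sgn_at t \<tau> * sgn_at t \<tau>) * x \<sigma> = 0" by (metis mult.assoc mult_zero_right)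
    then show ?case using p by simp
  qed
  show ?thesis
  proof (cases "\<sigma> \<in> U")
    case True
    then obtain q where q: "q \<in> set ps" "snd q = \<sigma>" by (auto simp: U_def)
    then obtain i where i: "i < length ps" "ps ! i = q" by (metis in_set_conv_nth)
    have "e (fst q) = e (snd q)" using pair_level q(1) by blast
    then show ?thesis using main[OF i(1)] i q s by simp
  qed (use o s in auto)
qed

lemma eliminate_unique:
  fixes u :: "'s set \<Rightarrow> 'r::{idom, ring_char_0}"
  assumes "\<And>\<sigma>. u \<sigma> \<noteq> 0 \<Longrightarrow> \<sigma> \<in> U" "\<And>\<tau>. \<tau> \<in> D \<Longrightarrow> bd S u \<tau> = 0"
  shows "u = (\<lambda>\<sigma>. 0)"
proof
  fix \<sigma>
  have "u S = 0" using assms(1) U_proper by blast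
  show "u \<sigma> = 0"
  proof (cases "\<sigma> \<subset> S")
    case True
    show ?thesis by (rule triangular_vanish[of u 0 \<sigma>, OF \<open>u S = 0\<close>]) (use assms True in auto)
  next
    case False then show ?thesis using assms(1) U_proper by blast
  qed
qed

text \<open>The cycles that vanish on \<open>D\<close> form a complement of the boundaries of the chains on \<open>U\<close>.\<close>

definition normal_cycles :: "nat \<Rightarrow> ('s set \<Rightarrow> 'r::comm_ring_1) set" where
  "normal_cycles k = {y \<in> cycles S k. \<forall>\<tau>\<in>D. y \<tau> = 0}"

text \<open>Bounds the levels at which a normal cycle can live by the levels of the critical sets at
  which it is nonzero. This links the positions of critical sets to powers of \<phi>.\<close>

lemma normal_cycle_level:
  fixes y :: "'s set \<Rightarrow> 'r::{idom, ring_char_0}"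
  assumes y: "y \<in> normal_cycles k" and k: "k \<le> n" and c: "\<And>\<kappa>. \<kappa> \<in> crit k \<Longrightarrow> e \<kappa> \<ge> j \<Longrightarrow> y \<kappa> = 0"
    and s: "\<sigma> \<subset> S" "e \<sigma> \<ge> j"
  shows "y \<sigma> = 0"
proof (rule triangular_vanish[of y j \<sigma>])
  have ch: "y \<in> chains S k" using y by (auto simp: normal_cycles_def cycles_def)
  show "y S = 0" by (rule chain_top_zero[OF ch k])
  show "bd S y \<tau> = 0" for \<tau> using y by (auto simp: normal_cycles_def cycles_def)
  fix \<rho> assume r: "\<rho> \<subset> S" "e \<rho> \<ge> j" "\<rho> \<notin> U"
  show "y \<rho> = 0"
  proof (cases "\<rho> \<in> D \<or> card \<rho> \<noteq> k")
    case True then show ?thesis using y chains_eq_0[OF ch, of \<rho>] by (auto simp: normal_cycles_def)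
  next
    case False then show ?thesis using c[of \<rho>] r by (auto simp: crit_def)
  qed
qed (use s in auto)

lemma normal_cycle_eq_0:
  fixes y :: "'s set \<Rightarrow> 'r::{idom, ring_char_0}"
  assumes "y \<in> normal_cycles k" "k \<le> n" "\<And>\<kappa>. \<kappa> \<in> crit k \<Longrightarrow> y \<kappa> = 0"
  shows "y = (\<lambda>\<sigma>. 0)"
proof
  fix \<sigma>
  have ch: "y \<in> chains S k" using assms(1) by (auto simp: normal_cycles_def cycles_def)
  show "y \<sigma> = 0"
  proof (cases "\<sigma> \<subset> S")
    case True
    show ?thesis by (rule normal_cycle_level[OF assms(1,2) _ True]) (use assms in auto)
  next
    case False
    then have "\<sigma> = S \<or> \<not> \<sigma> \<subseteq> S" by blast
    then show ?thesis using chain_top_zero[OF ch assms(2)] chains_eq_0[OF ch, of \<sigma>] by auto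
  qed
qed

lemma finite_crit: "finite (crit k)"
  by (rule finite_subset[of _ "Pow S"]) (use finS in \<open>auto simp: crit_def\<close>)


lemma lattice_one: "(x :: 's set \<Rightarrow> 'r::comm_ring_1) \<in> lattice 1" by (simp add: lattice_def)

lemma lin_closed_cycles: "lin_closed (cycles S k)"
  unfolding lin_closed_def using cycles_zero cycles_add cycles_scale by blast

lemma lin_closed_normal_cycles: "lin_closed (normal_cycles k)"
  unfolding lin_closed_def
proof (intro conjI ballI allI)
  show "(\<lambda>x. 0) \<in> normal_cycles k" by (simp add: normal_cycles_def cycles_zero)
  fix f :: "'s set \<Rightarrow> rat" and r assume f: "f \<in> normal_cycles k"
  show "(\<lambda>x. r * f x) \<in> normal_cycles k" using f cycles_scale[of f S k r] by (simp add: normal_cycles_def)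
  fix g :: "'s set \<Rightarrow> rat" assume g: "g \<in> normal_cycles k"
  show "(\<lambda>x. f x + g x) \<in> normal_cycles k" using f g cycles_add[of f S k g] by (simp add: normal_cycles_def)
qed

text \<open>Any function on the sets of size \<open>k\<close> avoiding \<open>v\<close> extends
  uniquely to a cycle, namely to the boundary of its cone. Hence the space of cycles has dimension n
  choose k.\<close>

lemma dual_coords_apex_free:
  assumes "v \<in> S" "\<And>s. s \<in> S \<Longrightarrow> v \<le> s"
  shows "dual_coords (cycles S k) {\<tau>. \<tau> \<subseteq> S - {v} \<and> card \<tau> = k}"
  unfolding dual_coords_def
proof (intro conjI ballI impI)
  show "finite {\<tau>. \<tau> \<subseteq> S - {v} \<and> card \<tau> = k}"
    by (rule finite_subset[of _ "Pow S"]) (use finS in auto)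
  fix z :: "'s set \<Rightarrow> rat" assume z: "z \<in> cycles S k" "\<forall>a\<in>{\<tau>. \<tau> \<subseteq> S - {v} \<and> card \<tau> = k}. z a = 0"
  show "z = (\<lambda>x. 0)"
  proof (rule cycle_eq_0[OF finS assms(1) z(1)])
    fix \<tau> assume t: "\<tau> \<subseteq> S" "v \<notin> \<tau>"
    show "z \<tau> = 0"
    proof (cases "card \<tau> = k")
      case True then show ?thesis using z(2) t by blast
    next
      case False then show ?thesis using chains_eq_0[OF cycles_chains[OF z(1)]] by blast
    qed
  qed
next
  fix a assume a: "a \<in> {\<tau>. \<tau> \<subseteq> S - {v} \<and> card \<tau> = k}"
  define d :: "'s set \<Rightarrow> rat" where "d = (\<lambda>\<tau>. if \<tau> = a then 1 else 0)"
  have d: "d \<in> chains S k" using a by (auto simp: chains_def d_def)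
  have z: "bd S (cone v d) \<in> cycles S k" by (rule bd_in_cycles[OF finS cone_chains[OF finS assms(1) d]])
  have at: "bd S (cone v d) b = d b" if "b \<in> {\<tau>. \<tau> \<subseteq> S - {v} \<and> card \<tau> = k}" for b
    by (rule bd_cone_apex_free[OF finS assms(1,2)]) (use that in auto)
  show "\<exists>z\<in>cycles S k. z a = (1 :: rat) \<and> (\<forall>b\<in>{\<tau>. \<tau> \<subseteq> S - {v} \<and> card \<tau> = k} - {a}. z b = 0)"
  proof (intro bexI[where x = "bd S (cone v d)"] conjI ballI z)
    show "bd S (cone v d) a = 1" using at[OF a] by (simp add: d_def)
    show "bd S (cone v d) b = 0" if "b \<in> {\<tau>. \<tau> \<subseteq> S - {v} \<and> card \<tau> = k} - {a}" for b
      using at[of b] that by (auto simp: d_def)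
  qed
qed

text \<open>The positions in \<open>P\<close> together with the lower matched sets of size
  \<open>k\<close> are coordinates for all cycles, and so are the sets avoiding the least vertex.
  Comparing the two numbers gives the size of \<open>P\<close>.\<close>

lemma normal_coords_rat:
  assumes k: "k \<le> n"
  shows "\<exists>P\<subseteq>crit k. dual_coords (normal_cycles k) P \<and> card P + card {\<tau> \<in> D. card \<tau> = k} = n choose k"
proof -
  obtain P where P: "P \<subseteq> crit k" "dual_coords (normal_cycles k) P"
  proof -
    have "z = (\<lambda>x. 0)" if "z \<in> normal_cycles k" "\<forall>a\<in>crit k. z a = 0" for z :: "'s set \<Rightarrow> rat"
      by (rule normal_cycle_eq_0[OF that(1) k]) (use that in auto)
    then obtain P where "P \<subseteq> crit k" "dual_coords (normal_cycles k) P"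
      using dual_coords_exists[OF finite_crit lin_closed_normal_cycles, of k k] by metis
    then show thesis by (rule that)
  qed
  have fP: "finite P" using P(2) by (simp add: dual_coords_def)
  obtain v :: "'s set \<Rightarrow> 's set \<Rightarrow> rat" where v: "\<And>a. a \<in> P \<Longrightarrow> v a \<in> normal_cycles k \<and> v a a = 1 \<and> (\<forall>b\<in>P - {a}. v a b = 0)"
    using dual_coords_basis[OF P(2)] by metis
  have vD: "v a \<tau> = 0" if "a \<in> P" "\<tau> \<in> D" for a \<tau> using v[OF that(1)] that(2) by (simp add: normal_cycles_def)
  have vZ: "v a \<in> cycles S k" if "a \<in> P" for a using v[OF that] by (simp add: normal_cycles_def)
  define Dk where "Dk = {\<tau> \<in> D. card \<tau> = k}"
  have PD: "P \<inter> Dk = {}" using P(1) by (auto simp: crit_def Dk_def)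
  have "dual_coords (cycles S k) (Dk \<union> P)"
    unfolding dual_coords_def
  proof (intro conjI ballI impI)
    show "finite (Dk \<union> P)" using fP finite_D by (simp add: Dk_def)
    fix z :: "'s set \<Rightarrow> rat" assume z: "z \<in> cycles S k" "\<forall>a\<in>Dk \<union> P. z a = 0"
    have "z \<tau> = 0" if "\<tau> \<in> D" for \<tau>
      using z(2) that chains_eq_0[OF cycles_chains[OF z(1)], of \<tau>] by (cases "card \<tau> = k") (auto simp: Dk_def)
    then have "z \<in> normal_cycles k" using z by (simp add: normal_cycles_def)
    then show "z = (\<lambda>x. 0)" using P(2) z(2) by (auto simp: dual_coords_def)
  next
    fix a assume a: "a \<in> Dk \<union> P"
    show "\<exists>z\<in>cycles S k. z a = (1 :: rat) \<and> (\<forall>b\<in>Dk \<union> P - {a}. z b = 0)"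
    proof (cases "a \<in> P")
      case True
      then show ?thesis using v[OF True] vZ[OF True] vD[OF True] by (intro bexI[of _ "v a"]) (auto simp: Dk_def)
    next
      case False
      then have aD: "a \<in> D" "card a = k" using a by (auto simp: Dk_def)
      define d :: "'s set \<Rightarrow> rat" where "d = (\<lambda>\<tau>. if \<tau> = a then 1 else 0)"
      have d: "d \<in> chains S k" using D_proper[OF aD(1)] aD(2) by (auto simp: chains_def d_def)
      obtain u where u: "u \<in> chains S (Suc k)" "\<forall>\<tau>\<in>D. d \<tau> = bd S u \<tau>"
        using eliminate[OF d lattice_one] by auto
      \<comment> \<open>\<open>bd S u\<close> is a cycle with the prescribed values on
        \<open>D\<close>; the sum corrects its values on \<open>P\<close> and vanishes on
        \<open>D\<close>.\<close>
      define z where "z = (\<lambda>\<sigma>. bd S u \<sigma> - (\<Sum>b\<in>P. bd S u b * v b \<sigma>))"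
      have "z \<in> cycles S k"
        unfolding z_def by (intro cycles_diff bd_in_cycles[OF finS u(1)] cycles_sum fP vZ)
      moreover have zD: "z \<tau> = d \<tau>" if "\<tau> \<in> D" for \<tau> using u(2) that vD[OF _ that] by (simp add: z_def)
      moreover have "z b = 0" if "b \<in> P" for b
      proof -
        have "(\<Sum>c\<in>P. bd S u c * v c b) = (\<Sum>c\<in>{b}. bd S u c * v c b)"
          using fP that v by (intro sum.mono_neutral_right) auto
        then show ?thesis using v[OF that] by (simp add: z_def)
      qed
      ultimately show ?thesis using aD by (intro bexI[of _ z]) (auto simp: d_def Dk_def split: if_splits)
    qed
  qed
  moreover obtain m where m: "m \<in> S" "\<And>s. s \<in> S \<Longrightarrow> m \<le> s"
  proof -
    have "S \<noteq> {}" using cardS by auto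
    then show thesis using that[of "Min S"] finS by auto
  qed
  ultimately have "card (Dk \<union> P) = card {\<tau>. \<tau> \<subseteq> S - {m} \<and> card \<tau> = k}"
    using dual_coords_card[OF lin_closed_cycles _ dual_coords_apex_free[OF m]] by blast
  also have "\<dots> = n choose k" using n_subsets[of "S - {m}" k] finS m cardS by simp
  finally have "card P + card Dk = n choose k"
    using PD fP finite_D card_Un_disjoint[of Dk P] by (simp add: Dk_def Int_commute)
  then show ?thesis using P by (auto simp: Dk_def)
qed

end

subsection \<open>Extension of scalars to Laurent polynomials\<close>

lemma sgn_at_cases: "sgn_at s \<tau> = (1 :: 'r::comm_ring_1) \<and> sgn_at s \<tau> = (1 :: 'q::comm_ring_1) \<or>
    sgn_at s \<tau> = (- 1 :: 'r) \<and> sgn_at s \<tau> = (- 1 :: 'q)"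
  by (cases "even (card {t \<in> \<tau>. t < s})") (auto simp: sgn_at_def)

lemma lookup_bd: "Poly_Mapping.lookup (bd S x \<tau>) i = bd S (\<lambda>\<sigma>. Poly_Mapping.lookup (x \<sigma> :: qlaurent) i) \<tau>"
proof -
  have "Poly_Mapping.lookup (sgn_at s \<tau> * p) i = sgn_at s \<tau> * Poly_Mapping.lookup (p :: qlaurent) i" for s p
    using sgn_at_cases[where 'r = qlaurent and 'q = rat, of s \<tau>] by auto
  then show ?thesis unfolding bd_def by (simp add: lookup_sum)
qed

lemma single_bd: "bd S (\<lambda>\<sigma>. Poly_Mapping.single 0 (v \<sigma>)) \<tau> = (Poly_Mapping.single 0 (bd S v \<tau>) :: qlaurent)"
proof -
  have s: "sgn_at s \<tau> * Poly_Mapping.single 0 p = (Poly_Mapping.single 0 (sgn_at s \<tau> * p) :: qlaurent)" for s and p :: rat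
    using sgn_at_cases[where 'r = qlaurent and 'q = rat, of s \<tau>] by (auto simp: single_uminus)
  have "(\<Sum>s\<in>A. Poly_Mapping.single 0 (f s)) = (Poly_Mapping.single 0 (sum f A) :: qlaurent)" for A and f :: "'a \<Rightarrow> rat"
    by (induction A rule: infinite_finite_induct) (auto simp: single_add)
  then show ?thesis unfolding bd_def by (simp add: s)
qed

context matched_filtration
begin

text \<open>The boundary has coefficients 1 and -1 only, so it commutes with taking the coefficient
  of a power of q and with constants. The rational coordinates \<open>P\<close> and their dual
  cycles therefore serve over the Laurent polynomials.\<close>

lemma normal_coords:
  assumes k: "k \<le> n"
  shows "\<exists>P\<subseteq>crit k. finite P \<and> card P + card {\<tau> \<in> D. card \<tau> = k} = n choose k \<and>
    (\<forall>x :: 's set \<Rightarrow> qlaurent. x \<in> normal_cycles k \<longrightarrow> (\<forall>\<kappa>\<in>P. x \<kappa> = 0) \<longrightarrow> x = (\<lambda>\<sigma>. 0)) \<and>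
    (\<exists>v :: 's set \<Rightarrow> 's set \<Rightarrow> qlaurent. \<forall>\<kappa>\<in>P. v \<kappa> \<in> normal_cycles k \<and> v \<kappa> \<kappa> = 1 \<and> (\<forall>\<kappa>'\<in>P - {\<kappa>}. v \<kappa> \<kappa>' = 0))"
proof -
  obtain P where P: "P \<subseteq> crit k" "dual_coords (normal_cycles k) P"
      "card P + card {\<tau> \<in> D. card \<tau> = k} = n choose k"
    using normal_coords_rat[OF k] by auto
  obtain v :: "'s set \<Rightarrow> 's set \<Rightarrow> rat" where v: "\<And>a. a \<in> P \<Longrightarrow> v a \<in> normal_cycles k \<and> v a a = 1 \<and> (\<forall>b\<in>P - {a}. v a b = 0)"
    using dual_coords_basis[OF P(2)] by metis
  show ?thesis
  proof (intro exI[of _ P] conjI allI impI)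
    show "P \<subseteq> crit k" "card P + card {\<tau> \<in> D. card \<tau> = k} = n choose k" by (fact P)+
    show "finite P" using P(2) by (simp add: dual_coords_def)
    fix x :: "'s set \<Rightarrow> qlaurent" assume x: "x \<in> normal_cycles k" "\<forall>\<kappa>\<in>P. x \<kappa> = 0"
    show "x = (\<lambda>\<sigma>. 0)"
    proof (intro ext poly_mapping_eqI)
      fix \<sigma> i
      let ?y = "\<lambda>\<sigma>. Poly_Mapping.lookup (x \<sigma>) i"
      have "bd S ?y \<tau> = 0" for \<tau>
        using lookup_bd[of S x \<tau> i] x(1) by (simp add: normal_cycles_def cycles_def)
      moreover have "?y \<in> chains S k"
        unfolding chains_def
      proof (intro CollectI allI impI)
        fix \<sigma> assume "?y \<sigma> \<noteq> 0"
        then have "x \<sigma> \<noteq> 0" by auto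
        then show "\<sigma> \<subseteq> S \<and> card \<sigma> = k" using x(1) by (auto simp: normal_cycles_def cycles_def chains_def)
      qed
      ultimately have "?y \<in> normal_cycles k"
        using x(1) by (auto simp: normal_cycles_def cycles_def)
      moreover have "\<forall>a\<in>P. ?y a = 0" using x(2) by simp
      ultimately have "?y = (\<lambda>\<sigma>. 0)" using P(2) by (auto simp: dual_coords_def)
      then show "Poly_Mapping.lookup (x \<sigma>) i = Poly_Mapping.lookup 0 i" by (simp add: fun_eq_iff)
    qed
  next
    define w where "w = (\<lambda>a \<sigma>. Poly_Mapping.single 0 (v a \<sigma>) :: qlaurent)"
    have "v a \<sigma> \<noteq> 0" if "w a \<sigma> \<noteq> 0" for a \<sigma> using that by (auto simp: w_def)
    then have "w a \<in> normal_cycles k" if "a \<in> P" for a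
      using v[OF that] single_bd[of S "v a"]
      by (simp add: normal_cycles_def cycles_def chains_def) (auto simp: w_def)
    then show "\<exists>v :: 's set \<Rightarrow> 's set \<Rightarrow> qlaurent. \<forall>\<kappa>\<in>P. v \<kappa> \<in> normal_cycles k \<and> v \<kappa> \<kappa> = 1 \<and>
        (\<forall>\<kappa>'\<in>P - {\<kappa>}. v \<kappa> \<kappa>' = 0)"
      using v by (intro exI[of _ w]) (auto simp: w_def)
  qed
qed

end

text \<open>The homology of the subcomplex \<open>L\<close> in degree \<open>k\<close> is the direct sum of the quotients by the
  elements of the list \<open>ds\<close>.\<close>

definition presents :: "'s::linorder set \<Rightarrow> nat \<Rightarrow> ('s set \<Rightarrow> qlaurent) set \<Rightarrow> qlaurent list \<Rightarrow> bool" where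
  "presents S k L ds \<longleftrightarrow> (\<exists>\<Psi>.
     (\<forall>i<length ds. \<forall>x\<in>cycles S k \<inter> L. \<forall>y\<in>cycles S k \<inter> L. \<Psi> i (\<lambda>\<sigma>. x \<sigma> + y \<sigma>) = \<Psi> i x + \<Psi> i y) \<and>
     (\<forall>i<length ds. \<forall>r. \<forall>x\<in>cycles S k \<inter> L. \<Psi> i (\<lambda>\<sigma>. r * x \<sigma>) = r * \<Psi> i x) \<and>
     (\<forall>x\<in>cycles S k \<inter> L. (\<forall>i<length ds. ds ! i dvd \<Psi> i x) \<longleftrightarrow> (\<exists>c\<in>chains S (Suc k) \<inter> L. bd S c = x)) \<and>
     (\<forall>y. \<exists>x\<in>cycles S k \<inter> L. \<forall>i<length ds. ds ! i dvd \<Psi> i x - y i))"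

lemma fun_diff_eq_0: "(\<lambda>\<sigma>. a \<sigma> - b \<sigma>) = (\<lambda>\<sigma>. 0) \<Longrightarrow> a = (b :: 'x \<Rightarrow> 'r::ab_group_add)"
proof
  fix \<sigma> assume "(\<lambda>\<sigma>. a \<sigma> - b \<sigma>) = (\<lambda>\<sigma>. 0)"
  from fun_cong[OF this, of \<sigma>] show "a \<sigma> = b \<sigma>" by simp
qed

lemma dvd_on_choice:
  assumes "\<And>x. x \<in> A \<Longrightarrow> a dvd f x" shows "\<exists>g. \<forall>x\<in>A. f x = a * g x"
proof -
  have "\<forall>x\<in>A. \<exists>b. f x = a * b" using assms unfolding dvd_def by blast
  then show ?thesis by (rule bchoice)
qed

section \<open>Homology of the part belonging to one cyclotomic polynomial\<close>

context matched_filtration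
begin

lemma lattice_power:
  fixes w :: "'s set \<Rightarrow> 'r::idom"
  assumes "\<And>\<sigma>. \<sigma> \<subset> S \<Longrightarrow> e \<sigma> > j \<Longrightarrow> w \<sigma> = 0"
  shows "(\<lambda>\<sigma>. \<phi> ^ j * w \<sigma>) \<in> lattice \<phi>"
  unfolding lattice_def
proof (intro CollectI allI impI)
  fix \<sigma> assume s: "\<sigma> \<subset> S"
  show "\<phi> ^ e \<sigma> dvd \<phi> ^ j * w \<sigma>"
  proof (cases "e \<sigma> \<le> j")
    case True then show ?thesis by (intro dvd_mult2 le_imp_power_dvd)
  next
    case False then show ?thesis using assms[OF s] by simp
  qed
qed

text \<open>The chain is unique by \<open>eliminate_unique\<close>. So it depends linearly on
  \<open>x\<close>, and one and the same chain inherits divisibility for every \<phi>.\<close>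

definition part :: "('s set \<Rightarrow> 'r::{idom, ring_char_0}) \<Rightarrow> 's set \<Rightarrow> 'r" where
  "part x = (SOME u. (\<forall>\<sigma>. u \<sigma> \<noteq> 0 \<longrightarrow> \<sigma> \<in> U) \<and> (\<forall>\<tau>\<in>D. x \<tau> = bd S u \<tau>))"

lemma part_unique:
  assumes "\<And>\<sigma>. u \<sigma> \<noteq> 0 \<Longrightarrow> \<sigma> \<in> U" "\<And>\<tau>. \<tau> \<in> D \<Longrightarrow> x \<tau> = bd S u \<tau>"
  shows "part x = (u :: 's set \<Rightarrow> 'r::{idom, ring_char_0})"
proof -
  have "(\<forall>\<sigma>. u \<sigma> \<noteq> 0 \<longrightarrow> \<sigma> \<in> U) \<and> (\<forall>\<tau>\<in>D. x \<tau> = bd S u \<tau>)" using assms by blast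
  then have p: "(\<forall>\<sigma>. part x \<sigma> \<noteq> 0 \<longrightarrow> \<sigma> \<in> U) \<and> (\<forall>\<tau>\<in>D. x \<tau> = bd S (part x) \<tau>)"
    unfolding part_def by (rule someI[where P = "\<lambda>u. (\<forall>\<sigma>. u \<sigma> \<noteq> 0 \<longrightarrow> \<sigma> \<in> U) \<and> (\<forall>\<tau>\<in>D. x \<tau> = bd S u \<tau>)"])
  have "(\<lambda>\<sigma>. part x \<sigma> - u \<sigma>) = (\<lambda>\<sigma>. 0)"
  proof (rule eliminate_unique)
    fix \<sigma> assume "part x \<sigma> - u \<sigma> \<noteq> 0"
    then have "part x \<sigma> \<noteq> 0 \<or> u \<sigma> \<noteq> 0" by auto
    then show "\<sigma> \<in> U" using p assms(1) by blast
  next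
    fix \<tau> assume "\<tau> \<in> D"
    then show "bd S (\<lambda>\<sigma>. part x \<sigma> - u \<sigma>) \<tau> = 0" using p assms(2)[of \<tau>] bd_diff[of S "part x" u] by simp
  qed
  then show ?thesis by (rule fun_diff_eq_0)
qed

lemma part_props:
  fixes x :: "'s set \<Rightarrow> 'r::{idom, ring_char_0}"
  assumes "x \<in> chains S k"
  shows "part x \<in> chains S (Suc k)" "\<And>\<sigma>. part x \<sigma> \<noteq> 0 \<Longrightarrow> \<sigma> \<in> U" "\<And>\<tau>. \<tau> \<in> D \<Longrightarrow> x \<tau> = bd S (part x) \<tau>"
    and "x \<in> lattice \<phi> \<Longrightarrow> part x \<in> lattice \<phi>"
proof -
  obtain u where u: "u \<in> chains S (Suc k)" "\<forall>\<sigma>. u \<sigma> \<noteq> 0 \<longrightarrow> \<sigma> \<in> U" "\<forall>\<tau>\<in>D. x \<tau> = bd S u \<tau>"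
    using eliminate[OF assms lattice_one] by blast
  have "part x = u" by (rule part_unique) (use u in auto)
  then show "part x \<in> chains S (Suc k)" "\<And>\<sigma>. part x \<sigma> \<noteq> 0 \<Longrightarrow> \<sigma> \<in> U" "\<And>\<tau>. \<tau> \<in> D \<Longrightarrow> x \<tau> = bd S (part x) \<tau>"
    using u by auto
  assume l: "x \<in> lattice \<phi>"
  obtain u where u: "u \<in> lattice \<phi>" "\<forall>\<sigma>. u \<sigma> \<noteq> 0 \<longrightarrow> \<sigma> \<in> U" "\<forall>\<tau>\<in>D. x \<tau> = bd S u \<tau>"
    using eliminate[OF assms l] by blast
  have "part x = u" by (rule part_unique) (use u in auto)
  then show "part x \<in> lattice \<phi>" using u(1) by (simp only:)
qed

lemma part_add:
  fixes x :: "'s set \<Rightarrow> 'r::{idom, ring_char_0}"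
  assumes "x \<in> chains S k" "y \<in> chains S k"
  shows "part (\<lambda>\<sigma>. x \<sigma> + y \<sigma>) = (\<lambda>\<sigma>. part x \<sigma> + part y \<sigma>)"
proof (rule part_unique)
  fix \<sigma> assume "part x \<sigma> + part y \<sigma> \<noteq> 0"
  then have "part x \<sigma> \<noteq> 0 \<or> part y \<sigma> \<noteq> 0" by auto
  then show "\<sigma> \<in> U" using part_props(2) assms by blast
next
  fix \<tau> assume "\<tau> \<in> D"
  then show "x \<tau> + y \<tau> = bd S (\<lambda>\<sigma>. part x \<sigma> + part y \<sigma>) \<tau>"
    using part_props(3)[OF assms(1)] part_props(3)[OF assms(2)] bd_add[of S "part x" "part y"] by simp
qed

lemma part_scale:
  fixes x :: "'s set \<Rightarrow> 'r::{idom, ring_char_0}"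
  assumes "x \<in> chains S k"
  shows "part (\<lambda>\<sigma>. r * x \<sigma>) = (\<lambda>\<sigma>. r * part x \<sigma>)"
proof (rule part_unique)
  fix \<sigma> assume "r * part x \<sigma> \<noteq> 0"
  then have "part x \<sigma> \<noteq> 0" by auto
  then show "\<sigma> \<in> U" using part_props(2) assms by blast
next
  fix \<tau> assume "\<tau> \<in> D"
  then show "r * x \<tau> = bd S (\<lambda>\<sigma>. r * part x \<sigma>) \<tau>"
    using part_props(3)[OF assms] bd_scale[of S r "part x"] by simp
qed

text \<open>On cycles this is the projection onto the normal cycles along the boundaries of chains
  supported on \<open>U\<close>.\<close>

definition normal :: "('s set \<Rightarrow> 'r::{idom, ring_char_0}) \<Rightarrow> 's set \<Rightarrow> 'r" where
  "normal x = (\<lambda>\<sigma>. x \<sigma> - bd S (part x) \<sigma>)"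

lemma normal_add:
  fixes x :: "'s set \<Rightarrow> 'r::{idom, ring_char_0}"
  assumes "x \<in> chains S k" "y \<in> chains S k"
  shows "normal (\<lambda>\<sigma>. x \<sigma> + y \<sigma>) \<kappa> = normal x \<kappa> + normal y \<kappa>"
  unfolding normal_def part_add[OF assms] bd_add by simp

lemma normal_scale:
  fixes x :: "'s set \<Rightarrow> 'r::{idom, ring_char_0}"
  assumes "x \<in> chains S k" shows "normal (\<lambda>\<sigma>. r * x \<sigma>) \<kappa> = r * normal x \<kappa>"
  unfolding normal_def part_scale[OF assms] bd_scale by (simp add: right_diff_distrib)

lemma normal_in:
  fixes x :: "'s set \<Rightarrow> 'r::{idom, ring_char_0}"
  assumes "x \<in> cycles S k" shows "normal x \<in> normal_cycles k"
proof -
  have ch: "x \<in> chains S k" using assms by (rule cycles_chains)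
  have "normal x \<in> cycles S k"
    unfolding normal_def by (intro cycles_diff assms bd_in_cycles[OF finS part_props(1)[OF ch]])
  then show ?thesis using part_props(3)[OF ch] by (simp add: normal_cycles_def normal_def)
qed

lemma part_top: "x \<in> chains S k \<Longrightarrow> part (x :: 's set \<Rightarrow> 'r::{idom, ring_char_0}) S = 0"
  using part_props(2)[of x k S] U_proper[of S] by blast

lemma normal_lattice:
  fixes x :: "'s set \<Rightarrow> 'r::{idom, ring_char_0}"
  assumes "x \<in> chains S k" "x \<in> lattice \<phi>" shows "normal x \<in> lattice \<phi>"
  unfolding normal_def
  by (intro lattice_diff assms bd_lattice[OF part_props(1)[OF assms(1)] part_props(4)[OF assms] part_top[OF assms(1)]])

lemma normal_coords_obtain:
  assumes k: "k \<le> n"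
  obtains P and v :: "'s set \<Rightarrow> 's set \<Rightarrow> qlaurent" where "P \<subseteq> crit k" "finite P"
    "card P + card {\<tau> \<in> D. card \<tau> = k} = n choose k"
    "\<And>x :: 's set \<Rightarrow> qlaurent. x \<in> normal_cycles k \<Longrightarrow> \<forall>\<kappa>\<in>P. x \<kappa> = 0 \<Longrightarrow> x = (\<lambda>\<sigma>. 0)"
    "\<And>\<kappa>. \<kappa> \<in> P \<Longrightarrow> v \<kappa> \<in> normal_cycles k" "\<And>\<kappa>. \<kappa> \<in> P \<Longrightarrow> v \<kappa> \<kappa> = 1"
    "\<And>\<kappa> \<kappa>'. \<kappa> \<in> P \<Longrightarrow> \<kappa>' \<in> P - {\<kappa>} \<Longrightarrow> v \<kappa> \<kappa>' = 0"
  using normal_coords[OF k]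
proof (elim exE conjE)
  fix P :: "'s set set" and v :: "'s set \<Rightarrow> 's set \<Rightarrow> qlaurent"
  assume P: "P \<subseteq> crit k" "finite P" "card P + card {\<tau> \<in> D. card \<tau> = k} = n choose k"
    and d: "\<forall>x :: 's set \<Rightarrow> qlaurent. x \<in> normal_cycles k \<longrightarrow> (\<forall>\<kappa>\<in>P. x \<kappa> = 0) \<longrightarrow> x = (\<lambda>\<sigma>. 0)"
    and v: "\<forall>\<kappa>\<in>P. v \<kappa> \<in> normal_cycles k \<and> v \<kappa> \<kappa> = 1 \<and> (\<forall>\<kappa>'\<in>P - {\<kappa>}. v \<kappa> \<kappa>' = 0)"
  show thesis
  proof (rule that[OF P])
    show "x = (\<lambda>\<sigma>. 0)" if "x \<in> normal_cycles k" "\<forall>\<kappa>\<in>P. x \<kappa> = 0" for x :: "'s set \<Rightarrow> qlaurent"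
      using d[rule_format, of x] that by simp
    show "v \<kappa> \<in> normal_cycles k" "v \<kappa> \<kappa> = 1" if "\<kappa> \<in> P" for \<kappa> using v that by simp_all
    show "v \<kappa> \<kappa>' = 0" if "\<kappa> \<in> P" "\<kappa>' \<in> P - {\<kappa>}" for \<kappa> \<kappa>' using v that by simp
  qed
qed

text \<open>A cycle in the lattice has a normal part whose values on \<open>P\<close> are \<phi>^j
  times arbitrary elements. It bounds in the lattice exactly if these values are divisible by
  \<phi>^(j + 1), so each element of \<open>P\<close> contributes one copy of R/(\<phi>).\<close>

theorem local_homology:
  fixes \<phi> :: qlaurent
  assumes k: "k < n" and phi: "\<phi> \<noteq> 0"
    and levels: "card {\<tau> \<in> D. card \<tau> = k} = n choose k \<or> (\<exists>j. (\<forall>\<kappa>\<in>crit k. e \<kappa> = j) \<and> (\<forall>\<kappa>\<in>crit (Suc k). e \<kappa> = Suc j))"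
  shows "\<exists>r. r + card {\<tau> \<in> D. card \<tau> = k} = n choose k \<and> presents S k (lattice \<phi>) (replicate r \<phi>)"
proof (rule normal_coords_obtain[OF less_imp_le[OF k]])
  fix P and v :: "'s set \<Rightarrow> 's set \<Rightarrow> qlaurent"
  assume P: "P \<subseteq> crit k" "finite P" "card P + card {\<tau> \<in> D. card \<tau> = k} = n choose k"
      and Pdet: "\<And>x :: 's set \<Rightarrow> qlaurent. x \<in> normal_cycles k \<Longrightarrow> \<forall>\<kappa>\<in>P. x \<kappa> = 0 \<Longrightarrow> x = (\<lambda>\<sigma>. 0)"
      and vZ: "\<And>\<kappa>. \<kappa> \<in> P \<Longrightarrow> v \<kappa> \<in> normal_cycles k" and v1: "\<And>\<kappa>. \<kappa> \<in> P \<Longrightarrow> v \<kappa> \<kappa> = 1"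
      and v0: "\<And>\<kappa> \<kappa>'. \<kappa> \<in> P \<Longrightarrow> \<kappa>' \<in> P - {\<kappa>} \<Longrightarrow> v \<kappa> \<kappa>' = 0"
  have Sne: "S \<noteq> {}" using cardS by auto
  \<comment> \<open>If \<open>P\<close> is empty there are no nonzero normal cycles and any
    \<open>j\<close> will do; this is the first alternative of \<open>levels\<close>.\<close>
  have "\<exists>j. P \<noteq> {} \<longrightarrow> (\<forall>\<kappa>\<in>crit k. e \<kappa> = j) \<and> (\<forall>\<kappa>\<in>crit (Suc k). e \<kappa> = Suc j)"
    using levels P(2,3) by auto
  then obtain j where j: "P \<noteq> {} \<longrightarrow> (\<forall>\<kappa>\<in>crit k. e \<kappa> = j) \<and> (\<forall>\<kappa>\<in>crit (Suc k). e \<kappa> = Suc j)" ..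
  have jk: "e \<kappa> = j" if "\<kappa> \<in> crit k" "P \<noteq> {}" for \<kappa> using j that by blast
  have jk1: "e \<kappa> = Suc j" if "\<kappa> \<in> crit (Suc k)" "P \<noteq> {}" for \<kappa> using j that by blast
  have vsum: "(\<Sum>\<kappa>\<in>P. b \<kappa> * v \<kappa> \<kappa>') = b \<kappa>'" if "\<kappa>' \<in> P" for b \<kappa>'
  proof -
    have "(\<Sum>\<kappa>\<in>P. b \<kappa> * v \<kappa> \<kappa>') = (\<Sum>\<kappa>\<in>{\<kappa>'}. b \<kappa> * v \<kappa> \<kappa>')"
      using P(2) that v0 by (intro sum.mono_neutral_right) auto
    then show ?thesis using v1 that by simp
  qed
  have comb: "(\<lambda>\<sigma>. \<Sum>\<kappa>\<in>P. b \<kappa> * v \<kappa> \<sigma>) \<in> normal_cycles k" for b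
    using cycles_sum[OF P(2), of v S k b] vZ by (simp add: normal_cycles_def)
  have expand: "y = (\<lambda>\<sigma>. \<Sum>\<kappa>\<in>P. y \<kappa> * v \<kappa> \<sigma>)" if y: "y \<in> normal_cycles k" for y
  proof -
    have "(\<lambda>\<sigma>. y \<sigma> - (\<Sum>\<kappa>\<in>P. y \<kappa> * v \<kappa> \<sigma>)) = (\<lambda>\<sigma>. 0)"
    proof (rule Pdet)
      show "(\<lambda>\<sigma>. y \<sigma> - (\<Sum>\<kappa>\<in>P. y \<kappa> * v \<kappa> \<sigma>)) \<in> normal_cycles k"
        using y comb[of y] cycles_diff[of y S k "\<lambda>\<sigma>. \<Sum>\<kappa>\<in>P. y \<kappa> * v \<kappa> \<sigma>"] by (simp add: normal_cycles_def)
    qed (simp add: vsum)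
    then show ?thesis by (rule fun_diff_eq_0)
  qed
  have low: "y \<sigma> = 0" if "y \<in> normal_cycles k" "\<sigma> \<subset> S" "e \<sigma> > j" for y :: "'s set \<Rightarrow> qlaurent" and \<sigma>
  proof (cases "P = {}")
    case True
    then have "y = (\<lambda>\<sigma>. 0)" using Pdet[OF that(1)] by simp
    then show ?thesis by simp
  next
    case False
    show ?thesis by (rule normal_cycle_level[OF that(1) less_imp_le[OF k], of "Suc j"]) (use that jk False in auto)
  qed
  have Pe: "e \<kappa> = j" "\<kappa> \<subset> S" if "\<kappa> \<in> P" for \<kappa>
  proof -
    have "\<kappa> \<in> crit k" "P \<noteq> {}" using that P(1) by auto
    then show "e \<kappa> = j" "\<kappa> \<subset> S" using jk by (simp_all add: crit_def)
  qed
  \<comment> \<open>A boundary is not changed if \<open>c\<close> is replaced by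
    \<open>normal c\<close>, which vanishes on \<open>D\<close>. Its part on \<open>U\<close>
    contributes nothing to the normal form, and the rest sits on critical sets, all of level j +
    1.\<close>
  have bdry: "\<phi> ^ Suc j dvd normal (bd S c) \<kappa>" if c: "c \<in> chains S (Suc k)" "c \<in> lattice \<phi>" and kP: "\<kappa> \<in> P" for c \<kappa>
  proof -
    define c' where "c' = normal c"
    have pc: "part c \<in> chains S (Suc (Suc k))" by (rule part_props(1)[OF c(1)])
    have c'ch: "c' \<in> chains S (Suc k)" unfolding c'_def normal_def by (intro chains_diff c(1) bd_chains[OF finS pc])
    have c'l: "c' \<in> lattice \<phi>" unfolding c'_def by (rule normal_lattice[OF c])
    have "bd S (bd S (part c)) = (\<lambda>\<tau>. 0)" using bd_in_cycles[OF finS pc] by (simp add: cycles_def)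
    then have bdc: "bd S c' = bd S c" unfolding c'_def normal_def bd_diff by simp
    have c'D: "c' \<tau> = 0" if "\<tau> \<in> D" for \<tau> using part_props(3)[OF c(1) that] by (simp add: c'_def normal_def)
    define cU where "cU = (\<lambda>\<sigma>. if \<sigma> \<in> U then c' \<sigma> else 0)"
    define cC where "cC = (\<lambda>\<sigma>. if \<sigma> \<in> U then 0 else c' \<sigma>)"
    have chU: "cU \<in> chains S (Suc k)" "cC \<in> chains S (Suc k)" using c'ch by (auto simp: chains_def cU_def cC_def)
    have split: "c' = (\<lambda>\<sigma>. cU \<sigma> + cC \<sigma>)" by (rule ext) (simp add: cU_def cC_def)
    have crit_ne: "P \<noteq> {}" using kP by auto
    have dv: "\<phi> ^ Suc j dvd cC \<sigma>" for \<sigma>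
    proof (cases "cC \<sigma> = 0")
      case False
      then have "c' \<sigma> \<noteq> 0" "\<sigma> \<notin> U" by (auto simp: cC_def split: if_splits)
      have s: "\<sigma> \<subseteq> S" "card \<sigma> = Suc k" using chains_eq_0[OF c'ch, of \<sigma>] \<open>c' \<sigma> \<noteq> 0\<close> by blast+
      have "\<sigma> \<notin> D" using c'D[of \<sigma>] \<open>c' \<sigma> \<noteq> 0\<close> by blast
      moreover have "\<sigma> \<noteq> S"
      proof
        assume "\<sigma> = S"
        then show False using s(2) cardS k by simp
      qed
      then have sS: "\<sigma> \<subset> S" using s(1) by blast
      ultimately have "\<sigma> \<in> crit (Suc k)" using \<open>\<sigma> \<notin> U\<close> s(2) by (simp add: crit_def)
      then have "e \<sigma> = Suc j" by (rule jk1[OF _ crit_ne])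
      moreover have "\<phi> ^ e \<sigma> dvd c' \<sigma>" using c'l sS unfolding lattice_def by blast
      ultimately show ?thesis using \<open>\<sigma> \<notin> U\<close> by (simp add: cC_def)
    qed simp
    obtain d where "\<forall>\<sigma>\<in>UNIV. cC \<sigma> = \<phi> ^ Suc j * d \<sigma>"
      using dvd_on_choice[of UNIV "\<phi> ^ Suc j" cC] dv by auto
    then have d: "cC \<sigma> = \<phi> ^ Suc j * d \<sigma>" for \<sigma> by blast
    have dch: "d \<in> chains S (Suc k)"
      unfolding chains_def
    proof (intro CollectI allI impI)
      fix \<sigma> assume "d \<sigma> \<noteq> 0"
      then have "cC \<sigma> \<noteq> 0" unfolding d using phi by simp
      then show "\<sigma> \<subseteq> S \<and> card \<sigma> = Suc k" using chU(2) by (auto simp: chains_def)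
    qed
    \<comment> \<open>\<open>cU\<close> is itself the chain on \<open>U\<close> that reproduces its
      boundary on \<open>D\<close>, so subtracting the boundary of the part leaves 0.\<close>
    have "part (bd S cU) = cU" by (rule part_unique) (auto simp: cU_def split: if_splits)
    then have nU: "normal (bd S cU) \<kappa> = 0" by (simp add: normal_def)
    have cCd: "cC = (\<lambda>\<sigma>. \<phi> ^ Suc j * d \<sigma>)" by (rule ext) (rule d)
    have bC: "bd S cC = (\<lambda>\<tau>. \<phi> ^ Suc j * bd S d \<tau>)" unfolding cCd by (rule bd_scale)
    have nC: "normal (bd S cC) \<kappa> = \<phi> ^ Suc j * normal (bd S d) \<kappa>"
      unfolding bC by (rule normal_scale[OF bd_chains[OF finS dch]])
    have bs: "bd S c = (\<lambda>\<tau>. bd S cU \<tau> + bd S cC \<tau>)" unfolding bdc[symmetric] split by (rule bd_add)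
    have "normal (bd S c) \<kappa> = normal (bd S cU) \<kappa> + normal (bd S cC) \<kappa>"
      unfolding bs by (rule normal_add[OF bd_chains[OF finS chU(1)] bd_chains[OF finS chU(2)]])
    then show ?thesis using nU nC by simp
  qed
  \<comment> \<open>Dividing the normal part by \<phi>^(j + 1) gives a cycle \<open>y\<close>, which
    bounds in the full simplex. A suitable filling \<open>w\<close> lives in levels up to j + 1, so
    multiplying it by \<phi>^(j + 1) brings it into the lattice; \<open>part x\<close> fills the
    remainder.\<close>
  have conv: "\<exists>c\<in>chains S (Suc k) \<inter> lattice \<phi>. bd S c = x"
    if x: "x \<in> cycles S k" "x \<in> lattice \<phi>" and dv: "\<forall>\<kappa>\<in>P. \<phi> ^ Suc j dvd normal x \<kappa>" for x
  proof -
    have ch: "x \<in> chains S k" using x(1) by (rule cycles_chains)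
    obtain b where "\<forall>\<kappa>\<in>P. normal x \<kappa> = \<phi> ^ Suc j * b \<kappa>"
      using dvd_on_choice[of P "\<phi> ^ Suc j" "normal x"] dv by auto
    then have b: "normal x \<kappa> = \<phi> ^ Suc j * b \<kappa>" if "\<kappa> \<in> P" for \<kappa> using that by blast
    define y where "y = (\<lambda>\<sigma>. \<Sum>\<kappa>\<in>P. b \<kappa> * v \<kappa> \<sigma>)"
    have y: "y \<in> normal_cycles k" unfolding y_def by (rule comb)
    have ny: "normal x \<sigma> = \<phi> ^ Suc j * y \<sigma>" for \<sigma>
    proof -
      have "normal x \<sigma> = (\<Sum>\<kappa>\<in>P. normal x \<kappa> * v \<kappa> \<sigma>)" by (rule fun_cong[OF expand[OF normal_in[OF x(1)]]])
      also have "\<dots> = (\<Sum>\<kappa>\<in>P. \<phi> ^ Suc j * b \<kappa> * v \<kappa> \<sigma>)" by (rule sum.cong) (simp_all only: b)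
      also have "\<dots> = \<phi> ^ Suc j * y \<sigma>" by (simp only: y_def sum_distrib_left mult.assoc)
      finally show ?thesis .
    qed
    have yc: "y \<in> cycles S k" using y by (simp add: normal_cycles_def)
    obtain w where wch: "w \<in> chains S (Suc k)" and bdw: "bd S w = y" and wl: "(\<lambda>\<sigma>. \<phi> ^ Suc j * w \<sigma>) \<in> lattice \<phi>"
    proof (cases "P = {}")
      case True
      then have "y = (\<lambda>\<sigma>. 0)" by (simp add: y_def)
      then show thesis using that[of "\<lambda>\<sigma>. 0"] by (simp add: chains_zero bd_zero lattice_def)
    next
      case False
      obtain w0 where w0: "w0 \<in> chains S (Suc k)" "bd S w0 = y" using cycle_is_bd[OF finS Sne yc] by blast
      define w where "w = normal w0"
      have pw: "part w0 \<in> chains S (Suc (Suc k))" by (rule part_props(1)[OF w0(1)])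
      have wch: "w \<in> chains S (Suc k)" unfolding w_def normal_def by (intro chains_diff w0(1) bd_chains[OF finS pw])
      have "bd S (bd S (part w0)) = (\<lambda>\<tau>. 0)" using bd_in_cycles[OF finS pw] by (simp add: cycles_def)
      then have bdw: "bd S w = y" unfolding w_def normal_def bd_diff w0(2) by simp
      have wD: "w \<tau> = 0" if "\<tau> \<in> D" for \<tau> using part_props(3)[OF w0(1) that] by (simp add: w_def normal_def)
      \<comment> \<open>Above level j + 1 the normalised filling vanishes: it is 0 on
        \<open>D\<close>, no critical set of its size lies there, and on the sets of
        \<open>D\<close> in these levels its boundary \<open>y\<close> is 0 as well.\<close>
      have "(\<lambda>\<sigma>. \<phi> ^ Suc j * w \<sigma>) \<in> lattice \<phi>"
      proof (rule lattice_power)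
        fix \<sigma> assume s: "\<sigma> \<subset> S" "e \<sigma> > Suc j"
        show "w \<sigma> = 0"
        proof (rule triangular_vanish[of w "Suc (Suc j)" \<sigma>])
          show "w S = 0" using chain_top_zero[OF wch] k by simp
          show "bd S w \<tau> = 0" if "\<tau> \<in> D" "e \<tau> \<ge> Suc (Suc j)" for \<tau>
            using low[OF y D_proper[OF that(1)]] that bdw by simp
          fix \<rho> assume r: "\<rho> \<subset> S" "e \<rho> \<ge> Suc (Suc j)" "\<rho> \<notin> U"
          show "w \<rho> = 0"
          proof (cases "\<rho> \<in> D \<or> card \<rho> \<noteq> Suc k")
            case True then show ?thesis using wD chains_eq_0[OF wch, of \<rho>] by auto
          next
            case not: False
            then have "\<rho> \<in> crit (Suc k)" using r by (auto simp: crit_def)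
            then show ?thesis using jk1[OF _ False] r by fastforce
          qed
        qed (use s in auto)
      qed
      with wch bdw show thesis by (rule that)
    qed
    show ?thesis
    proof (rule bexI[of _ "\<lambda>\<sigma>. part x \<sigma> + \<phi> ^ Suc j * w \<sigma>"])
      show "bd S (\<lambda>\<sigma>. part x \<sigma> + \<phi> ^ Suc j * w \<sigma>) = x"
      proof
        fix \<sigma>
        have "bd S (\<lambda>\<sigma>. part x \<sigma> + \<phi> ^ Suc j * w \<sigma>) \<sigma> = bd S (part x) \<sigma> + \<phi> ^ Suc j * y \<sigma>"
          unfolding bd_add bd_scale bdw by simp
        also have "\<dots> = x \<sigma>" using ny[of \<sigma>, symmetric] unfolding normal_def by (simp only:) simp
        finally show "bd S (\<lambda>\<sigma>. part x \<sigma> + \<phi> ^ Suc j * w \<sigma>) \<sigma> = x \<sigma>" .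
      qed
      show "(\<lambda>\<sigma>. part x \<sigma> + \<phi> ^ Suc j * w \<sigma>) \<in> chains S (Suc k) \<inter> lattice \<phi>"
        using chains_add[OF part_props(1)[OF ch] chains_scale[OF wch]] lattice_add[OF part_props(4)[OF ch x(2)] wl] by simp
    qed
  qed
  have nl: "\<phi> ^ j dvd normal x \<kappa>" if "x \<in> cycles S k" "x \<in> lattice \<phi>" "\<kappa> \<in> P" for x \<kappa>
  proof -
    have "\<phi> ^ e \<kappa> dvd normal x \<kappa>"
      using normal_lattice[OF cycles_chains[OF that(1)] that(2)] Pe(2)[OF that(3)] unfolding lattice_def by blast
    then show ?thesis unfolding Pe(1)[OF that(3)] .
  qed
  define r where "r = card P"
  obtain g where g: "bij_betw g {0..<r} P" using ex_bij_betw_nat_finite[OF P(2)] by (auto simp: r_def)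
  have gP: "g i \<in> P" if "i < r" for i using g that by (auto simp: bij_betw_def)
  \<comment> \<open>The coordinate of the homology class: the value of the normal part at the i-th
    element of \<open>P\<close>, divided by \<phi>^j.\<close>
  define \<Psi> where "\<Psi> = (\<lambda>i x. THE b. normal x (g i) = \<phi> ^ j * b)"
  have \<Psi>: "normal x (g i) = \<phi> ^ j * \<Psi> i x" if x: "x \<in> cycles S k \<inter> lattice \<phi>" and i: "i < r" for x i
  proof -
    have "\<phi> ^ j dvd normal x (g i)" using nl[of x "g i"] x gP[OF i] by simp
    then obtain b where b: "normal x (g i) = \<phi> ^ j * b" by (rule dvdE)
    have "\<Psi> i x = b" unfolding \<Psi>_def by (rule the_equality) (use b phi in auto)
    then show ?thesis using b by simp
  qed
  have canc: "a = b" if "\<phi> ^ j * a = \<phi> ^ j * b" for a b using that phi by simp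
  have sur: "\<exists>b. \<forall>i<r. b (g i) = y i" for y :: "nat \<Rightarrow> qlaurent"
  proof (intro exI[of _ "\<lambda>\<kappa>. y (inv_into {0..<r} g \<kappa>)"] allI impI)
    fix i assume "i < r"
    then show "y (inv_into {0..<r} g (g i)) = y i" using g inv_into_f_f[of g "{0..<r}" i] by (simp add: bij_betw_def)
  qed
  have "presents S k (lattice \<phi>) (replicate r \<phi>)"
    unfolding presents_def length_replicate
  proof (intro exI[of _ \<Psi>] conjI allI impI ballI)
    fix i x y assume i: "i < r" and x: "x \<in> cycles S k \<inter> lattice \<phi>" and y: "y \<in> cycles S k \<inter> lattice \<phi>"
    have xy: "(\<lambda>\<sigma>. x \<sigma> + y \<sigma>) \<in> cycles S k \<inter> lattice \<phi>"
      using cycles_add[of x S k y] lattice_add[of x \<phi> y] x y by simp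
    have ch: "x \<in> chains S k" "y \<in> chains S k" using cycles_chains[of x S k] cycles_chains[of y S k] x y by simp_all
    show "\<Psi> i (\<lambda>\<sigma>. x \<sigma> + y \<sigma>) = \<Psi> i x + \<Psi> i y"
      by (rule canc) (simp only: distrib_left \<Psi>[OF xy i, symmetric] \<Psi>[OF x i, symmetric] \<Psi>[OF y i, symmetric]
        normal_add[OF ch])
  next
    fix i s x assume i: "i < r" and x: "x \<in> cycles S k \<inter> lattice \<phi>"
    have sx: "(\<lambda>\<sigma>. s * x \<sigma>) \<in> cycles S k \<inter> lattice \<phi>"
      using cycles_scale[of x S k s] lattice_scale[of x \<phi> s] x by simp
    have ch: "x \<in> chains S k" using cycles_chains[of x S k] x by simp
    show "\<Psi> i (\<lambda>\<sigma>. s * x \<sigma>) = s * \<Psi> i x"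
      by (rule canc) (simp only: mult.left_commute[of _ s] \<Psi>[OF sx i, symmetric] \<Psi>[OF x i, symmetric] normal_scale[OF ch])
  next
    fix x assume x: "x \<in> cycles S k \<inter> lattice \<phi>"
    have dv: "replicate r \<phi> ! i dvd \<Psi> i x \<longleftrightarrow> \<phi> ^ Suc j dvd normal x (g i)" if "i < r" for i
      using \<Psi>[OF x that] that phi by (simp add: mult.commute[of \<phi>])
    show "(\<forall>i<r. replicate r \<phi> ! i dvd \<Psi> i x) \<longleftrightarrow> (\<exists>c\<in>chains S (Suc k) \<inter> lattice \<phi>. bd S c = x)"
    proof
      assume a: "\<forall>i<r. replicate r \<phi> ! i dvd \<Psi> i x"
      have "\<phi> ^ Suc j dvd normal x \<kappa>" if kP: "\<kappa> \<in> P" for \<kappa>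
      proof -
        have "\<kappa> \<in> g ` {0..<r}" using g kP by (simp add: bij_betw_def)
        then obtain i where "i < r" "g i = \<kappa>" by auto
        then show ?thesis using a dv[of i] by blast
      qed
      then show "\<exists>c\<in>chains S (Suc k) \<inter> lattice \<phi>. bd S c = x" using conv x by blast
    next
      assume "\<exists>c\<in>chains S (Suc k) \<inter> lattice \<phi>. bd S c = x"
      then obtain c where c: "c \<in> chains S (Suc k)" "c \<in> lattice \<phi>" "bd S c = x" by blast
      show "\<forall>i<r. replicate r \<phi> ! i dvd \<Psi> i x" using dv bdry[OF c(1,2) gP] c(3) by simp
    qed
  next
    fix y :: "nat \<Rightarrow> qlaurent"
    obtain b where b: "\<forall>i<r. b (g i) = y i" using sur by blast
    define z where "z = (\<lambda>\<sigma>. \<Sum>\<kappa>\<in>P. b \<kappa> * v \<kappa> \<sigma>)"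
    have z: "z \<in> normal_cycles k" unfolding z_def by (rule comb)
    define x where "x = (\<lambda>\<sigma>. \<phi> ^ j * z \<sigma>)"
    have xc: "x \<in> cycles S k" using z cycles_scale[of z S k "\<phi> ^ j"] by (simp add: x_def normal_cycles_def)
    have xl: "x \<in> lattice \<phi>" unfolding x_def by (rule lattice_power) (rule low[OF z])
    have "part x = (\<lambda>\<sigma>. 0)" by (rule part_unique) (use z in \<open>auto simp: x_def normal_cycles_def bd_zero\<close>)
    then have nx: "normal x = x" by (simp add: normal_def bd_zero)
    have "\<Psi> i x = y i" if i: "i < r" for i
    proof -
      have "\<phi> ^ j * \<Psi> i x = normal x (g i)" using \<Psi>[of x i] xc xl i by simp
      also have "\<dots> = \<phi> ^ j * z (g i)" unfolding nx by (simp only: x_def)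
      also have "z (g i) = y i" using vsum[OF gP[OF i], of b] b i by (simp add: z_def)
      finally show ?thesis by (rule canc)
    qed
    then show "\<exists>x\<in>cycles S k \<inter> lattice \<phi>. \<forall>i<r. replicate r \<phi> ! i dvd \<Psi> i x - y i"
      using xc xl by (intro bexI[of _ x]) auto
  qed
  then show ?thesis using P(3) by (auto simp: r_def)
qed

end

section \<open>Gluing the local computations\<close>

text \<open>Comaximality as an explicit identity: it is carried along by ring homomorphisms and
  supplies the weights with which chains are patched together.\<close>

definition bezout_coprime :: "'r::comm_ring_1 \<Rightarrow> 'r \<Rightarrow> bool" where
  "bezout_coprime a b \<longleftrightarrow> (\<exists>p q. a * p + b * q = 1)"

lemma bezout_coprime_sym: "bezout_coprime a b \<Longrightarrow> bezout_coprime b a"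
  unfolding bezout_coprime_def by (metis add.commute)

lemma bezout_coprime_mult:
  assumes "bezout_coprime a c" "bezout_coprime b c" shows "bezout_coprime (a * b) c"
proof -
  obtain p q where 1: "a * p + c * q = 1" using assms(1) unfolding bezout_coprime_def by blast
  obtain p' q' where 2: "b * p' + c * q' = 1" using assms(2) unfolding bezout_coprime_def by blast
  have "(a * b) * (p * p') + c * (q * (b * p') + q' * (a * p) + c * q * q') = (a * p + c * q) * (b * p' + c * q')"
    by (simp add: algebra_simps)
  also have "\<dots> = 1" using 1 2 by simp
  finally show ?thesis unfolding bezout_coprime_def by blast
qed

lemma bezout_coprime_one: "bezout_coprime 1 c"
  unfolding bezout_coprime_def by (intro exI[of _ 1] exI[of _ 0]) simp

lemma bezout_coprime_power: "bezout_coprime a c \<Longrightarrow> bezout_coprime (a ^ n) c"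
  by (induction n) (auto simp: bezout_coprime_one bezout_coprime_mult)

lemma bezout_coprime_powers: "bezout_coprime a c \<Longrightarrow> bezout_coprime (a ^ n) (c ^ m)"
  using bezout_coprime_power bezout_coprime_sym by metis

lemma bezout_coprime_prod:
  "(\<And>x. x \<in> set xs \<Longrightarrow> bezout_coprime (f x) c) \<Longrightarrow> bezout_coprime (prod_list (map f xs)) c"
  by (induction xs) (auto simp: bezout_coprime_one bezout_coprime_mult)

lemma bezout_coprime_dvd:
  assumes "bezout_coprime a b" "a dvd x" "b dvd x" shows "a * b dvd x"
proof -
  obtain p q where 1: "a * p + b * q = 1" using assms(1) unfolding bezout_coprime_def by blast
  have "x = x * (a * p) + x * (b * q)" using 1 by (metis distrib_left mult.right_neutral)
  moreover have "a * b dvd x * (a * p)" using mult_dvd_mono[OF assms(3) dvd_triv_left[of a p]] by (simp add: mult.commute)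
  moreover have "a * b dvd x * (b * q)" using mult_dvd_mono[OF assms(2) dvd_triv_left[of b q]] by simp
  ultimately show ?thesis by (metis dvd_add)
qed

lemma prod_list_power_dvd_iff:
  assumes "distinct ds" "\<And>d d'. d \<in> set ds \<Longrightarrow> d' \<in> set ds \<Longrightarrow> d \<noteq> d' \<Longrightarrow> bezout_coprime (f d) (f d')"
  shows "prod_list (map (\<lambda>d. f d ^ e d) ds) dvd x \<longleftrightarrow> (\<forall>d\<in>set ds. f d ^ e d dvd x)"
  using assms
proof (induction ds)
  case (Cons d ds)
  have "bezout_coprime (prod_list (map (\<lambda>d. f d ^ e d) ds)) (f d ^ e d)"
    by (rule bezout_coprime_prod) (use Cons.prems in \<open>auto intro!: bezout_coprime_powers\<close>)
  then have c: "bezout_coprime (f d ^ e d) (prod_list (map (\<lambda>d. f d ^ e d) ds))" by (rule bezout_coprime_sym)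
  have IH: "prod_list (map (\<lambda>d. f d ^ e d) ds) dvd x \<longleftrightarrow> (\<forall>d\<in>set ds. f d ^ e d dvd x)"
    using Cons by auto
  show ?case
  proof
    assume "prod_list (map (\<lambda>d. f d ^ e d) (d # ds)) dvd x"
    then have "f d ^ e d * prod_list (map (\<lambda>d. f d ^ e d) ds) dvd x" by simp
    then have "f d ^ e d dvd x" "prod_list (map (\<lambda>d. f d ^ e d) ds) dvd x"
      by (rule dvd_mult_left, rule dvd_mult_right)
    then show "\<forall>d\<in>set (d # ds). f d ^ e d dvd x" using IH by simp
  next
    assume "\<forall>d\<in>set (d # ds). f d ^ e d dvd x"
    then show "prod_list (map (\<lambda>d. f d ^ e d) (d # ds)) dvd x"
      using bezout_coprime_dvd[OF c] IH by simp
  qed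
qed simp

definition submod :: "('x \<Rightarrow> 'r::comm_ring_1) set \<Rightarrow> bool" where
  "submod L \<longleftrightarrow> (\<forall>x\<in>L. \<forall>y\<in>L. (\<lambda>\<sigma>. x \<sigma> + y \<sigma>) \<in> L) \<and> (\<forall>r. \<forall>x\<in>L. (\<lambda>\<sigma>. r * x \<sigma>) \<in> L)"

lemma submod_add: "submod L \<Longrightarrow> x \<in> L \<Longrightarrow> y \<in> L \<Longrightarrow> (\<lambda>\<sigma>. x \<sigma> + y \<sigma>) \<in> L"
  unfolding submod_def by (elim conjE) (drule (1) bspec, drule (1) bspec, assumption)

lemma submod_scale: "submod L \<Longrightarrow> x \<in> L \<Longrightarrow> (\<lambda>\<sigma>. r * x \<sigma>) \<in> L"
  unfolding submod_def by (elim conjE) (drule spec[of _ r], drule (1) bspec, assumption)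

text \<open>Chinese remainder theorem for two subcomplexes that contain \<open>a\<close> times and \<open>b\<close> times everything.\<close>

lemma presents_glue:
  fixes L1 L2 :: "('s::linorder set \<Rightarrow> qlaurent) set"
  assumes S: "finite S" "S \<noteq> {}"
    and L: "submod L1" "submod L2" and a: "\<And>c. (\<lambda>\<sigma>. a * c \<sigma>) \<in> L1" and b: "\<And>c. (\<lambda>\<sigma>. b * c \<sigma>) \<in> L2"
    and ab: "bezout_coprime a b" and p1: "presents S k L1 ds1" and p2: "presents S k L2 ds2"
  shows "presents S k (L1 \<inter> L2) (ds1 @ ds2)"
proof -
  obtain p q where pq: "a * p + b * q = 1" using ab unfolding bezout_coprime_def by blast
  from p1 obtain \<Psi>1 where
    P1: "\<forall>i<length ds1. \<forall>x\<in>cycles S k \<inter> L1. \<forall>y\<in>cycles S k \<inter> L1. \<Psi>1 i (\<lambda>\<sigma>. x \<sigma> + y \<sigma>) = \<Psi>1 i x + \<Psi>1 i y"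
      "\<forall>i<length ds1. \<forall>r. \<forall>x\<in>cycles S k \<inter> L1. \<Psi>1 i (\<lambda>\<sigma>. r * x \<sigma>) = r * \<Psi>1 i x"
      "\<forall>x\<in>cycles S k \<inter> L1. (\<forall>i<length ds1. ds1 ! i dvd \<Psi>1 i x) \<longleftrightarrow> (\<exists>c\<in>chains S (Suc k) \<inter> L1. bd S c = x)"
      "\<forall>y. \<exists>x\<in>cycles S k \<inter> L1. \<forall>i<length ds1. ds1 ! i dvd \<Psi>1 i x - y i"
    unfolding presents_def by (elim exE conjE)
  from p2 obtain \<Psi>2 where
    P2: "\<forall>i<length ds2. \<forall>x\<in>cycles S k \<inter> L2. \<forall>y\<in>cycles S k \<inter> L2. \<Psi>2 i (\<lambda>\<sigma>. x \<sigma> + y \<sigma>) = \<Psi>2 i x + \<Psi>2 i y"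
      "\<forall>i<length ds2. \<forall>r. \<forall>x\<in>cycles S k \<inter> L2. \<Psi>2 i (\<lambda>\<sigma>. r * x \<sigma>) = r * \<Psi>2 i x"
      "\<forall>x\<in>cycles S k \<inter> L2. (\<forall>i<length ds2. ds2 ! i dvd \<Psi>2 i x) \<longleftrightarrow> (\<exists>c\<in>chains S (Suc k) \<inter> L2. bd S c = x)"
      "\<forall>y. \<exists>x\<in>cycles S k \<inter> L2. \<forall>i<length ds2. ds2 ! i dvd \<Psi>2 i x - y i"
    unfolding presents_def by (elim exE conjE)
  define \<Psi> where "\<Psi> = (\<lambda>i x. if i < length ds1 then \<Psi>1 i x else \<Psi>2 (i - length ds1) x)"
  \<comment> \<open>By acyclicity \<open>t\<close> bounds some \<open>w\<close> in the full simplex,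
    and \<open>a\<close> times \<open>w\<close> lies in \<open>L1\<close>. So cycles divisible by
    \<open>a\<close> have trivial class.\<close>
  have kill1: "ds1 ! i dvd \<Psi>1 i (\<lambda>\<sigma>. a * t \<sigma>)" if t: "t \<in> cycles S k" and i: "i < length ds1" for t i
  proof -
    obtain w where w: "w \<in> chains S (Suc k)" "bd S w = t" using cycle_is_bd[OF S t] by blast
    have "(\<lambda>\<sigma>. a * w \<sigma>) \<in> chains S (Suc k) \<inter> L1" using chains_scale[OF w(1)] a[of w] by blast
    moreover have "bd S (\<lambda>\<sigma>. a * w \<sigma>) = (\<lambda>\<sigma>. a * t \<sigma>)" unfolding bd_scale w(2) ..
    moreover have "(\<lambda>\<sigma>. a * t \<sigma>) \<in> cycles S k \<inter> L1" using cycles_scale[OF t] a[of t] by blast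
    ultimately show ?thesis using P1(3) i by blast
  qed
  have kill2: "ds2 ! i dvd \<Psi>2 i (\<lambda>\<sigma>. b * t \<sigma>)" if t: "t \<in> cycles S k" and i: "i < length ds2" for t i
  proof -
    obtain w where w: "w \<in> chains S (Suc k)" "bd S w = t" using cycle_is_bd[OF S t] by blast
    have "(\<lambda>\<sigma>. b * w \<sigma>) \<in> chains S (Suc k) \<inter> L2" using chains_scale[OF w(1)] b[of w] by blast
    moreover have "bd S (\<lambda>\<sigma>. b * w \<sigma>) = (\<lambda>\<sigma>. b * t \<sigma>)" unfolding bd_scale w(2) ..
    moreover have "(\<lambda>\<sigma>. b * t \<sigma>) \<in> cycles S k \<inter> L2" using cycles_scale[OF t] b[of t] by blast
    ultimately show ?thesis using P2(3) i by blast
  qed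
  \<comment> \<open>The patched chain lies in both lattices; by \<open>mix1\<close> and
    \<open>mix2\<close> it is congruent to \<open>u\<close> modulo \<open>a\<close> and to
    \<open>w\<close> modulo \<open>b\<close>.\<close>
  have mix: "(\<lambda>\<sigma>. (b * q) * u \<sigma> + (a * p) * w \<sigma>) \<in> L1 \<inter> L2" if u: "u \<in> L1" and w: "w \<in> L2" for u w
  proof
    show "(\<lambda>\<sigma>. (b * q) * u \<sigma> + (a * p) * w \<sigma>) \<in> L1"
      using submod_add[OF L(1) submod_scale[OF L(1) u, of "b * q"] a[of "\<lambda>\<sigma>. p * w \<sigma>"]] by (simp only: mult.assoc)
    show "(\<lambda>\<sigma>. (b * q) * u \<sigma> + (a * p) * w \<sigma>) \<in> L2"
      using submod_add[OF L(2) b[of "\<lambda>\<sigma>. q * u \<sigma>"] submod_scale[OF L(2) w, of "a * p"]] by (simp only: mult.assoc)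
  qed
  have mix1: "(b * q) * u + (a * p) * w = u + a * (p * (w - u))" for u w
  proof -
    have "(b * q) * u + (a * p) * w = (b * q + a * p) * u + a * (p * (w - u))" by (simp add: algebra_simps)
    then show ?thesis using pq by (simp add: add.commute)
  qed
  have mix2: "(b * q) * u + (a * p) * w = w + b * (q * (u - w))" for u w
  proof -
    have "(b * q) * u + (a * p) * w = (b * q + a * p) * w + b * (q * (u - w))" by (simp add: algebra_simps)
    then show ?thesis using pq by (simp add: add.commute)
  qed
  show ?thesis
    unfolding presents_def
  proof (intro exI[of _ \<Psi>] conjI allI impI ballI)
    fix i x y assume i: "i < length (ds1 @ ds2)" and x: "x \<in> cycles S k \<inter> (L1 \<inter> L2)" and y: "y \<in> cycles S k \<inter> (L1 \<inter> L2)"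
    show "\<Psi> i (\<lambda>\<sigma>. x \<sigma> + y \<sigma>) = \<Psi> i x + \<Psi> i y"
    proof (cases "i < length ds1")
      case True then show ?thesis using P1(1)[rule_format, of i x y] x y by (simp add: \<Psi>_def)
    next
      case False then show ?thesis using P2(1)[rule_format, of "i - length ds1" x y] i x y by (simp add: \<Psi>_def)
    qed
  next
    fix i r x assume i: "i < length (ds1 @ ds2)" and x: "x \<in> cycles S k \<inter> (L1 \<inter> L2)"
    show "\<Psi> i (\<lambda>\<sigma>. r * x \<sigma>) = r * \<Psi> i x"
    proof (cases "i < length ds1")
      case True then show ?thesis using P1(2)[rule_format, of i x r] x by (simp add: \<Psi>_def)
    next
      case False then show ?thesis using P2(2)[rule_format, of "i - length ds1" x r] i x by (simp add: \<Psi>_def)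
    qed
  next
    fix x assume x: "x \<in> cycles S k \<inter> (L1 \<inter> L2)"
    have split: "(\<forall>i<length (ds1 @ ds2). (ds1 @ ds2) ! i dvd \<Psi> i x) \<longleftrightarrow>
        (\<forall>i<length ds1. ds1 ! i dvd \<Psi>1 i x) \<and> (\<forall>i<length ds2. ds2 ! i dvd \<Psi>2 i x)" (is "?A \<longleftrightarrow> ?B")
    proof
      assume A: ?A
      show ?B
      proof (intro conjI allI impI)
        show "ds1 ! i dvd \<Psi>1 i x" if "i < length ds1" for i
          using A[rule_format, of i] that by (simp add: \<Psi>_def nth_append)
        show "ds2 ! i dvd \<Psi>2 i x" if "i < length ds2" for i
          using A[rule_format, of "length ds1 + i"] that by (simp add: \<Psi>_def nth_append)
      qed
    next
      assume ?B then show ?A by (auto simp: \<Psi>_def nth_append)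
    qed
    have 1: "(\<forall>i<length ds1. ds1 ! i dvd \<Psi>1 i x) \<longleftrightarrow> (\<exists>c\<in>chains S (Suc k) \<inter> L1. bd S c = x)" using P1(3) x by blast
    have 2: "(\<forall>i<length ds2. ds2 ! i dvd \<Psi>2 i x) \<longleftrightarrow> (\<exists>c\<in>chains S (Suc k) \<inter> L2. bd S c = x)" using P2(3) x by blast
    show "(\<forall>i<length (ds1 @ ds2). (ds1 @ ds2) ! i dvd \<Psi> i x) \<longleftrightarrow> (\<exists>c\<in>chains S (Suc k) \<inter> (L1 \<inter> L2). bd S c = x)"
      unfolding split 1 2
    proof
      assume h: "(\<exists>c\<in>chains S (Suc k) \<inter> L1. bd S c = x) \<and> (\<exists>c\<in>chains S (Suc k) \<inter> L2. bd S c = x)"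
      obtain c1 where c1: "c1 \<in> chains S (Suc k)" "c1 \<in> L1" "bd S c1 = x" using h by blast
      obtain c2 where c2: "c2 \<in> chains S (Suc k)" "c2 \<in> L2" "bd S c2 = x" using h by blast
      define c where "c = (\<lambda>\<sigma>. (b * q) * c1 \<sigma> + (a * p) * c2 \<sigma>)"
      have "c \<in> chains S (Suc k)" unfolding c_def by (intro chains_add chains_scale c1 c2)
      moreover have "c \<in> L1 \<inter> L2" unfolding c_def by (rule mix[OF c1(2) c2(2)])
      moreover have "bd S c = x"
      proof -
        have "bd S c = (\<lambda>\<tau>. (b * q) * bd S c1 \<tau> + (a * p) * bd S c2 \<tau>)" unfolding c_def bd_add bd_scale ..
        then show ?thesis unfolding c1(3) c2(3) mix1 by simp
      qed
      ultimately show "\<exists>c\<in>chains S (Suc k) \<inter> (L1 \<inter> L2). bd S c = x" by blast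
    qed blast
  next
    fix y :: "nat \<Rightarrow> qlaurent"
    obtain z1 where z1: "z1 \<in> cycles S k" "z1 \<in> L1" "\<forall>i<length ds1. ds1 ! i dvd \<Psi>1 i z1 - y i" using P1(4) by blast
    obtain z2 where z2: "z2 \<in> cycles S k" "z2 \<in> L2" "\<forall>i<length ds2. ds2 ! i dvd \<Psi>2 i z2 - y (length ds1 + i)"
      using P2(4)[rule_format, of "\<lambda>i. y (length ds1 + i)"] by blast
    define z where "z = (\<lambda>\<sigma>. (b * q) * z1 \<sigma> + (a * p) * z2 \<sigma>)"
    define t1 where "t1 = (\<lambda>\<sigma>. p * (z2 \<sigma> - z1 \<sigma>))"
    define t2 where "t2 = (\<lambda>\<sigma>. q * (z1 \<sigma> - z2 \<sigma>))"
    have t: "t1 \<in> cycles S k" "t2 \<in> cycles S k" unfolding t1_def t2_def by (intro cycles_scale cycles_diff z1 z2)+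
    have zc: "z \<in> cycles S k" unfolding z_def by (intro cycles_add cycles_scale z1 z2)
    have zl: "z \<in> L1 \<inter> L2" unfolding z_def by (rule mix[OF z1(2) z2(2)])
    have e1: "z = (\<lambda>\<sigma>. z1 \<sigma> + a * t1 \<sigma>)" unfolding z_def t1_def mix1 ..
    have e2: "z = (\<lambda>\<sigma>. z2 \<sigma> + b * t2 \<sigma>)" unfolding z_def t2_def mix2 ..
    have c1: "ds1 ! i dvd \<Psi>1 i z - y i" if i: "i < length ds1" for i
    proof -
      have "\<Psi>1 i z = \<Psi>1 i z1 + \<Psi>1 i (\<lambda>\<sigma>. a * t1 \<sigma>)"
        unfolding e1 using P1(1)[rule_format, OF i, of z1 "\<lambda>\<sigma>. a * t1 \<sigma>"] z1 cycles_scale[OF t(1), of a] a[of t1] by simp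
      then have "\<Psi>1 i z - y i = (\<Psi>1 i z1 - y i) + \<Psi>1 i (\<lambda>\<sigma>. a * t1 \<sigma>)" by simp
      then show ?thesis using z1(3) kill1[OF t(1) i] i by (metis dvd_add)
    qed
    have c2: "ds2 ! i dvd \<Psi>2 i z - y (length ds1 + i)" if i: "i < length ds2" for i
    proof -
      have "\<Psi>2 i z = \<Psi>2 i z2 + \<Psi>2 i (\<lambda>\<sigma>. b * t2 \<sigma>)"
        unfolding e2 using P2(1)[rule_format, OF i, of z2 "\<lambda>\<sigma>. b * t2 \<sigma>"] z2 cycles_scale[OF t(2), of b] b[of t2] by simp
      then have "\<Psi>2 i z - y (length ds1 + i) = (\<Psi>2 i z2 - y (length ds1 + i)) + \<Psi>2 i (\<lambda>\<sigma>. b * t2 \<sigma>)" by simp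
      then show ?thesis using z2(3) kill2[OF t(2) i] i by (metis dvd_add)
    qed
    show "\<exists>x\<in>cycles S k \<inter> (L1 \<inter> L2). \<forall>i<length (ds1 @ ds2). (ds1 @ ds2) ! i dvd \<Psi> i x - y i"
    proof (intro bexI[where x = z] allI impI)
      fix i assume i: "i < length (ds1 @ ds2)"
      show "(ds1 @ ds2) ! i dvd \<Psi> i z - y i"
      proof (cases "i < length ds1")
        case True then show ?thesis using c1 by (simp add: \<Psi>_def nth_append)
      next
        case False then show ?thesis using c2[of "i - length ds1"] i by (simp add: \<Psi>_def nth_append)
      qed
    qed (use zc zl in simp)
  qed
qed

lemma presents_UNIV: "finite S \<Longrightarrow> S \<noteq> {} \<Longrightarrow> presents S k UNIV []"
  unfolding presents_def by (auto intro: cycle_is_bd cycles_zero)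

definition weight_lattice :: "'s set \<Rightarrow> ('s set \<Rightarrow> 'r::comm_ring_1) \<Rightarrow> ('s set \<Rightarrow> 'r) set" where
  "weight_lattice S w = {x. \<forall>\<sigma>. \<sigma> \<subset> S \<longrightarrow> w \<sigma> dvd x \<sigma>}"

lemma submod_weight_lattice: "submod (weight_lattice S w)"
  by (simp add: submod_def weight_lattice_def)

text \<open>Induction with \<open>presents_glue\<close>. The uniform bound \<open>N\<close> provides
  the elements \<open>f d ^ N\<close> that carry every chain into the respective lattice.\<close>

lemma presents_family:
  assumes S: "finite S" "S \<noteq> {}" and N: "\<And>d \<sigma>. d \<in> set ds \<Longrightarrow> \<sigma> \<subset> S \<Longrightarrow> e d \<sigma> \<le> N"
    and dist: "distinct ds" and cop: "\<And>d d'. d \<in> set ds \<Longrightarrow> d' \<in> set ds \<Longrightarrow> d \<noteq> d' \<Longrightarrow> bezout_coprime (f d) (f d')"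
    and loc: "\<And>d. d \<in> set ds \<Longrightarrow> presents S k (weight_lattice S (\<lambda>\<sigma>. f d ^ e d \<sigma>)) (replicate (r d) (f d))"
  shows "presents S k (weight_lattice S (\<lambda>\<sigma>. prod_list (map (\<lambda>d. f d ^ e d \<sigma>) ds)))
    (concat (map (\<lambda>d. replicate (r d) (f d)) ds))"
  using N dist cop loc
proof (induction ds)
  case Nil
  have "weight_lattice S (\<lambda>\<sigma>. prod_list (map (\<lambda>d. f d ^ e d \<sigma>) [])) = (UNIV :: ('a set \<Rightarrow> qlaurent) set)"
    by (simp add: weight_lattice_def)
  then show ?case using presents_UNIV[OF S] by simp
next
  case (Cons d ds)
  let ?W = "\<lambda>ds. weight_lattice S (\<lambda>\<sigma>. prod_list (map (\<lambda>d. f d ^ e d \<sigma>) ds))"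
  have IH: "presents S k (?W ds) (concat (map (\<lambda>d. replicate (r d) (f d)) ds))"
    by (rule Cons.IH) (use Cons.prems in auto)
  have L1: "(\<lambda>\<sigma>. f d ^ N * c \<sigma>) \<in> weight_lattice S (\<lambda>\<sigma>. f d ^ e d \<sigma>)" for c
    unfolding weight_lattice_def using Cons.prems(1) by (auto intro!: dvd_mult2 le_imp_power_dvd)
  have L2: "(\<lambda>\<sigma>. prod_list (map (\<lambda>d. f d ^ N) ds) * c \<sigma>) \<in> ?W ds" for c
  proof -
    have "prod_list (map (\<lambda>d. f d ^ e d \<sigma>) ds) dvd prod_list (map (\<lambda>d. f d ^ N) ds)" if "\<sigma> \<subset> S" for \<sigma>
      using Cons.prems(1) that by (induction ds) (auto intro!: mult_dvd_mono le_imp_power_dvd)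
    then show ?thesis unfolding weight_lattice_def by (auto intro: dvd_mult2)
  qed
  have "bezout_coprime (prod_list (map (\<lambda>d. f d ^ N) ds)) (f d ^ N)"
  proof (rule bezout_coprime_prod)
    fix d' assume "d' \<in> set ds"
    then have "bezout_coprime (f d') (f d)" using Cons.prems(2) Cons.prems(3)[of d' d] by auto
    then show "bezout_coprime (f d' ^ N) (f d ^ N)" by (rule bezout_coprime_powers)
  qed
  then have cop: "bezout_coprime (f d ^ N) (prod_list (map (\<lambda>d. f d ^ N) ds))" by (rule bezout_coprime_sym)
  have eq: "weight_lattice S (\<lambda>\<sigma>. f d ^ e d \<sigma>) \<inter> ?W ds = ?W (d # ds)"
  proof -
    have "prod_list (map (\<lambda>d. f d ^ e d \<sigma>) (d # ds)) dvd x \<longleftrightarrow>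
        f d ^ e d \<sigma> dvd x \<and> prod_list (map (\<lambda>d. f d ^ e d \<sigma>) ds) dvd x" for x \<sigma>
      using prod_list_power_dvd_iff[of "d # ds" f "\<lambda>d. e d \<sigma>" x] prod_list_power_dvd_iff[of ds f "\<lambda>d. e d \<sigma>" x]
        Cons.prems(2,3) by simp
    then show ?thesis unfolding weight_lattice_def by auto
  qed
  have loc: "presents S k (weight_lattice S (\<lambda>\<sigma>. f d ^ e d \<sigma>)) (replicate (r d) (f d))" using Cons.prems(4) by simp
  show ?case
    using presents_glue[OF S submod_weight_lattice submod_weight_lattice L1 L2 cop loc IH] unfolding eq by simp
qed


subsection \<open>Quotient modules\<close>

text \<open>The first isomorphism theorem with the calculus of cosets as hypotheses, in a form that
  applies directly to the concrete module records.\<close>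

lemma module_iso_quotient:
  fixes F :: "'m \<Rightarrow> 'n"
  assumes eq: "\<And>c c'. c \<in> carrier M \<Longrightarrow> c' \<in> carrier M \<Longrightarrow> F c = F c' \<longleftrightarrow> N +>\<^bsub>M\<^esub> c = N +>\<^bsub>M\<^esub> c'"
    and surj: "F ` carrier M = carrier M'"
    and hom: "\<And>c c'. c \<in> carrier M \<Longrightarrow> c' \<in> carrier M \<Longrightarrow> F (c \<oplus>\<^bsub>M\<^esub> c') = F c \<oplus>\<^bsub>M'\<^esub> F c'"
      "\<And>r c. r \<in> carrier R \<Longrightarrow> c \<in> carrier M \<Longrightarrow> F (r \<odot>\<^bsub>M\<^esub> c) = r \<odot>\<^bsub>M'\<^esub> F c"
    and closed: "\<And>c c'. c \<in> carrier M \<Longrightarrow> c' \<in> carrier M \<Longrightarrow> c \<oplus>\<^bsub>M\<^esub> c' \<in> carrier M"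
      "\<And>r c. r \<in> carrier R \<Longrightarrow> c \<in> carrier M \<Longrightarrow> r \<odot>\<^bsub>M\<^esub> c \<in> carrier M"
    and add: "\<And>c c'. c \<in> carrier M \<Longrightarrow> c' \<in> carrier M \<Longrightarrow>
        set_add M (N +>\<^bsub>M\<^esub> c) (N +>\<^bsub>M\<^esub> c') = N +>\<^bsub>M\<^esub> (c \<oplus>\<^bsub>M\<^esub> c')"
    and smult: "\<And>r c. r \<in> carrier R \<Longrightarrow> c \<in> carrier M \<Longrightarrow>
        (\<Union>x\<in>N +>\<^bsub>M\<^esub> c. N +>\<^bsub>M\<^esub> (r \<odot>\<^bsub>M\<^esub> x)) = N +>\<^bsub>M\<^esub> (r \<odot>\<^bsub>M\<^esub> c)"
  shows "module_iso R (quotient_module M N) M'"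
proof -
  define f where "f = (\<lambda>X. F (SOME c. c \<in> carrier M \<and> X = N +>\<^bsub>M\<^esub> c))"
  have f: "f (N +>\<^bsub>M\<^esub> c) = F c" if c: "c \<in> carrier M" for c
  proof -
    have "\<exists>c'. c' \<in> carrier M \<and> N +>\<^bsub>M\<^esub> c = N +>\<^bsub>M\<^esub> c'" using c by blast
    from someI_ex[OF this] show ?thesis unfolding f_def using eq[OF _ c] by metis
  qed
  have car: "carrier (quotient_module M N) = (\<lambda>c. N +>\<^bsub>M\<^esub> c) ` carrier M"
    by (auto simp: quotient_module_def A_RCOSETS_def')
  show ?thesis
    unfolding module_iso_def
  proof (intro exI[of _ f] conjI ballI)
    show "bij_betw f (carrier (quotient_module M N)) (carrier M')"
      unfolding bij_betw_def
    proof
      show "inj_on f (carrier (quotient_module M N))"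
      proof (rule inj_onI)
        fix X Y assume XY: "X \<in> carrier (quotient_module M N)" "Y \<in> carrier (quotient_module M N)" "f X = f Y"
        obtain c c' where "c \<in> carrier M" "c' \<in> carrier M" "X = N +>\<^bsub>M\<^esub> c" "Y = N +>\<^bsub>M\<^esub> c'" using XY(1,2) car by auto
        then show "X = Y" using XY(3) f eq by simp
      qed
      have "f ` carrier (quotient_module M N) = F ` carrier M" unfolding car image_image using f by (rule image_cong[OF HOL.refl])
      then show "f ` carrier (quotient_module M N) = carrier M'" using surj by simp
    qed
  next
    fix X Y assume XY: "X \<in> carrier (quotient_module M N)" "Y \<in> carrier (quotient_module M N)"
    obtain c c' where c: "c \<in> carrier M" "c' \<in> carrier M" "X = N +>\<^bsub>M\<^esub> c" "Y = N +>\<^bsub>M\<^esub> c'" using XY car by auto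
    have "X \<oplus>\<^bsub>quotient_module M N\<^esub> Y = N +>\<^bsub>M\<^esub> (c \<oplus>\<^bsub>M\<^esub> c')"
      unfolding c(3,4) using add[OF c(1,2)] by (simp add: quotient_module_def)
    then show "f (X \<oplus>\<^bsub>quotient_module M N\<^esub> Y) = f X \<oplus>\<^bsub>M'\<^esub> f Y"
      using f[OF closed(1)[OF c(1,2)]] f[OF c(1)] f[OF c(2)] hom(1)[OF c(1,2)] c(3,4) by simp
  next
    fix r X assume r: "r \<in> carrier R" and X: "X \<in> carrier (quotient_module M N)"
    obtain c where c: "c \<in> carrier M" "X = N +>\<^bsub>M\<^esub> c" using X car by auto
    have "r \<odot>\<^bsub>quotient_module M N\<^esub> X = N +>\<^bsub>M\<^esub> (r \<odot>\<^bsub>M\<^esub> c)"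
      unfolding c(2) using smult[OF r c(1)] by (simp add: quotient_module_def)
    then show "f (r \<odot>\<^bsub>quotient_module M N\<^esub> X) = r \<odot>\<^bsub>M'\<^esub> f X"
      using f[OF closed(2)[OF r c(1)]] f[OF c(1)] hom(2)[OF r c(1)] c(2) by simp
  qed
qed

lemma additive_cosets:
  fixes M :: "('r, 'm::ab_group_add) module"
  assumes plus: "add M = (+)" and N: "0 \<in> N" "\<And>x y. x \<in> N \<Longrightarrow> y \<in> N \<Longrightarrow> x - y \<in> N"
  shows "N +>\<^bsub>M\<^esub> c = (\<lambda>h. h + c) ` N"
    and "N +>\<^bsub>M\<^esub> c = N +>\<^bsub>M\<^esub> c' \<longleftrightarrow> c - c' \<in> N"
    and "set_add M (N +>\<^bsub>M\<^esub> c) (N +>\<^bsub>M\<^esub> c') = N +>\<^bsub>M\<^esub> (c \<oplus>\<^bsub>M\<^esub> c')"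
    and "(\<And>h. h \<in> N \<Longrightarrow> r \<odot>\<^bsub>M\<^esub> h \<in> N) \<Longrightarrow> (\<And>h. h \<in> N \<Longrightarrow> r \<odot>\<^bsub>M\<^esub> (h + c) = r \<odot>\<^bsub>M\<^esub> h + r \<odot>\<^bsub>M\<^esub> c) \<Longrightarrow>
      (\<Union>x\<in>N +>\<^bsub>M\<^esub> c. N +>\<^bsub>M\<^esub> (r \<odot>\<^bsub>M\<^esub> x)) = N +>\<^bsub>M\<^esub> (r \<odot>\<^bsub>M\<^esub> c)"
proof -
  have neg: "- x \<in> N" if "x \<in> N" for x using N(2)[OF N(1) that] by simp
  have pl: "x + y \<in> N" if "x \<in> N" "y \<in> N" for x y using N(2)[OF that(1) neg[OF that(2)]] by simp
  show cos: "N +>\<^bsub>M\<^esub> c = (\<lambda>h. h + c) ` N" for c by (auto simp: a_r_coset_def' plus)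
  show eq: "N +>\<^bsub>M\<^esub> c = N +>\<^bsub>M\<^esub> c' \<longleftrightarrow> c - c' \<in> N" for c c'
  proof
    assume "N +>\<^bsub>M\<^esub> c = N +>\<^bsub>M\<^esub> c'"
    moreover have "c \<in> N +>\<^bsub>M\<^esub> c" unfolding cos using N(1) by (intro image_eqI[of _ _ 0]) auto
    ultimately obtain h where "h \<in> N" "c = h + c'" unfolding cos by auto
    then show "c - c' \<in> N" by simp
  next
    assume d: "c - c' \<in> N"
    have "(\<lambda>h. h + c) ` N \<subseteq> (\<lambda>h. h + c') ` N"
    proof
      fix x assume "x \<in> (\<lambda>h. h + c) ` N"
      then obtain h where h: "h \<in> N" "x = h + c" by auto
      then show "x \<in> (\<lambda>h. h + c') ` N" using pl[OF h(1) d] by (intro image_eqI[of _ _ "h + (c - c')"]) auto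
    qed
    moreover have "(\<lambda>h. h + c') ` N \<subseteq> (\<lambda>h. h + c) ` N"
    proof
      fix x assume "x \<in> (\<lambda>h. h + c') ` N"
      then obtain h where h: "h \<in> N" "x = h + c'" by auto
      then show "x \<in> (\<lambda>h. h + c) ` N" using N(2)[OF h(1) d] by (intro image_eqI[of _ _ "h - (c - c')"]) auto
    qed
    ultimately show "N +>\<^bsub>M\<^esub> c = N +>\<^bsub>M\<^esub> c'" unfolding cos by (rule equalityI)
  qed
  show "set_add M (N +>\<^bsub>M\<^esub> c) (N +>\<^bsub>M\<^esub> c') = N +>\<^bsub>M\<^esub> (c \<oplus>\<^bsub>M\<^esub> c')"
  proof
    show "set_add M (N +>\<^bsub>M\<^esub> c) (N +>\<^bsub>M\<^esub> c') \<subseteq> N +>\<^bsub>M\<^esub> (c \<oplus>\<^bsub>M\<^esub> c')"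
    proof
      fix x assume "x \<in> set_add M (N +>\<^bsub>M\<^esub> c) (N +>\<^bsub>M\<^esub> c')"
      then obtain h h' where h: "h \<in> N" "h' \<in> N" "x = (h + c) + (h' + c')"
        unfolding set_add_def' cos plus by auto
      then show "x \<in> N +>\<^bsub>M\<^esub> (c \<oplus>\<^bsub>M\<^esub> c')"
        unfolding cos plus using pl[OF h(1,2)] by (intro image_eqI[of _ _ "h + h'"]) (auto simp: algebra_simps)
    qed
    show "N +>\<^bsub>M\<^esub> (c \<oplus>\<^bsub>M\<^esub> c') \<subseteq> set_add M (N +>\<^bsub>M\<^esub> c) (N +>\<^bsub>M\<^esub> c')"
    proof
      fix x assume "x \<in> N +>\<^bsub>M\<^esub> (c \<oplus>\<^bsub>M\<^esub> c')"
      then obtain h where h: "h \<in> N" "x = h + (c + c')" unfolding cos plus by auto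
      have "x = (h + c) + (0 + c')" using h by (simp add: add.assoc)
      then show "x \<in> set_add M (N +>\<^bsub>M\<^esub> c) (N +>\<^bsub>M\<^esub> c')"
        unfolding set_add_def' cos plus using h(1) N(1) by blast
    qed
  qed
  assume rN: "\<And>h. h \<in> N \<Longrightarrow> r \<odot>\<^bsub>M\<^esub> h \<in> N" and lin: "\<And>h. h \<in> N \<Longrightarrow> r \<odot>\<^bsub>M\<^esub> (h + c) = r \<odot>\<^bsub>M\<^esub> h + r \<odot>\<^bsub>M\<^esub> c"
  have "N +>\<^bsub>M\<^esub> (r \<odot>\<^bsub>M\<^esub> (h + c)) = N +>\<^bsub>M\<^esub> (r \<odot>\<^bsub>M\<^esub> c)" if "h \<in> N" for h
    unfolding eq using lin[OF that] rN[OF that] by simp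
  then have "(\<Union>x\<in>N +>\<^bsub>M\<^esub> c. N +>\<^bsub>M\<^esub> (r \<odot>\<^bsub>M\<^esub> x)) = (\<Union>h\<in>N. N +>\<^bsub>M\<^esub> (r \<odot>\<^bsub>M\<^esub> c))"
    unfolding cos[of c] by simp
  then show "(\<Union>x\<in>N +>\<^bsub>M\<^esub> c. N +>\<^bsub>M\<^esub> (r \<odot>\<^bsub>M\<^esub> x)) = N +>\<^bsub>M\<^esub> (r \<odot>\<^bsub>M\<^esub> c)" using N(1) by auto
qed

section \<open>Rescaling the Salvetti complex\<close>

lemma carrier_regular: "carrier free_rank_one = UNIV"
  and add_regular: "add free_rank_one = (+)"
  and smult_regular: "smult free_rank_one = (*)"
  by (simp_all add: regular_module_def qlaurent_ring_def ring.defs)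

definition principal :: "qlaurent \<Rightarrow> qlaurent set" where "principal \<phi> = PIdl\<^bsub>qlaurent_ring\<^esub> \<phi>"

lemma principal_iff: "x \<in> principal \<phi> \<longleftrightarrow> \<phi> dvd x"
  by (auto simp: principal_def cgenideal_def qlaurent_ring_def dvd_def mult.commute)

definition residue_class :: "qlaurent \<Rightarrow> qlaurent \<Rightarrow> qlaurent set" where
  "residue_class \<phi> x = principal \<phi> +>\<^bsub>free_rank_one\<^esub> x"

lemma residue_class_eq: "residue_class \<phi> x = residue_class \<phi> y \<longleftrightarrow> \<phi> dvd x - y"
  unfolding residue_class_def principal_iff[symmetric]
  by (rule additive_cosets(2)[OF add_regular]) (auto simp: principal_iff)

definition residue_module :: "qlaurent \<Rightarrow> (qlaurent, qlaurent set) module" where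
  "residue_module \<phi> = quotient_module free_rank_one (principal \<phi>)"

lemma residue_module_carrier: "carrier (residue_module \<phi>) = range (residue_class \<phi>)"
  by (auto simp: residue_module_def quotient_module_def A_RCOSETS_def' carrier_regular residue_class_def)

lemma residue_module_add:
  "residue_class \<phi> x \<oplus>\<^bsub>residue_module \<phi>\<^esub> residue_class \<phi> y = residue_class \<phi> (x + y)"
proof -
  have "set_add free_rank_one (principal \<phi> +>\<^bsub>free_rank_one\<^esub> x) (principal \<phi> +>\<^bsub>free_rank_one\<^esub> y) =
      principal \<phi> +>\<^bsub>free_rank_one\<^esub> (x \<oplus>\<^bsub>free_rank_one\<^esub> y)"
    by (rule additive_cosets(3)[OF add_regular]) (auto simp: principal_iff)
  then show ?thesis by (simp add: residue_module_def quotient_module_def residue_class_def add_regular)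
qed

lemma residue_module_smult: "r \<odot>\<^bsub>residue_module \<phi>\<^esub> residue_class \<phi> x = residue_class \<phi> (r * x)"
proof -
  have "(\<Union>y\<in>principal \<phi> +>\<^bsub>free_rank_one\<^esub> x. principal \<phi> +>\<^bsub>free_rank_one\<^esub> (r \<odot>\<^bsub>free_rank_one\<^esub> y)) =
      principal \<phi> +>\<^bsub>free_rank_one\<^esub> (r \<odot>\<^bsub>free_rank_one\<^esub> x)"
    by (rule additive_cosets(4)[OF add_regular]) (auto simp: principal_iff smult_regular distrib_left)
  then show ?thesis by (simp add: residue_module_def quotient_module_def residue_class_def smult_regular)
qed

text \<open>\<open>w \<sigma>\<close> will be the Poincare polynomial of \<sigma> as a Laurent
  polynomial. By \<open>quot\<close> the Salvetti coefficient times \<open>w \<tau>\<close> is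
  \<open>w \<sigma>\<close>, so multiplication by \<open>w\<close> turns the Salvetti boundary into
  the simplicial one.\<close>

locale rescaled_salvetti =
  fixes S :: "'s::linorder set" and m :: "'s \<Rightarrow> 's \<Rightarrow> enat" and w :: "'s set \<Rightarrow> qlaurent"
  assumes finS: "finite S" and Sne: "S \<noteq> {}"
    and ft: "finite_type_subsets S m = {\<sigma>. \<sigma> \<subset> S}"
    and w_nz: "\<sigma> \<subset> S \<Longrightarrow> w \<sigma> \<noteq> 0"
    and quot: "\<sigma> \<subset> S \<Longrightarrow> \<tau> \<subset> \<sigma> \<Longrightarrow> card \<sigma> = Suc (card \<tau>) \<Longrightarrow>
      laurent_of_poly (poincare_poly S m \<sigma> div poincare_poly S m \<tau>) * w \<tau> = w \<sigma>"
begin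

abbreviation Ch :: "nat \<Rightarrow> ('s set \<Rightarrow> qlaurent) set" where "Ch k \<equiv> carrier (salvetti_chains S m k)"
abbreviation Zm :: "nat \<Rightarrow> (qlaurent, 's set \<Rightarrow> qlaurent) module" where "Zm k \<equiv> salvetti_cycles S m k"
abbreviation L :: "('s set \<Rightarrow> qlaurent) set" where "L \<equiv> weight_lattice S w"
abbreviation bdS :: "('s set \<Rightarrow> qlaurent) \<Rightarrow> 's set \<Rightarrow> qlaurent" where "bdS \<equiv> salvetti_boundary S m"

definition scale :: "('s set \<Rightarrow> qlaurent) \<Rightarrow> 's set \<Rightarrow> qlaurent" where
  "scale c = (\<lambda>\<sigma>. if \<sigma> \<subset> S then w \<sigma> * c \<sigma> else 0)"

lemma Ch_iff: "c \<in> Ch k \<longleftrightarrow> (\<forall>\<sigma>. c \<sigma> \<noteq> 0 \<longrightarrow> \<sigma> \<subset> S \<and> card \<sigma> = k)"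
  by (simp add: salvetti_chains_def ft)

lemma Ch_zero: "c \<in> Ch k \<Longrightarrow> \<not> \<sigma> \<subset> S \<Longrightarrow> c \<sigma> = 0"
  by (auto simp: Ch_iff)

lemma scale_add: "scale (\<lambda>\<sigma>. a \<sigma> + b \<sigma>) = (\<lambda>\<sigma>. scale a \<sigma> + scale b \<sigma>)"
  by (rule ext) (simp add: scale_def distrib_left)

lemma scale_mult: "scale (\<lambda>\<sigma>. r * a \<sigma>) = (\<lambda>\<sigma>. r * scale a \<sigma>)"
  by (rule ext) (simp add: scale_def mult.left_commute)

lemma scale_chains: "c \<in> Ch k \<Longrightarrow> scale c \<in> chains S k \<inter> L"
  unfolding Ch_iff chains_def weight_lattice_def scale_def by auto

lemma incidence_insert: "s \<notin> \<tau> \<Longrightarrow> incidence (insert s \<tau>) \<tau> = sgn_at s \<tau>"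
proof -
  assume s: "s \<notin> \<tau>"
  have "insert s \<tau> - \<tau> = {s}" using s by auto
  moreover have "{t \<in> insert s \<tau>. t < s} = {t \<in> \<tau>. t < s}" by auto
  ultimately show ?thesis unfolding incidence_def sgn_at_def by simp
qed

lemma scale_boundary:
  assumes t: "\<tau> \<subset> S" shows "w \<tau> * bdS c \<tau> = bd S (scale c) \<tau>"
proof -
  have ft': "finite \<tau>" using t finS finite_subset by blast
  define A where "A = {s \<in> S - \<tau>. insert s \<tau> \<subset> S}"
  have img: "{\<sigma>. \<sigma> \<in> finite_type_subsets S m \<and> \<tau> \<subset> \<sigma> \<and> card \<sigma> = Suc (card \<tau>)} = (\<lambda>s. insert s \<tau>) ` A"
  proof
    show "{\<sigma>. \<sigma> \<in> finite_type_subsets S m \<and> \<tau> \<subset> \<sigma> \<and> card \<sigma> = Suc (card \<tau>)} \<subseteq> (\<lambda>s. insert s \<tau>) ` A"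
    proof
      fix \<sigma> assume "\<sigma> \<in> {\<sigma>. \<sigma> \<in> finite_type_subsets S m \<and> \<tau> \<subset> \<sigma> \<and> card \<sigma> = Suc (card \<tau>)}"
      then have s: "\<sigma> \<subset> S" "\<tau> \<subset> \<sigma>" "card \<sigma> = Suc (card \<tau>)" by (auto simp: ft)
      have fs: "finite \<sigma>" using s(1) finS finite_subset by blast
      have "card (\<sigma> - \<tau>) = 1" using card_Diff_subset[of \<tau> \<sigma>] ft' s(2,3) by (simp add: psubset_imp_subset)
      then obtain a where a: "\<sigma> - \<tau> = {a}" by (auto simp: card_1_singleton_iff)
      then have "\<sigma> = insert a \<tau>" "a \<notin> \<tau>" using s(2) by auto
      then show "\<sigma> \<in> (\<lambda>s. insert s \<tau>) ` A" using s(1) by (auto simp: A_def)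
    qed
    show "(\<lambda>s. insert s \<tau>) ` A \<subseteq> {\<sigma>. \<sigma> \<in> finite_type_subsets S m \<and> \<tau> \<subset> \<sigma> \<and> card \<sigma> = Suc (card \<tau>)}"
      using ft' by (auto simp: A_def ft)
  qed
  have inj: "inj_on (\<lambda>s. insert s \<tau>) A" by (rule inj_onI) (auto simp: A_def)
  have "w \<tau> * bdS c \<tau> = (\<Sum>s\<in>A. w \<tau> * (c (insert s \<tau>) * (incidence (insert s \<tau>) \<tau> *
      laurent_of_poly (poincare_poly S m (insert s \<tau>) div poincare_poly S m \<tau>))))"
    unfolding salvetti_boundary_def img sum_distrib_left by (simp add: sum.reindex[OF inj])
  also have "\<dots> = (\<Sum>s\<in>A. sgn_at s \<tau> * scale c (insert s \<tau>))"
  proof (rule sum.cong[OF HOL.refl])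
    fix s assume s: "s \<in> A"
    then have st: "s \<notin> \<tau>" "insert s \<tau> \<subset> S" by (auto simp: A_def)
    have q: "laurent_of_poly (poincare_poly S m (insert s \<tau>) div poincare_poly S m \<tau>) * w \<tau> = w (insert s \<tau>)"
      by (rule quot[OF st(2)]) (use st ft' in auto)
    have "scale c (insert s \<tau>) = w (insert s \<tau>) * c (insert s \<tau>)" using st by (simp add: scale_def)
    then show "w \<tau> * (c (insert s \<tau>) * (incidence (insert s \<tau>) \<tau> *
        laurent_of_poly (poincare_poly S m (insert s \<tau>) div poincare_poly S m \<tau>))) = sgn_at s \<tau> * scale c (insert s \<tau>)"
      unfolding incidence_insert[OF st(1)] q[symmetric] by (simp add: mult_ac)
  qed
  also have "\<dots> = bd S (scale c) \<tau>"
    unfolding bd_def using finS by (intro sum.mono_neutral_left) (auto simp: A_def scale_def)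
  finally show ?thesis .
qed

lemma boundary_outside: "\<not> \<tau> \<subset> S \<Longrightarrow> bdS c \<tau> = 0"
proof -
  assume t: "\<not> \<tau> \<subset> S"
  have e: "{\<sigma>. \<sigma> \<in> finite_type_subsets S m \<and> \<tau> \<subset> \<sigma> \<and> card \<sigma> = Suc (card \<tau>)} = {}" using t by (auto simp: ft)
  show ?thesis unfolding salvetti_boundary_def e by simp
qed

lemma bd_scale_outside: "\<not> \<tau> \<subset> S \<Longrightarrow> bd S (scale c) \<tau> = 0"
  unfolding bd_def by (intro sum.neutral) (auto simp: scale_def)

lemma scale_of_boundary: "scale (bdS c) = bd S (scale c)"
proof
  fix \<tau> show "scale (bdS c) \<tau> = bd S (scale c) \<tau>"
    using scale_boundary[of \<tau> c] bd_scale_outside[of \<tau> c] by (simp add: scale_def)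
qed

lemma scale_inj: "c \<in> Ch k \<Longrightarrow> c' \<in> Ch k' \<Longrightarrow> scale c = scale c' \<Longrightarrow> c = c'"
proof
  fix \<sigma> assume c: "c \<in> Ch k" "c' \<in> Ch k'" and e: "scale c = scale c'"
  show "c \<sigma> = c' \<sigma>"
  proof (cases "\<sigma> \<subset> S")
    case True
    then show ?thesis using fun_cong[OF e, of \<sigma>] w_nz[OF True] by (simp add: scale_def)
  next
    case False then show ?thesis using Ch_zero c by metis
  qed
qed

lemma boundary_Ch: "c \<in> Ch (Suc k) \<Longrightarrow> bdS c \<in> Ch k"
proof -
  assume c: "c \<in> Ch (Suc k)"
  have "bd S (scale c) \<in> chains S k" using bd_chains[OF finS] scale_chains[OF c] by blast
  then have "scale (bdS c) \<in> chains S k" unfolding scale_of_boundary .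
  then have *: "scale (bdS c) \<sigma> \<noteq> 0 \<Longrightarrow> card \<sigma> = k" for \<sigma> by (auto simp: chains_def)
  show ?thesis
    unfolding Ch_iff
  proof (intro allI impI)
    fix \<sigma> assume n: "bdS c \<sigma> \<noteq> 0"
    then have s: "\<sigma> \<subset> S" using boundary_outside by blast
    then have "scale (bdS c) \<sigma> \<noteq> 0" using n w_nz[OF s] by (simp add: scale_def)
    then show "\<sigma> \<subset> S \<and> card \<sigma> = k" using * s by blast
  qed
qed

lemma scale_surj:
  assumes x: "x \<in> chains S k" "x \<in> L" and k: "k < card S" shows "\<exists>c\<in>Ch k. scale c = x"
proof -
  have xS: "x \<sigma> = 0" if "\<not> \<sigma> \<subset> S" for \<sigma> using chains_eq_0[OF x(1), of \<sigma>] that k by blast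
  have "\<forall>\<sigma>\<in>{\<sigma>. \<sigma> \<subset> S}. \<exists>b. x \<sigma> = w \<sigma> * b" using x(2) by (auto simp: weight_lattice_def dvd_def)
  from bchoice[OF this] obtain b where b: "\<forall>\<sigma>\<in>{\<sigma>. \<sigma> \<subset> S}. x \<sigma> = w \<sigma> * b \<sigma>" by blast
  define c where "c = (\<lambda>\<sigma>. if \<sigma> \<subset> S then b \<sigma> else 0)"
  have "scale c = x" using b xS by (auto simp: scale_def c_def fun_eq_iff)
  moreover have "c \<in> Ch k"
    unfolding Ch_iff
  proof (intro allI impI)
    fix \<sigma> assume "c \<sigma> \<noteq> 0"
    then have s: "\<sigma> \<subset> S" "b \<sigma> \<noteq> 0" by (auto simp: c_def split: if_splits)
    then have "x \<sigma> \<noteq> 0" using b w_nz by auto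
    then show "\<sigma> \<subset> S \<and> card \<sigma> = k" using s x(1) by (auto simp: chains_def)
  qed
  ultimately show ?thesis by blast
qed

lemma carrier_Zm: "c \<in> carrier (Zm k) \<longleftrightarrow> c \<in> Ch k \<and> bdS c = (\<lambda>\<tau>. 0)"
  by (simp add: salvetti_cycles_def)

lemma add_Zm: "add (Zm k) = (+)"
  by (simp add: salvetti_cycles_def salvetti_chains_def fun_eq_iff)

lemma smult_Zm: "smult (Zm k) = (\<lambda>r c \<sigma>. r * c \<sigma>)"
  by (simp add: salvetti_cycles_def salvetti_chains_def)

lemma Zm_iff: "c \<in> Ch k \<Longrightarrow> c \<in> carrier (Zm k) \<longleftrightarrow> scale c \<in> cycles S k"
proof
  assume c: "c \<in> Ch k"
  { assume "c \<in> carrier (Zm k)"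
    then have "scale (bdS c) = (\<lambda>\<tau>. 0)" by (auto simp: carrier_Zm scale_def)
    then show "scale c \<in> cycles S k" using scale_chains[OF c] by (simp add: cycles_def scale_of_boundary) }
  { assume "scale c \<in> cycles S k"
    then have z: "scale (bdS c) = (\<lambda>\<tau>. 0)" by (simp add: cycles_def scale_of_boundary)
    have "bdS c \<tau> = 0" for \<tau>
      using fun_cong[OF z, of \<tau>] w_nz[of \<tau>] boundary_outside[of \<tau> c] by (cases "\<tau> \<subset> S") (auto simp: scale_def)
    then show "c \<in> carrier (Zm k)" using c by (auto simp: carrier_Zm) }
qed

lemma scale_Zm: "c \<in> carrier (Zm k) \<Longrightarrow> scale c \<in> cycles S k \<inter> L"
  using Zm_iff[of c k] scale_chains[of c k] carrier_Zm[of c k] by blast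

lemma Ch_add: "a \<in> Ch k \<Longrightarrow> b \<in> Ch k \<Longrightarrow> (\<lambda>\<sigma>. a \<sigma> + b \<sigma>) \<in> Ch k"
  unfolding Ch_iff by (metis add.right_neutral)

lemma Ch_mult: "a \<in> Ch k \<Longrightarrow> (\<lambda>\<sigma>. r * a \<sigma>) \<in> Ch k"
  unfolding Ch_iff by auto

lemma Zm_add: "a \<in> carrier (Zm k) \<Longrightarrow> b \<in> carrier (Zm k) \<Longrightarrow> a + b \<in> carrier (Zm k)"
proof -
  assume ab: "a \<in> carrier (Zm k)" "b \<in> carrier (Zm k)"
  then have ch: "a \<in> Ch k" "b \<in> Ch k" by (auto simp: carrier_Zm)
  have "(\<lambda>\<sigma>. scale a \<sigma> + scale b \<sigma>) \<in> cycles S k" using scale_Zm[OF ab(1)] scale_Zm[OF ab(2)] cycles_add by blast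
  then show ?thesis using Zm_iff[OF Ch_add[OF ch]] by (simp add: scale_add plus_fun_def)
qed

lemma Zm_mult: "a \<in> carrier (Zm k) \<Longrightarrow> (\<lambda>\<sigma>. r * a \<sigma>) \<in> carrier (Zm k)"
proof -
  assume a: "a \<in> carrier (Zm k)"
  then have ch: "a \<in> Ch k" by (auto simp: carrier_Zm)
  have "(\<lambda>\<sigma>. r * scale a \<sigma>) \<in> cycles S k" using scale_Zm[OF a] cycles_scale by blast
  then show ?thesis using Zm_iff[OF Ch_mult[OF ch]] by (simp add: scale_mult)
qed

abbreviation B :: "nat \<Rightarrow> ('s set \<Rightarrow> qlaurent) set" where "B k \<equiv> bdS ` Ch (Suc k)"

text \<open>The bound on \<open>k\<close> excludes chains of degree \<open>card S\<close>: there the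
  simplex has the cell \<open>S\<close>, which has no counterpart in the Salvetti complex.\<close>

lemma B_iff:
  assumes c: "c \<in> Ch k" and k: "Suc k < card S"
  shows "c \<in> B k \<longleftrightarrow> (\<exists>b\<in>chains S (Suc k) \<inter> L. bd S b = scale c)"
proof
  assume "c \<in> B k"
  then obtain b where b: "b \<in> Ch (Suc k)" "c = bdS b" by blast
  then show "\<exists>b\<in>chains S (Suc k) \<inter> L. bd S b = scale c" using scale_chains[OF b(1)] scale_of_boundary by metis
next
  assume "\<exists>b\<in>chains S (Suc k) \<inter> L. bd S b = scale c"
  then obtain b where b: "b \<in> chains S (Suc k)" "b \<in> L" "bd S b = scale c" by blast
  obtain b' where b': "b' \<in> Ch (Suc k)" "scale b' = b" using scale_surj[OF b(1,2) k] by blast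
  then have "scale (bdS b') = scale c" using b(3) scale_of_boundary by simp
  then have "bdS b' = c" by (rule scale_inj[OF boundary_Ch[OF b'(1)] c])
  then show "c \<in> B k" using b'(1) by blast
qed

lemma boundary_linear: "bdS (\<lambda>\<sigma>. a \<sigma> - b \<sigma>) = bdS a - bdS b" "bdS (\<lambda>\<sigma>. r * a \<sigma>) = (\<lambda>\<sigma>. r * bdS a \<sigma>)"
  by (rule ext, simp add: salvetti_boundary_def sum_subtractf left_diff_distrib)
    (rule ext, simp add: salvetti_boundary_def sum_distrib_left mult.assoc)

lemma Ch_diff: "a \<in> Ch k \<Longrightarrow> b \<in> Ch k \<Longrightarrow> (\<lambda>\<sigma>. a \<sigma> - b \<sigma>) \<in> Ch k"
  unfolding Ch_iff by (metis diff_zero)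

lemma B_zero: "0 \<in> B k"
proof (rule image_eqI)
  show "(\<lambda>\<sigma>. 0) \<in> Ch (Suc k)" by (simp add: Ch_iff)
  show "0 = bdS (\<lambda>\<sigma>. 0)" by (rule ext) (simp add: salvetti_boundary_def)
qed

lemma B_diff:
  assumes "x \<in> B k" "y \<in> B k" shows "x - y \<in> B k"
proof -
  obtain a where a: "x = bdS a" "a \<in> Ch (Suc k)" using assms(1) by (rule imageE)
  obtain b where b: "y = bdS b" "b \<in> Ch (Suc k)" using assms(2) by (rule imageE)
  show ?thesis unfolding a(1) b(1) boundary_linear(1)[symmetric] by (rule imageI[OF Ch_diff[OF a(2) b(2)]])
qed

lemma B_mult:
  assumes "x \<in> B k" shows "(\<lambda>\<sigma>. r * x \<sigma>) \<in> B k"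
proof -
  obtain a where a: "x = bdS a" "a \<in> Ch (Suc k)" using assms(1) by (rule imageE)
  show ?thesis unfolding a(1) boundary_linear(2)[symmetric] by (rule imageI[OF Ch_mult[OF a(2)]])
qed

lemma quotient_iso:
  fixes F :: "('s set \<Rightarrow> qlaurent) \<Rightarrow> 'n"
  assumes eq: "\<And>c c'. c \<in> carrier (Zm k) \<Longrightarrow> c' \<in> carrier (Zm k) \<Longrightarrow> F c = F c' \<longleftrightarrow> c - c' \<in> B k"
    and surj: "F ` carrier (Zm k) = carrier M'"
    and hom: "\<And>c c'. c \<in> carrier (Zm k) \<Longrightarrow> c' \<in> carrier (Zm k) \<Longrightarrow> F (c + c') = F c \<oplus>\<^bsub>M'\<^esub> F c'"
      "\<And>r c. c \<in> carrier (Zm k) \<Longrightarrow> F (\<lambda>\<sigma>. r * c \<sigma>) = r \<odot>\<^bsub>M'\<^esub> F c"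
  shows "salvetti_homology S m k \<cong>\<^sub>R M'"
  unfolding salvetti_homology_def
proof (rule module_iso_quotient[where F = F])
  note cos = additive_cosets[OF add_Zm[of k] B_zero[of k] B_diff[of _ k]]
  fix c c' assume c: "c \<in> carrier (Zm k)" and c': "c' \<in> carrier (Zm k)"
  show "F c = F c' \<longleftrightarrow> B k +>\<^bsub>Zm k\<^esub> c = B k +>\<^bsub>Zm k\<^esub> c'" using eq[OF c c'] cos(2) by simp
  show "F (c \<oplus>\<^bsub>Zm k\<^esub> c') = F c \<oplus>\<^bsub>M'\<^esub> F c'" using hom(1)[OF c c'] by (simp add: add_Zm)
  show "c \<oplus>\<^bsub>Zm k\<^esub> c' \<in> carrier (Zm k)" using Zm_add[OF c c'] by (simp add: add_Zm)
  show "set_add (Zm k) (B k +>\<^bsub>Zm k\<^esub> c) (B k +>\<^bsub>Zm k\<^esub> c') = B k +>\<^bsub>Zm k\<^esub> (c \<oplus>\<^bsub>Zm k\<^esub> c')" by (rule cos(3))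
next
  note cos = additive_cosets[OF add_Zm[of k] B_zero[of k] B_diff[of _ k]]
  fix r c assume c: "c \<in> carrier (Zm k)"
  show "F (r \<odot>\<^bsub>Zm k\<^esub> c) = r \<odot>\<^bsub>M'\<^esub> F c" using hom(2)[OF c] by (simp add: smult_Zm)
  show "r \<odot>\<^bsub>Zm k\<^esub> c \<in> carrier (Zm k)" using Zm_mult[OF c] by (simp add: smult_Zm)
  show "(\<Union>x\<in>B k +>\<^bsub>Zm k\<^esub> c. B k +>\<^bsub>Zm k\<^esub> (r \<odot>\<^bsub>Zm k\<^esub> x)) = B k +>\<^bsub>Zm k\<^esub> (r \<odot>\<^bsub>Zm k\<^esub> c)"
  proof (rule cos(4))
    fix h assume "h \<in> B k"
    then show "r \<odot>\<^bsub>Zm k\<^esub> h \<in> B k" unfolding smult_Zm by (rule B_mult)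
    show "r \<odot>\<^bsub>Zm k\<^esub> (h + c) = r \<odot>\<^bsub>Zm k\<^esub> h + r \<odot>\<^bsub>Zm k\<^esub> c" by (simp add: smult_Zm plus_fun_def distrib_left)
  qed
qed (rule surj)

theorem homology_iso_sum:
  assumes k: "Suc k < card S" and pres: "presents S k L ds"
  shows "salvetti_homology S m k \<cong>\<^sub>R direct_sum_module (map residue_module ds)"
proof -
  from pres obtain \<Psi> where
    P: "\<forall>i<length ds. \<forall>x\<in>cycles S k \<inter> L. \<forall>y\<in>cycles S k \<inter> L. \<Psi> i (\<lambda>\<sigma>. x \<sigma> + y \<sigma>) = \<Psi> i x + \<Psi> i y"
      "\<forall>i<length ds. \<forall>r. \<forall>x\<in>cycles S k \<inter> L. \<Psi> i (\<lambda>\<sigma>. r * x \<sigma>) = r * \<Psi> i x"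
      "\<forall>x\<in>cycles S k \<inter> L. (\<forall>i<length ds. ds ! i dvd \<Psi> i x) \<longleftrightarrow> (\<exists>c\<in>chains S (Suc k) \<inter> L. bd S c = x)"
      "\<forall>y. \<exists>x\<in>cycles S k \<inter> L. \<forall>i<length ds. ds ! i dvd \<Psi> i x - y i"
    unfolding presents_def by (elim exE conjE)
  define F where "F = (\<lambda>c. \<lambda>i\<in>{..<length ds}. residue_class (ds ! i) (\<Psi> i (scale c)))"
  have Padd: "\<Psi> i (scale (a + b)) = \<Psi> i (scale a) + \<Psi> i (scale b)"
    if "i < length ds" "a \<in> carrier (Zm k)" "b \<in> carrier (Zm k)" for i a b
    using P(1)[rule_format, OF that(1) scale_Zm[OF that(2)] scale_Zm[OF that(3)]] by (simp add: plus_fun_def scale_add)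
  have Pmult: "\<Psi> i (scale (\<lambda>\<sigma>. r * a \<sigma>)) = r * \<Psi> i (scale a)" if "i < length ds" "a \<in> carrier (Zm k)" for i a r
    using P(2)[rule_format, OF that(1) scale_Zm[OF that(2)], of r] by (simp add: scale_mult)
  show ?thesis
  proof (rule quotient_iso[where F = F])
    fix c c' assume c: "c \<in> carrier (Zm k)" and c': "c' \<in> carrier (Zm k)"
    have neg: "(\<lambda>\<sigma>. (-1) * c' \<sigma>) \<in> carrier (Zm k)" by (rule Zm_mult[OF c'])
    have dif: "c - c' = c + (\<lambda>\<sigma>. (-1) * c' \<sigma>)" by (rule ext) simp
    have dZ: "c - c' \<in> carrier (Zm k)" unfolding dif by (rule Zm_add[OF c neg])
    have dch: "c - c' \<in> Ch k" using dZ by (simp add: carrier_Zm)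
    have Pd: "\<Psi> i (scale (c - c')) = \<Psi> i (scale c) - \<Psi> i (scale c')" if "i < length ds" for i
      unfolding dif Padd[OF that c neg] Pmult[OF that c'] by simp
    have "F c = F c' \<longleftrightarrow> (\<forall>i<length ds. residue_class (ds ! i) (\<Psi> i (scale c)) = residue_class (ds ! i) (\<Psi> i (scale c')))"
    proof
      assume e: "F c = F c'"
      show "\<forall>i<length ds. residue_class (ds ! i) (\<Psi> i (scale c)) = residue_class (ds ! i) (\<Psi> i (scale c'))"
      proof (intro allI impI)
        fix i assume "i < length ds"
        then show "residue_class (ds ! i) (\<Psi> i (scale c)) = residue_class (ds ! i) (\<Psi> i (scale c'))"
          using fun_cong[OF e, of i] by (simp add: F_def)
      qed
    next
      assume a: "\<forall>i<length ds. residue_class (ds ! i) (\<Psi> i (scale c)) = residue_class (ds ! i) (\<Psi> i (scale c'))"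
      show "F c = F c'" unfolding F_def by (rule restrict_ext) (use a in simp)
    qed
    also have "\<dots> \<longleftrightarrow> (\<forall>i<length ds. ds ! i dvd \<Psi> i (scale (c - c')))" by (simp add: residue_class_eq Pd)
    also have "\<dots> \<longleftrightarrow> (\<exists>b\<in>chains S (Suc k) \<inter> L. bd S b = scale (c - c'))" using P(3) scale_Zm[OF dZ] by blast
    also have "\<dots> \<longleftrightarrow> c - c' \<in> B k" by (rule B_iff[OF dch k, symmetric])
    finally show "F c = F c' \<longleftrightarrow> c - c' \<in> B k" .
    show "F (c + c') = F c \<oplus>\<^bsub>direct_sum_module (map residue_module ds)\<^esub> F c'"
      by (rule ext) (simp add: F_def direct_sum_module_def Padd c c' residue_module_add)
  next
    fix r c assume c: "c \<in> carrier (Zm k)"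
    show "F (\<lambda>\<sigma>. r * c \<sigma>) = r \<odot>\<^bsub>direct_sum_module (map residue_module ds)\<^esub> F c"
      by (rule ext) (simp add: F_def direct_sum_module_def Pmult c residue_module_smult)
  next
    show "F ` carrier (Zm k) = carrier (direct_sum_module (map residue_module ds))"
    proof
      show "F ` carrier (Zm k) \<subseteq> carrier (direct_sum_module (map residue_module ds))"
        by (auto simp: F_def direct_sum_module_def residue_module_carrier)
      show "carrier (direct_sum_module (map residue_module ds)) \<subseteq> F ` carrier (Zm k)"
      proof
        fix g assume "g \<in> carrier (direct_sum_module (map residue_module ds))"
        then have g: "g \<in> (\<Pi>\<^sub>E i\<in>{..<length ds}. carrier (map residue_module ds ! i))" by (simp add: direct_sum_module_def)
        have "\<forall>i\<in>{..<length ds}. \<exists>y. g i = residue_class (ds ! i) y"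
        proof
          fix i assume i: "i \<in> {..<length ds}"
          then have "g i \<in> carrier (residue_module (ds ! i))" using PiE_mem[OF g i] by simp
          then show "\<exists>y. g i = residue_class (ds ! i) y" by (auto simp: residue_module_carrier)
        qed
        from bchoice[OF this] obtain y where y: "\<forall>i\<in>{..<length ds}. g i = residue_class (ds ! i) (y i)" by blast
        obtain x where x: "x \<in> cycles S k" "x \<in> L" "\<forall>i<length ds. ds ! i dvd \<Psi> i x - y i" using P(4) by blast
        obtain c where c: "c \<in> Ch k" "scale c = x"
          using scale_surj[OF cycles_chains[OF x(1)] x(2)] k by auto
        have "c \<in> carrier (Zm k)" using Zm_iff[OF c(1)] c(2) x(1) by simp
        moreover have "g = F c"
        proof
          fix i show "g i = F c i"
          proof (cases "i < length ds")
            case True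
            then have "residue_class (ds ! i) (\<Psi> i x) = residue_class (ds ! i) (y i)" using x(3) residue_class_eq by simp
            then show ?thesis using y c(2) True by (simp add: F_def)
          next
            case False then show ?thesis using PiE_arb[OF g, of i] by (simp add: F_def)
          qed
        qed
        ultimately show "g \<in> F ` carrier (Zm k)" by blast
      qed
    qed
  qed
qed

text \<open>In degree \<open>Suc k\<close> there are no Salvetti chains, so homology is the module
  of cycles. In the simplex these are the boundaries of \<open>r\<close> times the top cell; such a
  boundary lies in the lattice iff every \<open>w (S - {s})\<close> divides \<open>r\<close>, that
  is iff \<Lambda> does. Dividing \<open>r\<close> by \<Lambda> gives the isomorphism.\<close>

theorem homology_iso_top:
  assumes k: "card S = Suc k" and lcm: "\<Lambda> \<noteq> 0" "\<And>s. s \<in> S \<Longrightarrow> w (S - {s}) dvd \<Lambda>"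
    "\<And>r. (\<And>s. s \<in> S \<Longrightarrow> w (S - {s}) dvd r) \<Longrightarrow> \<Lambda> dvd r"
  shows "salvetti_homology S m k \<cong>\<^sub>R free_rank_one"
proof -
  have ChS: "Ch (Suc k) = {\<lambda>\<sigma>. 0}"
  proof -
    have "c = (\<lambda>\<sigma>. 0)" if "c \<in> Ch (Suc k)" for c
    proof
      fix \<sigma> show "c \<sigma> = 0"
      proof (rule ccontr)
        assume "c \<sigma> \<noteq> 0"
        then have s: "\<sigma> \<subset> S" "card \<sigma> = card S" using that k unfolding Ch_iff by simp_all
        from psubset_card_mono[OF finS s(1)] s(2) show False by simp
      qed
    qed
    moreover have "(\<lambda>\<sigma>. 0) \<in> Ch (Suc k)" by (simp add: Ch_iff)
    ultimately show ?thesis by blast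
  qed
  have "bdS (\<lambda>\<sigma>. 0) = 0" by (rule ext) (simp add: salvetti_boundary_def)
  then have B0: "B k = {0}" unfolding ChS by simp
  define u where "u = (\<lambda>r \<sigma>. if \<sigma> = S then r else (0 :: qlaurent))"
  have uch: "u r \<in> chains S (Suc k)" for r using k by (auto simp: u_def chains_def)
  have bdu: "bd S (u r) (S - {s}) = sgn_at s (S - {s}) * r" if s: "s \<in> S" for s r
  proof -
    have "S - (S - {s}) = {s}" "insert s (S - {s}) = S" using s by auto
    then show ?thesis unfolding bd_def by (simp add: u_def)
  qed
  have bdu0: "bd S (u r) \<tau> = 0" if "\<not> (\<exists>s\<in>S. \<tau> = S - {s})" for r \<tau>
    unfolding bd_def
  proof (rule sum.neutral, rule ballI)
    fix s assume s: "s \<in> S - \<tau>"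
    have "insert s \<tau> \<noteq> S" using that s by auto
    then show "sgn_at s \<tau> * u r (insert s \<tau>) = 0" by (simp add: u_def)
  qed
  have sgn_dvd: "a dvd sgn_at s \<tau> * b \<longleftrightarrow> a dvd b" for a b :: qlaurent and s \<tau>
    using sgn_at_cases[where 'r = qlaurent and 'q = qlaurent, of s \<tau>] by auto
  obtain s0 where s0: "s0 \<in> S" using Sne by blast
  \<comment> \<open>Any facet determines the multiple of the top cell; the sign is its own
    inverse.\<close>
  define coord where "coord = (\<lambda>x. sgn_at s0 (S - {s0}) * x (S - {s0}) :: qlaurent)"
  have cu: "coord (bd S (u r)) = r" for r
    unfolding coord_def bdu[OF s0] by (simp flip: mult.assoc)
  have form: "x = bd S (u (coord x))" if x: "x \<in> cycles S k" for x
  proof -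
    obtain v where v: "v \<in> chains S (Suc k)" "bd S v = x" using cycle_is_bd[OF finS Sne x] by blast
    have "v = u (v S)"
    proof
      fix \<sigma> show "v \<sigma> = u (v S) \<sigma>"
        using chains_eq_0[OF v(1), of \<sigma>] card_subset_eq[OF finS, of \<sigma>] k by (cases "\<sigma> = S") (auto simp: u_def)
    qed
    then have "x = bd S (u (v S))" using v(2) by simp
    then show ?thesis using cu[of "v S"] by simp
  qed
  have inL: "bd S (u r) \<in> L \<longleftrightarrow> \<Lambda> dvd r" for r
  proof
    assume "bd S (u r) \<in> L"
    then have "w (S - {s}) dvd r" if "s \<in> S" for s
      using bdu[OF that, of r] sgn_dvd[of "w (S - {s})" s "S - {s}" r] that by (auto simp: weight_lattice_def)
    then show "\<Lambda> dvd r" by (rule lcm(3))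
  next
    assume r: "\<Lambda> dvd r"
    show "bd S (u r) \<in> L"
      unfolding weight_lattice_def
    proof (intro CollectI allI impI)
      fix \<sigma> assume "\<sigma> \<subset> S"
      show "w \<sigma> dvd bd S (u r) \<sigma>"
      proof (cases "\<exists>s\<in>S. \<sigma> = S - {s}")
        case True
        then obtain s where s: "s \<in> S" "\<sigma> = S - {s}" by blast
        have "w \<sigma> dvd r" using lcm(2)[OF s(1)] r s(2) dvd_trans by blast
        then show ?thesis using bdu[OF s(1)] s(2) sgn_dvd by simp
      next
        case False then show ?thesis using bdu0 by simp
      qed
    qed
  qed
  have recover: "bd S (u (coord (scale c))) = scale c" if c: "c \<in> carrier (Zm k)" for c
    by (rule form[symmetric]) (use scale_Zm[OF c] in blast)
  define F where "F = (\<lambda>c. THE b. coord (scale c) = \<Lambda> * b)"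
  have F: "coord (scale c) = \<Lambda> * F c" if c: "c \<in> carrier (Zm k)" for c
  proof -
    have "bd S (u (coord (scale c))) \<in> L" unfolding recover[OF c] using scale_Zm[OF c] by blast
    then have "\<Lambda> dvd coord (scale c)" unfolding inL .
    then obtain b where b: "coord (scale c) = \<Lambda> * b" by (rule dvdE)
    have "F c = b" unfolding F_def by (rule the_equality) (use b lcm(1) in auto)
    then show ?thesis using b by simp
  qed
  have canc: "a = b" if "\<Lambda> * a = \<Lambda> * b" for a b using that lcm(1) by simp
  show ?thesis
  proof (rule quotient_iso[where F = F])
    fix c c' assume c: "c \<in> carrier (Zm k)" and c': "c' \<in> carrier (Zm k)"
    have ch: "c \<in> Ch k" "c' \<in> Ch k" using c c' by (auto simp: carrier_Zm)
    show "F c = F c' \<longleftrightarrow> c - c' \<in> B k"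
    proof
      assume "F c = F c'"
      then have "coord (scale c) = coord (scale c')" using F[OF c] F[OF c'] by simp
      then have "bd S (u (coord (scale c))) = bd S (u (coord (scale c')))" by simp
      then have "scale c = scale c'" unfolding recover[OF c] recover[OF c'] .
      then have "c = c'" by (rule scale_inj[OF ch])
      then show "c - c' \<in> B k" unfolding B0 by simp
    next
      assume "c - c' \<in> B k" then show "F c = F c'" unfolding B0 by simp
    qed
    show "F (c + c') = F c \<oplus>\<^bsub>free_rank_one\<^esub> F c'"
      unfolding add_regular
    proof (rule canc)
      have e: "scale (c + c') = (\<lambda>\<sigma>. scale c \<sigma> + scale c' \<sigma>)" by (simp add: plus_fun_def scale_add)
      have "coord (scale (c + c')) = coord (scale c) + coord (scale c')" unfolding e coord_def by (rule distrib_left)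
      then show "\<Lambda> * F (c + c') = \<Lambda> * (F c + F c')"
        unfolding F[OF Zm_add[OF c c']] F[OF c] F[OF c'] distrib_left .
    qed
  next
    fix r c assume c: "c \<in> carrier (Zm k)"
    show "F (\<lambda>\<sigma>. r * c \<sigma>) = r \<odot>\<^bsub>free_rank_one\<^esub> F c"
      unfolding smult_regular
    proof (rule canc)
      have "coord (scale (\<lambda>\<sigma>. r * c \<sigma>)) = r * coord (scale c)"
        unfolding scale_mult coord_def by (rule mult.left_commute)
      then show "\<Lambda> * F (\<lambda>\<sigma>. r * c \<sigma>) = \<Lambda> * (r * F c)"
        unfolding F[OF Zm_mult[OF c, of r]] F[OF c] by (simp only: mult.left_commute)
    qed
  next
    show "F ` carrier (Zm k) = carrier free_rank_one"
    proof -
      have "b \<in> F ` carrier (Zm k)" for b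
      proof -
        have z: "bd S (u (\<Lambda> * b)) \<in> cycles S k" by (rule bd_in_cycles[OF finS uch])
        have l: "bd S (u (\<Lambda> * b)) \<in> L" using inL by simp
        obtain c where c: "c \<in> Ch k" "scale c = bd S (u (\<Lambda> * b))"
          using scale_surj[OF cycles_chains[OF z] l] k by auto
        have cz: "c \<in> carrier (Zm k)" using Zm_iff[OF c(1)] c(2) z by simp
        have "\<Lambda> * F c = \<Lambda> * b" using F[OF cz, symmetric] unfolding c(2) cu .
        then have "F c = b" by (rule canc)
        then show ?thesis using cz by blast
      qed
      then show ?thesis by (auto simp: carrier_regular)
    qed
  qed
qed

end

section \<open>Cyclotomic polynomials\<close>

lemma map_poly_of_rat_mult: "map_poly (of_rat :: rat \<Rightarrow> complex) (p * q) = map_poly of_rat p * map_poly of_rat q"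
  by (rule poly_eqI) (simp add: coeff_map_poly coeff_mult of_rat_sum of_rat_mult)

lemma map_poly_of_rat_add: "map_poly (of_rat :: rat \<Rightarrow> complex) (p + q) = map_poly of_rat p + map_poly of_rat q"
  by (rule poly_eqI) (simp add: coeff_map_poly of_rat_add)

lemma map_poly_of_rat_inj: "map_poly (of_rat :: rat \<Rightarrow> complex) p = map_poly of_rat q \<Longrightarrow> p = q"
proof (rule poly_eqI)
  fix i assume "map_poly (of_rat :: rat \<Rightarrow> complex) p = map_poly of_rat q"
  then have "coeff (map_poly (of_rat :: rat \<Rightarrow> complex) p) i = coeff (map_poly of_rat q) i" by simp
  then show "coeff p i = coeff q i" by (simp add: coeff_map_poly)
qed

lemma degree_map_poly_of_rat: "degree (map_poly (of_rat :: rat \<Rightarrow> complex) p) = degree p"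
  by (rule degree_map_poly) simp

lemma map_poly_of_rat_prod: "map_poly (of_rat :: rat \<Rightarrow> complex) (prod f A) = (\<Prod>x\<in>A. map_poly of_rat (f x))"
  by (induction A rule: infinite_finite_induct) (auto simp: map_poly_of_rat_mult map_poly_1)

definition primitive_roots :: "nat \<Rightarrow> complex set" where
  "primitive_roots d = {\<zeta>. \<zeta> ^ d = 1 \<and> (\<forall>k. 0 < k \<and> k < d \<longrightarrow> \<zeta> ^ k \<noteq> 1)}"

definition cyclo_complex :: "nat \<Rightarrow> complex poly" where
  "cyclo_complex d = (\<Prod>\<zeta>\<in>primitive_roots d. [:- \<zeta>, 1:])"

lemma primitive_roots_dvd:
  assumes z: "\<zeta> \<in> primitive_roots d" and d: "d > 0" shows "\<zeta> ^ n = 1 \<longleftrightarrow> d dvd n"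
proof -
  have zd: "\<zeta> ^ d = 1" using z unfolding primitive_roots_def by blast
  have "\<zeta> ^ n = \<zeta> ^ (d * (n div d) + n mod d)" by (simp only: mult_div_mod_eq)
  also have "\<dots> = (\<zeta> ^ d) ^ (n div d) * \<zeta> ^ (n mod d)" by (simp only: power_add power_mult)
  also have "\<dots> = \<zeta> ^ (n mod d)" by (simp only: zd power_one mult_1_left)
  finally have e: "\<zeta> ^ n = \<zeta> ^ (n mod d)" .
  show ?thesis
  proof (cases "n mod d = 0")
    case True
    have "\<zeta> ^ n = 1" unfolding e True by (rule power_0)
    moreover have "d dvd n" using True by (simp add: dvd_eq_mod_eq_0)
    ultimately show ?thesis by blast
  next
    case False
    have "n mod d < d" using d by simp
    then have "\<zeta> ^ (n mod d) \<noteq> 1" using z False unfolding primitive_roots_def by blast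
    then have "\<zeta> ^ n \<noteq> 1" unfolding e .
    moreover have "\<not> d dvd n" using False by (simp add: dvd_eq_mod_eq_0)
    ultimately show ?thesis by blast
  qed
qed

lemma primitive_roots_disjoint:
  assumes "d > 0" "d' > 0" "d \<noteq> d'" shows "primitive_roots d \<inter> primitive_roots d' = {}"
proof (rule equals0I, elim IntE)
  fix \<zeta> assume z: "\<zeta> \<in> primitive_roots d" "\<zeta> \<in> primitive_roots d'"
  have "\<zeta> ^ d = 1" using z(1) by (simp add: primitive_roots_def)
  then have "d' dvd d" unfolding primitive_roots_dvd[OF z(2) assms(2)] .
  moreover have "\<zeta> ^ d' = 1" using z(2) by (simp add: primitive_roots_def)
  then have "d dvd d'" unfolding primitive_roots_dvd[OF z(1) assms(1)] .
  ultimately show False using assms(3) dvd_antisym by simp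
qed

lemma roots_unity_partition:
  assumes "n > 0" shows "{\<zeta> :: complex. \<zeta> ^ n = 1} = (\<Union>d\<in>{d. d dvd n}. primitive_roots d)"
proof
  show "{\<zeta> :: complex. \<zeta> ^ n = 1} \<subseteq> (\<Union>d\<in>{d. d dvd n}. primitive_roots d)"
  proof
    fix \<zeta> :: complex assume "\<zeta> \<in> {\<zeta>. \<zeta> ^ n = 1}"
    then have ex: "0 < n \<and> \<zeta> ^ n = 1" using assms by simp
    define d where "d = (LEAST d. 0 < d \<and> \<zeta> ^ d = 1)"
    have d: "0 < d \<and> \<zeta> ^ d = 1" unfolding d_def using ex by (rule LeastI[where P = "\<lambda>d. 0 < d \<and> \<zeta> ^ d = 1"])
    have "\<zeta> ^ k \<noteq> 1" if "0 < k" "k < d" for k using not_less_Least[of k "\<lambda>d. 0 < d \<and> \<zeta> ^ d = 1"] that unfolding d_def by blast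
    then have p: "\<zeta> \<in> primitive_roots d" using d by (simp add: primitive_roots_def)
    then have "d dvd n" using primitive_roots_dvd[OF p, of n] d ex by simp
    then show "\<zeta> \<in> (\<Union>d\<in>{d. d dvd n}. primitive_roots d)" using p by blast
  qed
  show "(\<Union>d\<in>{d. d dvd n}. primitive_roots d) \<subseteq> {\<zeta>. \<zeta> ^ n = 1}"
  proof
    fix \<zeta> assume "\<zeta> \<in> (\<Union>d\<in>{d. d dvd n}. primitive_roots d)"
    then obtain d where d: "d dvd n" "\<zeta> \<in> primitive_roots d" by blast
    then have "d > 0" using assms by (cases "d = 0") auto
    then show "\<zeta> \<in> {\<zeta>. \<zeta> ^ n = 1}" using primitive_roots_dvd[OF d(2)] d(1) by simp
  qed
qed

lemma finite_primitive_roots: assumes "d > 0" shows "finite (primitive_roots d)"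
proof (rule finite_subset)
  show "primitive_roots d \<subseteq> {\<zeta>. \<zeta> ^ d = 1}" unfolding primitive_roots_def by blast
  show "finite {\<zeta> :: complex. \<zeta> ^ d = 1}" by (rule finite_roots_unity) (use assms in simp)
qed

lemma degree_prod_linear: "finite A \<Longrightarrow> degree (\<Prod>\<zeta>\<in>A. [:- \<zeta>, 1 :: complex:]) = card A \<and> lead_coeff (\<Prod>\<zeta>\<in>A. [:- \<zeta>, 1 :: complex:]) = 1"
proof (induction A rule: finite_induct)
  case (insert a A)
  have "(\<Prod>\<zeta>\<in>A. [:- \<zeta>, 1 :: complex:]) \<noteq> 0" using insert.IH by auto
  then have d: "degree ([:- a, 1:] * (\<Prod>\<zeta>\<in>A. [:- \<zeta>, 1 :: complex:])) = Suc (card A)"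
    using insert.IH by (subst degree_mult_eq) auto
  have l: "lead_coeff ([:- a, 1:] * (\<Prod>\<zeta>\<in>A. [:- \<zeta>, 1 :: complex:])) = 1"
  proof -
    have "lead_coeff [:- a, 1:] = 1" by simp
    moreover have "lead_coeff (\<Prod>\<zeta>\<in>A. [:- \<zeta>, 1 :: complex:]) = 1" using insert.IH by (rule conjunct2)
    ultimately show ?thesis unfolding lead_coeff_mult by (simp only: mult_1_left)
  qed
  have i: "(\<Prod>\<zeta>\<in>insert a A. [:- \<zeta>, 1 :: complex:]) = [:- a, 1:] * (\<Prod>\<zeta>\<in>A. [:- \<zeta>, 1:])"
    using insert.hyps by (rule prod.insert)
  show ?case unfolding i card_insert_disjoint[OF insert.hyps] using d l by (rule conjI)
qed simp

text \<open>Both sides are monic of degree n, so their difference has smaller degree, but it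
  vanishes at all n roots of unity.\<close>

lemma prod_roots_unity:
  assumes n: "n > 0" shows "(\<Prod>\<zeta> | \<zeta> ^ n = 1. [:- \<zeta>, 1:]) = (monom 1 n - 1 :: complex poly)"
proof -
  let ?A = "{\<zeta> :: complex. \<zeta> ^ n = 1}" and ?p = "(\<Prod>\<zeta> | \<zeta> ^ n = 1. [:- \<zeta>, 1 :: complex:])"
  have fA: "finite ?A" by (rule finite_roots_unity) (use n in simp)
  have cA: "card ?A = n" by (rule card_roots_unity_eq[OF n])
  have dp: "degree ?p = n" using degree_prod_linear[OF fA] cA by simp
  have "lead_coeff ?p = 1" using degree_prod_linear[OF fA] by blast
  then have lp: "coeff ?p n = 1" unfolding dp .
  have dm: "degree (monom 1 n - 1 :: complex poly) = n"
  proof -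
    have "degree (monom 1 n + (- 1) :: complex poly) = degree (monom 1 n :: complex poly)"
      by (rule degree_add_eq_left) (use n in \<open>simp add: degree_monom_eq\<close>)
    then show ?thesis by (simp add: degree_monom_eq)
  qed
  let ?r = "?p - (monom 1 n - 1)"
  have "?r = 0"
  proof (rule ccontr)
    assume r: "?r \<noteq> 0"
    have "coeff ?r n = 0" using lp n by simp
    moreover have "degree ?r \<le> n" using degree_diff_le[of ?p n "monom 1 n - 1"] dp dm by simp
    ultimately have lt: "degree ?r < n" using r by (metis leading_coeff_0_iff order_le_less)
    have "?A \<subseteq> {x. poly ?r x = 0}"
      using fA by (auto simp: poly_prod poly_monom)
    then have "n \<le> card {x. poly ?r x = 0}" using card_mono[OF poly_roots_finite[OF r]] cA by metis
    also have "\<dots> \<le> degree ?r" using r by (rule card_poly_roots_bound)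
    finally show False using lt by simp
  qed
  then show ?thesis by simp
qed

lemma prod_cyclo_complex:
  assumes n: "n > 0" shows "(\<Prod>d\<in>{d. d dvd n}. cyclo_complex d) = monom 1 n - 1"
proof -
  have fin: "finite {d. d dvd n}" using n by simp
  have pos: "d > 0" if "d dvd n" for d using that n by (cases "d = 0") auto
  have "(\<Prod>\<zeta>\<in>(\<Union>d\<in>{d. d dvd n}. primitive_roots d). [:- \<zeta>, 1:]) = (\<Prod>d\<in>{d. d dvd n}. cyclo_complex d)"
    unfolding cyclo_complex_def
    using fin finite_primitive_roots primitive_roots_disjoint pos by (intro prod.UNION_disjoint) auto
  then show ?thesis using prod_roots_unity[OF n] roots_unity_partition[OF n] by simp
qed

text \<open>By induction the product of the other cyclotomic factors of q^n - 1 is rational.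
  Division with remainder over the rationals and the complex factorisation must agree, since a
  difference of quotients would force a remainder of too large a degree.\<close>

lemma cyclo_rational: "d > 0 \<Longrightarrow> \<exists>p. map_poly (of_rat :: rat \<Rightarrow> complex) p = cyclo_complex d"
proof (induction d rule: less_induct)
  case (less n)
  have fin: "finite {d. d dvd n}" using less.prems by simp
  have pos: "d > 0" "d < n" if "d dvd n" "d \<noteq> n" for d
    using that less.prems dvd_imp_le[of d n] by (cases "d = 0"; auto)+
  have "\<forall>d\<in>{d. d dvd n} - {n}. \<exists>p. map_poly of_rat p = cyclo_complex d" using less.IH pos by blast
  from bchoice[OF this] obtain q where q: "\<forall>d\<in>{d. d dvd n} - {n}. map_poly of_rat (q d) = cyclo_complex d" by blast
  define Q where "Q = (\<Prod>d\<in>{d. d dvd n} - {n}. q d)"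
  let ?m = "map_poly (of_rat :: rat \<Rightarrow> complex)"
  have Q: "?m Q = (\<Prod>d\<in>{d. d dvd n} - {n}. cyclo_complex d)" unfolding Q_def map_poly_of_rat_prod using q by simp
  define X where "X = (monom 1 n - 1 :: rat poly)"
  have X: "?m X = monom 1 n - 1"
    by (rule poly_eqI) (simp add: X_def coeff_map_poly of_rat_diff)
  have e: "?m X = cyclo_complex n * ?m Q"
    using prod_cyclo_complex[OF less.prems] prod.remove[OF fin, of n cyclo_complex] X Q by simp
  have Q0: "Q \<noteq> 0"
  proof
    assume "Q = 0"
    then have "monom 1 n - 1 = (0 :: complex poly)" using e X by simp
    then have "coeff (monom 1 n - 1 :: complex poly) 0 = 0" by simp
    then show False using less.prems by simp
  qed
  have mQ0: "?m Q \<noteq> 0" using Q0 map_poly_of_rat_inj[of Q 0] by auto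
  have "X = X div Q * Q + X mod Q" by simp
  then have "?m X = ?m (X div Q) * ?m Q + ?m (X mod Q)" by (metis map_poly_of_rat_add map_poly_of_rat_mult)
  then have d: "(cyclo_complex n - ?m (X div Q)) * ?m Q = ?m (X mod Q)" using e by (simp add: algebra_simps)
  have "cyclo_complex n - ?m (X div Q) = 0"
  proof (rule ccontr)
    assume nz: "cyclo_complex n - ?m (X div Q) \<noteq> 0"
    then have "?m (X mod Q) \<noteq> 0" using d mQ0 by (metis mult_eq_0_iff)
    then have "X mod Q \<noteq> 0" by auto
    then have "degree (X mod Q) < degree Q" using degree_mod_less[OF Q0, of X] by simp
    moreover have "degree (?m Q) \<le> degree (?m (X mod Q))"
      unfolding d[symmetric] using degree_mult_eq[OF nz mQ0] by simp
    ultimately show False by (simp add: degree_map_poly_of_rat)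
  qed
  then show ?case by (intro exI[of _ "X div Q"]) simp
qed

lemma map_cyclotomic: "d > 0 \<Longrightarrow> map_poly (of_rat :: rat \<Rightarrow> complex) (cyclotomic d) = cyclo_complex d"
proof -
  assume "d > 0"
  then obtain p where p: "map_poly (of_rat :: rat \<Rightarrow> complex) p = cyclo_complex d" using cyclo_rational by blast
  have "cyclotomic d = (THE p. map_poly (of_rat :: rat \<Rightarrow> complex) p = cyclo_complex d)"
    unfolding cyclotomic_def cyclo_complex_def primitive_roots_def ..
  also have "\<dots> = p" by (rule the_equality) (use p map_poly_of_rat_inj in auto)
  finally show ?thesis using p by simp
qed

lemma prod_cyclotomic: "n > 0 \<Longrightarrow> (\<Prod>d\<in>{d. d dvd n}. cyclotomic d) = monom 1 n - 1"
proof -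
  assume n: "n > 0"
  have pos: "d > 0" if "d dvd n" for d using that n by (cases "d = 0") auto
  have "map_poly (of_rat :: rat \<Rightarrow> complex) (\<Prod>d\<in>{d. d dvd n}. cyclotomic d) = (\<Prod>d\<in>{d. d dvd n}. cyclo_complex d)"
    unfolding map_poly_of_rat_prod using pos map_cyclotomic by (intro prod.cong) auto
  also have "\<dots> = map_poly of_rat (monom 1 n - 1 :: rat poly)"
    unfolding prod_cyclo_complex[OF n] by (rule poly_eqI) (simp add: coeff_map_poly of_rat_diff)
  finally show ?thesis by (rule map_poly_of_rat_inj)
qed

lemma cyclotomic_nonzero: "d > 0 \<Longrightarrow> cyclotomic d \<noteq> 0"
proof
  assume d: "d > 0" "cyclotomic d = 0"
  have "\<exists>k\<in>{k. k dvd d}. cyclotomic k = 0" using d(2) by (intro bexI[of _ d]) auto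
  then have "(\<Prod>k\<in>{k. k dvd d}. cyclotomic k) = 0" using d(1) by (intro prod_zero) auto
  then have "coeff (monom 1 d - 1 :: rat poly) 0 = 0" using prod_cyclotomic[OF d(1)] by simp
  then show False using d(1) by simp
qed

text \<open>A nonunit common factor has a complex root, which would be a primitive root of unity of
  two different orders.\<close>

lemma cyclotomic_coprime:
  assumes "d > 0" "d' > 0" "d \<noteq> d'" shows "coprime (cyclotomic d) (cyclotomic d')"
proof (rule ccontr)
  assume "\<not> coprime (cyclotomic d) (cyclotomic d')"
  then obtain g where g: "g dvd cyclotomic d" "g dvd cyclotomic d'" "\<not> is_unit g" by (auto simp: coprime_def)
  let ?m = "map_poly (of_rat :: rat \<Rightarrow> complex)"
  have "g \<noteq> 0" using g(1) cyclotomic_nonzero[OF assms(1)] by auto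
  then have dg: "degree g > 0" using g(3) by (metis is_unit_iff_degree not_gr_zero)
  have "\<not> constant (poly (?m g))" using dg by (simp add: constant_degree degree_map_poly_of_rat)
  then obtain z where z: "poly (?m g) z = 0" using fundamental_theorem_of_algebra by blast
  have root: "z \<in> primitive_roots k" if "g dvd cyclotomic k" "k > 0" for k
  proof -
    obtain h where "cyclotomic k = g * h" using \<open>g dvd cyclotomic k\<close> by (rule dvdE)
    then have "?m g * ?m h = cyclo_complex k" using map_cyclotomic[OF \<open>k > 0\<close>] map_poly_of_rat_mult by metis
    then have "poly (cyclo_complex k) z = 0" using z by (metis mult_zero_left poly_mult)
    then show ?thesis using finite_primitive_roots[OF \<open>k > 0\<close>] by (simp add: cyclo_complex_def poly_prod)
  qed
  then show False using root[OF g(1) assms(1)] root[OF g(2) assms(2)] primitive_roots_disjoint[OF assms] by blast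
qed


section \<open>Polynomials as Laurent polynomials\<close>

lemma laurent_sum: "degree p < N \<Longrightarrow> laurent_of_poly p = (\<Sum>i<N. Poly_Mapping.single (int i) (coeff p i))"
  unfolding laurent_of_poly_def by (rule sum.mono_neutral_left) (auto simp: coeff_eq_0)

text \<open>The Horner recursion, from which multiplicativity follows by induction on
  polynomials.\<close>

lemma laurent_pCons: "laurent_of_poly (pCons a p) = Poly_Mapping.single 0 a + Poly_Mapping.single 1 1 * laurent_of_poly p"
proof -
  have d: "degree (pCons a p) < Suc (Suc (degree p))" using degree_pCons_le[of a p] by simp
  have s: "Poly_Mapping.single (int (Suc i)) c = Poly_Mapping.single 1 1 * Poly_Mapping.single (int i) c" for i and c :: rat
    by (simp add: mult_single)
  have "laurent_of_poly (pCons a p) = Poly_Mapping.single 0 a + (\<Sum>i<Suc (degree p). Poly_Mapping.single (int (Suc i)) (coeff p i))"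
    unfolding laurent_sum[OF d] sum.lessThan_Suc_shift[of _ "Suc (degree p)"] by (simp del: sum.lessThan_Suc of_nat_Suc)
  also have "(\<Sum>i<Suc (degree p). Poly_Mapping.single (int (Suc i)) (coeff p i)) = Poly_Mapping.single 1 1 * laurent_of_poly p"
    unfolding laurent_sum[OF lessI[of "degree p"]] sum_distrib_left s ..
  finally show ?thesis .
qed

lemma laurent_0 [simp]: "laurent_of_poly 0 = 0"
  by (simp add: laurent_of_poly_def)

lemma laurent_1 [simp]: "laurent_of_poly 1 = 1"
  by (simp add: laurent_of_poly_def)

lemma laurent_add: "laurent_of_poly (p + q) = laurent_of_poly p + laurent_of_poly q"
proof -
  define N where "N = Suc (max (degree p) (degree q))"
  have "degree p < N" "degree q < N" "degree (p + q) < N"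
    using degree_add_le_max[of p q] by (auto simp: N_def)
  then show ?thesis by (simp add: laurent_sum[of _ N] sum.distrib single_add del: sum.lessThan_Suc)
qed

lemma laurent_smult: "laurent_of_poly (Polynomial.smult a q) = Poly_Mapping.single 0 a * laurent_of_poly q"
  by (induction q) (auto simp: laurent_pCons distrib_left mult_single mult.left_commute)

lemma laurent_mult: "laurent_of_poly (p * q) = laurent_of_poly p * laurent_of_poly q"
  by (induction p) (auto simp: laurent_pCons laurent_add laurent_smult distrib_right mult.assoc)

lemma laurent_power: "laurent_of_poly (p ^ n) = laurent_of_poly p ^ n"
  by (induction n) (auto simp: laurent_mult)

lemma laurent_prod_list: "laurent_of_poly (prod_list (map f xs)) = prod_list (map (\<lambda>x. laurent_of_poly (f x)) xs)"
  by (induction xs) (auto simp: laurent_mult)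

lemma laurent_nonzero: "p \<noteq> 0 \<Longrightarrow> laurent_of_poly p \<noteq> 0"
proof
  assume p: "p \<noteq> 0" "laurent_of_poly p = 0"
  have "Poly_Mapping.lookup (laurent_of_poly p) (int (degree p)) = (\<Sum>i\<le>degree p. if i = degree p then coeff p i else 0)"
    unfolding laurent_of_poly_def lookup_sum by (rule sum.cong) (auto simp: lookup_single when_def)
  also have "\<dots> = lead_coeff p" by simp
  finally have "lead_coeff p = 0" using p(2) by simp
  then show False using p(1) by simp
qed

definition phi :: "nat \<Rightarrow> qlaurent" where "phi d = laurent_of_poly (cyclotomic d)"

lemma phi_nonzero: "d > 0 \<Longrightarrow> phi d \<noteq> 0"
  unfolding phi_def by (intro laurent_nonzero cyclotomic_nonzero)

text \<open>Bezout coefficients exist in the Euclidean ring of rational polynomials and are mapped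
  to the Laurent polynomials.\<close>

lemma phi_coprime:
  assumes "d > 0" "d' > 0" "d \<noteq> d'" shows "bezout_coprime (phi d) (phi d')"
proof -
  let ?a = "cyclotomic d" and ?b = "cyclotomic d'"
  have "gcd ?a ?b = 1" using cyclotomic_coprime[OF assms] by (simp add: coprime_iff_gcd_eq_1)
  then have "fst (bezout_coefficients ?a ?b) * ?a + snd (bezout_coefficients ?a ?b) * ?b = 1"
    using bezout_coefficients_fst_snd[of ?a ?b] by simp
  then have "laurent_of_poly (fst (bezout_coefficients ?a ?b) * ?a + snd (bezout_coefficients ?a ?b) * ?b) = 1" by simp
  then show ?thesis unfolding bezout_coprime_def phi_def
    by (intro exI[of _ "laurent_of_poly (fst (bezout_coefficients ?a ?b))"]
        exI[of _ "laurent_of_poly (snd (bezout_coefficients ?a ?b))"])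
      (simp add: laurent_add laurent_mult mult.commute)
qed

lemma cyclo_sum_eq: "cyclo_sum ds = direct_sum_module (map residue_module (map phi ds))"
proof -
  have "cyclo_module d = residue_module (phi d)" for d
    unfolding cyclo_module_def residue_module_def principal_def phi_def ..
  then have "map cyclo_module ds = map (\<lambda>d. residue_module (phi d)) ds" by (intro map_cong HOL.refl)
  then show ?thesis by (simp only: cyclo_sum_def map_map o_def)
qed

section \<open>Greedy matchings\<close>

definition flip :: "'s \<Rightarrow> 's set \<Rightarrow> 's set" where
  "flip v \<sigma> = (if v \<in> \<sigma> then \<sigma> - {v} else insert v \<sigma>)"

definition unpaired :: "'s \<Rightarrow> 's set set \<Rightarrow> 's set set" where
  "unpaired v P = {\<sigma> \<in> P. flip v \<sigma> \<notin> P}"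

text \<open>The sets left after successive element matchings: for each vertex \<open>v\<close> in
  turn, a set is paired with the set obtained by toggling \<open>v\<close> whenever both are still
  present.\<close>

definition residual :: "'s list \<Rightarrow> 's set set \<Rightarrow> 's set set" where
  "residual vs P = foldl (\<lambda>P v. unpaired v P) P vs"

lemma residual_simps [simp]: "residual [] P = P" "residual (v # vs) P = residual vs (unpaired v P)"
  by (simp_all add: residual_def)

lemma residual_Int:
  "(\<And>v \<sigma>. v \<in> set vs \<Longrightarrow> flip v \<sigma> \<in> Q \<longleftrightarrow> \<sigma> \<in> Q) \<Longrightarrow> residual vs (P \<inter> Q) = residual vs P \<inter> Q"
proof (induction vs arbitrary: P)
  case (Cons v vs)
  have "unpaired v (P \<inter> Q) = unpaired v P \<inter> Q" using Cons.prems[of v] by (auto simp: unpaired_def)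
  then show ?case using Cons by simp
qed simp

lemma residual_subset: "residual vs P \<subseteq> P"
proof (induction vs arbitrary: P)
  case (Cons v vs)
  have "unpaired v P \<subseteq> P" by (auto simp: unpaired_def)
  then show ?case using Cons[of "unpaired v P"] by auto
qed simp

text \<open>Acyclicity of a discrete Morse matching, recorded as a linear order of its pairs: the
  lower set of an earlier pair is never a facet of the upper set of a later one.\<close>

definition removal :: "'s set set \<Rightarrow> ('s set \<times> 's set) list \<Rightarrow> 's set set \<Rightarrow> bool" where
  "removal P ps Q \<longleftrightarrow> (\<forall>p\<in>set ps. facet_of (fst p) (snd p) \<and> fst p \<in> P \<and> snd p \<in> P) \<and>
     distinct (map fst ps @ map snd ps) \<and> sorted_wrt (\<lambda>p q. \<not> facet_of (fst p) (snd q)) ps \<and>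
     Q = P - fst ` set ps - snd ` set ps"

lemma removal_append:
  assumes p: "removal P ps Q" and p': "removal P' ps' Q'" and dis: "P \<inter> P' = {}"
    and cross: "\<And>p p'. p \<in> set ps \<Longrightarrow> p' \<in> set ps' \<Longrightarrow> \<not> facet_of (fst p) (snd p')"
  shows "removal (P \<union> P') (ps @ ps') (Q \<union> Q')"
proof -
  have a: "fst ` set ps \<subseteq> P" "snd ` set ps \<subseteq> P" and b: "fst ` set ps' \<subseteq> P'" "snd ` set ps' \<subseteq> P'"
    using p p' by (auto simp: removal_def)
  have c: "Q = P - fst ` set ps - snd ` set ps" "Q' = P' - fst ` set ps' - snd ` set ps'"
    using p p' by (auto simp: removal_def)
  have gen: "(P - X - Y) \<union> (P' - X' - Y') = P \<union> P' - (X \<union> X') - (Y \<union> Y') \<and> (X \<union> Y) \<inter> (X' \<union> Y') = {}"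
    if "X \<subseteq> P" "Y \<subseteq> P" "X' \<subseteq> P'" "Y' \<subseteq> P'" for X Y X' Y'
    using that dis by auto
  have "Q \<union> Q' = (P \<union> P') - fst ` set (ps @ ps') - snd ` set (ps @ ps')"
    unfolding c set_append image_Un using gen[OF a b] by (rule conjunct1)
  moreover have "distinct (map fst (ps @ ps') @ map snd (ps @ ps'))"
    using p p' gen[OF a b, THEN conjunct2]
    unfolding removal_def distinct_append map_append set_append set_map Int_Un_distrib Int_Un_distrib2 Un_empty
    by (simp add: Int_commute)
  ultimately show ?thesis using p p' cross by (auto simp: removal_def sorted_wrt_append)
qed

text \<open>The sets without \<open>v\<close> come first: then no set containing \<open>v\<close> that is treated later can be a facet
  neighbour of one of them, since such pairs have already been taken out.\<close>

lemma removal_residual: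
  "finite P \<Longrightarrow> distinct vs \<Longrightarrow> \<exists>ps. removal P ps (residual vs P)"
proof (induction vs arbitrary: P)
  case Nil
  have "removal P [] P" by (simp add: removal_def)
  then show ?case by auto
next
  case (Cons v vs)
  define P' where "P' = unpaired v P"
  have P': "P' \<subseteq> P" "finite P'" using Cons.prems(1) by (auto simp: P'_def unpaired_def)
  have no_pair: "insert v \<tau> \<notin> P'" if "\<tau> \<in> P'" "v \<notin> \<tau>" for \<tau>
    using that by (auto simp: P'_def unpaired_def flip_def)
  let ?A = "P' \<inter> {\<sigma>. v \<notin> \<sigma>}" and ?C = "P' \<inter> {\<sigma>. v \<in> \<sigma>}"
  obtain as where A: "removal ?A as (residual vs ?A)" using Cons P' by (metis distinct.simps(2) finite_Int)
  obtain cs where C: "removal ?C cs (residual vs ?C)" using Cons P' by (metis distinct.simps(2) finite_Int)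
  define T where "T = {\<tau> \<in> P. v \<notin> \<tau> \<and> insert v \<tau> \<in> P}"
  have "finite T" using Cons.prems(1) by (simp add: T_def)
  then obtain ts where ts: "set ts = T" "distinct ts" using finite_distinct_list by blast
  define bs where "bs = map (\<lambda>\<tau>. (\<tau>, insert v \<tau>)) ts"
  have bs: "fst ` set bs = T" "snd ` set bs = insert v ` T" by (auto simp: bs_def ts(1) image_image)
  have inj: "inj_on (insert v) T" by (rule inj_onI) (auto simp: T_def)
  have PT: "P = P' \<union> T \<union> insert v ` T"
  proof (intro equalityI subsetI)
    fix \<sigma> assume s: "\<sigma> \<in> P"
    show "\<sigma> \<in> P' \<union> T \<union> insert v ` T"
    proof (cases "flip v \<sigma> \<in> P")
      case False then show ?thesis using s by (simp add: P'_def unpaired_def)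
    next
      case True
      show ?thesis
      proof (cases "v \<in> \<sigma>")
        case False then show ?thesis using s True by (simp add: T_def flip_def)
      next
        case v: True
        then have "\<sigma> - {v} \<in> T" "\<sigma> = insert v (\<sigma> - {v})" using s True by (auto simp: T_def flip_def insert_absorb)
        then show ?thesis by blast
      qed
    qed
  qed (use P' in \<open>auto simp: T_def\<close>)
  have disj: "P' \<inter> T = {}" "P' \<inter> insert v ` T = {}" "T \<inter> insert v ` T = {}"
    by (auto simp: P'_def T_def unpaired_def flip_def)
  \<comment> \<open>The later vertices differ from \<open>v\<close>, so toggling them never changes
    membership of \<open>v\<close>; the sets with and without \<open>v\<close> are processed
    independently.\<close>
  have res: "residual vs P' = residual vs ?A \<union> residual vs ?C"
  proof -
    have vv: "v \<notin> set vs" using Cons.prems by simp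
    have "residual vs ?A = residual vs P' \<inter> {\<sigma>. v \<notin> \<sigma>}"
      by (rule residual_Int) (use vv in \<open>auto simp: flip_def split: if_splits\<close>)
    moreover have "residual vs ?C = residual vs P' \<inter> {\<sigma>. v \<in> \<sigma>}"
      by (rule residual_Int) (use vv in \<open>auto simp: flip_def split: if_splits\<close>)
    ultimately show ?thesis by auto
  qed
  have Am: "facet_of (fst p) (snd p) \<and> fst p \<in> P' \<and> snd p \<in> P' \<and> v \<notin> fst p \<and> v \<notin> snd p" if "p \<in> set as" for p
    using A that by (auto simp: removal_def)
  have Cm: "facet_of (fst p) (snd p) \<and> fst p \<in> P' \<and> snd p \<in> P' \<and> v \<in> fst p \<and> v \<in> snd p" if "p \<in> set cs" for p
    using C that by (auto simp: removal_def)
  have Bm: "v \<notin> fst p \<and> snd p = insert v (fst p) \<and> fst p \<in> T \<and> snd p \<in> insert v ` T" if "p \<in> set bs" for p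
    using that by (auto simp: bs_def ts(1) T_def)
  have v_facet: "\<tau> = \<sigma> - {v} \<and> \<sigma> = insert v \<tau>" if "facet_of \<tau> \<sigma>" "v \<notin> \<tau>" "v \<in> \<sigma>" for \<tau> \<sigma>
    using that by (auto simp: facet_of_def)
  have "sorted_wrt (\<lambda>p q. \<not> facet_of (fst p) (snd q)) bs"
    unfolding bs_def sorted_wrt_map
  proof (rule sorted_wrt_mono_rel[of _ "(\<noteq>)"])
    fix x y assume "x \<in> set ts" "y \<in> set ts" "x \<noteq> y"
    then show "\<not> facet_of (fst (x, insert v x)) (snd (y, insert v y))"
      using v_facet[of x "insert v y"] by (auto simp: ts(1) T_def)
  qed (use ts(2) in \<open>simp add: distinct_conv_nth sorted_wrt_iff_nth_less\<close>)
  moreover have "\<not> facet_of (fst p) (snd q)" if "p \<in> set as" "q \<in> set bs" for p q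
    using v_facet[of "fst p" "snd q"] Am[OF that(1)] Bm[OF that(2)] disj(1) by (metis disjoint_iff insert_ident insertI1)
  moreover have "\<not> facet_of (fst p) (snd q)" if "p \<in> set as" "q \<in> set cs" for p q
    using v_facet[of "fst p" "snd q"] Am[OF that(1)] Cm[OF that(2)] no_pair by metis
  moreover have "\<not> facet_of (fst p) (snd q)" if "p \<in> set bs" "q \<in> set cs" for p q
    using v_facet[of "fst p" "snd q"] Bm[OF that(1)] Cm[OF that(2)] disj(2) by (metis disjoint_iff)
  ultimately have cross: "\<And>p q. p \<in> set bs \<Longrightarrow> q \<in> set cs \<Longrightarrow> \<not> facet_of (fst p) (snd q)"
      "\<And>p q. p \<in> set as \<Longrightarrow> q \<in> set (bs @ cs) \<Longrightarrow> \<not> facet_of (fst p) (snd q)"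
      and sorted: "sorted_wrt (\<lambda>p q. \<not> facet_of (fst p) (snd q)) bs"
    by auto
  have "distinct (map fst bs)" "distinct (map snd bs)"
    using ts inj by (auto simp: bs_def o_def distinct_map)
  then have "removal (T \<union> insert v ` T) bs {}"
    using Bm sorted disj(3) bs by (auto simp: removal_def facet_of_def)
  from removal_append[OF this C _ cross(1)] have "removal ((T \<union> insert v ` T) \<union> ?C) (bs @ cs) ({} \<union> residual vs ?C)"
    using disj by blast
  from removal_append[OF A this _ cross(2)]
  have "removal (?A \<union> ((T \<union> insert v ` T) \<union> ?C)) (as @ bs @ cs) (residual vs ?A \<union> ({} \<union> residual vs ?C))"
    using disj by blast
  moreover have "P = ?A \<union> ((T \<union> insert v ` T) \<union> ?C)" using PT by blast
  moreover have "residual (v # vs) P = residual vs ?A \<union> ({} \<union> residual vs ?C)" using res by (simp add: P'_def)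
  ultimately have "removal P (as @ bs @ cs) (residual (v # vs) P)" by simp
  then show ?case ..
qed

definition levels_below :: "'s set \<Rightarrow> ('s set \<Rightarrow> nat) \<Rightarrow> nat \<Rightarrow> 's set set" where
  "levels_below S e N = {\<sigma>. \<sigma> \<subset> S \<and> e \<sigma> < N}"

text \<open>Higher levels are put first. By monotonicity a facet never has a higher level than the
  set above it, so pairs of different levels respect the order.\<close>

lemma filtered_removal:
  assumes S: "finite S" and vs: "distinct vs" and mono: "\<And>\<tau> \<sigma>. \<tau> \<subseteq> \<sigma> \<Longrightarrow> \<sigma> \<subset> S \<Longrightarrow> e \<tau> \<le> e \<sigma>"
  shows "\<exists>ps. removal (levels_below S e N) ps (\<Union>j<N. residual vs {\<sigma>. \<sigma> \<subset> S \<and> e \<sigma> = j}) \<and>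
    (\<forall>p\<in>set ps. e (fst p) = e (snd p)) \<and> sorted_wrt (\<lambda>p q. e (fst q) \<le> e (fst p)) ps"
proof (induction N)
  case 0
  show ?case by (rule exI[of _ "[]"]) (simp add: removal_def levels_below_def)
next
  case (Suc N)
  let ?L = "{\<sigma>. \<sigma> \<subset> S \<and> e \<sigma> = N}"
  have "?L \<subseteq> Pow S" by auto
  then have fin: "finite ?L" using S finite_subset by blast
  obtain qs where qs: "removal ?L qs (residual vs ?L)" using removal_residual[OF fin vs] by blast
  obtain ps where ps: "removal (levels_below S e N) ps (\<Union>j<N. residual vs {\<sigma>. \<sigma> \<subset> S \<and> e \<sigma> = j})"
      "\<forall>p\<in>set ps. e (fst p) = e (snd p)" "sorted_wrt (\<lambda>p q. e (fst q) \<le> e (fst p)) ps" using Suc by blast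
  have q: "facet_of (fst p) (snd p) \<and> fst p \<subset> S \<and> snd p \<subset> S \<and> e (fst p) = N \<and> e (snd p) = N"
    if "p \<in> set qs" for p using qs that by (auto simp: removal_def)
  have p: "facet_of (fst p) (snd p) \<and> fst p \<subset> S \<and> snd p \<subset> S \<and> e (fst p) < N \<and> e (snd p) < N"
    if "p \<in> set ps" for p using ps that by (auto simp: removal_def levels_below_def)
  have L: "levels_below S e (Suc N) = ?L \<union> levels_below S e N" "?L \<inter> levels_below S e N = {}"
    by (auto simp: levels_below_def)
  have cross: "\<not> facet_of (fst x) (snd y)" if "x \<in> set qs" "y \<in> set ps" for x y
  proof
    assume "facet_of (fst x) (snd y)"
    then have "fst x \<subseteq> snd y" by (auto simp: facet_of_def)
    then show False using mono[of "fst x" "snd y"] q[OF that(1)] p[OF that(2)] by simp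
  qed
  have "(\<Union>j<Suc N. residual vs {\<sigma>. \<sigma> \<subset> S \<and> e \<sigma> = j}) =
      residual vs ?L \<union> (\<Union>j<N. residual vs {\<sigma>. \<sigma> \<subset> S \<and> e \<sigma> = j})" by (simp add: lessThan_Suc)
  then have "removal (levels_below S e (Suc N)) (qs @ ps) (\<Union>j<Suc N. residual vs {\<sigma>. \<sigma> \<subset> S \<and> e \<sigma> = j})"
    using removal_append[OF qs ps(1) L(2) cross] L(1) by simp
  moreover have "\<forall>p\<in>set (qs @ ps). e (fst p) = e (snd p)" using q ps(2) by auto
  moreover have "sorted_wrt (\<lambda>p q. e (fst q) \<le> e (fst p)) (qs @ ps)"
    using ps(3) q p by (simp add: sorted_wrt_append less_imp_le) (simp add: sorted_wrt_iff_nth_less)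
  ultimately show ?case by blast
qed

definition greedy_critical :: "'s set \<Rightarrow> ('s set \<Rightarrow> nat) \<Rightarrow> 's list \<Rightarrow> 's set set" where
  "greedy_critical S e vs = {\<kappa>. \<kappa> \<subset> S \<and> \<kappa> \<in> residual vs {\<sigma>. \<sigma> \<subset> S \<and> e \<sigma> = e \<kappa>}}"

lemma matched_filtration_exists:
  fixes S :: "'s::linorder set"
  assumes S: "finite S" "card S = Suc n" and vs: "distinct vs" and mono: "\<And>\<tau> \<sigma>. \<tau> \<subseteq> \<sigma> \<Longrightarrow> \<sigma> \<subset> S \<Longrightarrow> e \<tau> \<le> e \<sigma>"
  shows "\<exists>ps. matched_filtration S n e ps \<and>
    (\<forall>k. matched_filtration.crit S ps k = {\<kappa> \<in> greedy_critical S e vs. card \<kappa> = k})"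
proof -
  define N where "N = Suc (Max (e ` Pow S))"
  have lt: "e \<sigma> < N" if "\<sigma> \<subset> S" for \<sigma> using that S(1) by (auto simp: N_def less_Suc_eq_le)
  then have PS: "levels_below S e N = {\<sigma>. \<sigma> \<subset> S}" by (auto simp: levels_below_def)
  obtain ps where ps: "removal {\<sigma>. \<sigma> \<subset> S} ps (\<Union>j<N. residual vs {\<sigma>. \<sigma> \<subset> S \<and> e \<sigma> = j})"
      "\<forall>p\<in>set ps. e (fst p) = e (snd p)" "sorted_wrt (\<lambda>p q. e (fst q) \<le> e (fst p)) ps"
    using filtered_removal[of S vs e N, OF S(1) vs mono] unfolding PS by blast
  interpret matched_filtration S n e ps
  proof
    fix \<tau> \<sigma> assume "(\<tau>, \<sigma>) \<in> set ps"
    then show "facet_of \<tau> \<sigma> \<and> \<sigma> \<subset> S \<and> e \<sigma> = e \<tau>" using ps(1,2) by (fastforce simp: removal_def)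
  next
    show "sorted_wrt (\<lambda>p q. \<not> facet_of (fst p) (snd q) \<and> e (fst q) \<le> e (fst p)) ps"
      using ps(1,3) by (auto simp: removal_def sorted_wrt_iff_nth_less)
  qed (use S mono ps(1) in \<open>auto simp: removal_def\<close>)
  have "(\<Union>j<N. residual vs {\<sigma>. \<sigma> \<subset> S \<and> e \<sigma> = j}) = greedy_critical S e vs"
  proof (intro equalityI subsetI)
    fix \<kappa> assume "\<kappa> \<in> (\<Union>j<N. residual vs {\<sigma>. \<sigma> \<subset> S \<and> e \<sigma> = j})"
    then obtain j where j: "j < N" "\<kappa> \<in> residual vs {\<sigma>. \<sigma> \<subset> S \<and> e \<sigma> = j}" by blast
    then have "\<kappa> \<in> {\<sigma>. \<sigma> \<subset> S \<and> e \<sigma> = j}" using residual_subset[of vs "{\<sigma>. \<sigma> \<subset> S \<and> e \<sigma> = j}"] by blast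
    then show "\<kappa> \<in> greedy_critical S e vs" using j by (simp add: greedy_critical_def)
  qed (use lt in \<open>auto simp: greedy_critical_def\<close>)
  then have "crit k = {\<kappa> \<in> greedy_critical S e vs. card \<kappa> = k}" for k
    using ps(1) by (auto simp: crit_def D_def U_def removal_def greedy_critical_def)
  then show ?thesis using matched_filtration_axioms by blast
qed

section \<open>Counting critical sets\<close>

context matched_filtration begin

lemma crit_count: "k \<le> n \<Longrightarrow> card {\<tau> \<in> D. card \<tau> = k} + card {\<tau> \<in> U. card \<tau> = k} + card (crit k) = Suc n choose k"
proof -
  assume k: "k \<le> n"
  have "\<forall>p\<in>set ps. fst p \<subset> S \<and> snd p \<subset> S" using pairs pair_card by (metis prod.collapse)
  then have sub: "D \<subseteq> {\<sigma>. \<sigma> \<subset> S}" "U \<subseteq> {\<sigma>. \<sigma> \<subset> S}"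
    by (auto simp: D_def U_def)
  have eq: "{\<sigma>. \<sigma> \<subseteq> S \<and> card \<sigma> = k} = {\<tau> \<in> D. card \<tau> = k} \<union> {\<tau> \<in> U. card \<tau> = k} \<union> crit k"
    using sub k cardS by (auto simp: crit_def)
  have f: "finite {\<sigma>. \<sigma> \<subseteq> S \<and> card \<sigma> = k}" using finS by simp
  have "card {\<sigma>. \<sigma> \<subseteq> S \<and> card \<sigma> = k} = card ({\<tau> \<in> D. card \<tau> = k} \<union> {\<tau> \<in> U. card \<tau> = k}) + card (crit k)"
    unfolding eq by (rule card_Un_disjoint) (use f eq in \<open>auto simp: crit_def\<close>)
  also have "card ({\<tau> \<in> D. card \<tau> = k} \<union> {\<tau> \<in> U. card \<tau> = k}) = card {\<tau> \<in> D. card \<tau> = k} + card {\<tau> \<in> U. card \<tau> = k}"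
    by (rule card_Un_disjoint) (use f eq DU_disjoint in auto)
  finally show ?thesis using n_subsets[OF finS, of k] cardS by simp
qed

lemma card_U_Suc: "card {\<tau> \<in> U. card \<tau> = Suc k} = card {\<tau> \<in> D. card \<tau> = k}"
proof -
  let ?Q = "{p \<in> set ps. card (fst p) = k}"
  have "{\<tau> \<in> U. card \<tau> = Suc k} = snd ` ?Q" "{\<tau> \<in> D. card \<tau> = k} = fst ` ?Q"
    using pair_card by (force simp: D_def U_def)+
  moreover have "inj_on fst ?Q" "inj_on snd ?Q"
    using dist by (auto simp: distinct_map intro: inj_on_subset)
  ultimately show ?thesis by (simp add: card_image)
qed

text \<open>Of the sets of size k + 1, those in \<open>U\<close> correspond to the sets of size k in
  \<open>D\<close>, so the count of critical sets and Pascal's rule determine the number in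
  \<open>D\<close> step by step. This turns ranks read off from critical sets into the ranks of
  \<open>local_homology\<close>.\<close>

lemma rank_recursion:
  assumes r0: "card (crit 0) = r 0" and r: "\<And>k. Suc k < n \<Longrightarrow> card (crit (Suc k)) = r (Suc k) + r k"
  shows "k < n \<Longrightarrow> r k + card {\<tau> \<in> D. card \<tau> = k} = n choose k"
proof (induction k)
  case 0
  have "{\<tau> \<in> U. card \<tau> = 0} = {}" using pair_card by (fastforce simp: U_def)
  then have "card {\<tau> \<in> U. card \<tau> = 0} = 0" by (simp only: card.empty)
  then show ?case using crit_count[of 0] r0 by simp
next
  case (Suc k)
  have "Suc n choose Suc k = (n choose k) + (n choose Suc k)" by simp
  moreover have "r k + card {\<tau> \<in> D. card \<tau> = k} = (n choose k)" using Suc by simp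
  moreover have "card {\<tau> \<in> D. card \<tau> = Suc k} + card {\<tau> \<in> D. card \<tau> = k} + card (crit (Suc k)) = Suc n choose Suc k"
    using crit_count[of "Suc k"] Suc.prems unfolding card_U_Suc by linarith
  moreover have "card (crit (Suc k)) = r (Suc k) + r k" by (rule r[OF Suc.prems])
  ultimately show ?case by linarith
qed

end

lemma greedy_presents:
  fixes S :: "'s::linorder set"
  assumes S: "finite S" "card S = Suc n" and vs: "distinct vs"
    and mono: "\<And>\<tau> \<sigma>. \<tau> \<subseteq> \<sigma> \<Longrightarrow> \<sigma> \<subset> S \<Longrightarrow> e \<tau> \<le> e \<sigma>"
    and C: "\<And>k. C k = {\<kappa> \<in> greedy_critical S e vs. card \<kappa> = k}"
    and r0: "card (C 0) = r 0" and r: "\<And>k. Suc k < n \<Longrightarrow> card (C (Suc k)) = r (Suc k) + r k"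
    and lev: "\<And>k. k < n \<Longrightarrow> r k = 0 \<or> (\<exists>j. (\<forall>\<kappa>\<in>C k. e \<kappa> = j) \<and> (\<forall>\<kappa>\<in>C (Suc k). e \<kappa> = Suc j))"
    and k: "k < n" and phi: "\<phi> \<noteq> 0"
  shows "presents S k (weight_lattice S (\<lambda>\<sigma>. \<phi> ^ e \<sigma>)) (replicate (r k) \<phi>)"
proof -
  have "\<exists>ps. matched_filtration S n e ps \<and>
      (\<forall>k. matched_filtration.crit S ps k = {\<kappa> \<in> greedy_critical S e vs. card \<kappa> = k})"
    by (rule matched_filtration_exists[OF S vs mono])
  then obtain ps where mf: "matched_filtration S n e ps"
      and crit: "\<forall>k. matched_filtration.crit S ps k = {\<kappa> \<in> greedy_critical S e vs. card \<kappa> = k}"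
    by (elim exE conjE) (rule that)
  interpret matched_filtration S n e ps by (rule mf)
  have cC: "crit k = C k" for k unfolding C by (rule crit[rule_format])
  have rk: "r k + card {\<tau> \<in> D. card \<tau> = k} = n choose k"
    by (rule rank_recursion[OF _ _ k]) (unfold cC, fact r0, fact r)
  then have "card {\<tau> \<in> D. card \<tau> = k} = n choose k \<or>
      (\<exists>j. (\<forall>\<kappa>\<in>crit k. e \<kappa> = j) \<and> (\<forall>\<kappa>\<in>crit (Suc k). e \<kappa> = Suc j))"
    unfolding cC using lev[OF k] by (elim disjE) simp_all
  from local_homology[OF k phi this]
  obtain r' where r': "r' + card {\<tau> \<in> D. card \<tau> = k} = n choose k" "presents S k (lattice \<phi>) (replicate r' \<phi>)"
    by (elim exE conjE) (rule that)
  have "r' = r k" using r'(1) rk by simp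
  then show ?thesis using r'(2) by (simp add: lattice_def weight_lattice_def)
qed

section \<open>Functions on subsets as binary trees\<close>

text \<open>At depth \<open>i\<close> of a tree of type \<open>'a trie\<close> the left branch collects the sets without \<open>i\<close> and the
  right branch those with \<open>i\<close>.\<close>

datatype 'a trie = Leaf 'a | Node "'a trie" "'a trie"

fun val :: "nat \<Rightarrow> 'a trie \<Rightarrow> nat set \<Rightarrow> 'a" where
  "val i (Leaf a) \<sigma> = a"
| "val i (Node l r) \<sigma> = (if i \<in> \<sigma> then val (Suc i) r \<sigma> else val (Suc i) l \<sigma>)"

fun full :: "nat \<Rightarrow> 'a trie \<Rightarrow> bool" where
  "full k (Leaf a) \<longleftrightarrow> k = 0"
| "full k (Node l r) \<longleftrightarrow> (\<exists>j. k = Suc j \<and> full j l \<and> full j r)"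

primrec build :: "nat \<Rightarrow> nat \<Rightarrow> nat list \<Rightarrow> (nat list \<Rightarrow> 'a) \<Rightarrow> 'a trie" where
  "build 0 i T f = Leaf (f T)"
| "build (Suc k) i T f = Node (build k (Suc i) T f) (build k (Suc i) (i # T) f)"

text \<open>Siblings at depth \<open>i\<close> differ exactly in the vertex \<open>i\<close>. Equal
  leaves are a set and its toggled partner on the same level, hence matched and erased; the result
  is the first tree after erasing.\<close>

fun unpair2 :: "'a option trie \<Rightarrow> 'a option trie \<Rightarrow> 'a option trie" where
  "unpair2 (Leaf a) (Leaf b) = Leaf (if a = b then None else a)"
| "unpair2 (Node l r) (Node l' r') = Node (unpair2 l l') (unpair2 r r')"
| "unpair2 t u = t"

fun unpair :: "nat \<Rightarrow> 'a option trie \<Rightarrow> 'a option trie" where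
  "unpair i (Leaf a) = Leaf a"
| "unpair 0 (Node l r) = Node (unpair2 l r) (unpair2 r l)"
| "unpair (Suc i) (Node l r) = Node (unpair i l) (unpair i r)"

text \<open>\<open>None\<close> is the top element: in the tree of levels it marks the full vertex
  set, which lies above every proper subset.\<close>

fun le_top :: "nat option \<Rightarrow> nat option \<Rightarrow> bool" where
  "le_top x None = True"
| "le_top None (Some b) = False"
| "le_top (Some a) (Some b) = (a \<le> b)"

fun le_trie :: "nat option trie \<Rightarrow> nat option trie \<Rightarrow> bool" where
  "le_trie (Leaf a) (Leaf b) = le_top a b"
| "le_trie (Node l r) (Node l' r') = (le_trie l l' \<and> le_trie r r')"
| "le_trie t u = False"

fun mono_trie :: "nat option trie \<Rightarrow> bool" where
  "mono_trie (Leaf a) = True"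
| "mono_trie (Node l r) = (mono_trie l \<and> mono_trie r \<and> le_trie l r)"

fun collect :: "nat \<Rightarrow> 'a option trie \<Rightarrow> (nat \<times> 'a) list" where
  "collect c (Leaf a) = (case a of None \<Rightarrow> [] | Some j \<Rightarrow> [(c, j)])"
| "collect c (Node l r) = collect c l @ collect (Suc c) r"

lemma val_build: "val i (build k i T f) \<sigma> = f (rev (filter (\<lambda>j. j \<in> \<sigma>) [i..<i+k]) @ T)"
proof (induction k arbitrary: i T)
  case (Suc k)
  have "[i..<i + Suc k] = i # [Suc i..<Suc i + k]" by (simp add: upt_rec)
  then show ?case using Suc by simp
qed simp

lemma full_build: "full k (build k i T f)"
  by (induction k arbitrary: i T) auto

lemma val_map: "val i (map_trie f t) \<sigma> = f (val i t \<sigma>)"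
  by (induction t arbitrary: i) auto

lemma full_map: "full k (map_trie f t) \<longleftrightarrow> full k t"
  by (induction t arbitrary: k) auto

lemma val_insert_less: "j < i \<Longrightarrow> val i t (insert j \<sigma>) = val i t \<sigma>"
  by (induction t arbitrary: i) auto

lemma val_remove_less: "j < i \<Longrightarrow> val i t (\<sigma> - {j}) = val i t \<sigma>"
  by (induction t arbitrary: i) auto

lemma full_unpair2: "full k t \<Longrightarrow> full k u \<Longrightarrow> full k (unpair2 t u)"
  by (induction t u arbitrary: k rule: unpair2.induct) auto

lemma full_unpair: "full k t \<Longrightarrow> full k (unpair i t)"
  by (induction i t arbitrary: k rule: unpair.induct) (auto intro: full_unpair2)

lemma val_unpair2:
  "full k t \<Longrightarrow> full k u \<Longrightarrow> val i (unpair2 t u) \<sigma> = (if val i t \<sigma> = val i u \<sigma> then None else val i t \<sigma>)"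
  by (induction t u arbitrary: k i rule: unpair2.induct) auto

lemma val_unpair:
  "full k t \<Longrightarrow> v < k \<Longrightarrow> val i (unpair v t) \<sigma> =
    (if val i t (flip (i + v) \<sigma>) = val i t \<sigma> then None else val i t \<sigma>)"
proof (induction v t arbitrary: i k rule: unpair.induct)
  case (2 l r)
  then obtain j where "full j l" "full j r" by auto
  then show ?case using val_unpair2[of j l r "Suc i" \<sigma>] val_unpair2[of j r l "Suc i" \<sigma>]
    by (auto simp: flip_def val_insert_less val_remove_less)
next
  case (3 v l r)
  then obtain j where j: "full j l" "full j r" "v < j" by auto
  have "i \<in> flip (i + Suc v) \<sigma> \<longleftrightarrow> i \<in> \<sigma>" by (auto simp: flip_def)
  then show ?case using 3(1)[OF j(1,3), of "Suc i"] 3(2)[OF j(2,3), of "Suc i"] by simp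
qed auto

definition level_set :: "nat option trie \<Rightarrow> nat \<Rightarrow> nat set set" where
  "level_set t j = {\<sigma>. val 0 t \<sigma> = Some j}"

lemma level_set_unpair: "full k t \<Longrightarrow> v < k \<Longrightarrow> level_set (unpair v t) j = unpaired v (level_set t j)"
  by (auto simp: level_set_def unpaired_def val_unpair[where i = 0, simplified])

lemma level_set_fold_unpair:
  "full k t \<Longrightarrow> \<forall>v\<in>set vs. v < k \<Longrightarrow> level_set (foldl (\<lambda>t v. unpair v t) t vs) j = residual vs (level_set t j) \<and>
    full k (foldl (\<lambda>t v. unpair v t) t vs)"
  by (induction vs arbitrary: t) (auto simp: level_set_unpair full_unpair)

lemma le_trie_val: "le_trie t u \<Longrightarrow> le_top (val i t \<sigma>) (val i u \<sigma>)"
  by (induction t u arbitrary: i rule: le_trie.induct) auto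

lemma le_top_refl: "le_top x x" by (cases x) auto

lemma le_top_trans: "le_top x y \<Longrightarrow> le_top y z \<Longrightarrow> le_top x z"
  by (cases x; cases y; cases z) auto

lemma mono_trie_val: "mono_trie t \<Longrightarrow> \<tau> \<subseteq> \<sigma> \<Longrightarrow> le_top (val i t \<tau>) (val i t \<sigma>)"
proof (induction t arbitrary: i)
  case (Node l r)
  then have "le_top (val (Suc i) l \<tau>) (val (Suc i) l \<sigma>)" "le_top (val (Suc i) r \<tau>) (val (Suc i) r \<sigma>)"
      "le_top (val (Suc i) l \<sigma>) (val (Suc i) r \<sigma>)" using le_trie_val by auto
  moreover from this(1,3) have "le_top (val (Suc i) l \<tau>) (val (Suc i) r \<sigma>)" by (rule le_top_trans)
  ultimately show ?case using Node.prems(2) by auto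
qed (simp add: le_top_refl)

text \<open>Leaves of a full tree correspond to subsets, and right branches count elements, so
  critical sets can be counted by size and level on the tree alone.\<close>

lemma card_collect:
  "full k t \<Longrightarrow> card {\<sigma>. \<sigma> \<subseteq> {i..<i+k} \<and> (\<exists>j. val i t \<sigma> = Some j \<and> P (c + card \<sigma>) j)} =
    length (filter (\<lambda>(x, j). P x j) (collect c t))"
proof (induction t arbitrary: k i c)
  case (Leaf a)
  then have "{\<sigma>. \<sigma> \<subseteq> {i..<i+k} \<and> (\<exists>j. val i (Leaf a) \<sigma> = Some j \<and> P (c + card \<sigma>) j)} =
      (if \<exists>j. a = Some j \<and> P c j then {{}} else {})" by auto
  then show ?case by (auto split: option.splits)
next
  case (Node l r)
  then obtain k' where k: "k = Suc k'" "full k' l" "full k' r" by auto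
  let ?L = "{\<sigma>. \<sigma> \<subseteq> {Suc i..<Suc i+k'} \<and> (\<exists>j. val (Suc i) l \<sigma> = Some j \<and> P (c + card \<sigma>) j)}"
  let ?R = "{\<sigma>. \<sigma> \<subseteq> {Suc i..<Suc i+k'} \<and> (\<exists>j. val (Suc i) r \<sigma> = Some j \<and> P (Suc c + card \<sigma>) j)}"
  let ?A = "{\<sigma>. \<sigma> \<subseteq> {i..<i+k} \<and> (\<exists>j. val i (Node l r) \<sigma> = Some j \<and> P (c + card \<sigma>) j)}"
  have iv: "{i..<i+k} = insert i {Suc i..<Suc i+k'}" using k(1) by auto
  have finR: "finite \<sigma>" if "\<sigma> \<subseteq> {Suc i..<Suc i+k'}" for \<sigma> using that finite_subset by blast
  have "?A = ?L \<union> insert i ` ?R"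
  proof (intro equalityI subsetI)
    fix \<sigma> assume s: "\<sigma> \<in> ?A"
    show "\<sigma> \<in> ?L \<union> insert i ` ?R"
    proof (cases "i \<in> \<sigma>")
      case False then show ?thesis using s unfolding iv by auto
    next
      case True
      have sub: "\<sigma> - {i} \<subseteq> {Suc i..<Suc i+k'}" using s unfolding iv by auto
      have "card \<sigma> = Suc (card (\<sigma> - {i}))" using True finR[OF sub] by (metis card_Suc_Diff1 finite_Diff2 finite.emptyI finite_insert)
      then have "\<sigma> - {i} \<in> ?R" using s True sub by (auto simp: val_remove_less)
      moreover have "\<sigma> = insert i (\<sigma> - {i})" using True by auto
      ultimately show ?thesis by blast
    qed
  next
    fix \<sigma> assume s: "\<sigma> \<in> ?L \<union> insert i ` ?R"
    show "\<sigma> \<in> ?A"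
    proof (cases "\<sigma> \<in> ?L")
      case True
      then have "i \<notin> \<sigma>" by auto
      then show ?thesis using True unfolding iv by auto
    next
      case False
      then obtain \<rho> where r: "\<sigma> = insert i \<rho>" "\<rho> \<in> ?R" using s by blast
      then have "i \<notin> \<rho>" "finite \<rho>" using finR by auto
      then show ?thesis using r unfolding iv by (auto simp: val_insert_less)
    qed
  qed
  moreover have "?L \<inter> insert i ` ?R = {}" by auto
  moreover have "finite ?L" "finite ?R" by auto
  moreover have "card (insert i ` ?R) = card ?R"
  proof (rule card_image, rule inj_onI)
    fix x y assume "x \<in> ?R" "y \<in> ?R" and eq: "insert i x = insert i y"
    then have i: "i \<notin> x" "i \<notin> y" by auto
    show "x = y" using eq insert_ident[OF i] by simp
  qed
  ultimately have "card ?A = card ?L + card ?R" by (simp add: card_Un_disjoint)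
  then show ?case using Node(1)[OF k(2), of "Suc i" c] Node(2)[OF k(3), of "Suc i" "Suc c"] by simp
qed


section \<open>Certificates\<close>

text \<open>Tests |crit_k| = r_k + r_(k-1) and, where r_k is nonzero, that all critical sets have
  one level in degree k and the next one in degree k + 1. In that case \<open>A\<close> is nonempty
  by the count, so its head does give the level.\<close>

definition rank_check :: "nat \<Rightarrow> nat list \<Rightarrow> (nat \<times> nat) list \<Rightarrow> bool" where
  "rank_check n rs C \<longleftrightarrow> length rs = n \<and> list_all (\<lambda>k.
     length (filter (\<lambda>x. fst x = k) C) = rs ! k + (if k = 0 then 0 else rs ! (k - 1)) \<and>
     (let A = filter (\<lambda>x. fst x = k) C in rs ! k = 0 \<or>
        list_all (\<lambda>x. snd x = snd (hd A)) A \<and>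
        list_all (\<lambda>x. fst x = Suc k \<longrightarrow> snd x = Suc (snd (hd A))) C)) [0..<n]"

definition cert_check :: "nat \<Rightarrow> nat option trie \<Rightarrow> nat list \<Rightarrow> nat list \<Rightarrow> bool" where
  "cert_check n t vs rs \<longleftrightarrow> mono_trie t \<and> distinct vs \<and> list_all (\<lambda>v. v \<le> n) vs \<and>
     rank_check n rs (collect 0 (foldl (\<lambda>t v. unpair v t) t vs))"

lemma cert_presents:
  assumes cert: "cert_check n t vs rs" and full: "full (Suc n) t"
    and e: "\<And>\<sigma>. \<sigma> \<subset> {0..n} \<Longrightarrow> val 0 t \<sigma> = Some (e \<sigma>)" and top: "val 0 t {0..n} = None"
    and k: "k < n" and phi: "\<phi> \<noteq> 0"
  shows "presents {0..n} k (weight_lattice {0..n} (\<lambda>\<sigma>. \<phi> ^ e \<sigma>)) (replicate (rs ! k) \<phi>)"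
proof -
  let ?S = "{0..n}" and ?u = "foldl (\<lambda>t v. unpair v t) t vs"
  let ?C = "collect 0 ?u"
  have vsn: "\<forall>v\<in>set vs. v < Suc n" and dist: "distinct vs" and rc: "rank_check n rs ?C" and mt: "mono_trie t"
    using cert by (auto simp: cert_check_def list_all_iff)
  have fu: "full (Suc n) ?u" and lev: "level_set ?u j = residual vs (level_set t j)" for j
    using level_set_fold_unpair[OF full vsn] by auto
  have mono: "e \<tau> \<le> e \<sigma>" if "\<tau> \<subseteq> \<sigma>" "\<sigma> \<subset> ?S" for \<tau> \<sigma>
    using mono_trie_val[OF mt that(1), of 0] e[OF that(2)] e[of \<tau>] that by auto
  have Scut: "{0..<0 + Suc n} = ?S" by auto
  \<comment> \<open>The tree assigns values also to sets with elements above \<open>n\<close>, which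
    it ignores; these are cut away here, and toggling vertices up to \<open>n\<close> respects the
    cut.\<close>
  have level_cut: "level_set t j \<inter> {\<sigma>. \<sigma> \<subseteq> ?S} = {\<sigma>. \<sigma> \<subset> ?S \<and> e \<sigma> = j}" for j
  proof (intro equalityI subsetI)
    fix \<sigma> assume "\<sigma> \<in> level_set t j \<inter> {\<sigma>. \<sigma> \<subseteq> ?S}"
    then have s: "val 0 t \<sigma> = Some j" "\<sigma> \<subseteq> ?S" by (auto simp: level_set_def)
    then have "\<sigma> \<subset> ?S" using top by (cases "\<sigma> = ?S") auto
    then show "\<sigma> \<in> {\<sigma>. \<sigma> \<subset> ?S \<and> e \<sigma> = j}" using e s by simp
  next
    fix \<sigma> assume "\<sigma> \<in> {\<sigma>. \<sigma> \<subset> ?S \<and> e \<sigma> = j}"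
    then have "\<sigma> \<subset> ?S" "e \<sigma> = j" by simp_all
    then show "\<sigma> \<in> level_set t j \<inter> {\<sigma>. \<sigma> \<subseteq> ?S}" using e[of \<sigma>] by (simp add: level_set_def less_imp_le)
  qed
  have res: "residual vs {\<sigma>. \<sigma> \<subset> ?S \<and> e \<sigma> = j} = level_set ?u j \<inter> {\<sigma>. \<sigma> \<subseteq> ?S}" for j
    unfolding level_cut[symmetric] lev
  proof (rule residual_Int)
    fix v \<sigma> assume "v \<in> set vs"
    then have "v \<in> ?S" using vsn by auto
    then show "flip v \<sigma> \<in> {\<sigma>. \<sigma> \<subseteq> ?S} \<longleftrightarrow> \<sigma> \<in> {\<sigma>. \<sigma> \<subseteq> ?S}"
      by (simp add: flip_def Diff_subset_conv insert_absorb)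
  qed
  define C where "C = (\<lambda>k. {\<kappa> \<in> greedy_critical ?S e vs. card \<kappa> = k})"
  have C_iff: "\<kappa> \<in> C k \<longleftrightarrow> \<kappa> \<subseteq> ?S \<and> val 0 ?u \<kappa> = Some (e \<kappa>) \<and> \<kappa> \<subset> ?S \<and> card \<kappa> = k" for \<kappa> k
    unfolding C_def greedy_critical_def res by (auto simp: level_set_def)
  have Ccard: "card \<kappa> = j" and Csub: "\<kappa> \<in> Pow ?S" if "\<kappa> \<in> C j" for \<kappa> j using that by (simp_all add: C_iff)
  have u_level: "\<kappa> \<subset> ?S \<and> j = e \<kappa>" if "\<kappa> \<subseteq> ?S" "val 0 ?u \<kappa> = Some j" for \<kappa> j
  proof -
    have "\<kappa> \<in> residual vs {\<sigma>. \<sigma> \<subset> ?S \<and> e \<sigma> = j}" using res that by (simp add: level_set_def)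
    then show ?thesis using residual_subset by blast
  qed
  \<comment> \<open>The leaves that keep a level after all unpairings are exactly the critical sets,
    and the level they show is their exponent.\<close>
  have C_eq: "{\<kappa>. \<kappa> \<subseteq> {0..<0 + Suc n} \<and> (\<exists>j. val 0 ?u \<kappa> = Some j \<and> Q (0 + card \<kappa>) j)} =
      {\<kappa> \<in> (\<Union>k. C k). Q (card \<kappa>) (e \<kappa>)}" for Q
  proof (intro equalityI subsetI)
    fix \<kappa> assume "\<kappa> \<in> {\<kappa>. \<kappa> \<subseteq> {0..<0 + Suc n} \<and> (\<exists>j. val 0 ?u \<kappa> = Some j \<and> Q (0 + card \<kappa>) j)}"
    then obtain j where j: "\<kappa> \<subseteq> ?S" "val 0 ?u \<kappa> = Some j" "Q (card \<kappa>) j" unfolding Scut by auto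
    then have "\<kappa> \<in> C (card \<kappa>)" "j = e \<kappa>" using u_level[OF j(1,2)] by (simp_all add: C_iff)
    then show "\<kappa> \<in> {\<kappa> \<in> (\<Union>k. C k). Q (card \<kappa>) (e \<kappa>)}" using j(3) by blast
  next
    fix \<kappa> assume "\<kappa> \<in> {\<kappa> \<in> (\<Union>k. C k). Q (card \<kappa>) (e \<kappa>)}"
    then obtain k where "\<kappa> \<in> C k" "Q (card \<kappa>) (e \<kappa>)" by blast
    then show "\<kappa> \<in> {\<kappa>. \<kappa> \<subseteq> {0..<0 + Suc n} \<and> (\<exists>j. val 0 ?u \<kappa> = Some j \<and> Q (0 + card \<kappa>) j)}"
      unfolding Scut by (simp add: C_iff)
  qed
  have count: "card {\<kappa> \<in> (\<Union>k. C k). Q (card \<kappa>) (e \<kappa>)} = length (filter (\<lambda>(x, j). Q x j) ?C)" for Q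
    unfolding C_eq[symmetric] by (rule card_collect[OF fu])
  have cardC: "card (C k) = length (filter (\<lambda>x. fst x = k) ?C)" for k
  proof -
    have "C k = {\<kappa> \<in> (\<Union>k. C k). card \<kappa> = k}" using Ccard by blast
    then show ?thesis using count[of "\<lambda>x j. x = k"] by (simp add: case_prod_unfold)
  qed
  have finC: "finite {\<kappa> \<in> (\<Union>k. C k). Q \<kappa>}" for Q
    by (rule finite_subset[of _ "Pow ?S"]) (use Csub in blast, simp)
  have member: "(k, e \<kappa>) \<in> set ?C" if "\<kappa> \<in> C k" for \<kappa> k
  proof -
    let ?X = "{\<kappa>' \<in> (\<Union>k. C k). card \<kappa>' = k \<and> e \<kappa>' = e \<kappa>}"
    have "\<kappa> \<in> ?X" using that Ccard[OF that] by blast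
    then have "card ?X \<noteq> 0" using finC[of "\<lambda>\<kappa>'. card \<kappa>' = k \<and> e \<kappa>' = e \<kappa>"] by auto
    then have "filter (\<lambda>(x, j). x = k \<and> j = e \<kappa>) ?C \<noteq> []" using count[of "\<lambda>x j. x = k \<and> j = e \<kappa>"] by auto
    then show ?thesis by (auto simp: filter_empty_conv)
  qed
  have ck: "length (filter (\<lambda>x. fst x = k) ?C) = rs ! k + (if k = 0 then 0 else rs ! (k - 1)) \<and>
     (let A = filter (\<lambda>x. fst x = k) ?C in rs ! k = 0 \<or> list_all (\<lambda>x. snd x = snd (hd A)) A \<and>
        list_all (\<lambda>x. fst x = Suc k \<longrightarrow> snd x = Suc (snd (hd A))) ?C)" if "k < n" for k
    using rc that by (simp add: rank_check_def list_all_iff)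
  show ?thesis
  proof (rule greedy_presents[where C = C and r = "\<lambda>k. rs ! k", OF _ _ dist mono _ _ _ _ k phi])
    show "card (C 0) = rs ! 0" using ck[of 0] k cardC[of 0] by simp
    show "card (C (Suc k)) = rs ! Suc k + rs ! k" if "Suc k < n" for k using ck[OF that] cardC[of "Suc k"] by simp
    show "rs ! k = 0 \<or> (\<exists>j. (\<forall>\<kappa>\<in>C k. e \<kappa> = j) \<and> (\<forall>\<kappa>\<in>C (Suc k). e \<kappa> = Suc j))" if kn: "k < n" for k
    proof (cases "rs ! k = 0")
      case True
      then show ?thesis ..
    next
      case False
      define j where "j = snd (hd (filter (\<lambda>x. fst x = k) ?C))"
      have a: "\<forall>x\<in>set ?C. fst x = k \<longrightarrow> snd x = j" "\<forall>x\<in>set ?C. fst x = Suc k \<longrightarrow> snd x = Suc j"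
        using ck[OF kn] False by (auto simp: Let_def list_all_iff j_def)
      have "e \<kappa> = j" if "\<kappa> \<in> C k" for \<kappa> using a(1) member[OF that] by fastforce
      moreover have "e \<kappa> = Suc j" if "\<kappa> \<in> C (Suc k)" for \<kappa> using a(2) member[OF that] by fastforce
      ultimately show ?thesis by blast
    qed
  qed (simp_all add: C_def)
qed

section \<open>Cyclotomic factorisation of Poincare polynomials\<close>

lemma cyclotomic_1: "cyclotomic 1 = monom 1 1 - 1"
proof -
  have "{d :: nat. d dvd 1} = {1}" by auto
  then show ?thesis using prod_cyclotomic[of 1] by simp
qed

lemma qint_geometric: "(monom 1 1 - 1) * qint x = monom 1 x - 1"
proof (induction x)
  case (Suc x)
  have "qint (Suc x) = qint x + monom 1 x" by (simp add: qint_def)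
  then show ?case using Suc by (simp add: distrib_left left_diff_distrib mult_monom)
qed (simp add: qint_def one_pCons monom_0)

text \<open>This is (q^x - 1)/(q - 1) with the factor for d = 1 cancelled. The product runs over a
  fixed list \<open>dl\<close> containing all other divisors, so that different degrees can be
  multiplied factor by factor.\<close>

lemma qint_cyclotomic:
  assumes x: "x > 0" and dl: "distinct dl" "\<forall>d\<in>set dl. 1 < d" and div: "\<And>d. d dvd x \<Longrightarrow> 1 < d \<Longrightarrow> d \<in> set dl"
  shows "qint x = prod_list (map (\<lambda>d. if d dvd x then cyclotomic d else 1) dl)"
proof -
  have fin: "finite {d. d dvd x}" using x by simp
  have "(monom 1 1 - 1) * qint x = (\<Prod>d\<in>{d. d dvd x}. cyclotomic d)"
    using prod_cyclotomic[OF x] qint_geometric by simp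
  also have "\<dots> = cyclotomic 1 * (\<Prod>d\<in>{d. d dvd x} - {1}. cyclotomic d)"
    using fin by (intro prod.remove) auto
  finally have "cyclotomic 1 * qint x = cyclotomic 1 * (\<Prod>d\<in>{d. d dvd x} - {1}. cyclotomic d)"
    by (simp only: cyclotomic_1)
  then have "qint x = (\<Prod>d\<in>{d. d dvd x} - {1}. cyclotomic d)"
    using cyclotomic_nonzero[of 1] by (simp only: mult_cancel_left) simp
  also have "{d. d dvd x} - {1} = {d \<in> set dl. d dvd x}"
  proof (intro equalityI subsetI)
    fix d assume d: "d \<in> {d. d dvd x} - {1}"
    then have "d \<noteq> 0" using x by (intro notI) simp
    then show "d \<in> {d \<in> set dl. d dvd x}" using d div[of d] by auto
  qed (use dl in auto)
  also have "(\<Prod>d\<in>{d \<in> set dl. d dvd x}. cyclotomic d) = (\<Prod>d\<in>set dl. if d dvd x then cyclotomic d else 1)"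
    by (simp add: prod.If_cases Int_def)
  also have "\<dots> = prod_list (map (\<lambda>d. if d dvd x then cyclotomic d else 1) dl)"
    by (rule prod.distinct_set_conv_list[OF dl(1)])
  finally show ?thesis .
qed

text \<open>The exponents of the cyclotomic polynomials in the product formula: the d-th one divides
  \<open>qint x\<close> exactly once if d divides x, for d > 1, and not at all otherwise.\<close>

definition multiplicities :: "nat list \<Rightarrow> nat list \<Rightarrow> nat list" where
  "multiplicities dl ds = map (\<lambda>d. length (filter (\<lambda>x. d dvd x) ds)) dl"

lemma prod_list_map_mult:
  fixes f g :: "'a \<Rightarrow> 'b::comm_monoid_mult"
  shows "prod_list (map (\<lambda>d. f d * g d) dl) = prod_list (map f dl) * prod_list (map g dl)"
  by (induction dl) (simp_all add: ac_simps)

lemma qprod_cyclotomic: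
  assumes dl: "distinct dl" "\<forall>d\<in>set dl. 1 < d"
    and ds: "\<And>x. x \<in> set ds \<Longrightarrow> x > 0 \<and> (\<forall>d. d dvd x \<longrightarrow> 1 < d \<longrightarrow> d \<in> set dl)"
  shows "qprod ds = prod_list (map (\<lambda>d. cyclotomic d ^ length (filter (\<lambda>x. d dvd x) ds)) dl)"
  using ds
proof (induction ds)
  case Nil
  then show ?case by (induction dl) (simp_all add: qprod_def)
next
  case (Cons x ds)
  have "qprod (x # ds) = qint x * qprod ds" by (simp add: qprod_def)
  also have "\<dots> = prod_list (map (\<lambda>d. (if d dvd x then cyclotomic d else 1) *
      cyclotomic d ^ length (filter (\<lambda>x. d dvd x) ds)) dl)"
  proof -
    have "qint x = prod_list (map (\<lambda>d. if d dvd x then cyclotomic d else 1) dl)"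
      by (rule qint_cyclotomic[OF _ dl]) (use Cons.prems[of x] in simp_all)
    moreover have "qprod ds = prod_list (map (\<lambda>d. cyclotomic d ^ length (filter (\<lambda>x. d dvd x) ds)) dl)"
      by (rule Cons.IH, rule Cons.prems) simp
    ultimately show ?thesis by (simp only: prod_list_map_mult)
  qed
  also have "\<dots> = prod_list (map (\<lambda>d. cyclotomic d ^ length (filter (\<lambda>x. d dvd x) (x # ds))) dl)"
    by (intro arg_cong[where f = prod_list] map_cong) auto
  finally show ?case .
qed

lemma prod_list_power_dvd:
  fixes b :: "'a \<Rightarrow> 'b::comm_semiring_1"
  shows "(\<And>d. d \<in> set ds \<Longrightarrow> f d \<le> g d) \<Longrightarrow> prod_list (map (\<lambda>d. b d ^ f d) ds) dvd prod_list (map (\<lambda>d. b d ^ g d) ds)"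
  by (induction ds) (simp_all add: mult_dvd_mono le_imp_power_dvd)

definition multiplicity_table :: "nat list \<Rightarrow> degree_table \<Rightarrow> (nat list \<times> nat list) list" where
  "multiplicity_table dl tab = map (\<lambda>(K, s, ds). (K, multiplicities dl ds)) tab"

text \<open>\<open>None\<close> is reserved for the full vertex set. A failed table lookup yields
  the empty vector instead, whose wrong length is then detected by
  \<open>lengths_ok\<close>.\<close>

definition leaf_multiplicities :: "int list list \<Rightarrow> nat \<Rightarrow> nat list \<Rightarrow> (nat list \<times> nat list) list \<Rightarrow> nat list \<Rightarrow> nat list option" where
  "leaf_multiplicities rows N zs vt T = (if length T = N then None else
     case those (map (map_of vt) (components rows N T)) of None \<Rightarrow> Some []
     | Some vs \<Rightarrow> Some (foldr (map2 (+)) vs zs))"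

text \<open>One tree carries the exponents of all cyclotomic polynomials as vectors, so components
  and degrees are evaluated once; the certificates look at its projections.\<close>

definition multiplicity_trie :: "((nat \<times> nat) \<times> enat) list \<Rightarrow> nat \<Rightarrow> nat list \<Rightarrow> degree_table \<Rightarrow> nat list option trie" where
  "multiplicity_trie es n dl tab = build (Suc n) 0 []
     (leaf_multiplicities (cartan_rows es (Suc n)) (Suc n) (multiplicities dl []) (multiplicity_table dl tab))"

fun lengths_ok :: "nat \<Rightarrow> nat list option trie \<Rightarrow> bool" where
  "lengths_ok L (Leaf a) = (case a of None \<Rightarrow> True | Some v \<Rightarrow> length v = L)"
| "lengths_ok L (Node l r) = (lengths_ok L l \<and> lengths_ok L r)"

fun check_all :: "nat \<Rightarrow> nat list option trie \<Rightarrow> nat \<Rightarrow> (nat \<times> nat list \<times> nat list) list \<Rightarrow> bool" where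
  "check_all n t i [] = True"
| "check_all n t i ((d, vs, rs) # cs) =
    (cert_check n (map_trie (map_option (\<lambda>v. v ! i)) t) vs rs \<and> check_all n t (Suc i) cs)"

definition certificates_ok :: "nat \<Rightarrow> (nat \<times> nat list \<times> nat list) list \<Rightarrow> nat list option trie \<Rightarrow> bool" where
  "certificates_ok n cs t \<longleftrightarrow> lengths_ok (length cs) t \<and> check_all n t 0 cs"

definition diagram_ok :: "((nat \<times> nat) \<times> enat) list \<Rightarrow> nat \<Rightarrow> degree_table \<Rightarrow> nat list \<Rightarrow> int list \<Rightarrow> bool" where
  "diagram_ok es n tab dl cs \<longleftrightarrow> valid_diagram es n \<and> 0 < n \<and> ((\<forall>x\<in>set es. snd x \<noteq> \<infinity>) \<or> n = 1) \<and>
     list_all (\<lambda>(K, s, ds). K \<noteq> [] \<and> list_all (\<lambda>x. list_all (\<lambda>d. d dvd x \<longrightarrow> List.member dl d) [2..<Suc x]) ds) tab \<and>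
     distinct dl \<and> dl \<noteq> [] \<and> list_all (\<lambda>d. 1 < d) dl \<and> length cs = Suc n \<and> list_all (\<lambda>c. 0 < c) cs \<and>
     list_all (\<lambda>r. sum_list (map2 (*) cs r) = 0) (cartan_rows es (Suc n))"


section \<open>From evaluated certificates to the homology modules\<close>

lemma lengths_ok_val: "lengths_ok L t \<Longrightarrow> val i t \<sigma> = Some v \<Longrightarrow> length v = L"
  by (induction t arbitrary: i) (auto split: if_splits)

lemma check_all_nth: "check_all n t i cs \<Longrightarrow> j < length cs \<Longrightarrow>
    cert_check n (map_trie (map_option (\<lambda>v. v ! (i + j))) t) (fst (snd (cs ! j))) (snd (snd (cs ! j)))"
proof (induction cs arbitrary: i j)
  case (Cons c cs)
  obtain d vs rs where c: "c = (d, vs, rs)" by (cases c) auto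
  show ?case
  proof (cases j)
    case 0
    then show ?thesis using Cons.prems c by simp
  next
    case (Suc j')
    then show ?thesis using Cons.prems c Cons.IH[of "Suc i" j'] by simp
  qed
qed simp

lemma those_multiplicity_table:
  assumes "[] \<notin> fst ` set tab"
  shows "those (map (map_of (multiplicity_table dl tab)) Ks) = Some vs \<Longrightarrow>
    \<exists>dss. those (map (table_degrees tab) Ks) = Some dss \<and> vs = map (multiplicities dl) dss \<and>
      set (concat dss) \<subseteq> (\<Union>(K, s, ds)\<in>set tab. set ds)"
proof (induction Ks arbitrary: vs)
  case (Cons K Ks)
  obtain v vs' where v: "map_of (multiplicity_table dl tab) K = Some v"
      "those (map (map_of (multiplicity_table dl tab)) Ks) = Some vs'" "vs = v # vs'"
    using Cons.prems by (auto split: option.splits)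
  obtain dss where dss: "those (map (table_degrees tab) Ks) = Some dss" "vs' = map (multiplicities dl) dss"
      "set (concat dss) \<subseteq> (\<Union>(K, s, ds)\<in>set tab. set ds)" using Cons.IH[OF v(2)] by blast
  have "map_of (multiplicity_table dl tab) K = map_option (\<lambda>x. multiplicities dl (snd x)) (map_of tab K)"
    unfolding multiplicity_table_def by (induction tab) auto
  then obtain s ds where ds: "map_of tab K = Some (s, ds)" "v = multiplicities dl ds" using v(1) by (cases "map_of tab K") auto
  have K: "(K, s, ds) \<in> set tab" by (rule map_of_SomeD[OF ds(1)])
  then have "K \<noteq> []" using assms by force
  then have "table_degrees tab K = Some ds" using ds by (simp add: table_degrees_def)
  moreover have "set ds \<subseteq> (\<Union>(K, s, ds)\<in>set tab. set ds)" using K by fast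
  ultimately show ?case using dss ds(2) v(3) by (intro exI[of _ "ds # dss"]) simp
qed simp

lemma foldr_multiplicities:
  "foldr (map2 (+)) (map (multiplicities dl) dss) (multiplicities dl []) = multiplicities dl (concat dss)"
proof (induction dss)
  case (Cons ds dss)
  have "map2 (+) (multiplicities dl a) (multiplicities dl b) = multiplicities dl (a @ b)" for a b
    unfolding multiplicities_def by (rule nth_equalityI) simp_all
  then show ?case using Cons by simp
qed simp

definition cyclo_indices :: "(nat \<times> nat list \<times> nat list) list \<Rightarrow> nat \<Rightarrow> nat list" where
  "cyclo_indices cs k = concat (map (\<lambda>(d, vs, rs). replicate (rs ! k) d) cs)"

locale certified_diagram =
  fixes es :: "((nat \<times> nat) \<times> enat) list" and n :: nat and tab :: degree_table
    and cs :: "(nat \<times> nat list \<times> nat list) list" and marks :: "int list"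
  assumes diag: "diagram_ok es n tab (map fst cs) marks"
    and tab: "table_ok es n tab"
    and certs: "certificates_ok n cs (multiplicity_trie es n (map fst cs) tab)"
begin

abbreviation S :: "nat set" where "S \<equiv> {0..n}"
abbreviation m :: "nat \<Rightarrow> nat \<Rightarrow> enat" where "m \<equiv> diagram_matrix es"
abbreviation dl :: "nat list" where "dl \<equiv> map fst cs"
abbreviation rows :: "int list list" where "rows \<equiv> cartan_rows es (Suc n)"
abbreviation trie :: "nat list option trie" where "trie \<equiv> multiplicity_trie es n dl tab"

definition nodes :: "nat set \<Rightarrow> nat list" where "nodes \<sigma> = rev (filter (\<lambda>j. j \<in> \<sigma>) [0..<Suc n])"
definition degs :: "nat set \<Rightarrow> nat list" where
  "degs \<sigma> = concat (the (those (map (table_degrees tab) (components rows (Suc n) (nodes \<sigma>)))))"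
definition e :: "nat \<Rightarrow> nat set \<Rightarrow> nat" where "e d \<sigma> = length (filter (\<lambda>x. d dvd x) (degs \<sigma>))"
definition w :: "nat set \<Rightarrow> qlaurent" where "w \<sigma> = prod_list (map (\<lambda>d. phi d ^ e d \<sigma>) dl)"

lemma valid: "valid_diagram es n" and n_pos: "0 < n" and dist: "distinct dl" and dl_ne: "dl \<noteq> []"
  and dl_gt: "\<forall>d\<in>set dl. 1 < d" and bonds: "(\<forall>x\<in>set es. snd x \<noteq> \<infinity>) \<or> n = 1"
  using diag by (auto simp: diagram_ok_def list_all_iff)

lemma tab_ne: "[] \<notin> fst ` set tab"
  using diag by (auto simp: diagram_ok_def list_all_iff)

lemma tab_divisors:
  assumes "(K, s, ds) \<in> set tab" "x \<in> set ds" "d dvd x" "1 < d" "0 < x" shows "d \<in> set dl"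
proof -
  have "\<forall>d\<in>set [2..<Suc x]. d dvd x \<longrightarrow> d \<in> set dl"
    using diag assms(1,2) by (auto simp: diagram_ok_def list_all_iff simp del: upt_Suc)
  moreover have "d \<in> set [2..<Suc x]" using assms dvd_imp_le[of d x] by (simp del: upt_Suc)
  ultimately show ?thesis using assms(3) by blast
qed

lemma nodes_set: "\<sigma> \<subseteq> S \<Longrightarrow> set (nodes \<sigma>) = \<sigma>"
  by (auto simp: nodes_def simp del: upt_Suc)

lemma nodes_distinct: "distinct (nodes \<sigma>)"
  by (simp add: nodes_def del: upt_Suc)

lemma nodes_length: "\<sigma> \<subset> S \<Longrightarrow> length (nodes \<sigma>) < Suc n"
  using distinct_card[OF nodes_distinct, of \<sigma>] nodes_set[of \<sigma>] psubset_card_mono[of S \<sigma>] by auto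

lemma trie_val: "val 0 trie \<sigma> = leaf_multiplicities rows (Suc n) (multiplicities dl []) (multiplicity_table dl tab) (nodes \<sigma>)"
  unfolding multiplicity_trie_def nodes_def by (subst val_build) (simp del: upt_Suc)

lemma trie_full: "full (Suc n) trie"
  unfolding multiplicity_trie_def by (rule full_build)

lemma degs_eq:
  assumes s: "\<sigma> \<subset> S"
  shows "\<exists>dss. those (map (table_degrees tab) (components rows (Suc n) (nodes \<sigma>))) = Some dss \<and> degs \<sigma> = concat dss \<and>
    val 0 trie \<sigma> = Some (multiplicities dl (concat dss)) \<and> set (concat dss) \<subseteq> (\<Union>(K, s, ds)\<in>set tab. set ds)"
proof -
  have len: "length (nodes \<sigma>) \<noteq> Suc n" using nodes_length[OF s] by simp
  let ?Ks = "components rows (Suc n) (nodes \<sigma>)"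
  \<comment> \<open>A missing table entry would leave the empty vector at this leaf, against the
    checked length and the nonempty list \<open>dl\<close>.\<close>
  have "those (map (map_of (multiplicity_table dl tab)) ?Ks) \<noteq> None"
  proof
    assume "those (map (map_of (multiplicity_table dl tab)) ?Ks) = None"
    then have "val 0 trie \<sigma> = Some []" using len unfolding trie_val leaf_multiplicities_def by simp
    then show False using lengths_ok_val[of "length cs" trie 0 \<sigma> "[]"] certs dl_ne by (auto simp: certificates_ok_def)
  qed
  then obtain vs where vs: "those (map (map_of (multiplicity_table dl tab)) ?Ks) = Some vs" by blast
  obtain dss where dss: "those (map (table_degrees tab) ?Ks) = Some dss" "vs = map (multiplicities dl) dss"
      "set (concat dss) \<subseteq> (\<Union>(K, s, ds)\<in>set tab. set ds)"
    using those_multiplicity_table[OF tab_ne vs] by blast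
  have "val 0 trie \<sigma> = Some (multiplicities dl (concat dss))"
    using len vs unfolding trie_val leaf_multiplicities_def dss(2) by (simp add: foldr_multiplicities)
  then show ?thesis using dss by (simp add: degs_def)
qed

lemma no_infinite_bond: "\<sigma> \<subset> S \<Longrightarrow> i \<in> \<sigma> \<Longrightarrow> j \<in> \<sigma> \<Longrightarrow> m i j \<noteq> \<infinity>"
proof (cases "i = j")
  case False
  assume s: "\<sigma> \<subset> S" "i \<in> \<sigma>" "j \<in> \<sigma>"
  have "n \<noteq> 1"
  proof
    assume "n = 1"
    then have "i \<in> {0, 1}" "j \<in> {0, 1}" "S = {0, 1}" using s by auto
    then have "S \<subseteq> \<sigma>" using s False by auto
    then show False using s by auto
  qed
  then have "\<forall>x\<in>set es. snd x \<noteq> \<infinity>" using bonds by simp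
  then show ?thesis using False
    by (auto simp: diagram_matrix_def split: option.splits dest!: map_of_SomeD) (metis numeral_eq_enat infinity_ne_i0 enat.distinct(1))
qed (simp add: diagram_matrix_def one_enat_def)

lemma poincare_proper:
  assumes s: "\<sigma> \<subset> S"
  shows "finite (parabolic S m \<sigma>) \<and> poincare_poly S m \<sigma> = prod_list (map (\<lambda>d. cyclotomic d ^ e d \<sigma>) dl)"
proof -
  obtain dss where dss: "those (map (table_degrees tab) (components rows (Suc n) (nodes \<sigma>))) = Some dss" "degs \<sigma> = concat dss"
      "set (concat dss) \<subseteq> (\<Union>(K, s, ds)\<in>set tab. set ds)" using degs_eq[OF s] by blast
  have p: "finite (parabolic S m (set (nodes \<sigma>))) \<and>
      poincare_poly S m (set (nodes \<sigma>)) = qprod (concat dss) \<and> 0 \<notin> set (concat dss)"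
  proof (rule poincare_components[OF valid tab _ nodes_distinct _ _ dss(1)])
    show "length (nodes \<sigma>) \<le> Suc n" using nodes_length[OF s] by simp
    show "set (nodes \<sigma>) \<subseteq> S" using nodes_set[of \<sigma>] s by simp
    show "m i j \<noteq> \<infinity>" if "i \<in> set (nodes \<sigma>)" "j \<in> set (nodes \<sigma>)" for i j
      using no_infinite_bond[OF s] that nodes_set[of \<sigma>] s by simp
  qed
  have "qprod (concat dss) = prod_list (map (\<lambda>d. cyclotomic d ^ length (filter (\<lambda>x. d dvd x) (concat dss))) dl)"
  proof (rule qprod_cyclotomic[OF dist dl_gt])
    fix x assume x: "x \<in> set (concat dss)"
    have "0 \<notin> set (concat dss)" using p by blast
    then have x0: "0 < x" using x by (intro gr0I) blast
    obtain K s ds where "(K, s, ds) \<in> set tab" "x \<in> set ds" using dss(3) x by fast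
    then show "0 < x \<and> (\<forall>d. d dvd x \<longrightarrow> 1 < d \<longrightarrow> d \<in> set dl)" using x0 tab_divisors by blast
  qed
  then show ?thesis using p nodes_set[of \<sigma>] s dss(2) by (simp add: e_def)
qed

lemma w_laurent: "\<sigma> \<subset> S \<Longrightarrow> w \<sigma> = laurent_of_poly (poincare_poly S m \<sigma>)"
  using poincare_proper[of \<sigma>] by (simp add: w_def phi_def laurent_prod_list laurent_power o_def)

lemma infinite_total: "infinite (parabolic S m S)"
proof (rule infinite_parabolic[where z = "Suc n" and o' = 0 and c = "\<lambda>i. marks ! i", OF coxeter_diagram cartan_for_diagram[OF valid]])
  have len: "length marks = Suc n" and pos: "\<forall>c\<in>set marks. 0 < c"
      and null: "\<forall>r\<in>set rows. sum_list (map2 (*) marks r) = 0"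
    using diag by (auto simp: diagram_ok_def list_all_iff)
  fix i assume i: "i \<in> S"
  show "0 < marks ! i" using pos len i by simp
  have "length rows = Suc n" by (simp add: cartan_rows_def)
  then have r: "rows ! i \<in> set rows" "length (rows ! i) = Suc n"
    using i nth_mem[of i rows] by (simp_all add: cartan_rows_def del: upt_Suc)
  have "sum_list (map2 (*) marks (rows ! i)) = (\<Sum>j=0..<Suc n. map2 (*) marks (rows ! i) ! j)"
    using r len by (simp add: sum_list_sum_nth del: sum.op_ivl_Suc)
  also have "\<dots> = (\<Sum>j=0..<Suc n. marks ! j * cartan es i j)"
    using r len i by (intro sum.cong) (auto simp: cartan_rows_nth)
  also have "{0..<Suc n} = S" by auto
  finally show "(\<Sum>j\<in>S. marks ! j * cartan es i j) = 0" using null r(1) by simp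
qed simp_all

lemma finite_types: "finite_type_subsets S m = {\<sigma>. \<sigma> \<subset> S}"
  using poincare_proper infinite_total by (auto simp: finite_type_subsets_def psubset_eq)

lemma index:
  assumes "i < length cs" "\<sigma> \<subset> S"
  shows "val 0 (map_trie (map_option (\<lambda>v. v ! i)) trie) \<sigma> = Some (e (dl ! i) \<sigma>)"
  using degs_eq[OF assms(2)] assms(1) by (auto simp: val_map e_def multiplicities_def)

lemma index_cert: "i < length cs \<Longrightarrow>
    cert_check n (map_trie (map_option (\<lambda>v. v ! i)) trie) (fst (snd (cs ! i))) (snd (snd (cs ! i)))"
  using check_all_nth[of n trie 0 cs i] certs by (simp add: certificates_ok_def)

text \<open>Monotonicity of the exponents is part of each certificate. It makes the boundary
  coefficients exact quotients and the levels a filtration.\<close>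

lemma e_mono:
  assumes "d \<in> set dl" "\<tau> \<subseteq> \<sigma>" "\<sigma> \<subset> S" shows "e d \<tau> \<le> e d \<sigma>"
proof -
  obtain i where i: "i < length cs" "dl ! i = d" using assms(1) by (metis in_set_conv_nth length_map)
  have "\<tau> \<subset> S" using assms by blast
  moreover have "mono_trie (map_trie (map_option (\<lambda>v. v ! i)) trie)" using index_cert[OF i(1)] by (simp add: cert_check_def)
  from mono_trie_val[OF this assms(2), of 0] show ?thesis
    using index[OF i(1)] assms(3) calculation i(2) by simp
qed

lemma poincare_dvd:
  assumes "\<tau> \<subseteq> \<sigma>" "\<sigma> \<subset> S" shows "poincare_poly S m \<tau> dvd poincare_poly S m \<sigma>"
proof -
  have "prod_list (map (\<lambda>d. cyclotomic d ^ e d \<tau>) dl) dvd prod_list (map (\<lambda>d. cyclotomic d ^ e d \<sigma>) dl)"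
    by (rule prod_list_power_dvd) (rule e_mono[OF _ assms])
  moreover have "\<tau> \<subset> S" using assms by blast
  ultimately show ?thesis using poincare_proper[of \<tau>] poincare_proper[OF assms(2)] by (simp only:)
qed

lemma phi_family: "d \<in> set dl \<Longrightarrow> d' \<in> set dl \<Longrightarrow> d \<noteq> d' \<Longrightarrow> bezout_coprime (phi d) (phi d')"
  using dl_gt by (intro phi_coprime) auto

lemma phi_nz: "d \<in> set dl \<Longrightarrow> phi d \<noteq> 0"
  using dl_gt by (intro phi_nonzero) auto

lemma prod_phi_nz: "prod_list (map (\<lambda>d. phi d ^ f d) dl) \<noteq> 0"
proof -
  have "prod_list (map (\<lambda>d. phi d ^ f d) ds) \<noteq> 0" if "set ds \<subseteq> set dl" for ds
    using that by (induction ds) (simp_all add: phi_nz)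
  then show ?thesis by blast
qed

lemma prod_phi_dvd_iff: "prod_list (map (\<lambda>d. phi d ^ f d) dl) dvd r \<longleftrightarrow> (\<forall>d\<in>set dl. phi d ^ f d dvd r)"
  by (rule prod_list_power_dvd_iff[OF dist phi_family])

sublocale rescaled_salvetti S m w
proof
  fix \<sigma> \<tau> :: "nat set"
  assume s: "\<sigma> \<subset> S" "\<tau> \<subset> \<sigma>"
  then have t: "\<tau> \<subset> S" by blast
  have "laurent_of_poly (poincare_poly S m \<sigma> div poincare_poly S m \<tau>) * w \<tau> =
      laurent_of_poly (poincare_poly S m \<sigma> div poincare_poly S m \<tau> * poincare_poly S m \<tau>)"
    by (simp only: w_laurent[OF t] laurent_mult)
  also have "poincare_poly S m \<sigma> div poincare_poly S m \<tau> * poincare_poly S m \<tau> = poincare_poly S m \<sigma>"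
    by (rule dvd_div_mult_self[OF poincare_dvd]) (use s in auto)
  finally show "laurent_of_poly (poincare_poly S m \<sigma> div poincare_poly S m \<tau>) * w \<tau> = w \<sigma>"
    by (simp only: w_laurent[OF s(1)])
next
  show "w \<sigma> \<noteq> 0" for \<sigma> unfolding w_def by (rule prod_phi_nz)
qed (simp_all add: finite_types)

lemma presents_index:
  assumes i: "i < length cs" and k: "k < n"
  shows "presents S k (weight_lattice S (\<lambda>\<sigma>. phi (dl ! i) ^ e (dl ! i) \<sigma>)) (replicate (snd (snd (cs ! i)) ! k) (phi (dl ! i)))"
proof (rule cert_presents[OF index_cert[OF i] _ _ _ k])
  show "full (Suc n) (map_trie (map_option (\<lambda>v. v ! i)) trie)" by (simp add: full_map trie_full)
  have "length (nodes S) = Suc n" using distinct_card[OF nodes_distinct, of S] nodes_set[of S] by simp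
  then show "val 0 (map_trie (map_option (\<lambda>v. v ! i)) trie) S = None"
    by (simp add: val_map trie_val leaf_multiplicities_def)
  show "phi (dl ! i) \<noteq> 0" using i by (intro phi_nz) simp
qed (rule index[OF i])

theorem homology_below_top:
  assumes k: "k < n" shows "salvetti_homology S m k \<cong>\<^sub>R cyclo_sum (cyclo_indices cs k)"
proof -
  define r where "r = (\<lambda>d. snd (the (map_of cs d)) ! k)"
  have r: "r (dl ! i) = snd (snd (cs ! i)) ! k" if "i < length cs" for i
  proof -
    have "(fst (cs ! i), snd (cs ! i)) \<in> set cs" using that by simp
    then have "map_of cs (fst (cs ! i)) = Some (snd (cs ! i))" using dist by (simp add: map_of_eq_Some_iff)
    then show ?thesis using that by (simp add: r_def)
  qed
  define N where "N = Max ((\<lambda>(d, \<sigma>). e d \<sigma>) ` (set dl \<times> Pow S))"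
  have "presents S k (weight_lattice S (\<lambda>\<sigma>. prod_list (map (\<lambda>d. phi d ^ e d \<sigma>) dl)))
      (concat (map (\<lambda>d. replicate (r d) (phi d)) dl))"
  proof (rule presents_family[where N = N])
    show "e d \<sigma> \<le> N" if "d \<in> set dl" "\<sigma> \<subset> S" for d \<sigma>
      unfolding N_def using that by (intro Max_ge) (auto intro!: image_eqI[of _ _ "(d, \<sigma>)"])
    fix d assume "d \<in> set dl"
    then obtain i where i: "i < length cs" "dl ! i = d" by (metis in_set_conv_nth length_map)
    then show "presents S k (weight_lattice S (\<lambda>\<sigma>. phi d ^ e d \<sigma>)) (replicate (r d) (phi d))"
      using presents_index[OF i(1) k] r[OF i(1)] by simp
  qed (use dist phi_family in simp_all)
  then have "presents S k (weight_lattice S w) (concat (map (\<lambda>d. replicate (r d) (phi d)) dl))"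
    by (simp only: w_def[abs_def])
  moreover have "concat (map (\<lambda>d. replicate (r d) (phi d)) dl) = map phi (cyclo_indices cs k)"
  proof -
    have "map (\<lambda>d. replicate (r d) (phi d)) dl = map (map phi) (map (\<lambda>(d, vs, rs). replicate (rs ! k) d) cs)"
      by (rule nth_equalityI) (use r in \<open>simp_all add: case_prod_unfold\<close>)
    then show ?thesis by (simp only: cyclo_indices_def map_concat)
  qed
  ultimately have "presents S k (weight_lattice S w) (map phi (cyclo_indices cs k))" by simp
  from homology_iso_sum[OF _ this] k show ?thesis by (simp add: cyclo_sum_eq)
qed

text \<open>The least common multiple of the facet weights takes the largest exponent of each
  cyclotomic polynomial; its universal property follows from pairwise coprimality.\<close>

theorem homology_top: "salvetti_homology S m n \<cong>\<^sub>R free_rank_one"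
proof (rule homology_iso_top)
  define M where "M = (\<lambda>d. Max ((\<lambda>s. e d (S - {s})) ` S))"
  show "card S = Suc n" by simp
  show "prod_list (map (\<lambda>d. phi d ^ M d) dl) \<noteq> 0" by (rule prod_phi_nz)
  show "w (S - {s}) dvd prod_list (map (\<lambda>d. phi d ^ M d) dl)" if "s \<in> S" for s
  proof -
    have "e d (S - {s}) \<le> M d" for d unfolding M_def using that by (intro Max_ge) auto
    then show ?thesis unfolding w_def by (rule prod_list_power_dvd)
  qed
  fix r assume r: "\<And>s. s \<in> S \<Longrightarrow> w (S - {s}) dvd r"
  have "phi d ^ M d dvd r" if d: "d \<in> set dl" for d
  proof -
    have "M d \<in> (\<lambda>s. e d (S - {s})) ` S" unfolding M_def by (rule Max_in) simp_all
    then obtain s where s: "s \<in> S" "M d = e d (S - {s})" by blast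
    have "w (S - {s}) dvd r" by (rule r[OF s(1)])
    then show ?thesis using d unfolding w_def prod_phi_dvd_iff s(2) by blast
  qed
  then show "prod_list (map (\<lambda>d. phi d ^ M d) dl) dvd r"
    unfolding prod_phi_dvd_iff by blast
qed

end

section \<open>The exceptional affine types\<close>

text \<open>A table entry \<open>(K, s, ds)\<close> lists a connected set \<open>K\<close> of nodes, a node \<open>s\<close> whose removal leaves it
  connected, and the degrees of \<open>W\<^sub>K\<close>. An entry \<open>(d, vs, rs)\<close> of a list of matchings gives an order \<open>vs\<close> of
  the nodes, found by random search, for which the greedy matching is optimal, and the multiplicities
  \<open>rs\<close> of \<open>{d}\<close> in the homology below the top degree.\<close>

definition i1_table :: degree_table where
  "i1_table = [
    ([0], 0, [2]), ([1], 1, [2])]"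

definition i1_matchings :: "(nat \<times> nat list \<times> nat list) list" where
  "i1_matchings = [
    (2, [0, 1], [1])]"

lemma i1_diagram_ok: "diagram_ok (affine_diagram I1_tilde) 1 i1_table (map fst i1_matchings) [1, 1]"
  by code_simp

lemma i1_table_ok: "table_ok (affine_diagram I1_tilde) 1 i1_table"
  by code_simp

lemma i1_matchings_ok: "certificates_ok 1 i1_matchings
    (multiplicity_trie (affine_diagram I1_tilde) 1 (map fst i1_matchings) i1_table)"
  by code_simp

interpretation i1: certified_diagram "affine_diagram I1_tilde" 1 i1_table i1_matchings "[1, 1]"
  by unfold_locales (fact i1_diagram_ok i1_table_ok i1_matchings_ok)+

definition g2_table :: degree_table where
  "g2_table = [
    ([0], 0, [2]), ([1], 1, [2]), ([2], 2, [2]), ([0, 1], 0, [2, 3]), ([1, 2], 1, [2, 6])]"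

text \<open>An entry with ranks 0 has content too: the 6th cyclotomic polynomial divides the
  Poincare polynomial of {1, 2}, and its part of the complex has to be shown acyclic below the top
  degree.\<close>

definition g2_matchings :: "(nat \<times> nat list \<times> nat list) list" where
  "g2_matchings = [
    (2, [0, 1, 2], [1, 1]), (3, [0, 1, 2], [0, 1]), (6, [0, 1, 2], [0, 0])]"

lemma g2_diagram_ok: "diagram_ok (affine_diagram G2_tilde) 2 g2_table (map fst g2_matchings) [1, 2, 1]"
  by code_simp

lemma g2_table_ok: "table_ok (affine_diagram G2_tilde) 2 g2_table"
  by code_simp

lemma g2_matchings_ok: "certificates_ok 2 g2_matchings
    (multiplicity_trie (affine_diagram G2_tilde) 2 (map fst g2_matchings) g2_table)"
  by code_simp

interpretation g2: certified_diagram "affine_diagram G2_tilde" 2 g2_table g2_matchings "[1, 2, 1]"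
  by unfold_locales (fact g2_diagram_ok g2_table_ok g2_matchings_ok)+

definition f4_table :: degree_table where
  "f4_table = [
    ([0], 0, [2]), ([1], 1, [2]), ([2], 2, [2]), ([3], 3, [2]), ([4], 4, [2]), ([0, 1], 0, [2, 3]),
    ([1, 2], 1, [2, 3]), ([2, 3], 2, [2, 4]), ([3, 4], 3, [2, 3]), ([0, 1, 2], 0, [2, 3, 4]),
    ([1, 2, 3], 1, [2, 4, 6]), ([2, 3, 4], 4, [2, 4, 6]), ([0, 1, 2, 3], 0, [2, 4, 6, 8]),
    ([1, 2, 3, 4], 1, [2, 6, 8, 12])]"

definition f4_matchings :: "(nat \<times> nat list \<times> nat list) list" where
  "f4_matchings = [
    (2, [0, 1, 2, 3, 4], [1, 1, 1, 2]), (3, [0, 1, 2, 3, 4], [0, 0, 1, 1]), (4, [0, 1, 2, 3, 4], [0, 0, 0, 1]),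
    (6, [0, 1, 2, 3, 4], [0, 0, 0, 0]), (8, [0, 1, 2, 3, 4], [0, 0, 0, 1]), (12, [0, 1, 2, 3, 4], [0, 0, 0, 0])]"

lemma f4_diagram_ok: "diagram_ok (affine_diagram F4_tilde) 4 f4_table (map fst f4_matchings) [1, 2, 3, 2, 1]"
  by code_simp

lemma f4_table_ok: "table_ok (affine_diagram F4_tilde) 4 f4_table"
  by code_simp

lemma f4_matchings_ok: "certificates_ok 4 f4_matchings
    (multiplicity_trie (affine_diagram F4_tilde) 4 (map fst f4_matchings) f4_table)"
  by code_simp

interpretation f4: certified_diagram "affine_diagram F4_tilde" 4 f4_table f4_matchings "[1, 2, 3, 2, 1]"
  by unfold_locales (fact f4_diagram_ok f4_table_ok f4_matchings_ok)+

definition e6_table :: degree_table where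
  "e6_table = [
    ([0], 0, [2]), ([1], 1, [2]), ([2], 2, [2]), ([3], 3, [2]), ([4], 4, [2]), ([5], 5, [2]), ([6], 6, [2]),
    ([0, 2], 0, [2, 3]), ([1, 3], 1, [2, 3]), ([2, 4], 2, [2, 3]), ([3, 4], 3, [2, 3]), ([4, 5], 4, [2, 3]),
    ([5, 6], 5, [2, 3]), ([0, 2, 4], 0, [2, 3, 4]), ([1, 3, 4], 1, [2, 3, 4]), ([2, 3, 4], 2, [2, 3, 4]),
    ([2, 4, 5], 2, [2, 3, 4]), ([3, 4, 5], 3, [2, 3, 4]), ([4, 5, 6], 4, [2, 3, 4]),
    ([0, 2, 3, 4], 0, [2, 3, 4, 5]), ([0, 2, 4, 5], 0, [2, 3, 4, 5]), ([1, 2, 3, 4], 1, [2, 3, 4, 5]),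
    ([1, 3, 4, 5], 1, [2, 3, 4, 5]), ([2, 3, 4, 5], 2, [2, 4, 4, 6]), ([2, 4, 5, 6], 2, [2, 3, 4, 5]),
    ([3, 4, 5, 6], 3, [2, 3, 4, 5]), ([0, 1, 2, 3, 4], 0, [2, 3, 4, 5, 6]),
    ([0, 2, 3, 4, 5], 0, [2, 4, 5, 6, 8]), ([0, 2, 4, 5, 6], 0, [2, 3, 4, 5, 6]),
    ([1, 2, 3, 4, 5], 1, [2, 4, 5, 6, 8]), ([1, 3, 4, 5, 6], 1, [2, 3, 4, 5, 6]),
    ([2, 3, 4, 5, 6], 6, [2, 4, 5, 6, 8]), ([0, 1, 2, 3, 4, 5], 0, [2, 5, 6, 8, 9, 12]),
    ([0, 2, 3, 4, 5, 6], 0, [2, 5, 6, 8, 9, 12]), ([1, 2, 3, 4, 5, 6], 1, [2, 5, 6, 8, 9, 12])]"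

definition e6_matchings :: "(nat \<times> nat list \<times> nat list) list" where
  "e6_matchings = [
    (2, [1, 4, 0, 2, 5, 6, 3], [1, 0, 0, 0, 0, 1]), (3, [3, 5, 6, 1, 0, 4, 2], [0, 0, 0, 1, 0, 3]),
    (4, [6, 3, 5, 0, 2, 1, 4], [0, 0, 0, 0, 0, 0]), (5, [5, 1, 4, 0, 6, 3, 2], [0, 0, 0, 0, 1, 0]),
    (6, [0, 5, 4, 6, 1, 3, 2], [0, 0, 0, 0, 0, 2]), (8, [5, 0, 4, 1, 3, 2, 6], [0, 0, 0, 0, 1, 0]),
    (9, [2, 1, 5, 3, 4, 0, 6], [0, 0, 0, 0, 0, 2]), (12, [6, 4, 0, 1, 2, 3, 5], [0, 0, 0, 0, 0, 2])]"

lemma e6_diagram_ok: "diagram_ok (affine_diagram E6_tilde) 6 e6_table (map fst e6_matchings) [1, 1, 2, 2, 3, 2, 1]"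
  by code_simp

lemma e6_table_ok: "table_ok (affine_diagram E6_tilde) 6 e6_table"
  by code_simp

lemma e6_matchings_ok: "certificates_ok 6 e6_matchings
    (multiplicity_trie (affine_diagram E6_tilde) 6 (map fst e6_matchings) e6_table)"
  by code_simp

interpretation e6: certified_diagram "affine_diagram E6_tilde" 6 e6_table e6_matchings "[1, 1, 2, 2, 3, 2, 1]"
  by unfold_locales (fact e6_diagram_ok e6_table_ok e6_matchings_ok)+

definition e7_table :: degree_table where
  "e7_table = [
    ([0], 0, [2]), ([1], 1, [2]), ([2], 2, [2]), ([3], 3, [2]), ([4], 4, [2]), ([5], 5, [2]), ([6], 6, [2]),
    ([7], 7, [2]), ([0, 1], 0, [2, 3]), ([1, 3], 1, [2, 3]), ([2, 4], 2, [2, 3]), ([3, 4], 3, [2, 3]),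
    ([4, 5], 4, [2, 3]), ([5, 6], 5, [2, 3]), ([6, 7], 6, [2, 3]), ([0, 1, 3], 0, [2, 3, 4]),
    ([1, 3, 4], 1, [2, 3, 4]), ([2, 3, 4], 2, [2, 3, 4]), ([2, 4, 5], 2, [2, 3, 4]), ([3, 4, 5], 3, [2, 3, 4]),
    ([4, 5, 6], 4, [2, 3, 4]), ([5, 6, 7], 5, [2, 3, 4]), ([0, 1, 3, 4], 0, [2, 3, 4, 5]),
    ([1, 2, 3, 4], 1, [2, 3, 4, 5]), ([1, 3, 4, 5], 1, [2, 3, 4, 5]), ([2, 3, 4, 5], 2, [2, 4, 4, 6]),
    ([2, 4, 5, 6], 2, [2, 3, 4, 5]), ([3, 4, 5, 6], 3, [2, 3, 4, 5]), ([4, 5, 6, 7], 4, [2, 3, 4, 5]),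
    ([0, 1, 2, 3, 4], 0, [2, 3, 4, 5, 6]), ([0, 1, 3, 4, 5], 0, [2, 3, 4, 5, 6]),
    ([1, 2, 3, 4, 5], 1, [2, 4, 5, 6, 8]), ([1, 3, 4, 5, 6], 1, [2, 3, 4, 5, 6]),
    ([2, 3, 4, 5, 6], 6, [2, 4, 5, 6, 8]), ([2, 4, 5, 6, 7], 2, [2, 3, 4, 5, 6]),
    ([3, 4, 5, 6, 7], 3, [2, 3, 4, 5, 6]), ([0, 1, 2, 3, 4, 5], 0, [2, 4, 6, 6, 8, 10]),
    ([0, 1, 3, 4, 5, 6], 0, [2, 3, 4, 5, 6, 7]), ([1, 2, 3, 4, 5, 6], 1, [2, 5, 6, 8, 9, 12]),
    ([1, 3, 4, 5, 6, 7], 1, [2, 3, 4, 5, 6, 7]), ([2, 3, 4, 5, 6, 7], 7, [2, 4, 6, 6, 8, 10]),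
    ([0, 1, 2, 3, 4, 5, 6], 0, [2, 6, 8, 10, 12, 14, 18]), ([0, 1, 3, 4, 5, 6, 7], 0, [2, 3, 4, 5, 6, 7, 8]),
    ([1, 2, 3, 4, 5, 6, 7], 7, [2, 6, 8, 10, 12, 14, 18])]"

definition e7_matchings :: "(nat \<times> nat list \<times> nat list) list" where
  "e7_matchings = [
    (2, [5, 7, 6, 4, 3, 2, 0, 1], [1, 0, 0, 0, 0, 0, 3]), (3, [4, 7, 3, 6, 5, 2, 0, 1], [0, 0, 0, 1, 0, 0, 1]),
    (4, [3, 5, 7, 6, 1, 4, 2, 0], [0, 0, 0, 0, 0, 0, 1]), (5, [7, 5, 4, 0, 1, 2, 3, 6], [0, 0, 0, 0, 0, 0, 0]),
    (6, [7, 5, 0, 3, 6, 1, 2, 4], [0, 0, 0, 0, 0, 0, 1]), (7, [2, 4, 1, 0, 5, 7, 6, 3], [0, 0, 0, 0, 0, 0, 0]),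
    (8, [5, 6, 4, 2, 3, 1, 0, 7], [0, 0, 0, 0, 0, 0, 1]), (9, [2, 4, 6, 1, 3, 0, 5, 7], [0, 0, 0, 0, 0, 0, 0]),
    (10, [3, 4, 7, 5, 2, 1, 6, 0], [0, 0, 0, 0, 0, 0, 1]),
    (12, [5, 3, 4, 0, 1, 2, 7, 6], [0, 0, 0, 0, 0, 0, 0]),
    (14, [1, 6, 4, 2, 0, 5, 3, 7], [0, 0, 0, 0, 0, 0, 1]), (18, [0, 3, 7, 2, 1, 6, 5, 4], [0, 0, 0, 0, 0, 0, 1])]"

lemma e7_diagram_ok: "diagram_ok (affine_diagram E7_tilde) 7 e7_table (map fst e7_matchings) [1, 2, 2, 3, 4, 3, 2, 1]"
  by code_simp

lemma e7_table_ok: "table_ok (affine_diagram E7_tilde) 7 e7_table"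
  by code_simp

lemma e7_matchings_ok: "certificates_ok 7 e7_matchings
    (multiplicity_trie (affine_diagram E7_tilde) 7 (map fst e7_matchings) e7_table)"
  by code_simp

interpretation e7: certified_diagram "affine_diagram E7_tilde" 7 e7_table e7_matchings "[1, 2, 2, 3, 4, 3, 2, 1]"
  by unfold_locales (fact e7_diagram_ok e7_table_ok e7_matchings_ok)+

definition e8_table :: degree_table where
  "e8_table = [
    ([0], 0, [2]), ([1], 1, [2]), ([2], 2, [2]), ([3], 3, [2]), ([4], 4, [2]), ([5], 5, [2]), ([6], 6, [2]),
    ([7], 7, [2]), ([8], 8, [2]), ([0, 8], 0, [2, 3]), ([1, 3], 1, [2, 3]), ([2, 4], 2, [2, 3]),
    ([3, 4], 3, [2, 3]), ([4, 5], 4, [2, 3]), ([5, 6], 5, [2, 3]), ([6, 7], 6, [2, 3]), ([7, 8], 7, [2, 3]),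
    ([0, 7, 8], 0, [2, 3, 4]), ([1, 3, 4], 1, [2, 3, 4]), ([2, 3, 4], 2, [2, 3, 4]), ([2, 4, 5], 2, [2, 3, 4]),
    ([3, 4, 5], 3, [2, 3, 4]), ([4, 5, 6], 4, [2, 3, 4]), ([5, 6, 7], 5, [2, 3, 4]), ([6, 7, 8], 6, [2, 3, 4]),
    ([0, 6, 7, 8], 0, [2, 3, 4, 5]), ([1, 2, 3, 4], 1, [2, 3, 4, 5]), ([1, 3, 4, 5], 1, [2, 3, 4, 5]),
    ([2, 3, 4, 5], 2, [2, 4, 4, 6]), ([2, 4, 5, 6], 2, [2, 3, 4, 5]), ([3, 4, 5, 6], 3, [2, 3, 4, 5]),
    ([4, 5, 6, 7], 4, [2, 3, 4, 5]), ([5, 6, 7, 8], 5, [2, 3, 4, 5]), ([0, 5, 6, 7, 8], 0, [2, 3, 4, 5, 6]),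
    ([1, 2, 3, 4, 5], 1, [2, 4, 5, 6, 8]), ([1, 3, 4, 5, 6], 1, [2, 3, 4, 5, 6]),
    ([2, 3, 4, 5, 6], 6, [2, 4, 5, 6, 8]), ([2, 4, 5, 6, 7], 2, [2, 3, 4, 5, 6]),
    ([3, 4, 5, 6, 7], 3, [2, 3, 4, 5, 6]), ([4, 5, 6, 7, 8], 4, [2, 3, 4, 5, 6]),
    ([0, 4, 5, 6, 7, 8], 0, [2, 3, 4, 5, 6, 7]), ([1, 2, 3, 4, 5, 6], 1, [2, 5, 6, 8, 9, 12]),
    ([1, 3, 4, 5, 6, 7], 1, [2, 3, 4, 5, 6, 7]), ([2, 3, 4, 5, 6, 7], 7, [2, 4, 6, 6, 8, 10]),
    ([2, 4, 5, 6, 7, 8], 2, [2, 3, 4, 5, 6, 7]), ([3, 4, 5, 6, 7, 8], 3, [2, 3, 4, 5, 6, 7]),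
    ([0, 2, 4, 5, 6, 7, 8], 0, [2, 3, 4, 5, 6, 7, 8]), ([0, 3, 4, 5, 6, 7, 8], 0, [2, 3, 4, 5, 6, 7, 8]),
    ([1, 2, 3, 4, 5, 6, 7], 7, [2, 6, 8, 10, 12, 14, 18]), ([1, 3, 4, 5, 6, 7, 8], 1, [2, 3, 4, 5, 6, 7, 8]),
    ([2, 3, 4, 5, 6, 7, 8], 8, [2, 4, 6, 7, 8, 10, 12]),
    ([0, 1, 3, 4, 5, 6, 7, 8], 0, [2, 3, 4, 5, 6, 7, 8, 9]),
    ([0, 2, 3, 4, 5, 6, 7, 8], 0, [2, 4, 6, 8, 8, 10, 12, 14]),
    ([1, 2, 3, 4, 5, 6, 7, 8], 8, [2, 8, 12, 14, 18, 20, 24, 30])]"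

definition e8_matchings :: "(nat \<times> nat list \<times> nat list) list" where
  "e8_matchings = [
    (2, [8, 6, 4, 1, 7, 3, 0, 2, 5], [1, 0, 0, 0, 0, 0, 0, 2]),
    (3, [0, 8, 4, 1, 6, 3, 7, 2, 5], [0, 0, 0, 0, 0, 0, 0, 1]),
    (4, [3, 5, 0, 1, 4, 8, 2, 6, 7], [0, 0, 0, 0, 1, 0, 0, 1]),
    (5, [1, 6, 2, 4, 3, 0, 8, 7, 5], [0, 0, 0, 0, 0, 0, 1, 1]),
    (6, [0, 2, 1, 7, 4, 6, 3, 5, 8], [0, 0, 0, 0, 0, 0, 0, 0]),
    (7, [4, 1, 6, 3, 8, 2, 5, 7, 0], [0, 0, 0, 0, 0, 0, 0, 0]),
    (8, [1, 0, 7, 8, 5, 4, 2, 6, 3], [0, 0, 0, 0, 0, 0, 1, 1]),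
    (9, [5, 4, 2, 6, 8, 0, 1, 3, 7], [0, 0, 0, 0, 0, 0, 0, 1]),
    (10, [2, 1, 8, 0, 3, 5, 7, 4, 6], [0, 0, 0, 0, 0, 0, 0, 0]),
    (12, [5, 1, 4, 6, 3, 0, 2, 8, 7], [0, 0, 0, 0, 0, 0, 0, 0]),
    (14, [4, 5, 2, 8, 7, 0, 1, 6, 3], [0, 0, 0, 0, 0, 0, 0, 1]),
    (15, [0, 4, 8, 7, 6, 5, 1, 3, 2], [0, 0, 0, 0, 0, 0, 0, 0]),
    (18, [3, 8, 6, 4, 7, 1, 0, 5, 2], [0, 0, 0, 0, 0, 0, 0, 0]),
    (20, [3, 2, 5, 0, 8, 4, 7, 1, 6], [0, 0, 0, 0, 0, 0, 0, 0]),
    (24, [7, 5, 0, 1, 2, 6, 3, 4, 8], [0, 0, 0, 0, 0, 0, 0, 0]),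
    (30, [5, 7, 3, 2, 6, 0, 4, 1, 8], [0, 0, 0, 0, 0, 0, 0, 0])]"

lemma e8_diagram_ok: "diagram_ok (affine_diagram E8_tilde) 8 e8_table (map fst e8_matchings) [1, 2, 3, 4, 6, 5, 4, 3, 2]"
  by code_simp

lemma e8_table_ok: "table_ok (affine_diagram E8_tilde) 8 e8_table"
  by code_simp

lemma e8_matchings_ok: "certificates_ok 8 e8_matchings
    (multiplicity_trie (affine_diagram E8_tilde) 8 (map fst e8_matchings) e8_table)"
  by code_simp

interpretation e8: certified_diagram "affine_diagram E8_tilde" 8 e8_table e8_matchings "[1, 2, 3, 4, 6, 5, 4, 3, 2]"
  by unfold_locales (fact e8_diagram_ok e8_table_ok e8_matchings_ok)+

theorem mainTheorem5:
  shows
    "(affine_homology I1_tilde 0 \<cong>\<^sub>R cyclo_sum [2] \<and>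
      affine_homology I1_tilde 1 \<cong>\<^sub>R free_rank_one) \<and>
     (affine_homology G2_tilde 0 \<cong>\<^sub>R cyclo_sum [2] \<and>
      affine_homology G2_tilde 1 \<cong>\<^sub>R cyclo_sum [2, 3] \<and>
      affine_homology G2_tilde 2 \<cong>\<^sub>R free_rank_one) \<and>
     (affine_homology F4_tilde 0 \<cong>\<^sub>R cyclo_sum [2] \<and>
      affine_homology F4_tilde 1 \<cong>\<^sub>R cyclo_sum [2] \<and>
      affine_homology F4_tilde 2 \<cong>\<^sub>R cyclo_sum [2, 3] \<and>
      affine_homology F4_tilde 3 \<cong>\<^sub>R cyclo_sum [2, 2, 3, 4, 8] \<and>
      affine_homology F4_tilde 4 \<cong>\<^sub>R free_rank_one) \<and>
     (affine_homology E6_tilde 0 \<cong>\<^sub>R cyclo_sum [2] \<and>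
      affine_homology E6_tilde 1 \<cong>\<^sub>R cyclo_sum [] \<and>
      affine_homology E6_tilde 2 \<cong>\<^sub>R cyclo_sum [] \<and>
      affine_homology E6_tilde 3 \<cong>\<^sub>R cyclo_sum [3] \<and>
      affine_homology E6_tilde 4 \<cong>\<^sub>R cyclo_sum [5, 8] \<and>
      affine_homology E6_tilde 5 \<cong>\<^sub>R cyclo_sum [2, 3, 3, 3, 6, 6, 9, 9, 12, 12] \<and>
      affine_homology E6_tilde 6 \<cong>\<^sub>R free_rank_one) \<and>
     (affine_homology E7_tilde 0 \<cong>\<^sub>R cyclo_sum [2] \<and>
      affine_homology E7_tilde 1 \<cong>\<^sub>R cyclo_sum [] \<and>
      affine_homology E7_tilde 2 \<cong>\<^sub>R cyclo_sum [] \<and>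
      affine_homology E7_tilde 3 \<cong>\<^sub>R cyclo_sum [3] \<and>
      affine_homology E7_tilde 4 \<cong>\<^sub>R cyclo_sum [] \<and>
      affine_homology E7_tilde 5 \<cong>\<^sub>R cyclo_sum [] \<and>
      affine_homology E7_tilde 6 \<cong>\<^sub>R cyclo_sum [2, 2, 2, 3, 4, 6, 8, 10, 14, 18] \<and>
      affine_homology E7_tilde 7 \<cong>\<^sub>R free_rank_one) \<and>
     (affine_homology E8_tilde 0 \<cong>\<^sub>R cyclo_sum [2] \<and>
      affine_homology E8_tilde 1 \<cong>\<^sub>R cyclo_sum [] \<and>
      affine_homology E8_tilde 2 \<cong>\<^sub>R cyclo_sum [] \<and>
      affine_homology E8_tilde 3 \<cong>\<^sub>R cyclo_sum [] \<and>
      affine_homology E8_tilde 4 \<cong>\<^sub>R cyclo_sum [4] \<and>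
      affine_homology E8_tilde 5 \<cong>\<^sub>R cyclo_sum [] \<and>
      affine_homology E8_tilde 6 \<cong>\<^sub>R cyclo_sum [5, 8] \<and>
      affine_homology E8_tilde 7 \<cong>\<^sub>R cyclo_sum [2, 2, 3, 4, 5, 8, 9, 14] \<and>
      affine_homology E8_tilde 8 \<cong>\<^sub>R free_rank_one)"
proof (intro conjI)
  have "cyclo_indices i1_matchings 0 = [2]" by code_simp
  then show "affine_homology I1_tilde 0 \<cong>\<^sub>R cyclo_sum [2]"
    using i1.homology_below_top[of 0] by (simp add: affine_homology_def)
  show "affine_homology I1_tilde 1 \<cong>\<^sub>R free_rank_one"
    using i1.homology_top by (simp add: affine_homology_def)
  have "cyclo_indices g2_matchings 0 = [2]" by code_simp
  then show "affine_homology G2_tilde 0 \<cong>\<^sub>R cyclo_sum [2]"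
    using g2.homology_below_top[of 0] by (simp add: affine_homology_def)
  have "cyclo_indices g2_matchings 1 = [2, 3]" by code_simp
  then show "affine_homology G2_tilde 1 \<cong>\<^sub>R cyclo_sum [2, 3]"
    using g2.homology_below_top[of 1] by (simp add: affine_homology_def)
  show "affine_homology G2_tilde 2 \<cong>\<^sub>R free_rank_one"
    using g2.homology_top by (simp add: affine_homology_def)
  have "cyclo_indices f4_matchings 0 = [2]" by code_simp
  then show "affine_homology F4_tilde 0 \<cong>\<^sub>R cyclo_sum [2]"
    using f4.homology_below_top[of 0] by (simp add: affine_homology_def)
  have "cyclo_indices f4_matchings 1 = [2]" by code_simp
  then show "affine_homology F4_tilde 1 \<cong>\<^sub>R cyclo_sum [2]"
    using f4.homology_below_top[of 1] by (simp add: affine_homology_def)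
  have "cyclo_indices f4_matchings 2 = [2, 3]" by code_simp
  then show "affine_homology F4_tilde 2 \<cong>\<^sub>R cyclo_sum [2, 3]"
    using f4.homology_below_top[of 2] by (simp add: affine_homology_def)
  have "cyclo_indices f4_matchings 3 = [2, 2, 3, 4, 8]" by code_simp
  then show "affine_homology F4_tilde 3 \<cong>\<^sub>R cyclo_sum [2, 2, 3, 4, 8]"
    using f4.homology_below_top[of 3] by (simp add: affine_homology_def)
  show "affine_homology F4_tilde 4 \<cong>\<^sub>R free_rank_one"
    using f4.homology_top by (simp add: affine_homology_def)
  have "cyclo_indices e6_matchings 0 = [2]" by code_simp
  then show "affine_homology E6_tilde 0 \<cong>\<^sub>R cyclo_sum [2]"
    using e6.homology_below_top[of 0] by (simp add: affine_homology_def)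
  have "cyclo_indices e6_matchings 1 = []" by code_simp
  then show "affine_homology E6_tilde 1 \<cong>\<^sub>R cyclo_sum []"
    using e6.homology_below_top[of 1] by (simp add: affine_homology_def)
  have "cyclo_indices e6_matchings 2 = []" by code_simp
  then show "affine_homology E6_tilde 2 \<cong>\<^sub>R cyclo_sum []"
    using e6.homology_below_top[of 2] by (simp add: affine_homology_def)
  have "cyclo_indices e6_matchings 3 = [3]" by code_simp
  then show "affine_homology E6_tilde 3 \<cong>\<^sub>R cyclo_sum [3]"
    using e6.homology_below_top[of 3] by (simp add: affine_homology_def)
  have "cyclo_indices e6_matchings 4 = [5, 8]" by code_simp
  then show "affine_homology E6_tilde 4 \<cong>\<^sub>R cyclo_sum [5, 8]"
    using e6.homology_below_top[of 4] by (simp add: affine_homology_def)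
  have "cyclo_indices e6_matchings 5 = [2, 3, 3, 3, 6, 6, 9, 9, 12, 12]" by code_simp
  then show "affine_homology E6_tilde 5 \<cong>\<^sub>R cyclo_sum [2, 3, 3, 3, 6, 6, 9, 9, 12, 12]"
    using e6.homology_below_top[of 5] by (simp add: affine_homology_def)
  show "affine_homology E6_tilde 6 \<cong>\<^sub>R free_rank_one"
    using e6.homology_top by (simp add: affine_homology_def)
  have "cyclo_indices e7_matchings 0 = [2]" by code_simp
  then show "affine_homology E7_tilde 0 \<cong>\<^sub>R cyclo_sum [2]"
    using e7.homology_below_top[of 0] by (simp add: affine_homology_def)
  have "cyclo_indices e7_matchings 1 = []" by code_simp
  then show "affine_homology E7_tilde 1 \<cong>\<^sub>R cyclo_sum []"
    using e7.homology_below_top[of 1] by (simp add: affine_homology_def)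
  have "cyclo_indices e7_matchings 2 = []" by code_simp
  then show "affine_homology E7_tilde 2 \<cong>\<^sub>R cyclo_sum []"
    using e7.homology_below_top[of 2] by (simp add: affine_homology_def)
  have "cyclo_indices e7_matchings 3 = [3]" by code_simp
  then show "affine_homology E7_tilde 3 \<cong>\<^sub>R cyclo_sum [3]"
    using e7.homology_below_top[of 3] by (simp add: affine_homology_def)
  have "cyclo_indices e7_matchings 4 = []" by code_simp
  then show "affine_homology E7_tilde 4 \<cong>\<^sub>R cyclo_sum []"
    using e7.homology_below_top[of 4] by (simp add: affine_homology_def)
  have "cyclo_indices e7_matchings 5 = []" by code_simp
  then show "affine_homology E7_tilde 5 \<cong>\<^sub>R cyclo_sum []"
    using e7.homology_below_top[of 5] by (simp add: affine_homology_def)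
  have "cyclo_indices e7_matchings 6 = [2, 2, 2, 3, 4, 6, 8, 10, 14, 18]" by code_simp
  then show "affine_homology E7_tilde 6 \<cong>\<^sub>R cyclo_sum [2, 2, 2, 3, 4, 6, 8, 10, 14, 18]"
    using e7.homology_below_top[of 6] by (simp add: affine_homology_def)
  show "affine_homology E7_tilde 7 \<cong>\<^sub>R free_rank_one"
    using e7.homology_top by (simp add: affine_homology_def)
  have "cyclo_indices e8_matchings 0 = [2]" by code_simp
  then show "affine_homology E8_tilde 0 \<cong>\<^sub>R cyclo_sum [2]"
    using e8.homology_below_top[of 0] by (simp add: affine_homology_def)
  have "cyclo_indices e8_matchings 1 = []" by code_simp
  then show "affine_homology E8_tilde 1 \<cong>\<^sub>R cyclo_sum []"
    using e8.homology_below_top[of 1] by (simp add: affine_homology_def)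
  have "cyclo_indices e8_matchings 2 = []" by code_simp
  then show "affine_homology E8_tilde 2 \<cong>\<^sub>R cyclo_sum []"
    using e8.homology_below_top[of 2] by (simp add: affine_homology_def)
  have "cyclo_indices e8_matchings 3 = []" by code_simp
  then show "affine_homology E8_tilde 3 \<cong>\<^sub>R cyclo_sum []"
    using e8.homology_below_top[of 3] by (simp add: affine_homology_def)
  have "cyclo_indices e8_matchings 4 = [4]" by code_simp
  then show "affine_homology E8_tilde 4 \<cong>\<^sub>R cyclo_sum [4]"
    using e8.homology_below_top[of 4] by (simp add: affine_homology_def)
  have "cyclo_indices e8_matchings 5 = []" by code_simp
  then show "affine_homology E8_tilde 5 \<cong>\<^sub>R cyclo_sum []"
    using e8.homology_below_top[of 5] by (simp add: affine_homology_def)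
  have "cyclo_indices e8_matchings 6 = [5, 8]" by code_simp
  then show "affine_homology E8_tilde 6 \<cong>\<^sub>R cyclo_sum [5, 8]"
    using e8.homology_below_top[of 6] by (simp add: affine_homology_def)
  have "cyclo_indices e8_matchings 7 = [2, 2, 3, 4, 5, 8, 9, 14]" by code_simp
  then show "affine_homology E8_tilde 7 \<cong>\<^sub>R cyclo_sum [2, 2, 3, 4, 5, 8, 9, 14]"
    using e8.homology_below_top[of 7] by (simp add: affine_homology_def)
  show "affine_homology E8_tilde 8 \<cong>\<^sub>R free_rank_one"
    using e8.homology_top by (simp add: affine_homology_def)
qed

end
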